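(* Let $(G,E,\sigma)$ be a twisted self-similar groupoid action. If any of the inclusions $C_0(\partial E)\subseteq\mathcal O_{\mathrm{red}}(G,E,\sigma)_*$ or $C_0(E^{\le\infty})\subseteq\mathcal T_{\mathrm{red}}(G,E,\sigma)_*$, for some $*$ = no symbol, $0$, $00$, is Cartan, then (Fin) and (Evr) hold. Conversely, assume that (Fin) holds. Then $$\mathcal O_{\mathrm{red}}(G,E,\sigma)_*=\mathcal O_{\mathrm{ess}}(G,E,\sigma)_*\quad\text{and}\quad\mathcal T_{\mathrm{red}}(G,E,\sigma)_*=\mathcal T_{\mathrm{ess}}(G,E,\sigma)_*$$ for every $*$ = no symbol, $0$, $00$. Moreover (still assuming (Fin)), (1) $C_0(\partial E)\subseteq\mathcal O_{\mathrm{red}}(G,E,\sigma)$ is Cartan if and only if (Cyc) and (Evr) hold; (2) any of the inclusions $C_0(E^{\le\infty})\subseteq\mathcal T_{\mathrm{red}}(G,E,\sigma),\ \mathcal T_{\mathrm{red}}(G,E,\sigma)_0,\ \mathcal T_{\mathrm{red}}(G,E,\sigma)_{00}$ is Cartan if and only if (Rec) and (Evr) hold; and (3) any of the inclusions $C_0(\partial E)\subseteq\mathcal O_{\mathrm{red}}(G,E,\sigma)_0,\ \mathcal O_{\mathrm{red}}(G,E,\sigma)_{00}$ is Cartan if and only if (Evr) holds.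
   Context: Graphs. A directed graph $E=(E^0,E^1,r,s)$ has vertices $E^0$, edges $E^1$, and maps $r,s:E^1\to E^0$. For $n\ge1$, $E^n$ is the set of paths $\mu=\mu_1\cdots\mu_n$ ($\mu_i\in E^1$, $s(\mu_i)=r(\mu_{i+1})$), $r(\mu)=r(\mu_1)$, $s(\mu)=s(\mu_n)$, $|\mu|=n$; vertices are paths of length $0$ with $r(v)=s(v)=v$; $E^*=\bigcup_{n\ge0}E^n$; $E^\infty$ is the set of infinite paths; $vE^n,vE^*$ denote paths with range $v$. $\beta$ is a prefix of $\alpha$ if $\alpha=\beta\beta'$. A vertex $v$ is a finite receiver if $vE^1$ is finite (possibly empty), regular if $0<|vE^1|<\infty$, singular otherwise. A path $\alpha=\alpha_1\cdots\alpha_n$ has an entrance if one of the vertices $r(\alpha_1),\dots,r(\alpha_n),s(\alpha_n)$ is the range of two distinct edges. Self-similar actions. $(G,E)$ is a self-similar action if $G$ is a discrete groupoid with $G^0=E^0$, equipped with a left action $(g,e)\mapsto ge$ on $E^1$ (defined when $s(g)=r(e)$, with $r(ge)=r(g)$, $(hg)e=h(ge)$, $r(e)e=e$) and a map $(g,e)\mapsto g|_e\in G$ with $(hg)|_e=h|_{ge}\,g|_e$, $s(g|_e)=s(e)$, $r(g|_e)=s(ge)$. It extends to paths by $g\,s(g)=r(g)$, $g|_{s(g)}=g$, $g(e\mu)=(ge)(g|_e\mu)$, $g|_{e\mu}=(g|_e)|_\mu$, and to infinite paths by $g(\mu_1\mu_2\cdots)=(g\mu_1)(g|_{\mu_1}\mu_2)(g|_{\mu_1\mu_2}\mu_3)\cdots$.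 Both $G$ and $E$ are assumed countable. A path $\mu\in s(g)E^*$ is strongly $g$-fixed if $g\mu=\mu$ and $g|_\mu=s(\mu)$; it is minimal if no proper prefix is strongly $g$-fixed. A $g$-cycle is a path $\alpha\in E^*\setminus E^0$ with $s(\alpha)=s(g)$, $r(\alpha)=r(g)$. (Fin): every $g\in G$ admits at most finitely many minimal strongly $g$-fixed paths. (Evr): if $g\in G$ fixes every path in $s(g)E^*$, then $g$ strongly fixes some path in $s(g)E^*$. (Cyc): for every $g\in G$, every $g$-cycle has an entrance. (Rec): if $g\in G$ fixes a path $\mu\in E^*$ whose source is a finite receiver, then $\mu$ is strongly $g$-fixed. Twists. A twist of $(G,E)$ is $\sigma=(\sigma_G,\sigma_{\bowtie})$ where $\sigma_G:G^{2}\to\mathbb T$ satisfies $\sigma_G(a,b)\sigma_G(ab,c)=\sigma_G(b,c)\sigma_G(a,bc)$ and $\sigma_G(r(g),g)=1=\sigma_G(g,s(g))$, and $\sigma_{\bowtie}:\{(g,e)\in G\times E^1:s(g)=r(e)\}\to\mathbb T$ satisfies $\sigma_{\bowtie}(r(e),e)=1$ and $\sigma_{\bowtie}(h,e)\overline{\sigma_{\bowtie}(gh,e)}\sigma_{\bowtie}(g,he)=\overline{\sigma_G(g|_{he},h|_e)}\sigma_G(g,h)$. Extend $\sigma_{\bowtie}$ to paths by $\sigma_{\bowtie}(h,s(h))=1$, $\sigma_{\bowtie}(h,e\mu)=\sigma_{\bowtie}(h,e)\sigma_{\bowtie}(h|_e,\mu)$. Groupoids. $E^{\le\infty}=E^*\cup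 E^\infty$; $Z(\alpha)$ is the set of elements of $E^{\le\infty}$ with prefix $\alpha$; the sets $Z(\alpha)\setminus\bigcup_{\beta\in F}Z(\alpha\beta)$ ($F\subseteq s(\alpha)E^*$ finite) form a basis of the topology. $\partial E=E^\infty\cup\{\mu\in E^*:s(\mu)\text{ singular}\}$. $\widetilde{\mathcal G}(G,E)$ consists of classes $[\alpha,g,\beta;\xi]$, where $\alpha,\beta\in E^*$, $g\in G$, $r(g)=s(\alpha)$, $s(g)=s(\beta)$, $\xi\in Z(\beta)$, and $[\alpha,g,\beta;\xi]=[\gamma,h,\delta;\eta]$ iff $\xi=\eta$ and there are $\beta',\delta'\in E^*$ with $\beta\beta'=\delta\delta'$ a prefix of $\xi$, $\alpha(g\beta')=\gamma(h\delta')$ and $g|_{\beta'}=h|_{\delta'}$. The source of $[\alpha,g,\beta;\beta\xi]$ is $\beta\xi$, its range is $\alpha(g\xi)$; basic open sets are $\{[\alpha,g,\beta;\xi]:\xi\in V\}$, $V\subseteq Z(\beta)$ open. $\mathcal G(G,E)$ is its restriction to $\partial E$. $\mathcal H_{\mathrm H}$ denotes the set of points of $\mathcal H$ that can be separated by disjoint open sets from every other point of $\mathcal H$. Algebras. Let $L_\gamma$, $\gamma\in\widetilde{\mathcal G}(G,E)$, be the one-dimensional normed space spanned by unit vectors $\delta_{(\alpha,g,\beta;\xi)}$, one for each representative of $\gamma$, subject to $\delta_{(\alpha,g,\beta;\xi)}=\sigma_{\bowtie}(g,\beta')\,\delta_{(\alpha(g\beta'),g|_{\beta'},\beta\beta';\xi)}$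 whenever $\beta\beta'$ is a prefix of $\xi$. On the Hilbert space $\bigoplus_{\gamma}L_\gamma$ define partial isometries $W_g\delta_{(\alpha,h,\beta;\xi)}=\sigma_{\bowtie}(g,\alpha)\sigma_G(g|_\alpha,h)\delta_{(g\alpha,g|_\alpha h,\beta;\xi)}$ if $s(g)=r(\alpha)$ (else $0$) and $T_e\delta_{(\alpha,h,\beta;\xi)}=\delta_{(e\alpha,h,\beta;\xi)}$ if $s(e)=r(\alpha)$ (else $0$), for $g\in G$, $e\in E^1$. $\mathcal T_{\mathrm{red}}$, $\mathcal T_{\mathrm{ess}}$, $\mathcal O_{\mathrm{red}}$, $\mathcal O_{\mathrm{ess}}(G,E,\sigma)$ are the $C^*$-algebras generated by the restrictions of $(W,T)$ to the invariant subspaces $\bigoplus_\gamma L_\gamma$ with $\gamma$ ranging over $\widetilde{\mathcal G}(G,E)$, $\widetilde{\mathcal G}(G,E)_{\mathrm H}$, $\mathcal G(G,E)$, $\mathcal G(G,E)_{\mathrm H}$, respectively. With $T_\mu=T_{\mu_1}\cdots T_{\mu_n}$, $T_v=W_v$, the subscript $0$ denotes the closed span of $T_\alpha W_gT_\beta^*$ with $|\alpha|=|\beta|$, and the subscript $00$ the closed span of $W_gT_\beta T_\beta^*$ with $s(g)=r(\beta)$. The closed span of $\{T_\beta T_\beta^*:\beta\in E^*\}$ is identified with $C_0(E^{\le\infty})$ in the Toeplitz case ($T_\beta T_\beta^*\leftrightarrow 1_{Z(\beta)}$) and with $C_0(\partial E)$ in the $\mathcal O$-case ($T_\beta T_\beta^*\leftrightarrow1_{Z(\beta)\cap\partial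 E}$). Equalities of red and ess algebras mean that the canonical maps are isomorphisms. A $C^*$-inclusion $A\subseteq B$ is Cartan if $A$ is a maximal abelian $C^*$-subalgebra containing an approximate unit of $B$, $B$ is the closed span of $\{b\in B:bAb^*\cup b^*Ab\subseteq A\}$, and there is a faithful conditional expectation $B\to A$. *)

theory Defs
  imports "HOL-Analysis.Analysis"
begin

section \<open>Self-similar groupoid actions on graphs\<close>

record 'g groupoid =
  Grp :: "'g set"
  Vert :: "'g set"
  grng :: "'g \<Rightarrow> 'g"
  gsrc :: "'g \<Rightarrow> 'g"
  gmult :: "'g \<Rightarrow> 'g \<Rightarrow> 'g"
  ginv :: "'g \<Rightarrow> 'g"

record ('g, 'e) action = "'g groupoid" +
  Edges :: "'e set"
  erng :: "'e \<Rightarrow> 'g"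
  esrc :: "'e \<Rightarrow> 'g"
  act :: "'g \<Rightarrow> 'e \<Rightarrow> 'e"
  sect :: "'g \<Rightarrow> 'e \<Rightarrow> 'g"

record ('g, 'e) twisted_action = "('g, 'e) action" +
  twG :: "'g \<Rightarrow> 'g \<Rightarrow> complex"
  twE :: "'g \<Rightarrow> 'e \<Rightarrow> complex"

text \<open>
  The units of the groupoid are elements of the groupoid, and they are literally the vertices of
  the graph. All operations are total functions of which only the values at composable arguments
  matter. The field \<open>sect\<close> is the restriction \<open>g|\<^sub>e\<close>, and
  \<open>twG\<close>, \<open>twE\<close> are the two components of a twist.
\<close>

locale discrete_groupoid =
  fixes S
  assumes Vert_subset: "Vert S \<subseteq> Grp S"
    and grng_Vert: "g \<in> Grp S \<Longrightarrow> grng S g \<in> Vert S"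
    and gsrc_Vert: "g \<in> Grp S \<Longrightarrow> gsrc S g \<in> Vert S"
    and grng_unit: "v \<in> Vert S \<Longrightarrow> grng S v = v"
    and gsrc_unit: "v \<in> Vert S \<Longrightarrow> gsrc S v = v"
    and gmult_closed: "\<lbrakk>g \<in> Grp S; h \<in> Grp S; gsrc S g = grng S h\<rbrakk> \<Longrightarrow> gmult S g h \<in> Grp S"
    and grng_gmult: "\<lbrakk>g \<in> Grp S; h \<in> Grp S; gsrc S g = grng S h\<rbrakk>
          \<Longrightarrow> grng S (gmult S g h) = grng S g"
    and gsrc_gmult: "\<lbrakk>g \<in> Grp S; h \<in> Grp S; gsrc S g = grng S h\<rbrakk>
          \<Longrightarrow> gsrc S (gmult S g h) = gsrc S h"
    and gmult_assoc: "\<lbrakk>g \<in> Grp S; h \<in> Grp S; k \<in> Grp S; gsrc S g = grng S h; gsrc S h = grng S k\<rbrakk>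
          \<Longrightarrow> gmult S (gmult S g h) k = gmult S g (gmult S h k)"
    and unit_left: "g \<in> Grp S \<Longrightarrow> gmult S (grng S g) g = g"
    and unit_right: "g \<in> Grp S \<Longrightarrow> gmult S g (gsrc S g) = g"
    and ginv_closed: "g \<in> Grp S \<Longrightarrow> ginv S g \<in> Grp S"
    and grng_ginv: "g \<in> Grp S \<Longrightarrow> grng S (ginv S g) = gsrc S g"
    and gsrc_ginv: "g \<in> Grp S \<Longrightarrow> gsrc S (ginv S g) = grng S g"
    and ginv_left: "g \<in> Grp S \<Longrightarrow> gmult S (ginv S g) g = gsrc S g"
    and ginv_right: "g \<in> Grp S \<Longrightarrow> gmult S g (ginv S g) = grng S g"

locale self_similar_action = discrete_groupoid S for S +
  assumes erng_Vert: "e \<in> Edges S \<Longrightarrow> erng S e \<in> Vert S"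
    and esrc_Vert: "e \<in> Edges S \<Longrightarrow> esrc S e \<in> Vert S"
    and act_closed: "\<lbrakk>g \<in> Grp S; e \<in> Edges S; gsrc S g = erng S e\<rbrakk> \<Longrightarrow> act S g e \<in> Edges S"
    and erng_act: "\<lbrakk>g \<in> Grp S; e \<in> Edges S; gsrc S g = erng S e\<rbrakk>
          \<Longrightarrow> erng S (act S g e) = grng S g"
    and act_gmult: "\<lbrakk>h \<in> Grp S; g \<in> Grp S; e \<in> Edges S; gsrc S h = grng S g; gsrc S g = erng S e\<rbrakk>
          \<Longrightarrow> act S (gmult S h g) e = act S h (act S g e)"
    and act_unit: "e \<in> Edges S \<Longrightarrow> act S (erng S e) e = e"
    and sect_closed: "\<lbrakk>g \<in> Grp S; e \<in> Edges S; gsrc S g = erng S e\<rbrakk> \<Longrightarrow> sect S g e \<in> Grp S"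
    and gsrc_sect: "\<lbrakk>g \<in> Grp S; e \<in> Edges S; gsrc S g = erng S e\<rbrakk>
          \<Longrightarrow> gsrc S (sect S g e) = esrc S e"
    and grng_sect: "\<lbrakk>g \<in> Grp S; e \<in> Edges S; gsrc S g = erng S e\<rbrakk>
          \<Longrightarrow> grng S (sect S g e) = esrc S (act S g e)"
    and sect_gmult: "\<lbrakk>h \<in> Grp S; g \<in> Grp S; e \<in> Edges S; gsrc S h = grng S g; gsrc S g = erng S e\<rbrakk>
          \<Longrightarrow> sect S (gmult S h g) e = gmult S (sect S h (act S g e)) (sect S g e)"
    and countable_Grp: "countable (Grp S)"
    and countable_Edges: "countable (Edges S)"

locale twisted_self_similar_action = self_similar_action S for S +
  assumes twG_circle: "\<lbrakk>a \<in> Grp S; b \<in> Grp S; gsrc S a = grng S b\<rbrakk> \<Longrightarrow> cmod (twG S a b) = 1"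
    and twG_cocycle: "\<lbrakk>a \<in> Grp S; b \<in> Grp S; c \<in> Grp S; gsrc S a = grng S b; gsrc S b = grng S c\<rbrakk>
          \<Longrightarrow> twG S a b * twG S (gmult S a b) c = twG S b c * twG S a (gmult S b c)"
    and twG_unit_left: "g \<in> Grp S \<Longrightarrow> twG S (grng S g) g = 1"
    and twG_unit_right: "g \<in> Grp S \<Longrightarrow> twG S g (gsrc S g) = 1"
    and twE_circle: "\<lbrakk>g \<in> Grp S; e \<in> Edges S; gsrc S g = erng S e\<rbrakk> \<Longrightarrow> cmod (twE S g e) = 1"
    and twE_unit: "e \<in> Edges S \<Longrightarrow> twE S (erng S e) e = 1"
    and twE_gmult: "\<lbrakk>g \<in> Grp S; h \<in> Grp S; e \<in> Edges S; gsrc S g = grng S h; gsrc S h = erng S e\<rbrakk>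
          \<Longrightarrow> twE S h e * cnj (twE S (gmult S g h) e) * twE S g (act S h e)
              = cnj (twG S (sect S g (act S h e)) (sect S h e)) * twG S g h"


section \<open>Paths\<close>

text \<open>
  A finite path is a pair of its range and its list of edges, so that \<open>(v, [])\<close> is the
  vertex \<open>v\<close> regarded as a path of length zero.
\<close>

type_synonym ('g, 'e) path = "'g \<times> 'e list"

fun walk :: "('g, 'e, 'z) action_scheme \<Rightarrow> 'g \<Rightarrow> 'e list \<Rightarrow> bool" where
  "walk S v [] \<longleftrightarrow> v \<in> Vert S"
| "walk S v (e # es) \<longleftrightarrow> e \<in> Edges S \<and> erng S e = v \<and> walk S (esrc S e) es"

definition paths :: "('g, 'e, 'z) action_scheme \<Rightarrow> ('g, 'e) path set" where
  "paths S = {(v, es). walk S v es}"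

definition prng :: "('g, 'e) path \<Rightarrow> 'g" where
  "prng \<mu> = fst \<mu>"

definition psrc :: "('g, 'e, 'z) action_scheme \<Rightarrow> ('g, 'e) path \<Rightarrow> 'g" where
  "psrc S \<mu> = (if snd \<mu> = [] then fst \<mu> else esrc S (last (snd \<mu>)))"

definition plen :: "('g, 'e) path \<Rightarrow> nat" where
  "plen \<mu> = length (snd \<mu>)"

definition pcat :: "('g, 'e) path \<Rightarrow> ('g, 'e) path \<Rightarrow> ('g, 'e) path" where
  "pcat \<alpha> \<beta> = (fst \<alpha>, snd \<alpha> @ snd \<beta>)"

definition pprefix :: "('g, 'e, 'z) action_scheme \<Rightarrow> ('g, 'e) path \<Rightarrow> ('g, 'e) path \<Rightarrow> bool" where
  "pprefix S \<beta> \<alpha> \<longleftrightarrow> (\<exists>\<beta>'\<in>paths S. prng \<beta>' = psrc S \<beta> \<and> \<alpha> = pcat \<beta> \<beta>')"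

definition inf_paths :: "('g, 'e, 'z) action_scheme \<Rightarrow> (nat \<Rightarrow> 'e) set" where
  "inf_paths S = {x. \<forall>n. x n \<in> Edges S \<and> esrc S (x n) = erng S (x (Suc n))}"

definition edges_into :: "('g, 'e, 'z) action_scheme \<Rightarrow> 'g \<Rightarrow> 'e set" where
  "edges_into S v = {e \<in> Edges S. erng S e = v}"

definition finite_receiver :: "('g, 'e, 'z) action_scheme \<Rightarrow> 'g \<Rightarrow> bool" where
  "finite_receiver S v \<longleftrightarrow> v \<in> Vert S \<and> finite (edges_into S v)"

definition regular_vertex :: "('g, 'e, 'z) action_scheme \<Rightarrow> 'g \<Rightarrow> bool" where
  "regular_vertex S v \<longleftrightarrow> v \<in> Vert S \<and> finite (edges_into S v) \<and> edges_into S v \<noteq> {}"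

definition singular_vertex :: "('g, 'e, 'z) action_scheme \<Rightarrow> 'g \<Rightarrow> bool" where
  "singular_vertex S v \<longleftrightarrow> v \<in> Vert S \<and> \<not> regular_vertex S v"

definition has_entrance :: "('g, 'e, 'z) action_scheme \<Rightarrow> ('g, 'e) path \<Rightarrow> bool" where
  "has_entrance S \<alpha> \<longleftrightarrow>
    (\<exists>w \<in> insert (psrc S \<alpha>) (erng S ` set (snd \<alpha>)).
       \<exists>e \<in> edges_into S w. \<exists>f \<in> edges_into S w. e \<noteq> f)"


subsection \<open>The action on paths\<close>

fun act_list :: "('g, 'e, 'z) action_scheme \<Rightarrow> 'g \<Rightarrow> 'e list \<Rightarrow> 'e list" where
  "act_list S g [] = []"
| "act_list S g (e # es) = act S g e # act_list S (sect S g e) es"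

fun sect_list :: "('g, 'e, 'z) action_scheme \<Rightarrow> 'g \<Rightarrow> 'e list \<Rightarrow> 'g" where
  "sect_list S g [] = g"
| "sect_list S g (e # es) = sect_list S (sect S g e) es"

fun twE_list :: "('g, 'e, 'z) twisted_action_scheme \<Rightarrow> 'g \<Rightarrow> 'e list \<Rightarrow> complex" where
  "twE_list S g [] = 1"
| "twE_list S g (e # es) = twE S g e * twE_list S (sect S g e) es"

definition pact :: "('g, 'e, 'z) action_scheme \<Rightarrow> 'g \<Rightarrow> ('g, 'e) path \<Rightarrow> ('g, 'e) path" where
  "pact S g \<mu> = (grng S g, act_list S g (snd \<mu>))"

definition psect :: "('g, 'e, 'z) action_scheme \<Rightarrow> 'g \<Rightarrow> ('g, 'e) path \<Rightarrow> 'g" where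
  "psect S g \<mu> = sect_list S g (snd \<mu>)"

definition ptw :: "('g, 'e, 'z) twisted_action_scheme \<Rightarrow> 'g \<Rightarrow> ('g, 'e) path \<Rightarrow> complex" where
  "ptw S g \<mu> = twE_list S g (snd \<mu>)"

definition fixes_path :: "('g, 'e, 'z) action_scheme \<Rightarrow> 'g \<Rightarrow> ('g, 'e) path \<Rightarrow> bool" where
  "fixes_path S g \<mu> \<longleftrightarrow> \<mu> \<in> paths S \<and> prng \<mu> = gsrc S g \<and> pact S g \<mu> = \<mu>"

definition strongly_fixed :: "('g, 'e, 'z) action_scheme \<Rightarrow> 'g \<Rightarrow> ('g, 'e) path \<Rightarrow> bool" where
  "strongly_fixed S g \<mu> \<longleftrightarrow> fixes_path S g \<mu> \<and> psect S g \<mu> = psrc S \<mu>"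

definition minimal_strongly_fixed ::
    "('g, 'e, 'z) action_scheme \<Rightarrow> 'g \<Rightarrow> ('g, 'e) path \<Rightarrow> bool" where
  "minimal_strongly_fixed S g \<mu> \<longleftrightarrow>
    strongly_fixed S g \<mu> \<and> \<not> (\<exists>\<nu>\<in>paths S. pprefix S \<nu> \<mu> \<and> \<nu> \<noteq> \<mu> \<and> strongly_fixed S g \<nu>)"

definition g_cycle :: "('g, 'e, 'z) action_scheme \<Rightarrow> 'g \<Rightarrow> ('g, 'e) path \<Rightarrow> bool" where
  "g_cycle S g \<alpha> \<longleftrightarrow>
    \<alpha> \<in> paths S \<and> plen \<alpha> > 0 \<and> psrc S \<alpha> = gsrc S g \<and> prng \<alpha> = grng S g"

definition cond_Fin :: "('g, 'e, 'z) action_scheme \<Rightarrow> bool" where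
  "cond_Fin S \<longleftrightarrow> (\<forall>g\<in>Grp S. finite {\<mu>. minimal_strongly_fixed S g \<mu>})"

definition cond_Evr :: "('g, 'e, 'z) action_scheme \<Rightarrow> bool" where
  "cond_Evr S \<longleftrightarrow>
    (\<forall>g\<in>Grp S. (\<forall>\<mu>\<in>paths S. prng \<mu> = gsrc S g \<longrightarrow> fixes_path S g \<mu>) \<longrightarrow>
       (\<exists>\<mu>\<in>paths S. strongly_fixed S g \<mu>))"

definition cond_Cyc :: "('g, 'e, 'z) action_scheme \<Rightarrow> bool" where
  "cond_Cyc S \<longleftrightarrow> (\<forall>g\<in>Grp S. \<forall>\<alpha>. g_cycle S g \<alpha> \<longrightarrow> has_entrance S \<alpha>)"

definition cond_Rec :: "('g, 'e, 'z) action_scheme \<Rightarrow> bool" where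
  "cond_Rec S \<longleftrightarrow>
    (\<forall>g\<in>Grp S. \<forall>\<mu>\<in>paths S.
       fixes_path S g \<mu> \<and> finite_receiver S (psrc S \<mu>) \<longrightarrow> strongly_fixed S g \<mu>)"


section \<open>The path space and its germ groupoids\<close>

datatype ('g, 'e) xpath = FinP "('g, 'e) path" | InfP "nat \<Rightarrow> 'e"

definition path_space :: "('g, 'e, 'z) action_scheme \<Rightarrow> ('g, 'e) xpath set" where
  "path_space S = FinP ` paths S \<union> InfP ` inf_paths S"

fun xprefix :: "('g, 'e, 'z) action_scheme \<Rightarrow> ('g, 'e) path \<Rightarrow> ('g, 'e) xpath \<Rightarrow> bool" where
  "xprefix S \<alpha> (FinP \<mu>) \<longleftrightarrow> pprefix S \<alpha> \<mu>"
| "xprefix S \<alpha> (InfP x) \<longleftrightarrow> prng \<alpha> = erng S (x 0) \<and> snd \<alpha> = map x [0..<plen \<alpha>]"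

definition cylinder :: "('g, 'e, 'z) action_scheme \<Rightarrow> ('g, 'e) path \<Rightarrow> ('g, 'e) xpath set" where
  "cylinder S \<alpha> = {\<xi> \<in> path_space S. xprefix S \<alpha> \<xi>}"

definition path_topology :: "('g, 'e, 'z) action_scheme \<Rightarrow> ('g, 'e) xpath topology" where
  "path_topology S = topology_generated_by
    {cylinder S \<alpha> - (\<Union>\<beta>\<in>F. cylinder S (pcat \<alpha> \<beta>)) | \<alpha> F.
       \<alpha> \<in> paths S \<and> finite F \<and> F \<subseteq> {\<beta> \<in> paths S. prng \<beta> = psrc S \<alpha>}}"

definition boundary_paths :: "('g, 'e, 'z) action_scheme \<Rightarrow> ('g, 'e) xpath set" where
  "boundary_paths S = InfP ` inf_paths S \<union> FinP ` {\<mu> \<in> paths S. singular_vertex S (psrc S \<mu>)}"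

fun xact :: "('g, 'e, 'z) action_scheme \<Rightarrow> 'g \<Rightarrow> ('g, 'e) xpath \<Rightarrow> ('g, 'e) xpath" where
  "xact S g (FinP \<mu>) = FinP (pact S g \<mu>)"
| "xact S g (InfP x) = InfP (\<lambda>n. act S (sect_list S g (map x [0..<n])) (x n))"

fun xcat :: "('g, 'e) path \<Rightarrow> ('g, 'e) xpath \<Rightarrow> ('g, 'e) xpath" where
  "xcat \<alpha> (FinP \<mu>) = FinP (pcat \<alpha> \<mu>)"
| "xcat \<alpha> (InfP x) = InfP (\<lambda>n. if n < plen \<alpha> then snd \<alpha> ! n else x (n - plen \<alpha>))"

text \<open>The tail \<open>\<eta>\<close> of \<open>\<xi> = \<beta>\<eta>\<close>.\<close>

fun xtail :: "('g, 'e, 'z) action_scheme \<Rightarrow> ('g, 'e) path \<Rightarrow> ('g, 'e) xpath \<Rightarrow> ('g, 'e) xpath" where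
  "xtail S \<beta> (FinP \<mu>) = FinP (psrc S \<beta>, drop (plen \<beta>) (snd \<mu>))"
| "xtail S \<beta> (InfP x) = InfP (\<lambda>n. x (n + plen \<beta>))"

type_synonym ('g, 'e) germ_rep = "('g, 'e) path \<times> 'g \<times> ('g, 'e) path \<times> ('g, 'e) xpath"

definition germ_reps :: "('g, 'e, 'z) action_scheme \<Rightarrow> ('g, 'e) germ_rep set" where
  "germ_reps S = {(\<alpha>, g, \<beta>, \<xi>). \<alpha> \<in> paths S \<and> g \<in> Grp S \<and> \<beta> \<in> paths S \<and>
     grng S g = psrc S \<alpha> \<and> gsrc S g = psrc S \<beta> \<and> \<xi> \<in> cylinder S \<beta>}"

definition germ_rel ::
    "('g, 'e, 'z) action_scheme \<Rightarrow> (('g, 'e) germ_rep \<times> ('g, 'e) germ_rep) set" where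
  "germ_rel S = {((\<alpha>, g, \<beta>, \<xi>), (\<gamma>, h, \<delta>, \<eta>)).
     (\<alpha>, g, \<beta>, \<xi>) \<in> germ_reps S \<and> (\<gamma>, h, \<delta>, \<eta>) \<in> germ_reps S \<and> \<xi> = \<eta> \<and>
     (\<exists>\<beta>'\<in>paths S. \<exists>\<delta>'\<in>paths S.
        prng \<beta>' = psrc S \<beta> \<and> prng \<delta>' = psrc S \<delta> \<and>
        pcat \<beta> \<beta>' = pcat \<delta> \<delta>' \<and> xprefix S (pcat \<beta> \<beta>') \<xi> \<and>
        pcat \<alpha> (pact S g \<beta>') = pcat \<gamma> (pact S h \<delta>') \<and>
        psect S g \<beta>' = psect S h \<delta>')}"

text \<open>Elements of the groupoids are equivalence classes of representatives.\<close>

type_synonym ('g, 'e) germ = "('g, 'e) germ_rep set"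

definition germ_of :: "('g, 'e, 'z) action_scheme \<Rightarrow> ('g, 'e) germ_rep \<Rightarrow> ('g, 'e) germ" where
  "germ_of S p = germ_rel S `` {p}"

definition toeplitz_groupoid :: "('g, 'e, 'z) action_scheme \<Rightarrow> ('g, 'e) germ set" where
  "toeplitz_groupoid S = germ_reps S // germ_rel S"

definition toeplitz_topology :: "('g, 'e, 'z) action_scheme \<Rightarrow> ('g, 'e) germ topology" where
  "toeplitz_topology S = topology_generated_by
    {{germ_of S (\<alpha>, g, \<beta>, \<xi>) | \<xi>. \<xi> \<in> V} | \<alpha> g \<beta> V.
       \<alpha> \<in> paths S \<and> g \<in> Grp S \<and> \<beta> \<in> paths S \<and> grng S g = psrc S \<alpha> \<and> gsrc S g = psrc S \<beta> \<and>
       V \<subseteq> cylinder S \<beta> \<and> openin (path_topology S) V}"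

fun rep_source :: "('g, 'e) germ_rep \<Rightarrow> ('g, 'e) xpath" where
  "rep_source (\<alpha>, g, \<beta>, \<xi>) = \<xi>"

fun rep_range :: "('g, 'e, 'z) action_scheme \<Rightarrow> ('g, 'e) germ_rep \<Rightarrow> ('g, 'e) xpath" where
  "rep_range S (\<alpha>, g, \<beta>, \<xi>) = xcat \<alpha> (xact S g (xtail S \<beta> \<xi>))"

definition boundary_groupoid :: "('g, 'e, 'z) action_scheme \<Rightarrow> ('g, 'e) germ set" where
  "boundary_groupoid S = {germ_of S p | p. p \<in> germ_reps S \<and>
     rep_source p \<in> boundary_paths S \<and> rep_range S p \<in> boundary_paths S}"

definition boundary_topology :: "('g, 'e, 'z) action_scheme \<Rightarrow> ('g, 'e) germ topology" where
  "boundary_topology S = subtopology (toeplitz_topology S) (boundary_groupoid S)"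

definition hausdorff_points :: "'a topology \<Rightarrow> 'a set" where
  "hausdorff_points X = {x \<in> topspace X. \<forall>y\<in>topspace X. y \<noteq> x \<longrightarrow>
     (\<exists>U V. openin X U \<and> openin X V \<and> x \<in> U \<and> y \<in> V \<and> U \<inter> V = {})}"


section \<open>Complex square-summable families\<close>

typedef 'a ell2 = "{f :: 'a \<Rightarrow> complex. (\<lambda>i. (cmod (f i))\<^sup>2) summable_on UNIV}"
  morphisms coef Abs_ell2
  by (rule exI[of _ "\<lambda>_. 0"]) simp

setup_lifting type_definition_ell2

lemma ell2_prod_summable:
  fixes f g :: "'a \<Rightarrow> complex"
  assumes "(\<lambda>i. (cmod (f i))\<^sup>2) summable_on UNIV" "(\<lambda>i. (cmod (g i))\<^sup>2) summable_on UNIV"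
  shows "(\<lambda>i. cnj (f i) * g i) summable_on UNIV"
proof -
  have "(\<lambda>i. norm (cnj (f i) * g i)) summable_on UNIV"
    by (rule Infinite_Sum.abs_summable_product)
      (use assms in \<open>simp_all add: norm_mult power2_eq_square\<close>)
  then show ?thesis
    by (rule Infinite_Sum.abs_summable_summable)
qed

lemma ell2_add_closed:
  fixes f g :: "'a \<Rightarrow> complex"
  assumes "(\<lambda>i. (cmod (f i))\<^sup>2) summable_on UNIV" "(\<lambda>i. (cmod (g i))\<^sup>2) summable_on UNIV"
  shows "(\<lambda>i. (cmod (f i + g i))\<^sup>2) summable_on UNIV"
proof (rule summable_on_comparison_test)
  show "(\<lambda>i. 2 * (cmod (f i))\<^sup>2 + 2 * (cmod (g i))\<^sup>2) summable_on UNIV"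
    using assms by (intro summable_on_add summable_on_cmult_right)
  fix i
  have "(cmod (f i + g i))\<^sup>2 \<le> (cmod (f i) + cmod (g i))\<^sup>2"
    by (intro power_mono norm_triangle_ineq) simp
  also have "\<dots> \<le> 2 * (cmod (f i))\<^sup>2 + 2 * (cmod (g i))\<^sup>2"
    using sum_squares_bound[of "cmod (f i)" "cmod (g i)"] by (simp add: power2_sum)
  finally show "(cmod (f i + g i))\<^sup>2 \<le> 2 * (cmod (f i))\<^sup>2 + 2 * (cmod (g i))\<^sup>2" .
qed simp

lemma ell2_scale_closed:
  fixes f :: "'a \<Rightarrow> complex"
  assumes "(\<lambda>i. (cmod (f i))\<^sup>2) summable_on UNIV"
  shows "(\<lambda>i. (cmod (c * f i))\<^sup>2) summable_on UNIV"
  using summable_on_cmult_right[OF assms, of "(cmod c)\<^sup>2"]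
  by (simp add: norm_mult power_mult_distrib)

lift_definition cscale :: "complex \<Rightarrow> 'a ell2 \<Rightarrow> 'a ell2" is "\<lambda>c f i. c * f i"
  by (rule ell2_scale_closed)

lift_definition cinner :: "'a ell2 \<Rightarrow> 'a ell2 \<Rightarrow> complex" is
  "\<lambda>f g. \<Sum>\<^sub>\<infinity>i. cnj (f i) * g i" .

lift_definition ket :: "'a \<Rightarrow> 'a ell2" is "\<lambda>i j. if j = i then 1 else 0"
proof -
  fix i :: 'a
  show "(\<lambda>j. (cmod (if j = i then 1 else 0))\<^sup>2) summable_on UNIV"
    by (rule finite_nonzero_values_imp_summable_on) (auto intro: finite_subset[of _ "{i}"])
qed

lift_definition cut :: "'a set \<Rightarrow> 'a ell2 \<Rightarrow> 'a ell2" is "\<lambda>X f i. if i \<in> X then f i else 0"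
proof -
  fix X :: "'a set" and f :: "'a \<Rightarrow> complex"
  assume "(\<lambda>i. (cmod (f i))\<^sup>2) summable_on UNIV"
  then show "(\<lambda>i. (cmod (if i \<in> X then f i else 0))\<^sup>2) summable_on UNIV"
    by (rule summable_on_comparison_test) auto
qed

instantiation ell2 :: (type) real_inner
begin

lift_definition zero_ell2 :: "'a ell2" is "\<lambda>_. 0" by simp
lift_definition plus_ell2 :: "'a ell2 \<Rightarrow> 'a ell2 \<Rightarrow> 'a ell2" is "\<lambda>f g i. f i + g i"
  by (rule ell2_add_closed)
lift_definition uminus_ell2 :: "'a ell2 \<Rightarrow> 'a ell2" is "\<lambda>f i. - f i" by simp
lift_definition minus_ell2 :: "'a ell2 \<Rightarrow> 'a ell2 \<Rightarrow> 'a ell2" is "\<lambda>f g i. f i - g i"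
  subgoal for f g using ell2_add_closed[of f "\<lambda>i. - g i"] by simp
  done
lift_definition scaleR_ell2 :: "real \<Rightarrow> 'a ell2 \<Rightarrow> 'a ell2" is "\<lambda>r f i. of_real r * f i"
  by (rule ell2_scale_closed)

definition inner_ell2 :: "'a ell2 \<Rightarrow> 'a ell2 \<Rightarrow> real" where
  "inner_ell2 f g = Re (cinner f g)"
definition norm_ell2 :: "'a ell2 \<Rightarrow> real" where
  "norm_ell2 f = sqrt (inner f f)"
definition sgn_ell2 :: "'a ell2 \<Rightarrow> 'a ell2" where
  "sgn_ell2 f = scaleR (inverse (norm f)) f"
definition dist_ell2 :: "'a ell2 \<Rightarrow> 'a ell2 \<Rightarrow> real" where
  "dist_ell2 f g = norm (f - g)"
definition uniformity_ell2 :: "('a ell2 \<times> 'a ell2) filter" where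
  "uniformity_ell2 = (INF e\<in>{0<..}. principal {(x, y). dist x y < e})"
definition open_ell2 :: "'a ell2 set \<Rightarrow> bool" where
  "open_ell2 U \<longleftrightarrow> (\<forall>x\<in>U. \<forall>\<^sub>F (x', y) in uniformity. x' = x \<longrightarrow> y \<in> U)"

lemma inner_ell2_self: "inner f f = (\<Sum>\<^sub>\<infinity>i. (cmod (coef f i))\<^sup>2)"
proof -
  have s: "(\<lambda>i. (cmod (coef f i))\<^sup>2) summable_on UNIV"
    using coef[of f] by simp
  have "cinner f f = (\<Sum>\<^sub>\<infinity>i. complex_of_real ((cmod (coef f i))\<^sup>2))"
    unfolding cinner.rep_eq by (intro infsum_cong) (simp only: complex_norm_square mult.commute)
  also have "\<dots> = complex_of_real (\<Sum>\<^sub>\<infinity>i. (cmod (coef f i))\<^sup>2)"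
    by (rule infsumI, rule has_sum_of_real) (use s in simp)
  finally show ?thesis
    by (simp add: inner_ell2_def)
qed

instance
proof
  fix x y z :: "'a ell2" and r :: real
  have summ: "(\<lambda>i. cnj (coef f i) * coef g i) summable_on UNIV" for f g :: "'a ell2"
    using ell2_prod_summable coef by blast
  show "inner x y = inner y x"
  proof -
    have "cinner y x = cnj (cinner x y)"
      unfolding cinner.rep_eq infsum_cnj[symmetric] by (simp add: mult.commute)
    then show ?thesis by (simp add: inner_ell2_def)
  qed
  show "inner (x + y) z = inner x z + inner y z"
    unfolding inner_ell2_def cinner.rep_eq plus_ell2.rep_eq
    using infsum_add[OF summ[of x z] summ[of y z]] by (simp add: algebra_simps)
  show "inner (r *\<^sub>R x) y = r * inner x y"
    unfolding inner_ell2_def cinner.rep_eq scaleR_ell2.rep_eq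
    using infsum_cmult_right[OF summ[of x y], of "of_real r"] by (simp add: mult.assoc)
  show "0 \<le> inner x x"
    unfolding inner_ell2_self by (simp add: infsum_nonneg)
  show "inner x x = 0 \<longleftrightarrow> x = 0"
  proof
    assume "inner x x = 0"
    then have "(\<Sum>\<^sub>\<infinity>i. (cmod (coef x i))\<^sup>2) = 0"
      by (simp add: inner_ell2_self)
    then have "(cmod (coef x i))\<^sup>2 = 0" for i
      using coef[of x] by (intro nonneg_infsum_le_0D[of "\<lambda>i. (cmod (coef x i))\<^sup>2" UNIV]) auto
    then have "coef x i = 0" for i by simp
    then have "coef x = coef 0"
      by (simp add: zero_ell2.rep_eq fun_eq_iff)
    then show "x = 0" by (simp add: coef_inject)
  next
    assume "x = 0"
    then show "inner x x = 0"
      by (simp add: inner_ell2_self zero_ell2.rep_eq)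
  qed
  show "norm x = sqrt (inner x x)" by (rule norm_ell2_def)
  show "dist x y = norm (x - y)" by (rule dist_ell2_def)
  show "sgn x = scaleR (inverse (norm x)) x" by (rule sgn_ell2_def)
  show "uniformity = (INF e\<in>{0<..}. principal {(x, y :: 'a ell2). dist x y < e})"
    by (rule uniformity_ell2_def)
  show "open U \<longleftrightarrow> (\<forall>x\<in>U. \<forall>\<^sub>F (x', y) in uniformity. x' = x \<longrightarrow> y \<in> U)" for U :: "'a ell2 set"
    by (rule open_ell2_def)
qed (transfer; simp add: algebra_simps)+

end


section \<open>Bounded operators and concrete C*-algebras\<close>

text \<open>
  Bounded operators are rendered by the library type of bounded real-linear maps; the predicate
  \<open>clinear_op\<close> singles out the complex-linear ones, on which both the operator norm and
  the adjoint are the usual ones.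
\<close>

type_synonym 'a oper = "'a ell2 \<Rightarrow>\<^sub>L 'a ell2"

definition clinear_op :: "'a oper \<Rightarrow> bool" where
  "clinear_op A \<longleftrightarrow> (\<forall>c x. blinfun_apply A (cscale c x) = cscale c (blinfun_apply A x))"

definition adj :: "'a oper \<Rightarrow> 'a oper" where
  "adj A = (THE B. \<forall>x y. cinner (blinfun_apply B x) y = cinner x (blinfun_apply A y))"

lift_definition cscalar_op :: "complex \<Rightarrow> 'a oper" is cscale
proof -
  fix c :: complex
  show "bounded_linear (cscale c :: 'a ell2 \<Rightarrow> 'a ell2)"
  proof (rule bounded_linear_intro[where K = "cmod c"])
    fix x y :: "'a ell2" and r :: real
    show "cscale c (x + y) = cscale c x + cscale c y"
      by transfer (simp add: algebra_simps)
    show "cscale c (r *\<^sub>R x) = r *\<^sub>R cscale c x"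
      by transfer (simp add: algebra_simps)
    have "inner (cscale c x) (cscale c x) = (cmod c)\<^sup>2 * inner x x"
      unfolding inner_ell2_self cscale.rep_eq norm_mult power_mult_distrib
      by (rule infsum_cmult_right) (use coef[of x] in simp)
    then show "norm (cscale c x) \<le> norm x * cmod c"
      by (simp add: norm_ell2_def real_sqrt_mult)
  qed
qed

lift_definition proj :: "'a set \<Rightarrow> 'a oper" is cut
proof -
  fix X :: "'a set"
  show "bounded_linear (cut X :: 'a ell2 \<Rightarrow> 'a ell2)"
  proof (rule bounded_linear_intro[where K = 1])
    fix x y :: "'a ell2" and r :: real
    show "cut X (x + y) = cut X x + cut X y"
      by transfer auto
    show "cut X (r *\<^sub>R x) = r *\<^sub>R cut X x"
      by transfer auto
    have "inner (cut X x) (cut X x) \<le> inner x x"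
      unfolding inner_ell2_self
    proof (rule infsum_mono)
      show "(\<lambda>i. (cmod (coef (cut X x) i))\<^sup>2) summable_on UNIV"
        "(\<lambda>i. (cmod (coef x i))\<^sup>2) summable_on UNIV"
        using coef[of "cut X x"] coef[of x] by simp_all
    qed (simp add: cut.rep_eq)
    then show "norm (cut X x) \<le> norm x * 1"
      by (simp add: norm_ell2_def)
  qed
qed

definition oscale :: "complex \<Rightarrow> 'a oper \<Rightarrow> 'a oper" where
  "oscale c A = cscalar_op c o\<^sub>L A"

global_interpretation oper: vector_space "oscale :: complex \<Rightarrow> 'a oper \<Rightarrow> 'a oper"
proof
  fix a b :: complex and x y :: "'a oper"
  show "oscale a (x + y) = oscale a x + oscale a y"
    by (rule blinfun_eqI) (simp add: oscale_def blinfun.add_left blinfun.add_right)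
  show "oscale (a + b) x = oscale a x + oscale b x"
    by (rule blinfun_eqI)
      (simp add: oscale_def blinfun.add_left cscalar_op.rep_eq, transfer, simp add: algebra_simps)
  show "oscale a (oscale b x) = oscale (a * b) x"
    by (rule blinfun_eqI) (simp add: oscale_def cscalar_op.rep_eq, transfer, simp add: algebra_simps)
  show "oscale 1 x = x"
    by (rule blinfun_eqI) (simp add: oscale_def cscalar_op.rep_eq, transfer, simp)
qed

definition closed_span :: "'a oper set \<Rightarrow> 'a oper set" where
  "closed_span M = closure (oper.span M)"

definition cstar_algebra :: "'a oper set \<Rightarrow> bool" where
  "cstar_algebra A \<longleftrightarrow>
    (\<forall>a\<in>A. clinear_op a) \<and> oper.subspace A \<and> closed A \<and>
    (\<forall>a\<in>A. \<forall>b\<in>A. a o\<^sub>L b \<in> A) \<and> (\<forall>a\<in>A. adj a \<in> A)"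

definition cstar_generated :: "'a oper set \<Rightarrow> 'a oper set" where
  "cstar_generated M = \<Inter>{A. cstar_algebra A \<and> M \<subseteq> A}"

definition positives :: "'a oper set \<Rightarrow> 'a oper set" where
  "positives A = {adj a o\<^sub>L a | a. a \<in> A}"

definition abelian :: "'a oper set \<Rightarrow> bool" where
  "abelian A \<longleftrightarrow> (\<forall>a\<in>A. \<forall>b\<in>A. a o\<^sub>L b = b o\<^sub>L a)"

definition maximal_abelian :: "'a oper set \<Rightarrow> 'a oper set \<Rightarrow> bool" where
  "maximal_abelian A B \<longleftrightarrow>
    cstar_algebra A \<and> abelian A \<and> A \<subseteq> B \<and>
    (\<forall>A'. cstar_algebra A' \<and> abelian A' \<and> A \<subseteq> A' \<and> A' \<subseteq> B \<longrightarrow> A' = A)"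

text \<open>The net is represented by a proper filter.\<close>

definition contains_approximate_unit :: "'a oper set \<Rightarrow> 'a oper set \<Rightarrow> bool" where
  "contains_approximate_unit A B \<longleftrightarrow>
    (\<exists>F. F \<noteq> bot \<and> eventually (\<lambda>u. u \<in> positives A \<and> norm u \<le> 1) F \<and>
      (\<forall>b\<in>B. ((\<lambda>u. u o\<^sub>L b) \<longlongrightarrow> b) F \<and> ((\<lambda>u. b o\<^sub>L u) \<longlongrightarrow> b) F))"

definition normalizers :: "'a oper set \<Rightarrow> 'a oper set \<Rightarrow> 'a oper set" where
  "normalizers A B = {b \<in> B. \<forall>a\<in>A. b o\<^sub>L a o\<^sub>L adj b \<in> A \<and> adj b o\<^sub>L a o\<^sub>L b \<in> A}"

definition conditional_expectation ::
    "('a oper \<Rightarrow> 'a oper) \<Rightarrow> 'a oper set \<Rightarrow> 'a oper set \<Rightarrow> bool" where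
  "conditional_expectation P A B \<longleftrightarrow>
    P ` B \<subseteq> A \<and> (\<forall>a\<in>A. P a = a) \<and>
    (\<forall>x\<in>B. \<forall>y\<in>B. P (x + y) = P x + P y) \<and> (\<forall>c. \<forall>x\<in>B. P (oscale c x) = oscale c (P x)) \<and>
    (\<forall>x\<in>B. norm (P x) \<le> norm x) \<and> P ` positives B \<subseteq> positives A \<and>
    (\<forall>a\<in>A. \<forall>x\<in>B. P (a o\<^sub>L x) = a o\<^sub>L P x \<and> P (x o\<^sub>L a) = P x o\<^sub>L a)"

definition faithful_on :: "('a oper \<Rightarrow> 'a oper) \<Rightarrow> 'a oper set \<Rightarrow> bool" where
  "faithful_on P B \<longleftrightarrow> (\<forall>x\<in>positives B. P x = 0 \<longrightarrow> x = 0)"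

definition cartan_inclusion :: "'a oper set \<Rightarrow> 'a oper set \<Rightarrow> bool" where
  "cartan_inclusion A B \<longleftrightarrow>
    cstar_algebra B \<and> maximal_abelian A B \<and> contains_approximate_unit A B \<and>
    B = closed_span (normalizers A B) \<and>
    (\<exists>P. conditional_expectation P A B \<and> faithful_on P B)"

definition cstar_isomorphism ::
    "('a oper \<Rightarrow> 'a oper) \<Rightarrow> 'a oper set \<Rightarrow> 'a oper set \<Rightarrow> bool" where
  "cstar_isomorphism \<phi> A B \<longleftrightarrow>
    cstar_algebra A \<and> cstar_algebra B \<and> bij_betw \<phi> A B \<and>
    (\<forall>x\<in>A. \<forall>y\<in>A. \<phi> (x + y) = \<phi> x + \<phi> y \<and> \<phi> (x o\<^sub>L y) = \<phi> x o\<^sub>L \<phi> y) \<and>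
    (\<forall>c. \<forall>x\<in>A. \<phi> (oscale c x) = oscale c (\<phi> x)) \<and> (\<forall>x\<in>A. \<phi> (adj x) = adj (\<phi> x))"


section \<open>The algebras of a twisted action\<close>

text \<open>
  The line \<open>L\<^sub>\<gamma>\<close> is \<open>\<complex>\<close> times the basis vector
  \<open>ket \<gamma>\<close>. A system of unit vectors as below exists and is unique up to one
  phase for each \<open>\<gamma>\<close>.
\<close>

definition delta_system ::
    "('g, 'e) twisted_action \<Rightarrow> (('g, 'e) germ_rep \<Rightarrow> ('g, 'e) germ ell2) \<Rightarrow> bool" where
  "delta_system S d \<longleftrightarrow>
    (\<forall>p\<in>germ_reps S. \<exists>c. cmod c = 1 \<and> d p = cscale c (ket (germ_of S p))) \<and>
    (\<forall>\<alpha> g \<beta> \<xi>. (\<alpha>, g, \<beta>, \<xi>) \<in> germ_reps S \<longrightarrow>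
      (\<forall>\<beta>'\<in>paths S. prng \<beta>' = psrc S \<beta> \<and> xprefix S (pcat \<beta> \<beta>') \<xi> \<longrightarrow>
        d (\<alpha>, g, \<beta>, \<xi>) =
          cscale (ptw S g \<beta>') (d (pcat \<alpha> (pact S g \<beta>'), psect S g \<beta>', pcat \<beta> \<beta>', \<xi>))))"

definition delta :: "('g, 'e) twisted_action \<Rightarrow> ('g, 'e) germ_rep \<Rightarrow> ('g, 'e) germ ell2" where
  "delta S = (SOME d. delta_system S d)"

text \<open>
  The type of all sets of representatives contains more than the elements of the groupoid; the
  operators are extended by zero to the superfluous basis vectors.
\<close>

definition W_op :: "('g, 'e) twisted_action \<Rightarrow> 'g \<Rightarrow> ('g, 'e) germ oper" where
  "W_op S g = (THE A. clinear_op A \<and>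
    (\<forall>x. x \<notin> toeplitz_groupoid S \<longrightarrow> blinfun_apply A (ket x) = 0) \<and>
    (\<forall>\<alpha> h \<beta> \<xi>. (\<alpha>, h, \<beta>, \<xi>) \<in> germ_reps S \<longrightarrow>
      blinfun_apply A (delta S (\<alpha>, h, \<beta>, \<xi>)) =
        (if gsrc S g = prng \<alpha>
         then cscale (ptw S g \<alpha> * twG S (psect S g \<alpha>) h)
                (delta S (pact S g \<alpha>, gmult S (psect S g \<alpha>) h, \<beta>, \<xi>))
         else 0)))"

definition T_op :: "('g, 'e) twisted_action \<Rightarrow> 'e \<Rightarrow> ('g, 'e) germ oper" where
  "T_op S e = (THE A. clinear_op A \<and>
    (\<forall>x. x \<notin> toeplitz_groupoid S \<longrightarrow> blinfun_apply A (ket x) = 0) \<and>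
    (\<forall>\<alpha> h \<beta> \<xi>. (\<alpha>, h, \<beta>, \<xi>) \<in> germ_reps S \<longrightarrow>
      blinfun_apply A (delta S (\<alpha>, h, \<beta>, \<xi>)) =
        (if esrc S e = prng \<alpha> then delta S (pcat (erng S e, [e]) \<alpha>, h, \<beta>, \<xi>) else 0)))"

text \<open>
  Operators on the subspace spanned by the \<open>L\<^sub>\<gamma>\<close> with
  \<open>\<gamma> \<in> X\<close> are regarded as operators on the whole space that vanish on its
  orthogonal complement, so restricting to the subspace is composing with the projection.
\<close>

definition restrict_op :: "'a set \<Rightarrow> 'a oper \<Rightarrow> 'a oper" where
  "restrict_op X A = A o\<^sub>L proj X"

definition W_on :: "('g, 'e) twisted_action \<Rightarrow> ('g, 'e) germ set \<Rightarrow> 'g \<Rightarrow> ('g, 'e) germ oper" where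
  "W_on S X g = restrict_op X (W_op S g)"

definition T_on :: "('g, 'e) twisted_action \<Rightarrow> ('g, 'e) germ set \<Rightarrow> 'e \<Rightarrow> ('g, 'e) germ oper" where
  "T_on S X e = restrict_op X (T_op S e)"

definition T_path ::
    "('g, 'e) twisted_action \<Rightarrow> ('g, 'e) germ set \<Rightarrow> ('g, 'e) path \<Rightarrow> ('g, 'e) germ oper" where
  "T_path S X \<mu> = (if snd \<mu> = [] then W_on S X (fst \<mu>)
     else foldr (\<lambda>e A. T_on S X e o\<^sub>L A) (snd \<mu>) id_blinfun)"

text \<open>
  The whole algebra (no subscript), and the subspaces with the subscripts \<open>0\<close> and
  \<open>00\<close>.
\<close>

datatype subscript = NoSub | Sub0 | Sub00

fun alg_on ::
    "('g, 'e) twisted_action \<Rightarrow> ('g, 'e) germ set \<Rightarrow> subscript \<Rightarrow> ('g, 'e) germ oper set" where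
  "alg_on S X NoSub = cstar_generated (W_on S X ` Grp S \<union> T_on S X ` Edges S)"
| "alg_on S X Sub0 = closed_span
     {T_path S X \<alpha> o\<^sub>L W_on S X g o\<^sub>L adj (T_path S X \<beta>) | \<alpha> g \<beta>.
        \<alpha> \<in> paths S \<and> g \<in> Grp S \<and> \<beta> \<in> paths S \<and> plen \<alpha> = plen \<beta>}"
| "alg_on S X Sub00 = closed_span
     {W_on S X g o\<^sub>L T_path S X \<beta> o\<^sub>L adj (T_path S X \<beta>) | g \<beta>.
        g \<in> Grp S \<and> \<beta> \<in> paths S \<and> gsrc S g = prng \<beta>}"

definition diag_on ::
    "('g, 'e) twisted_action \<Rightarrow> ('g, 'e) germ set \<Rightarrow> ('g, 'e) germ oper set" where
  "diag_on S X = closed_span {T_path S X \<beta> o\<^sub>L adj (T_path S X \<beta>) | \<beta>. \<beta> \<in> paths S}"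

definition toeplitz_hausdorff :: "('g, 'e) twisted_action \<Rightarrow> ('g, 'e) germ set" where
  "toeplitz_hausdorff S = hausdorff_points (toeplitz_topology S)"

definition boundary_hausdorff :: "('g, 'e) twisted_action \<Rightarrow> ('g, 'e) germ set" where
  "boundary_hausdorff S = hausdorff_points (boundary_topology S)"

definition T_red :: "('g, 'e) twisted_action \<Rightarrow> subscript \<Rightarrow> ('g, 'e) germ oper set" where
  "T_red S = alg_on S (toeplitz_groupoid S)"

definition T_ess :: "('g, 'e) twisted_action \<Rightarrow> subscript \<Rightarrow> ('g, 'e) germ oper set" where
  "T_ess S = alg_on S (toeplitz_hausdorff S)"

definition O_red :: "('g, 'e) twisted_action \<Rightarrow> subscript \<Rightarrow> ('g, 'e) germ oper set" where
  "O_red S = alg_on S (boundary_groupoid S)"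

definition O_ess :: "('g, 'e) twisted_action \<Rightarrow> subscript \<Rightarrow> ('g, 'e) germ oper set" where
  "O_ess S = alg_on S (boundary_hausdorff S)"

text \<open>
  The commutative subalgebras identified with the continuous functions vanishing at infinity on
  the path space and on the boundary path space.
\<close>

definition C0_path_space :: "('g, 'e) twisted_action \<Rightarrow> ('g, 'e) germ oper set" where
  "C0_path_space S = diag_on S (toeplitz_groupoid S)"

definition C0_boundary :: "('g, 'e) twisted_action \<Rightarrow> ('g, 'e) germ oper set" where
  "C0_boundary S = diag_on S (boundary_groupoid S)"

text \<open>
  The canonical map from a reduced to an essential algebra maps generators to generators, that
  is, it restricts operators to the Hausdorff part.
\<close>

definition O_red_eq_ess :: "('g, 'e) twisted_action \<Rightarrow> subscript \<Rightarrow> bool" where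
  "O_red_eq_ess S k \<longleftrightarrow>
    cstar_isomorphism (restrict_op (boundary_hausdorff S)) (O_red S k) (O_ess S k)"

definition T_red_eq_ess :: "('g, 'e) twisted_action \<Rightarrow> subscript \<Rightarrow> bool" where
  "T_red_eq_ess S k \<longleftrightarrow>
    cstar_isomorphism (restrict_op (toeplitz_hausdorff S)) (T_red S k) (T_ess S k)"

end

theory Submission
  imports Defs
begin

text \<open>
  All algebras are closed spans of monomials \<open>T\<^sub>\<alpha> W\<^sub>g T\<^sub>\<beta>\<^sup>*\<close>, which map each basis
  vector of a germ to a multiple of such a vector or to zero, and the diagonal acts on the basis
  vector of a germ through the range of the germ. Hence an operator commutes with the diagonal iff
  its matrix entries only link germs with the same range.

  Under (Fin), the points at which the germ of \<open>g\<close> is a unit form a finite union of cylinders.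
  Therefore the groupoids are Hausdorff, and passing to the diagonal of a matrix is a faithful
  conditional expectation onto the diagonal subalgebra. What remains is maximality, which follows
  if two germs with a common source that agree as partial maps near it are equal; this is where
  (Evr), (Cyc) and (Rec) enter.

  Conversely, if \<open>g\<close> acts trivially near \<open>\<zeta>\<close>, then \<open>W\<^sub>g\<close> compressed to a neighbourhood of
  \<open>\<zeta>\<close> commutes with the diagonal, and maximality forces the germ of \<open>g\<close> at \<open>\<zeta>\<close> to be a unit.
  This gives (Evr) and (Rec). A cycle \<open>\<alpha>\<close> without entrance leads to a single boundary path, so
  that \<open>T\<^sub>\<alpha> W\<^sub>g\<^sup>*\<close> commutes with the diagonal of \<open>O\<close>. If (Fin) fails for \<open>g\<close>, then strongly fixed
  paths accumulate at a boundary path \<open>\<xi>\<close> at which the germ of \<open>g\<close> is not a unit. For a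
  conditional expectation \<open>E\<close>, the continuous function \<open>E(W\<^sub>g)\<close> has modulus one on strongly
  fixed paths and vanishes where \<open>g\<close> moves points; so \<open>g\<close> acts trivially near \<open>\<xi>\<close>, a
  contradiction.
\<close>

section \<open>Operators on square-summable families\<close>

text \<open>Toeplitz and boundary case are treated at once, by germs with source in a set
  \<open>Y\<close> that is the path space or the boundary. Apart from the Hausdorff points, topology
  enters only as the filter \<open>near\<close> of agreement on finitely many cylinders.

  The obstacle to maximality is that an element of an algebra is a norm limit of sums of monomials,
  so its matrix entries have no local formula. Entries of a finite sum, however, are constant along
  suitable families of germs near a given one; a large entry therefore persists and gives two germs
  equal ranges on a neighbourhood. If their left paths are equally long, they differ by a groupoid
  element that fixes all paths of a cylinder, and (Evr) applies; a path ending at a regular vertex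
  is isolated in the path space and needs (Rec). On the path space finite paths exclude different
  lengths; on the boundary these lead to a cycle without entrance, hence (Cyc).

  In the converse the expectation is arbitrary and its bimodule property has to do. Positive
  elements are products \<open>adj a o\<^sub>L a\<close> within the algebra, so positivity of the
  diagonal map needs square roots in the diagonal algebra.\<close>

lemma coef_add [simp]: "coef (x + y) i = coef x i + coef y i"
  by (simp add: plus_ell2.rep_eq)

lemma coef_diff [simp]: "coef (x - y) i = coef x i - coef y i"
  by (simp add: minus_ell2.rep_eq)

lemma coef_zero [simp]: "coef 0 i = 0"
  by (simp add: zero_ell2.rep_eq)

lemma coef_scaleR [simp]: "coef (r *\<^sub>R x) i = of_real r * coef x i"
  by (simp add: scaleR_ell2.rep_eq)

lemma coef_cscale [simp]: "coef (cscale c x) i = c * coef x i"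
  by (simp add: cscale.rep_eq)

lemma coef_ket: "coef (ket i) j = (if j = i then 1 else 0)"
  by (simp add: ket.rep_eq)

lemma coef_cut [simp]: "coef (cut X x) i = (if i \<in> X then coef x i else 0)"
  by (simp add: cut.rep_eq)

lemma coef_sum [simp]: "coef (sum f A) i = (\<Sum>a\<in>A. coef (f a) i)"
  by (induction A rule: infinite_finite_induct) auto

lemma ell2_eqI: "(\<And>i. coef x i = coef y i) \<Longrightarrow> x = y"
  by (metis coef_inject ext)

lemma coef_summable: "(\<lambda>i. (cmod (coef x i))\<^sup>2) summable_on UNIV"
  using coef[of x] by simp

lemma norm_ell2_sq: "(norm x)\<^sup>2 = (\<Sum>\<^sub>\<infinity>i. (cmod (coef x i))\<^sup>2)"
  by (simp add: norm_ell2_def inner_ell2_self infsum_nonneg)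

lemma norm_ell2_sq_has_sum: "((\<lambda>i. (cmod (coef x i))\<^sup>2) has_sum (norm x)\<^sup>2) UNIV"
  unfolding norm_ell2_sq using coef_summable by (rule has_sum_infsum)

lemma sum_le_norm_sq: "finite F \<Longrightarrow> (\<Sum>i\<in>F. (cmod (coef x i))\<^sup>2) \<le> (norm x)\<^sup>2"
  unfolding norm_ell2_sq by (rule finite_sum_le_infsum) (auto simp: coef_summable)

lemma norm_coef_le: "cmod (coef x i) \<le> norm x"
  using sum_le_norm_sq[of "{i}" x] by (auto intro: power2_le_imp_le)

lemma norm_cscale [simp]: "norm (cscale c x) = cmod c * norm x"
proof -
  have "(norm (cscale c x))\<^sup>2 = (cmod c * norm x)\<^sup>2"
    unfolding norm_ell2_sq coef_cscale norm_mult power_mult_distrib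
    by (rule infsum_cmult_right) (use coef_summable in simp)
  then show ?thesis by (simp add: power2_eq_iff_nonneg)
qed

lemma norm_ket [simp]: "norm (ket i) = 1"
proof -
  have "(norm (ket i))\<^sup>2 = (\<Sum>\<^sub>\<infinity>j. if j = i then 1 else 0)"
    unfolding norm_ell2_sq by (intro infsum_cong) (simp add: coef_ket)
  also have "\<dots> = (\<Sum>\<^sub>\<infinity>j\<in>{i}. 1)"
    by (intro infsum_cong_neutral) auto
  finally have "(norm (ket i))\<^sup>2 = 1" by simp
  then show ?thesis using power2_eq_iff_nonneg[of "norm (ket i)" 1] by simp
qed

lemma cscale_cscale [simp]: "cscale a (cscale b x) = cscale (a * b) x"
  by (rule ell2_eqI) simp

lemma cscale_1 [simp]: "cscale 1 x = x"
  by (rule ell2_eqI) simp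

lemma cscale_0 [simp]: "cscale 0 x = 0" "cscale c 0 = 0"
  by (rule ell2_eqI, simp)+

lemma cscale_add_right: "cscale c (x + y) = cscale c x + cscale c y"
  by (rule ell2_eqI) (simp add: algebra_simps)

lemma cscale_of_real: "cscale (of_real r) x = r *\<^sub>R x"
  by (rule ell2_eqI) simp

lemma cscale_cancel: "c \<noteq> 0 \<Longrightarrow> cscale c x = cscale c y \<longleftrightarrow> x = y"
  by (metis cscale_1 cscale_cscale left_inverse)

lemma cscale_ket_eq_iff: "c \<noteq> 0 \<Longrightarrow> cscale c (ket i) = cscale d (ket j) \<longleftrightarrow> i = j \<and> c = d"
proof
  assume c: "c \<noteq> 0" and eq: "cscale c (ket i) = cscale d (ket j)"
  from eq have "coef (cscale c (ket i)) i = coef (cscale d (ket j)) i" by simp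
  with c show "i = j \<and> c = d" by (auto simp: coef_ket split: if_splits)
qed auto

lemma cinner_summable: "(\<lambda>i. cnj (coef x i) * coef y i) summable_on UNIV"
  using ell2_prod_summable coef by blast

lemma cinner_add_right: "cinner x (y + z) = cinner x y + cinner x z"
  unfolding cinner.rep_eq
  using infsum_add[OF cinner_summable[of x y] cinner_summable[of x z]]
  by (simp add: algebra_simps)

lemma cinner_cscale_right: "cinner x (cscale c y) = c * cinner x y"
  unfolding cinner.rep_eq
  using infsum_cmult_right[OF cinner_summable[of x y], of c] by (simp add: mult_ac)

lemma cinner_commute: "cinner x y = cnj (cinner y x)"
  unfolding cinner.rep_eq infsum_cnj[symmetric] by (simp add: mult.commute)

lemma cinner_add_left: "cinner (y + z) x = cinner y x + cinner z x"
  by (subst (1 2 3) cinner_commute) (simp add: cinner_add_right)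

lemma cinner_cscale_left: "cinner (cscale c y) x = cnj c * cinner y x"
  by (subst (1 2) cinner_commute) (simp add: cinner_cscale_right)

lemma cinner_zero [simp]: "cinner x 0 = 0" "cinner 0 x = 0"
  by (simp_all add: cinner.rep_eq)

lemma cinner_sum_left: "cinner (sum f A) x = (\<Sum>a\<in>A. cinner (f a) x)"
  by (induction A rule: infinite_finite_induct) (auto simp: cinner_add_left)

lemma cinner_ket_left [simp]: "cinner (ket i) x = coef x i"
proof -
  have "cinner (ket i) x = (\<Sum>\<^sub>\<infinity>j. if j = i then coef x i else 0)"
    unfolding cinner.rep_eq by (intro infsum_cong) (simp add: coef_ket)
  also have "\<dots> = (\<Sum>\<^sub>\<infinity>j\<in>{i}. coef x i)"
    by (intro infsum_cong_neutral) auto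
  finally show ?thesis by simp
qed

lemma cinner_ket_right [simp]: "cinner x (ket i) = cnj (coef x i)"
  by (subst cinner_commute) simp

lemma cinner_self: "cinner x x = of_real ((norm x)\<^sup>2)"
proof -
  have "((\<lambda>i. complex_of_real ((cmod (coef x i))\<^sup>2)) has_sum of_real ((norm x)\<^sup>2)) UNIV"
    using norm_ell2_sq_has_sum has_sum_of_real by blast
  moreover have "complex_of_real ((cmod (coef x i))\<^sup>2) = cnj (coef x i) * coef x i" for i
    by (simp only: complex_norm_square mult.commute)
  ultimately show ?thesis
    unfolding cinner.rep_eq by (simp add: infsumI)
qed

lemma Re_cinner: "Re (cinner x y) = inner x y"
  by (simp add: inner_ell2_def)

text \<open>The real Cauchy-Schwarz inequality concerns \<open>inner\<close>, the real part of
  \<open>cinner\<close>. Multiplying \<open>y\<close> by the unimodular \<open>c\<close> makes the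
  product real and nonnegative without changing the norm of \<open>y\<close>.\<close>

lemma norm_cinner_le: "cmod (cinner x y) \<le> norm x * norm y"
proof (cases "cinner x y = 0")
  case False
  define c where "c = cnj (cinner x y) / cmod (cinner x y)"
  have "cmod c = 1" using False by (simp add: c_def norm_divide)
  have "c * cinner x y = (cinner x y * cnj (cinner x y)) / cmod (cinner x y)"
    by (simp add: c_def)
  also have "\<dots> = of_real (cmod (cinner x y))"
    unfolding complex_norm_square[symmetric] using False by (simp add: power2_eq_square)
  finally have "c * cinner x y = of_real (cmod (cinner x y))" .
  then have "cmod (cinner x y) = Re (cinner x (cscale c y))"
    by (simp add: cinner_cscale_right)
  also have "\<dots> \<le> norm x * norm (cscale c y)"
    unfolding Re_cinner by (rule norm_cauchy_schwarz)
  finally show ?thesis using \<open>cmod c = 1\<close> by simp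
qed simp

lemma cut_eq_sum: "finite F \<Longrightarrow> cut F x = (\<Sum>i\<in>F. cscale (coef x i) (ket i))"
  by (rule ell2_eqI) (auto simp: coef_ket if_distrib cong: if_cong)

text \<open>The squared norm of \<open>x - cut F x\<close> is the tail of the convergent series of
  squared coefficients.\<close>

lemma tendsto_cut: "((\<lambda>F. cut F x) \<longlongrightarrow> x) (finite_subsets_at_top UNIV)"
proof -
  have norm_eq: "(norm (x - cut F x))\<^sup>2 = (norm x)\<^sup>2 - (\<Sum>i\<in>F. (cmod (coef x i))\<^sup>2)"
    if "finite F" for F
  proof -
    have "((\<lambda>i. (cmod (coef x i))\<^sup>2) has_sum ((norm x)\<^sup>2 - (\<Sum>i\<in>F. (cmod (coef x i))\<^sup>2))) (UNIV - F)"
      by (rule has_sum_Diff[OF norm_ell2_sq_has_sum has_sum_finite[OF that]]) auto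
    moreover have "((\<lambda>i. (cmod (coef (x - cut F x) i))\<^sup>2) has_sum (norm (x - cut F x))\<^sup>2) (UNIV - F)"
      by (rule has_sum_cong_neutral[THEN iffD1, OF _ _ _ norm_ell2_sq_has_sum]) auto
    then have "((\<lambda>i. (cmod (coef x i))\<^sup>2) has_sum (norm (x - cut F x))\<^sup>2) (UNIV - F)"
      by (rule has_sum_cong[THEN iffD1, rotated]) auto
    ultimately show ?thesis using has_sum_unique by blast
  qed
  have "((\<lambda>F. (norm x)\<^sup>2 - (\<Sum>i\<in>F. (cmod (coef x i))\<^sup>2)) \<longlongrightarrow> (norm x)\<^sup>2 - (norm x)\<^sup>2)
     (finite_subsets_at_top UNIV)"
    using norm_ell2_sq_has_sum[of x] unfolding has_sum_def by (intro tendsto_intros)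
  then have "((\<lambda>F. (norm (x - cut F x))\<^sup>2) \<longlongrightarrow> 0) (finite_subsets_at_top UNIV)"
    by (rule Lim_transform_eventually[OF tendsto_eq_rhs])
      (auto simp: norm_eq eventually_finite_subsets_at_top intro!: exI[of _ "{}"])
  then have "((\<lambda>F. sqrt ((norm (x - cut F x))\<^sup>2)) \<longlongrightarrow> sqrt 0) (finite_subsets_at_top UNIV)"
    by (rule tendsto_real_sqrt)
  then have "((\<lambda>F. norm (cut F x - x)) \<longlongrightarrow> 0) (finite_subsets_at_top UNIV)"
    by (simp add: norm_minus_commute)
  then show ?thesis
    using LIM_zero_cancel tendsto_norm_zero_iff by blast
qed

section \<open>Complex-linear operators and their matrix entries\<close>

lemma clinear_opD: "clinear_op A \<Longrightarrow> blinfun_apply A (cscale c x) = cscale c (blinfun_apply A x)"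
  by (simp add: clinear_op_def)

lemma clinear_apply_cut:
  fixes A :: "'a oper"
  assumes "clinear_op A" "finite F"
  shows "blinfun_apply A (cut F x) = (\<Sum>i\<in>F. cscale (coef x i) (blinfun_apply A (ket i)))"
  using assms by (simp add: cut_eq_sum blinfun.sum_right clinear_opD)

text \<open>Finite truncations \<open>cut F x\<close> converge to \<open>x\<close>, and on them
  complex linearity determines an operator from its values on basis vectors. Real linearity would
  leave the values on \<open>cscale \<i> (ket i)\<close> open.\<close>

lemma clinear_op_eqI:
  fixes A :: "'a oper"
  assumes "clinear_op A" "clinear_op B" "\<And>i. blinfun_apply A (ket i) = blinfun_apply B (ket i)"
  shows "A = B"
proof (rule blinfun_eqI)
  fix x
  let ?G = "finite_subsets_at_top (UNIV :: 'a set)"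
  have lim: "((\<lambda>F. blinfun_apply C (cut F x)) \<longlongrightarrow> blinfun_apply C x) ?G" for C :: "'a oper"
    by (intro blinfun.tendsto tendsto_cut tendsto_const)
  have "\<forall>\<^sub>F F in ?G. blinfun_apply A (cut F x) = blinfun_apply B (cut F x)"
    by (auto simp: eventually_finite_subsets_at_top clinear_apply_cut assms intro!: exI[of _ "{}"])
  with lim[of B] have "((\<lambda>F. blinfun_apply A (cut F x)) \<longlongrightarrow> blinfun_apply B x) ?G"
    by (simp add: tendsto_cong)
  then show "blinfun_apply A x = blinfun_apply B x"
    using tendsto_unique[OF finite_subsets_at_top_neq_bot lim[of A]] by blast
qed

definition entry :: "'a oper \<Rightarrow> 'a \<Rightarrow> 'a \<Rightarrow> complex" where
  "entry A i j = coef (blinfun_apply A (ket j)) i"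

lemma clinear_op_entry_eqI:
  assumes "clinear_op A" "clinear_op B" "\<And>i j. entry A i j = entry B i j"
  shows "A = B"
  using assms by (intro clinear_op_eqI ell2_eqI) (auto simp: entry_def)

lemma norm_entry_le: "cmod (entry A i j) \<le> norm A"
proof -
  have "cmod (entry A i j) \<le> norm (blinfun_apply A (ket j))"
    unfolding entry_def by (rule norm_coef_le)
  also have "\<dots> \<le> norm A" using norm_blinfun[of A "ket j"] by simp
  finally show ?thesis .
qed

lemma entry_add [simp]: "entry (A + B) i j = entry A i j + entry B i j"
  by (simp add: entry_def blinfun.add_left)

lemma entry_diff [simp]: "entry (A - B) i j = entry A i j - entry B i j"
  by (simp add: entry_def blinfun.diff_left)

lemma entry_zero [simp]: "entry 0 i j = 0"
  by (simp add: entry_def)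

lemma oscale_apply [simp]: "blinfun_apply (oscale c A) x = cscale c (blinfun_apply A x)"
  by (simp add: oscale_def cscalar_op.rep_eq)

lemma entry_oscale [simp]: "entry (oscale c A) i j = c * entry A i j"
  by (simp add: entry_def)

lemma entry_sum [simp]: "entry (sum f I) i j = (\<Sum>a\<in>I. entry (f a) i j)"
  by (induction I rule: infinite_finite_induct) auto

lemma bounded_linear_entry: "bounded_linear (\<lambda>A. entry A i j)"
  by (rule bounded_linear_intro[where K = 1])
    (auto simp: norm_entry_le, auto simp: entry_def blinfun.scaleR_left scaleR_conv_of_real)

lemma clinear_op_add: "clinear_op A \<Longrightarrow> clinear_op B \<Longrightarrow> clinear_op (A + B)"
  by (simp add: clinear_op_def blinfun.add_left cscale_add_right)

lemma clinear_op_oscale: "clinear_op A \<Longrightarrow> clinear_op (oscale c A)"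
  by (simp add: clinear_op_def mult.commute)

lemma clinear_op_zero [simp]: "clinear_op 0"
  by (simp add: clinear_op_def)

lemma clinear_op_id [simp]: "clinear_op id_blinfun"
  by (simp add: clinear_op_def)

lemma clinear_op_uminus: "clinear_op A \<Longrightarrow> clinear_op (- A)"
  using clinear_op_oscale[of A "-1"] by (simp add: oper.scale_minus_left)

lemma clinear_op_diff: "clinear_op A \<Longrightarrow> clinear_op B \<Longrightarrow> clinear_op (A - B)"
  using clinear_op_add[OF _ clinear_op_uminus, of A B] by simp

lemma clinear_op_sum: "(\<And>i. i \<in> I \<Longrightarrow> clinear_op (f i)) \<Longrightarrow> clinear_op (sum f I)"
  by (induction I rule: infinite_finite_induct) (auto intro: clinear_op_add)

lemma clinear_op_comp: "clinear_op A \<Longrightarrow> clinear_op B \<Longrightarrow> clinear_op (A o\<^sub>L B)"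
  by (simp add: clinear_op_def)

lemma clinear_op_proj [simp]: "clinear_op (proj X)"
  unfolding clinear_op_def proj.rep_eq by (auto intro!: ell2_eqI)

lemma oscale_comp_left [simp]: "oscale c A o\<^sub>L B = oscale c (A o\<^sub>L B)"
  by (rule blinfun_eqI) simp

lemma oscale_comp_right: "clinear_op A \<Longrightarrow> A o\<^sub>L oscale c B = oscale c (A o\<^sub>L B)"
  by (rule blinfun_eqI) (simp add: clinear_opD)

lemma norm_oscale [simp]: "norm (oscale c A) = cmod c * norm A"
proof -
  have le: "norm (oscale c A) \<le> cmod c * norm A" for c :: complex and A :: "'a oper"
    by (rule norm_blinfun_bound)
      (auto simp: mult.assoc intro!: mult_left_mono norm_blinfun)
  show ?thesis
  proof (cases "c = 0")
    case False
    have "norm A = norm (oscale (inverse c) (oscale c A))" using False by simp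
    also have "\<dots> \<le> cmod (inverse c) * norm (oscale c A)" by (rule le)
    finally have "cmod c * norm A \<le> cmod c * (cmod (inverse c) * norm (oscale c A))"
      by (intro mult_left_mono) auto
    also have "\<dots> = norm (oscale c A)"
      using False by (simp add: norm_inverse)
    finally have "cmod c * norm A \<le> norm (oscale c A)" .
    with le[of c A] show ?thesis by simp
  qed simp
qed

lemma proj_ket: "blinfun_apply (proj X) (ket i) = (if i \<in> X then ket i else 0)"
  by (auto intro!: ell2_eqI simp: proj.rep_eq coef_ket)

subsection \<open>Adjoints\<close>

lemma norm_sum_ket:
  assumes "finite F"
  shows "(norm (\<Sum>i\<in>F. cscale (c i) (ket i)))\<^sup>2 = (\<Sum>i\<in>F. (cmod (c i))\<^sup>2)"
proof -
  let ?y = "\<Sum>i\<in>F. cscale (c i) (ket i)"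
  have c: "coef ?y j = (if j \<in> F then c j else 0)" for j
  proof -
    have "coef ?y j = (\<Sum>i\<in>F. if i = j then c i else 0)"
      unfolding coef_sum by (intro sum.cong) (auto simp: coef_ket)
    then show ?thesis using assms by simp
  qed
  have "(norm ?y)\<^sup>2 = (\<Sum>\<^sub>\<infinity>i\<in>F. (cmod (c i))\<^sup>2)"
    unfolding norm_ell2_sq c by (intro infsum_cong_neutral) auto
  then show ?thesis using assms by simp
qed

text \<open>Test \<open>A\<close> on the vector \<open>?y\<close> built from the coefficients
  themselves: their sum of squares \<open>?S\<close> is then at most
  \<open>norm A * norm x * sqrt ?S\<close>, and one factor \<open>sqrt ?S\<close> cancels.\<close>

lemma adj_coef_bound:
  assumes "clinear_op A" "finite F"
  shows "(\<Sum>i\<in>F. (cmod (cinner (blinfun_apply A (ket i)) x))\<^sup>2) \<le> (norm A * norm x)\<^sup>2"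
proof -
  let ?c = "\<lambda>i. cinner (blinfun_apply A (ket i)) x"
  let ?y = "\<Sum>i\<in>F. cscale (?c i) (ket i)"
  let ?S = "\<Sum>i\<in>F. (cmod (?c i))\<^sup>2"
  have S: "?S \<ge> 0" by (simp add: sum_nonneg)
  have "cinner (blinfun_apply A ?y) x = (\<Sum>i\<in>F. cnj (?c i) * ?c i)"
    using assms(1) by (simp add: blinfun.sum_right clinear_opD cinner_sum_left cinner_cscale_left)
  also have "\<dots> = of_real ?S"
    unfolding of_real_sum by (intro sum.cong) (simp_all only: complex_norm_square mult.commute)
  finally have "cmod (cinner (blinfun_apply A ?y) x) = \<bar>?S\<bar>"
    by (simp only: norm_of_real)
  then have "?S = cmod (cinner (blinfun_apply A ?y) x)"
    using S by linarith
  also have "\<dots> \<le> norm (blinfun_apply A ?y) * norm x"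
    by (rule norm_cinner_le)
  also have "\<dots> \<le> (norm A * norm ?y) * norm x"
    by (intro mult_right_mono norm_blinfun) auto
  also have "norm ?y = sqrt ?S"
    by (rule real_sqrt_unique[OF norm_sum_ket[OF assms(2)] norm_ge_zero, symmetric])
  finally have le: "?S \<le> (norm A * norm x) * sqrt ?S" by (simp add: mult_ac)
  show ?thesis
  proof (cases "?S = 0")
    case False
    then have "sqrt ?S > 0" using S by simp
    moreover have "sqrt ?S * sqrt ?S \<le> (norm A * norm x) * sqrt ?S" using le S by simp
    ultimately have "sqrt ?S \<le> norm A * norm x" by (rule mult_right_le_imp_le[rotated])
    then have "(sqrt ?S)\<^sup>2 \<le> (norm A * norm x)\<^sup>2"
      using \<open>sqrt ?S > 0\<close> less_imp_le power_mono by blast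
    then show ?thesis using real_sqrt_pow2[OF S] by simp
  qed simp
qed

lemma summable_from_bound:
  fixes f :: "'a \<Rightarrow> complex"
  assumes "\<And>F. finite F \<Longrightarrow> (\<Sum>i\<in>F. (cmod (f i))\<^sup>2) \<le> K\<^sup>2" and "K \<ge> 0"
  shows "(\<lambda>i. (cmod (f i))\<^sup>2) summable_on UNIV" "norm (Abs_ell2 f) \<le> K" "coef (Abs_ell2 f) = f"
proof -
  show s: "(\<lambda>i. (cmod (f i))\<^sup>2) summable_on UNIV"
    by (rule nonneg_bdd_above_summable_on) (use assms in \<open>auto intro!: bdd_aboveI[of _ "K\<^sup>2"]\<close>)
  then show c: "coef (Abs_ell2 f) = f" by (simp add: Abs_ell2_inverse)
  have "(norm (Abs_ell2 f))\<^sup>2 \<le> K\<^sup>2"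
    unfolding norm_ell2_sq c using s assms(1) by (intro infsum_le_finite_sums) auto
  then show "norm (Abs_ell2 f) \<le> K" using assms(2) by (rule power2_le_imp_le)
qed

text \<open>The coordinates of \<open>B x\<close> are forced to be the products of
  \<open>A (ket i)\<close> with \<open>x\<close>, and \<open>adj_coef_bound\<close> makes them
  square-summable. The adjoint identity holds for truncations of \<open>y\<close> and passes to the
  limit. Existence is what gives the definite description in \<open>adj\<close> a value.\<close>

lemma adj_exists:
  assumes A: "clinear_op A"
  obtains B where "\<And>x y. cinner (blinfun_apply B x) y = cinner x (blinfun_apply A y)"
    "clinear_op B" "norm B \<le> norm A"
proof -
  define f where "f x = Abs_ell2 (\<lambda>i. cinner (blinfun_apply A (ket i)) x)" for x
  have coef_f: "coef (f x) i = cinner (blinfun_apply A (ket i)) x" for x i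
    unfolding f_def
    by (subst summable_from_bound(3)[where K = "norm A * norm x"]) (auto intro: adj_coef_bound A)
  have nf: "norm (f x) \<le> norm A * norm x" for x
    unfolding f_def by (rule summable_from_bound(2)) (auto intro: adj_coef_bound A)
  have bl: "bounded_linear f"
  proof (rule bounded_linear_intro[where K = "norm A"])
    show "f (x + y) = f x + f y" for x y
      by (rule ell2_eqI) (simp add: coef_f cinner_add_right)
    show "f (r *\<^sub>R x) = r *\<^sub>R f x" for r x
      by (rule ell2_eqI) (simp add: coef_f cscale_of_real[symmetric] cinner_cscale_right)
    show "norm (f x) \<le> norm x * norm A" for x using nf[of x] by (simp add: mult.commute)
  qed
  define B where "B = Blinfun f"
  have B: "blinfun_apply B = f" using bl by (simp add: B_def bounded_linear_Blinfun_apply)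
  have cB: "clinear_op B" unfolding clinear_op_def B
    by (auto intro!: ell2_eqI simp: coef_f cinner_cscale_right)
  have "norm B \<le> norm A" by (rule norm_blinfun_bound) (auto simp: B nf)
  moreover have "cinner (blinfun_apply B x) y = cinner x (blinfun_apply A y)" for x y
  proof -
    have bl2: "bounded_linear (cinner z)" for z :: "'a ell2"
      by (rule bounded_linear_intro[where K = "norm z"])
        (auto simp: cinner_add_right cscale_of_real[symmetric] cinner_cscale_right
          scaleR_conv_of_real, metis norm_cinner_le mult.commute)
    have lim1: "((\<lambda>F. cinner (f x) (cut F y)) \<longlongrightarrow> cinner (f x) y) (finite_subsets_at_top UNIV)"
      by (intro bounded_linear.tendsto[OF bl2] tendsto_cut)
    have lim2: "((\<lambda>F. cinner x (blinfun_apply A (cut F y))) \<longlongrightarrow> cinner x (blinfun_apply A y))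
        (finite_subsets_at_top UNIV)"
      by (intro bounded_linear.tendsto[OF bl2] blinfun.tendsto tendsto_cut tendsto_const)
    have "\<forall>\<^sub>F F in finite_subsets_at_top UNIV.
        cinner (f x) (cut F y) = cinner x (blinfun_apply A (cut F y))"
    proof -
      have "cinner (f x) (cut F y) = cinner x (blinfun_apply A (cut F y))" if "finite F" for F
      proof -
        have s: "cinner z (sum h F) = (\<Sum>i\<in>F. cinner z (h i))" for z :: "'a ell2" and h
          using that by (induction F) (auto simp: cinner_add_right)
        show ?thesis
          by (simp add: clinear_apply_cut[OF A that] cut_eq_sum[OF that] s cinner_cscale_right
              coef_f cinner_commute[of x] blinfun.sum_right cinner_sum_left
              clinear_opD[OF A] cinner_cscale_left)
      qed
      then show ?thesis by (auto simp: eventually_finite_subsets_at_top intro!: exI[of _ "{}"])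
    qed
    with lim1 have "((\<lambda>F. cinner x (blinfun_apply A (cut F y))) \<longlongrightarrow> cinner (f x) y)
        (finite_subsets_at_top UNIV)"
      by (simp add: tendsto_cong)
    then show ?thesis
      unfolding B using tendsto_unique[OF finite_subsets_at_top_neq_bot lim2] by auto
  qed
  ultimately show thesis using cB that by blast
qed

lemma adj_unique:
  assumes "\<And>x y. cinner (blinfun_apply B x) y = cinner x (blinfun_apply A y)"
  shows "adj A = B"
  unfolding adj_def
proof (rule the_equality)
  show "\<forall>x y. cinner (blinfun_apply B x) y = cinner x (blinfun_apply A y)" using assms by blast
  fix C assume C: "\<forall>x y. cinner (blinfun_apply C x) y = cinner x (blinfun_apply A y)"
  have "coef (blinfun_apply C x) i = coef (blinfun_apply B x) i" for x i
  proof -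
    have "cinner (blinfun_apply C x) (ket i) = cinner (blinfun_apply B x) (ket i)"
      using C assms by metis
    then show ?thesis by simp
  qed
  then show "C = B" by (intro blinfun_eqI ell2_eqI)
qed

lemma
  assumes "clinear_op A"
  shows cinner_adj: "cinner (blinfun_apply (adj A) x) y = cinner x (blinfun_apply A y)"
    and clinear_op_adj [simp, intro]: "clinear_op (adj A)"
    and norm_adj_le: "norm (adj A) \<le> norm A"
proof -
  obtain B where B: "\<And>x y. cinner (blinfun_apply B x) y = cinner x (blinfun_apply A y)"
    "clinear_op B" "norm B \<le> norm A" using adj_exists[OF assms] by blast
  have "adj A = B" using B(1) by (rule adj_unique)
  then show "cinner (blinfun_apply (adj A) x) y = cinner x (blinfun_apply A y)"
    "clinear_op (adj A)" "norm (adj A) \<le> norm A" using B by auto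
qed

lemma entry_adj [simp]: "clinear_op A \<Longrightarrow> entry (adj A) i j = cnj (entry A j i)"
  using cinner_adj[of A "ket j" "ket i"] unfolding entry_def
  by (metis cinner_ket_left cinner_ket_right complex_cnj_cnj)

lemma adj_adj [simp]: "clinear_op A \<Longrightarrow> adj (adj A) = A"
  by (rule clinear_op_entry_eqI) auto

lemma norm_adj: "clinear_op A \<Longrightarrow> norm (adj A) = norm A"
  by (metis adj_adj clinear_op_adj norm_adj_le order_antisym)

lemma adj_add: "clinear_op A \<Longrightarrow> clinear_op B \<Longrightarrow> adj (A + B) = adj A + adj B"
  by (rule clinear_op_entry_eqI) (auto simp: clinear_op_add)

lemma adj_diff: "clinear_op A \<Longrightarrow> clinear_op B \<Longrightarrow> adj (A - B) = adj A - adj B"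
  by (rule clinear_op_entry_eqI) (auto simp: clinear_op_diff)

lemma adj_oscale: "clinear_op A \<Longrightarrow> adj (oscale c A) = oscale (cnj c) (adj A)"
  by (rule clinear_op_entry_eqI) (auto simp: clinear_op_oscale)

lemma adj_zero [simp]: "adj 0 = 0"
  by (rule clinear_op_entry_eqI) auto

lemma adj_comp: "clinear_op A \<Longrightarrow> clinear_op B \<Longrightarrow> adj (A o\<^sub>L B) = adj B o\<^sub>L adj A"
  by (rule adj_unique) (simp add: cinner_adj)

lemma cinner_adj': "clinear_op A \<Longrightarrow> cinner x (blinfun_apply (adj A) y) = cinner (blinfun_apply A x) y"
  by (metis adj_adj cinner_adj clinear_op_adj)

lemma entry_adj_comp_self:
  assumes "clinear_op A"
  shows "entry (adj A o\<^sub>L A) i i = of_real ((norm (blinfun_apply A (ket i)))\<^sup>2)"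
proof -
  have "entry (adj A o\<^sub>L A) i i = cinner (ket i) (blinfun_apply (adj A) (blinfun_apply A (ket i)))"
    by (simp add: entry_def)
  also have "\<dots> = cinner (blinfun_apply A (ket i)) (blinfun_apply A (ket i))"
    by (rule cinner_adj'[OF assms])
  finally show ?thesis by (simp add: cinner_self)
qed

text \<open>The equality case of the Cauchy-Schwarz inequality.\<close>

lemma contraction_adj_apply:
  assumes "clinear_op A" "norm A \<le> 1" "blinfun_apply A x = y" "norm x = norm y"
  shows "blinfun_apply (adj A) y = x"
proof -
  let ?z = "blinfun_apply (adj A) y"
  have "norm ?z \<le> norm y"
  proof -
    have "norm ?z \<le> norm (adj A) * norm y" by (rule norm_blinfun)
    also have "\<dots> \<le> 1 * norm y"
      using assms(2) norm_adj[OF assms(1)] by (intro mult_right_mono) auto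
    finally show ?thesis by simp
  qed
  moreover have "inner ?z x = (norm y)\<^sup>2"
    using assms cinner_adj[of A y x] by (simp add: Re_cinner[symmetric] cinner_self)
  moreover have "(norm (?z - x))\<^sup>2 = (norm ?z)\<^sup>2 - 2 * inner ?z x + (norm x)\<^sup>2"
    by (simp add: power2_norm_eq_inner inner_diff_left inner_diff_right inner_commute)
  moreover have "(norm ?z)\<^sup>2 \<le> (norm y)\<^sup>2" using calculation(1) by (intro power_mono) auto
  ultimately have "(norm (?z - x))\<^sup>2 \<le> 0" using assms(4) by simp
  then show ?thesis by simp
qed

lemma adj_ket_eq_0:
  assumes "clinear_op A" "\<And>j. entry A i j = 0"
  shows "blinfun_apply (adj A) (ket i) = 0"
  by (rule ell2_eqI) (use entry_adj[OF assms(1), of _ i] assms(2) in \<open>auto simp: entry_def\<close>)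

subsection \<open>Monomial and diagonal operators\<close>

text \<open>By injectivity each coordinate of the image comes from at most one coordinate of
  \<open>x\<close>, so the bound \<open>K\<close> on the weights bounds the norm. The operators of
  groupoid elements and edges, and the diagonal operators with given entries, are obtained from
  this.\<close>

lemma monomial_op_exists:
  fixes D :: "'a set" and c :: "'a \<Rightarrow> complex"
  assumes inj: "inj_on f D" and c: "\<And>i. i \<in> D \<Longrightarrow> cmod (c i) \<le> K" and K: "K \<ge> 0"
  obtains A where "clinear_op A" "norm A \<le> K"
    "\<And>i. blinfun_apply A (ket i) = (if i \<in> D then cscale (c i) (ket (f i)) else 0)"
proof -
  define h where "h x j = (if j \<in> f ` D then c (inv_into D f j) * coef x (inv_into D f j) else 0)"
    for x :: "'a ell2" and j
  have bound: "(\<Sum>j\<in>F. (cmod (h x j))\<^sup>2) \<le> (K * norm x)\<^sup>2" if "finite F" for F x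
  proof -
    have "(\<Sum>j\<in>F. (cmod (h x j))\<^sup>2) = (\<Sum>j\<in>F \<inter> f ` D. (cmod (h x j))\<^sup>2)"
      using that by (intro sum.mono_neutral_right) (auto simp: h_def)
    also have "\<dots> \<le> (\<Sum>j\<in>F \<inter> f ` D. K\<^sup>2 * (cmod (coef x (inv_into D f j)))\<^sup>2)"
      by (intro sum_mono)
        (auto simp: h_def norm_mult power_mult_distrib inj c intro!: mult_right_mono power_mono)
    also have "\<dots> = K\<^sup>2 * (\<Sum>i\<in>inv_into D f ` (F \<inter> f ` D). (cmod (coef x i))\<^sup>2)"
      by (subst sum.reindex) (auto simp: sum_distrib_left intro: inj_on_inv_into)
    also have "\<dots> \<le> K\<^sup>2 * (norm x)\<^sup>2"
      using that by (intro mult_left_mono sum_le_norm_sq) auto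
    finally show ?thesis by (simp add: power_mult_distrib)
  qed
  define g where "g x = Abs_ell2 (h x)" for x
  have cg: "coef (g x) = h x" for x
    unfolding g_def by (rule summable_from_bound(3)[OF bound]) (auto simp: K)
  have ng: "norm (g x) \<le> K * norm x" for x
    unfolding g_def by (rule summable_from_bound(2)[OF bound]) (auto simp: K)
  have bl: "bounded_linear g"
  proof (rule bounded_linear_intro[where K = K])
    show "g (x + y) = g x + g y" for x y by (rule ell2_eqI) (simp add: cg h_def distrib_left)
    show "g (r *\<^sub>R x) = r *\<^sub>R g x" for r x by (rule ell2_eqI) (simp add: cg h_def)
    show "norm (g x) \<le> norm x * K" for x using ng[of x] by (simp add: mult.commute)
  qed
  define A where "A = Blinfun g"
  have A: "blinfun_apply A = g" using bl by (simp add: A_def bounded_linear_Blinfun_apply)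
  show thesis
  proof
    show "clinear_op A" unfolding clinear_op_def A by (auto intro!: ell2_eqI simp: cg h_def)
    show "norm A \<le> K" by (rule norm_blinfun_bound) (auto simp: A ng K)
    show "blinfun_apply A (ket i) = (if i \<in> D then cscale (c i) (ket (f i)) else 0)" for i
    proof (rule ell2_eqI)
      fix j
      show "coef (blinfun_apply A (ket i)) j =
          coef (if i \<in> D then cscale (c i) (ket (f i)) else 0) j"
      proof (cases "j \<in> f ` D")
        case True
        then obtain k where k: "k \<in> D" "j = f k" by blast
        then have "inv_into D f j = k" "i \<in> D \<Longrightarrow> f k = f i \<longleftrightarrow> k = i"
          using inj inj_onD by (fastforce simp: inv_into_f_f)+
        then show ?thesis using k by (auto simp: A cg h_def coef_ket)
      next
        case False
        then show ?thesis by (auto simp: A cg h_def coef_ket)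
      qed
    qed
  qed
qed

definition diagonal :: "'a oper \<Rightarrow> bool" where
  "diagonal A \<longleftrightarrow> clinear_op A \<and> (\<forall>i j. i \<noteq> j \<longrightarrow> entry A i j = 0)"

lemma diagonal_apply_ket: "diagonal A \<Longrightarrow> blinfun_apply A (ket i) = cscale (entry A i i) (ket i)"
  by (rule ell2_eqI) (auto simp: diagonal_def entry_def coef_ket)

lemma diagonal_eqI:
  assumes "diagonal A" "diagonal B" "\<And>i. entry A i i = entry B i i"
  shows "A = B"
  using assms by (intro clinear_op_entry_eqI) (metis diagonal_def)+

lemma diag_op_exists:
  assumes "\<And>i. cmod (d i) \<le> K"
  obtains A where "diagonal A" "norm A \<le> K" "\<And>i. entry A i i = d i"
proof -
  have K: "K \<ge> 0" using assms[of undefined] norm_ge_zero order_trans by blast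
  obtain A where A: "clinear_op A" "norm A \<le> K"
    "\<And>i. blinfun_apply A (ket i) = (if i \<in> UNIV then cscale (d i) (ket (id i)) else 0)"
    using monomial_op_exists[of id UNIV d K] assms K by auto
  have "entry A i j = (if i = j then d i else 0)" for i j
    using A(3)[of j] by (auto simp: entry_def coef_ket)
  then show thesis using A that[of A] by (auto simp: diagonal_def)
qed

lemma norm_diagonal_le:
  assumes "diagonal A" "\<And>i. cmod (entry A i i) \<le> K"
  shows "norm A \<le> K"
proof -
  obtain B where "diagonal B" "norm B \<le> K" "\<And>i. entry B i i = entry A i i"
    using diag_op_exists[of "\<lambda>i. entry A i i"] assms(2) by blast
  then show ?thesis using diagonal_eqI[of A B] assms(1) by auto
qed

lemma entry_comp_diagonal_right:
  "clinear_op A \<Longrightarrow> diagonal B \<Longrightarrow> entry (A o\<^sub>L B) i j = entry A i j * entry B j j"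
  by (simp add: entry_def[of "A o\<^sub>L B"] diagonal_apply_ket clinear_opD) (simp add: entry_def)

text \<open>A left factor acts on rows, while \<open>entry\<close> is read off from the image of a
  basis vector; adjoints reduce this to the case of a right factor.\<close>

lemma entry_comp_diagonal_left:
  assumes "clinear_op A" "diagonal B"
  shows "entry (B o\<^sub>L A) i j = entry B i i * entry A i j"
proof -
  have cB: "clinear_op B" using assms by (simp add: diagonal_def)
  have dB: "diagonal (adj B)" using assms by (auto simp: diagonal_def)
  have "entry (B o\<^sub>L A) i j = cnj (entry (adj (B o\<^sub>L A)) j i)"
    using clinear_op_comp[OF cB assms(1)] by simp
  also have "\<dots> = cnj (entry (adj A o\<^sub>L adj B) j i)"
    using assms(1) cB by (simp add: adj_comp)
  also have "\<dots> = entry B i i * entry A i j"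
    using assms(1) cB dB by (simp add: entry_comp_diagonal_right)
  finally show ?thesis .
qed

lemma diagonal_add: "diagonal A \<Longrightarrow> diagonal B \<Longrightarrow> diagonal (A + B)"
  by (auto simp: diagonal_def clinear_op_add)

lemma diagonal_oscale: "diagonal A \<Longrightarrow> diagonal (oscale c A)"
  by (auto simp: diagonal_def clinear_op_oscale)

lemma diagonal_zero [simp]: "diagonal 0"
  by (auto simp: diagonal_def)

lemma diagonal_adj: "diagonal A \<Longrightarrow> diagonal (adj A)"
  by (auto simp: diagonal_def)

lemma diagonal_comp: "diagonal A \<Longrightarrow> diagonal B \<Longrightarrow> diagonal (A o\<^sub>L B)"
  using entry_comp_diagonal_right[of A B] by (auto simp: diagonal_def clinear_op_comp)

text \<open>The compression of a matrix to its diagonal. The entries are bounded, so such an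
  operator exists, and they determine it; the description only carries the norm bound along.\<close>

definition pinch :: "'a oper \<Rightarrow> 'a oper" where
  "pinch A = (SOME B. diagonal B \<and> norm B \<le> norm A \<and> (\<forall>i. entry B i i = entry A i i))"

lemma pinch: "diagonal (pinch A)" "norm (pinch A) \<le> norm A" "entry (pinch A) i i = entry A i i"
proof -
  have "\<exists>B. diagonal B \<and> norm B \<le> norm A \<and> (\<forall>i. entry B i i = entry A i i)"
    using diag_op_exists[of "\<lambda>i. entry A i i" "norm A"] norm_entry_le by metis
  from someI_ex[OF this] show "diagonal (pinch A)" "norm (pinch A) \<le> norm A"
    "entry (pinch A) i i = entry A i i" unfolding pinch_def by auto
qed

subsection \<open>Closed spans and concrete C*-algebras\<close>

lemma closed_span_superset: "M \<subseteq> closed_span M"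
  unfolding closed_span_def using closure_subset oper.span_superset by blast

lemma closed_closed_span [simp]: "closed (closed_span M)"
  by (simp add: closed_span_def)

lemma closed_span_minimal:
  assumes "M \<subseteq> C" "oper.subspace C" "closed C"
  shows "closed_span M \<subseteq> C"
  unfolding closed_span_def using assms by (intro closure_minimal oper.span_minimal)

lemma tendsto_oscale:
  fixes f :: "_ \<Rightarrow> 'a oper"
  assumes "(f \<longlongrightarrow> a) F"
  shows "((\<lambda>x. oscale c (f x)) \<longlongrightarrow> oscale c a) F"
proof -
  have "bounded_linear (oscale c :: 'a oper \<Rightarrow> 'a oper)"
  proof (rule bounded_linear_intro[where K = "cmod c"])
    show "oscale c (A + B) = oscale c A + oscale c B" for A B :: "'a oper"
      by (rule oper.scale_right_distrib)
    show "oscale c (r *\<^sub>R A) = r *\<^sub>R oscale c A" for r and A :: "'a oper"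
      by (rule blinfun_eqI, rule ell2_eqI) (simp add: blinfun.scaleR_left)
  qed (simp add: mult.commute)
  then show ?thesis using assms by (rule bounded_linear.tendsto)
qed

lemma subspace_closed_span: "oper.subspace (closed_span M)"
proof (rule oper.subspaceI)
  show "0 \<in> closed_span M"
    unfolding closed_span_def using closure_subset oper.span_zero by blast
next
  fix x y assume "x \<in> closed_span M" "y \<in> closed_span M"
  then obtain f g where f: "\<And>n. f n \<in> oper.span M" "f \<longlonglongrightarrow> x"
    and g: "\<And>n. g n \<in> oper.span M" "g \<longlonglongrightarrow> y"
    unfolding closed_span_def closure_sequential by metis
  then show "x + y \<in> closed_span M"
    unfolding closed_span_def closure_sequential
    by (intro exI[of _ "\<lambda>n. f n + g n"]) (auto intro: tendsto_add oper.span_add)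
next
  fix c x assume "x \<in> closed_span M"
  then obtain f where f: "\<And>n. f n \<in> oper.span M" "f \<longlonglongrightarrow> x"
    unfolding closed_span_def closure_sequential by metis
  then show "oscale c x \<in> closed_span M"
    unfolding closed_span_def closure_sequential
    by (intro exI[of _ "\<lambda>n. oscale c (f n)"]) (auto intro: tendsto_oscale oper.span_scale)
qed

lemma closed_span_mono: "M \<subseteq> N \<Longrightarrow> closed_span M \<subseteq> closed_span N"
  unfolding closed_span_def by (intro closure_mono oper.span_mono)

lemma closed_span_subsetI: "M \<subseteq> closed_span N \<Longrightarrow> closed_span M \<subseteq> closed_span N"
  by (intro closed_span_minimal subspace_closed_span) auto

lemma closed_span_approx:
  assumes "x \<in> closed_span M" "e > 0"
  obtains y where "y \<in> oper.span M" "norm (x - y) < e"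
  using assms unfolding closed_span_def closure_approachable dist_norm
  by (metis norm_minus_commute)

text \<open>Sequences suffice for the closure since operators form a metric space. Most facts about
  the algebras are reduced to their generators in this way.\<close>

lemma closed_span_induct [consumes 1, case_names zero add scale limit gen]:
  assumes x: "x \<in> closed_span M"
    and "P 0" "\<And>x y. P x \<Longrightarrow> P y \<Longrightarrow> P (x + y)" "\<And>c x. P x \<Longrightarrow> P (oscale c x)"
    and "\<And>f x. (\<And>n::nat. P (f n)) \<Longrightarrow> f \<longlonglongrightarrow> x \<Longrightarrow> P x"
    and "\<And>x. x \<in> M \<Longrightarrow> P x"
  shows "P x"
proof -
  have "closed_span M \<subseteq> {x. P x}"
  proof (rule closed_span_minimal)
    show "oper.subspace {x. P x}" using assms by (intro oper.subspaceI) auto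
    show "closed {x. P x}" unfolding closed_sequential_limits using assms(5) by blast
  qed (use assms in auto)
  with x show ?thesis by blast
qed

lemma clinear_op_limit:
  assumes "\<And>n::nat. clinear_op (f n)" "f \<longlonglongrightarrow> A"
  shows "clinear_op A"
proof -
  have "blinfun_apply A (cscale c x) = cscale c (blinfun_apply A x)" for c x
  proof -
    have "(\<lambda>n. blinfun_apply (f n) (cscale c x)) \<longlonglongrightarrow> blinfun_apply A (cscale c x)"
      by (intro blinfun.tendsto assms tendsto_const)
    moreover have "(\<lambda>n. blinfun_apply (cscalar_op c) (blinfun_apply (f n) x))
        \<longlonglongrightarrow> blinfun_apply (cscalar_op c) (blinfun_apply A x)"
      by (intro blinfun.tendsto assms tendsto_const)
    ultimately show ?thesis
      using assms(1) by (simp add: cscalar_op.rep_eq clinear_opD LIMSEQ_unique)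
  qed
  then show ?thesis by (simp add: clinear_op_def)
qed

lemma clinear_op_closed_span:
  assumes "x \<in> closed_span M" "\<And>a. a \<in> M \<Longrightarrow> clinear_op a"
  shows "clinear_op x"
  using assms(1)
  by (induction rule: closed_span_induct)
    (auto intro: clinear_op_add clinear_op_oscale clinear_op_limit assms(2))

lemma tendsto_comp:
  fixes f g :: "_ \<Rightarrow> 'a oper"
  shows "(f \<longlongrightarrow> a) F \<Longrightarrow> (g \<longlongrightarrow> b) F \<Longrightarrow> ((\<lambda>x. f x o\<^sub>L g x) \<longlongrightarrow> a o\<^sub>L b) F"
  by (rule bounded_bilinear.tendsto[OF bounded_bilinear_blinfun_compose])

lemmas comp_add_left = bounded_bilinear.add_left[OF bounded_bilinear_blinfun_compose]
lemmas comp_add_right = bounded_bilinear.add_right[OF bounded_bilinear_blinfun_compose]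
lemmas comp_diff_right = bounded_bilinear.diff_right[OF bounded_bilinear_blinfun_compose]
lemmas comp_zero_left [simp] = bounded_bilinear.zero_left[OF bounded_bilinear_blinfun_compose]
lemmas comp_zero_right [simp] = bounded_bilinear.zero_right[OF bounded_bilinear_blinfun_compose]

lemma comp_assoc: "(a o\<^sub>L b) o\<^sub>L c = a o\<^sub>L (b o\<^sub>L (c :: 'a oper))"
  by (rule blinfun_eqI) simp

lemma tendsto_adj:
  assumes "\<And>n::nat. clinear_op (f n)" "f \<longlonglongrightarrow> A"
  shows "(\<lambda>n. adj (f n)) \<longlonglongrightarrow> adj A"
proof -
  have A: "clinear_op A" using assms by (rule clinear_op_limit)
  have "norm (adj (f n) - adj A) = norm (f n - A)" for n
    using assms(1) A by (simp add: adj_diff[symmetric] norm_adj clinear_op_diff)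
  then have "(\<lambda>n. norm (adj (f n) - adj A)) \<longlonglongrightarrow> 0"
    using assms(2) by (simp add: LIM_zero_iff tendsto_norm_zero_iff)
  then show ?thesis using LIM_zero_cancel tendsto_norm_zero_iff by blast
qed

text \<open>Products are treated one factor at a time: first a generator on the right of an
  arbitrary element, then an arbitrary right factor. Complex linearity lets scalars pass through the
  left factor and makes the adjoint isometric, hence continuous.\<close>

lemma cstar_algebra_closed_span:
  assumes cl: "\<And>a. a \<in> M \<Longrightarrow> clinear_op a"
    and mult: "\<And>a b. a \<in> M \<Longrightarrow> b \<in> M \<Longrightarrow> a o\<^sub>L b \<in> closed_span M"
    and star: "\<And>a. a \<in> M \<Longrightarrow> adj a \<in> closed_span M"
  shows "cstar_algebra (closed_span M)"
proof -
  note sub = subspace_closed_span[of M]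
  note sp = oper.subspace_add[OF sub] oper.subspace_scale[OF sub] oper.subspace_0[OF sub]
  note cls = clinear_op_closed_span[OF _ cl]
  have lim: "x \<in> closed_span M" if "\<And>n::nat. f n \<in> closed_span M" "f \<longlonglongrightarrow> x" for f x
    using closed_closed_span that closed_sequentially by blast
  have 1: "a o\<^sub>L b \<in> closed_span M" if "a \<in> closed_span M" "b \<in> M" for a b
    using that(1)
  proof (induction rule: closed_span_induct)
    case (limit f x)
    show ?case using limit(1) by (rule lim[of "\<lambda>n. f n o\<^sub>L b"]) (intro tendsto_comp limit(2) tendsto_const)
  qed (auto simp: comp_add_left intro: sp mult that)
  have 2: "a o\<^sub>L b \<in> closed_span M" if a: "a \<in> closed_span M" and b: "b \<in> closed_span M" for a b
    using b
  proof (induction rule: closed_span_induct)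
    case (limit f x)
    show ?case using limit(1) by (rule lim[of "\<lambda>n. a o\<^sub>L f n"]) (intro tendsto_comp limit(2) tendsto_const)
  qed (auto simp: comp_add_right oscale_comp_right cls[OF a] intro: sp 1 a)
  have "a \<in> closed_span M \<Longrightarrow> a \<in> closed_span M \<and> adj a \<in> closed_span M" for a
  proof (induction rule: closed_span_induct)
    case (limit f x)
    have "(\<lambda>n. adj (f n)) \<longlonglongrightarrow> adj x"
      by (rule tendsto_adj[OF _ limit(2)]) (use limit(1) cls in blast)
    then show ?case using limit(1) lim[of "\<lambda>n. adj (f n)" "adj x"] lim[OF _ limit(2)] by blast
  next
    case (gen x)
    then show ?case using closed_span_superset star by blast
  qed (auto simp: adj_add adj_oscale cls intro: sp)
  then have 3: "adj a \<in> closed_span M" if "a \<in> closed_span M" for a using that by blast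
  show ?thesis
    unfolding cstar_algebra_def by (intro conjI ballI cls sub 2 3) auto
qed

lemma cstar_algebraD:
  assumes "cstar_algebra A"
  shows "a \<in> A \<Longrightarrow> clinear_op a" "oper.subspace A" "closed A"
    "a \<in> A \<Longrightarrow> b \<in> A \<Longrightarrow> a o\<^sub>L b \<in> A" "a \<in> A \<Longrightarrow> adj a \<in> A"
    "0 \<in> A" "a \<in> A \<Longrightarrow> b \<in> A \<Longrightarrow> a + b \<in> A" "a \<in> A \<Longrightarrow> oscale c a \<in> A"
    "a \<in> A \<Longrightarrow> b \<in> A \<Longrightarrow> a - b \<in> A"
  using assms by (auto simp: cstar_algebra_def
      intro: oper.subspace_0 oper.subspace_add oper.subspace_scale oper.subspace_diff)

lemma cstar_algebra_sum:
  "cstar_algebra A \<Longrightarrow> (\<And>i. i \<in> I \<Longrightarrow> f i \<in> A) \<Longrightarrow> sum f I \<in> A"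
  by (rule oper.subspace_sum) (auto intro: cstar_algebraD)

lemma cstar_algebra_limit:
  "cstar_algebra A \<Longrightarrow> (\<And>n::nat. f n \<in> A) \<Longrightarrow> f \<longlonglongrightarrow> x \<Longrightarrow> x \<in> A"
  using closed_sequentially cstar_algebraD(3) by blast

lemma cstar_generated_subset: "cstar_algebra A \<Longrightarrow> M \<subseteq> A \<Longrightarrow> cstar_generated M \<subseteq> A"
  unfolding cstar_generated_def by blast

lemma cstar_generated_superset: "M \<subseteq> cstar_generated M"
  unfolding cstar_generated_def by blast

text \<open>The hypothesis excludes an intersection over no algebra at all, which would contain
  every real-linear operator.\<close>

lemma cstar_algebra_generated:
  assumes "\<exists>A. cstar_algebra A \<and> M \<subseteq> A"
  shows "cstar_algebra (cstar_generated M)"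
proof -
  obtain A0 where A0: "cstar_algebra A0" "M \<subseteq> A0" using assms by blast
  let ?F = "{A. cstar_algebra A \<and> M \<subseteq> A}"
  have "\<forall>a\<in>cstar_generated M. clinear_op a"
    using A0 cstar_algebraD(1) unfolding cstar_generated_def by blast
  moreover have "oper.subspace (cstar_generated M)"
    unfolding cstar_generated_def by (rule oper.subspace_Inter) (auto intro: cstar_algebraD)
  moreover have "closed (cstar_generated M)"
    unfolding cstar_generated_def by (rule closed_Inter) (auto intro: cstar_algebraD)
  ultimately show ?thesis
    unfolding cstar_algebra_def by (auto simp: cstar_generated_def intro: cstar_algebraD)
qed

section \<open>Commutants and maximal abelian subalgebras\<close>

definition commutant :: "'a oper set \<Rightarrow> 'a oper set" where
  "commutant M = {x. clinear_op x \<and> (\<forall>a\<in>M. x o\<^sub>L a = a o\<^sub>L x)}"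

lemma commutantD:
  assumes "x \<in> commutant M"
  shows "clinear_op x" "a \<in> M \<Longrightarrow> x o\<^sub>L a = a o\<^sub>L x"
  using assms unfolding commutant_def by blast+

lemma cstar_algebra_commutant:
  assumes "\<And>a. a \<in> M \<Longrightarrow> clinear_op a" "\<And>a. a \<in> M \<Longrightarrow> adj a \<in> M"
  shows "cstar_algebra (commutant M)"
proof -
  have "closed (commutant M)"
  proof (unfold closed_sequential_limits, intro allI impI, elim conjE)
    fix f x assume f: "\<forall>n::nat. f n \<in> commutant M" and lim: "f \<longlonglongrightarrow> x"
    have "x o\<^sub>L a = a o\<^sub>L x" if "a \<in> M" for a
    proof (rule LIMSEQ_unique)
      show "(\<lambda>n. f n o\<^sub>L a) \<longlonglongrightarrow> (x o\<^sub>L a)" by (intro tendsto_comp lim tendsto_const)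
      have "(\<lambda>n. a o\<^sub>L f n) \<longlonglongrightarrow> (a o\<^sub>L x)" by (intro tendsto_comp lim tendsto_const)
      moreover have "f n o\<^sub>L a = a o\<^sub>L f n" for n using f that commutantD(2) by blast
      ultimately show "(\<lambda>n. f n o\<^sub>L a) \<longlonglongrightarrow> (a o\<^sub>L x)" by (simp only:)
    qed
    moreover have "clinear_op x"
      using commutantD(1) f by (intro clinear_op_limit[OF _ lim]) blast
    ultimately show "x \<in> commutant M" by (simp add: commutant_def)
  qed
  moreover have "oper.subspace (commutant M)"
    unfolding commutant_def
    by (rule oper.subspaceI)
      (auto simp: comp_add_left comp_add_right oscale_comp_right assms(1)
        clinear_op_add clinear_op_oscale)
  moreover have "adj x \<in> commutant M" if "x \<in> commutant M" for x
  proof -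
    have "adj x o\<^sub>L a = a o\<^sub>L adj x" if "a \<in> M" for a
    proof -
      have "adj (adj a o\<^sub>L x) = adj (x o\<^sub>L adj a)"
        using commutantD(2)[OF \<open>x \<in> _\<close> assms(2)[OF that]] by simp
      moreover have "clinear_op x" using \<open>x \<in> _\<close> by (rule commutantD)
      ultimately show ?thesis
        using assms[OF that] by (simp add: adj_comp assms(1))
    qed
    moreover have "clinear_op x" using that by (rule commutantD)
    ultimately show ?thesis unfolding commutant_def by blast
  qed
  moreover have "x o\<^sub>L y \<in> commutant M" if "x \<in> commutant M" "y \<in> commutant M" for x y
  proof -
    have "(x o\<^sub>L y) o\<^sub>L a = a o\<^sub>L (x o\<^sub>L y)" if "a \<in> M" for a
    proof -
      have xa: "x o\<^sub>L a = a o\<^sub>L x" and ya: "y o\<^sub>L a = a o\<^sub>L y"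
        using \<open>x \<in> _\<close> \<open>y \<in> _\<close> that by (auto intro: commutantD)
      have "(x o\<^sub>L y) o\<^sub>L a = x o\<^sub>L (a o\<^sub>L y)" by (simp add: comp_assoc ya)
      also have "\<dots> = a o\<^sub>L (x o\<^sub>L y)" by (simp add: comp_assoc[symmetric] xa)
      finally show ?thesis .
    qed
    moreover have "clinear_op (x o\<^sub>L y)" using that by (intro clinear_op_comp commutantD(1))
    ultimately show ?thesis unfolding commutant_def by blast
  qed
  ultimately show ?thesis unfolding cstar_algebra_def using commutantD(1) by blast
qed

text \<open>If \<open>A\<close> is maximal, a self-adjoint element \<open>h\<close> of the relative
  commutant can be adjoined to \<open>A\<close> without losing commutativity, so it lies in
  \<open>A\<close>; a general element is a combination of two self-adjoint ones. Conversely, a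
  larger abelian algebra lies in the commutant of \<open>A\<close>.\<close>

lemma maximal_abelian_iff:
  assumes A: "cstar_algebra A" "abelian A" "A \<subseteq> B" and B: "cstar_algebra B"
  shows "maximal_abelian A B \<longleftrightarrow> B \<inter> commutant A \<subseteq> A"
proof
  note Ad = cstar_algebraD[OF A(1)]
  note Bd = cstar_algebraD[OF B]
  assume R: "B \<inter> commutant A \<subseteq> A"
  have "A' = A" if A': "cstar_algebra A'" "abelian A'" "A \<subseteq> A'" "A' \<subseteq> B" for A'
  proof -
    have "A' \<subseteq> commutant A"
      using A' cstar_algebraD(1)[OF A'(1)] unfolding commutant_def abelian_def by blast
    then show ?thesis using A' R by blast
  qed
  then show "maximal_abelian A B" using A by (auto simp: maximal_abelian_def)
next
  note Ad = cstar_algebraD[OF A(1)]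
  note Bd = cstar_algebraD[OF B]
  assume L: "maximal_abelian A B"
  have cA: "cstar_algebra (commutant A)" using Ad by (intro cstar_algebra_commutant) auto
  have sa: "h \<in> A" if h: "h \<in> B" "h \<in> commutant A" "adj h = h" for h
  proof -
    let ?M = "insert h A"
    have clM: "clinear_op a" "adj a \<in> ?M" if "a \<in> ?M" for a
      using that h Ad Bd by auto
    have cM: "cstar_algebra (commutant ?M)" using clM by (intro cstar_algebra_commutant) auto
    have "cstar_generated ?M \<subseteq> B" using A h B by (intro cstar_generated_subset) auto
    moreover have C: "cstar_algebra (cstar_generated ?M)"
      using B A(3) h(1) by (intro cstar_algebra_generated) blast
    \<comment> \<open>Commutation spreads from the generators in two steps, since the commutant of a
      set closed under adjoints is a C*-algebra: first to one factor, then to both.\<close>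
    moreover have "?M \<subseteq> commutant ?M"
    proof
      fix a assume a: "a \<in> ?M"
      have "a o\<^sub>L b = b o\<^sub>L a" if "b \<in> ?M" for b
        using a that A(2) commutantD(2)[OF h(2)] unfolding abelian_def by (metis insert_iff)
      then show "a \<in> commutant ?M" using clM(1)[OF a] unfolding commutant_def by blast
    qed
    then have sub: "cstar_generated ?M \<subseteq> commutant ?M"
      using cM by (intro cstar_generated_subset)
    have "?M \<subseteq> commutant (cstar_generated ?M)"
    proof
      fix a assume a: "a \<in> ?M"
      have "a o\<^sub>L b = b o\<^sub>L a" if "b \<in> cstar_generated ?M" for b
        using commutantD(2)[OF subsetD[OF sub that] a] by (rule sym)
      then show "a \<in> commutant (cstar_generated ?M)" using clM(1)[OF a] unfolding commutant_def by blast
    qed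
    then have "cstar_generated ?M \<subseteq> commutant (cstar_generated ?M)"
      using cstar_algebraD[OF C] by (intro cstar_generated_subset cstar_algebra_commutant) auto
    then have "abelian (cstar_generated ?M)" unfolding abelian_def using commutantD(2) by blast
    ultimately have "cstar_generated ?M = A"
      using L cstar_generated_superset[of ?M] unfolding maximal_abelian_def by blast
    then show ?thesis using cstar_generated_superset[of ?M] by blast
  qed
  show "B \<inter> commutant A \<subseteq> A"
  proof
    fix b assume b: "b \<in> B \<inter> commutant A"
    then have cb: "clinear_op b" using Bd by blast
    \<comment> \<open>Twice the real part of \<open>b\<close> and minus twice its imaginary
      part.\<close>
    define h k where "h = b + adj b" and "k = oscale \<i> (b - adj b)"
    have "adj h = h" using cb by (simp add: h_def adj_add add.commute)
    moreover have "adj k = k"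
      using cb by (simp add: k_def adj_oscale adj_diff clinear_op_diff)
        (simp add: oper.scale_right_diff_distrib oper.scale_minus_left)
    moreover have "h \<in> B" "k \<in> B" using b Bd by (auto simp: h_def k_def)
    moreover have "h \<in> commutant A" "k \<in> commutant A"
      using b cstar_algebraD[OF cA] by (auto simp: h_def k_def)
    ultimately have "h \<in> A" "k \<in> A" using sa by auto
    moreover have "b = oscale (1/2) (h + oscale (-\<i>) k)"
      unfolding h_def k_def
      by (rule blinfun_eqI, rule ell2_eqI) (simp add: blinfun.add_left blinfun.diff_left algebra_simps)
    ultimately show "b \<in> A" using Ad by auto
  qed
qed

section \<open>Paths and the action on paths\<close>

lemma psrc_Nil [simp]: "psrc S (v, []) = v"
  by (simp add: psrc_def)

lemma psrc_Cons [simp]: "psrc S (v, e # es) = psrc S (esrc S e, es)"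
  by (simp add: psrc_def)

lemma psrc_append: "psrc S (v, es @ fs) = psrc S (psrc S (v, es), fs)"
  by (induction es arbitrary: v) auto

lemma prng_pair [simp]: "prng (v, es) = v"
  by (simp add: prng_def)

lemma plen_pair [simp]: "plen (v, es) = length es"
  by (simp add: plen_def)

lemma pcat_pair [simp]: "pcat (v, es) (w, fs) = (v, es @ fs)"
  by (simp add: pcat_def)

lemma paths_iff [simp]: "(v, es) \<in> paths S \<longleftrightarrow> walk S v es"
  by (simp add: paths_def)

lemma pact_pair [simp]: "pact S g (v, es) = (grng S g, act_list S g es)"
  by (simp add: pact_def)

lemma psect_pair [simp]: "psect S g (v, es) = sect_list S g es"
  by (simp add: psect_def)

lemma ptw_pair [simp]: "ptw S g (v, es) = twE_list S g es"
  by (simp add: ptw_def)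

lemma act_list_append: "act_list S g (es @ fs) = act_list S g es @ act_list S (sect_list S g es) fs"
  by (induction es arbitrary: g) auto

lemma sect_list_append: "sect_list S g (es @ fs) = sect_list S (sect_list S g es) fs"
  by (induction es arbitrary: g) auto

lemma twE_list_append: "twE_list S g (es @ fs) = twE_list S g es * twE_list S (sect_list S g es) fs"
  by (induction es arbitrary: g) auto

lemma length_act_list [simp]: "length (act_list S g es) = length es"
  by (induction es arbitrary: g) auto

lemma take_act_list: "take n (act_list S g es) = act_list S g (take n es)"
  by (induction es arbitrary: g n) (auto simp: take_Cons split: nat.split)

context discrete_groupoid
begin

lemma idempotent_unit:
  assumes "g \<in> Grp S" "gsrc S g = grng S g" "gmult S g g = g"
  shows "g = gsrc S g"
proof -
  have "gmult S (ginv S g) (gmult S g g) = gmult S (gmult S (ginv S g) g) g"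
    using assms by (simp add: gmult_assoc ginv_closed gsrc_ginv)
  then show ?thesis
    using assms by (simp add: ginv_left unit_left)
qed

lemma left_cancel:
  assumes "g \<in> Grp S" "h \<in> Grp S" "gsrc S g = grng S h"
  shows "gmult S (ginv S g) (gmult S g h) = h"
  using assms by (simp add: gmult_assoc[symmetric] ginv_closed gsrc_ginv ginv_left unit_left)

lemma left_cancel':
  assumes "g \<in> Grp S" "h \<in> Grp S" "grng S g = grng S h"
  shows "gmult S g (gmult S (ginv S g) h) = h"
  using assms by (simp add: gmult_assoc[symmetric] ginv_closed gsrc_ginv grng_ginv ginv_right unit_left)

lemma ginv_unique:
  assumes "g \<in> Grp S" "h \<in> Grp S" "gsrc S g = grng S h" "gmult S g h = gsrc S h"
  shows "g = ginv S h"
proof -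
  have "gmult S (gmult S g h) (ginv S h) = g"
    using assms(1-3) by (simp add: gmult_assoc ginv_closed grng_ginv ginv_right)
      (metis unit_right)
  moreover have "gmult S (gmult S g h) (ginv S h) = ginv S h"
    using assms by (metis grng_ginv ginv_closed unit_left)
  ultimately show ?thesis by simp
qed

lemma ginv_ginv: "g \<in> Grp S \<Longrightarrow> ginv S (ginv S g) = g"
  by (rule ginv_unique[symmetric]) (auto simp: ginv_closed grng_ginv gsrc_ginv ginv_right)

lemma Vert_Grp: "v \<in> Vert S \<Longrightarrow> v \<in> Grp S"
  using Vert_subset by blast

lemma ginv_unit: "v \<in> Vert S \<Longrightarrow> ginv S v = v"
  by (rule ginv_unique[symmetric])
    (auto simp: Vert_Grp grng_unit gsrc_unit, metis Vert_Grp grng_unit unit_left)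

end

context self_similar_action
begin

lemma walk_Vert: "walk S v es \<Longrightarrow> v \<in> Vert S"
  by (cases es) (auto intro: erng_Vert)

lemma walk_psrc: "walk S v es \<Longrightarrow> psrc S (v, es) \<in> Vert S"
  by (induction es arbitrary: v) (auto simp: psrc_def split: if_splits)

lemma walk_append: "walk S v (es @ fs) \<longleftrightarrow> walk S v es \<and> walk S (psrc S (v, es)) fs"
proof (induction es arbitrary: v)
  case Nil
  then show ?case using walk_Vert by auto
qed auto

lemma walk_act_list:
  assumes "g \<in> Grp S" "walk S (gsrc S g) es"
  shows "walk S (grng S g) (act_list S g es)" "sect_list S g es \<in> Grp S"
    "gsrc S (sect_list S g es) = psrc S (gsrc S g, es)"
    "grng S (sect_list S g es) = psrc S (grng S g, act_list S g es)"
  using assms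
proof (induction es arbitrary: g)
  case Nil
  {
    case 1 then show ?case by (simp add: grng_Vert)
  next
    case 2 then show ?case by simp
  next
    case 3 then show ?case by simp
  next
    case 4 then show ?case by simp
  }
next
  case (Cons e es)
  {
    case 1
    then show ?case
      using Cons.IH(1)[of "sect S g e"] by (simp add: act_closed erng_act sect_closed gsrc_sect grng_sect)
  next
    case 2
    then show ?case using Cons.IH(2)[of "sect S g e"] by (simp add: sect_closed gsrc_sect)
  next
    case 3
    then show ?case using Cons.IH(3)[of "sect S g e"] by (simp add: sect_closed gsrc_sect)
  next
    case 4
    then show ?case using Cons.IH(4)[of "sect S g e"] by (simp add: sect_closed gsrc_sect grng_sect)
  }
qed

lemma
  assumes "g \<in> Grp S" "h \<in> Grp S" "gsrc S g = grng S h" "walk S (gsrc S h) es"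
  shows act_list_gmult: "act_list S (gmult S g h) es = act_list S g (act_list S h es)"
    and sect_list_gmult:
      "sect_list S (gmult S g h) es = gmult S (sect_list S g (act_list S h es)) (sect_list S h es)"
proof -
  from assms have "act_list S (gmult S g h) es = act_list S g (act_list S h es) \<and>
    sect_list S (gmult S g h) es = gmult S (sect_list S g (act_list S h es)) (sect_list S h es)"
  proof (induction es arbitrary: g h)
    case (Cons e es)
    let ?g = "sect S g (act S h e)" and ?h = "sect S h e"
    have gh: "?g \<in> Grp S" "?h \<in> Grp S" "gsrc S ?g = grng S ?h" "walk S (gsrc S ?h) es"
      using Cons.prems by (auto simp: sect_closed gsrc_sect grng_sect act_closed erng_act)
    show ?case using Cons.IH[OF gh] Cons.prems by (simp add: act_gmult sect_gmult)
  qed auto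
  then show "act_list S (gmult S g h) es = act_list S g (act_list S h es)"
    "sect_list S (gmult S g h) es = gmult S (sect_list S g (act_list S h es)) (sect_list S h es)"
    by auto
qed

text \<open>A unit is idempotent and fixes \<open>e\<close>, so the product rule makes its
  restriction idempotent; in a groupoid an idempotent is a unit.\<close>

lemma sect_unit:
  assumes "e \<in> Edges S"
  shows "sect S (erng S e) e = esrc S e"
proof -
  let ?v = "erng S e" and ?u = "sect S (erng S e) e"
  have v: "?v \<in> Vert S" "?v \<in> Grp S" using assms by (auto simp: erng_Vert Vert_Grp)
  have vv: "gmult S ?v ?v = ?v" using v by (metis grng_unit unit_left)
  have u: "?u \<in> Grp S" "gsrc S ?u = esrc S e" "grng S ?u = esrc S e"
    using assms v by (auto simp: sect_closed gsrc_sect grng_sect gsrc_unit act_unit)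
  have "gmult S ?u ?u = ?u"
    using sect_gmult[of ?v ?v e] assms v by (simp add: gsrc_unit grng_unit act_unit vv)
  then show ?thesis using idempotent_unit u by metis
qed

lemma act_list_unit:
  assumes "walk S v es"
  shows "act_list S v es = es" "sect_list S v es = psrc S (v, es)"
  using assms by (induction es arbitrary: v) (auto simp: act_unit sect_unit)

text \<open>Both follow from the product rules for the inverse of \<open>g\<close> times
  \<open>g\<close>, which is a unit.\<close>

lemma act_list_ginv:
  assumes "g \<in> Grp S" "walk S (gsrc S g) es"
  shows "act_list S (ginv S g) (act_list S g es) = es"
    "sect_list S (ginv S g) (act_list S g es) = ginv S (sect_list S g es)"
proof -
  note gi = ginv_closed[OF assms(1)] gsrc_ginv[OF assms(1)] grng_ginv[OF assms(1)]
  note w = walk_act_list[OF assms]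
  have "act_list S (gmult S (ginv S g) g) es = act_list S (ginv S g) (act_list S g es)"
    by (rule act_list_gmult) (use assms gi in auto)
  then show "act_list S (ginv S g) (act_list S g es) = es"
    using assms by (simp add: ginv_left act_list_unit)
  let ?k = "sect_list S (ginv S g) (act_list S g es)"
  have "sect_list S (gmult S (ginv S g) g) es = gmult S ?k (sect_list S g es)"
    by (rule sect_list_gmult) (use assms gi in auto)
  then have k: "gmult S ?k (sect_list S g es) = gsrc S (sect_list S g es)"
    using assms w by (simp add: ginv_left act_list_unit)
  have "walk S (gsrc S (ginv S g)) (act_list S g es)" using w gi by simp
  from walk_act_list[OF gi(1) this] show "?k = ginv S (sect_list S g es)"
    using w k gi by (intro ginv_unique) auto
qed

lemma act_list_inj:
  assumes "g \<in> Grp S" "walk S (gsrc S g) es" "walk S (gsrc S g) fs"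
    "act_list S g es = act_list S g fs"
  shows "es = fs"
  using act_list_ginv(1)[OF assms(1,2)] act_list_ginv(1)[OF assms(1,3)] unfolding assms(4) by (rule trans[OF sym])

lemma bij_betw_edges_into:
  assumes "g \<in> Grp S"
  shows "bij_betw (act S g) (edges_into S (gsrc S g)) (edges_into S (grng S g))"
proof (rule bij_betw_byWitness[where f' = "act S (ginv S g)"])
  note gi = ginv_closed[OF assms] gsrc_ginv[OF assms] grng_ginv[OF assms]
  show "\<forall>e\<in>edges_into S (gsrc S g). act S (ginv S g) (act S g e) = e"
    using act_list_ginv(1)[OF assms, of "[e]" for e] by (auto simp: edges_into_def esrc_Vert)
  show "\<forall>e\<in>edges_into S (grng S g). act S g (act S (ginv S g) e) = e"
    using act_list_ginv(1)[OF gi(1), of "[e]" for e] gi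
    by (auto simp: edges_into_def esrc_Vert ginv_ginv[OF assms])
  show "act S g ` edges_into S (gsrc S g) \<subseteq> edges_into S (grng S g)"
    using assms by (auto simp: edges_into_def act_closed erng_act)
  show "act S (ginv S g) ` edges_into S (grng S g) \<subseteq> edges_into S (gsrc S g)"
    using gi by (auto simp: edges_into_def act_closed erng_act)
qed

text \<open>The action is a bijection between the edges into the source and the edges into the range
  of \<open>g\<close>. This is why germs preserve the boundary.\<close>

lemma singular_transport:
  assumes "g \<in> Grp S"
  shows "singular_vertex S (gsrc S g) \<longleftrightarrow> singular_vertex S (grng S g)"
proof -
  note b = bij_betw_edges_into[OF assms]
  have "edges_into S (gsrc S g) = {} \<longleftrightarrow> edges_into S (grng S g) = {}"
    using b by (auto simp: bij_betw_def)
  then show ?thesis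
    using bij_betw_finite[OF b] assms
    by (auto simp: singular_vertex_def regular_vertex_def grng_Vert gsrc_Vert)
qed

end

section \<open>The twist along paths\<close>

context twisted_self_similar_action
begin

lemma twE_list_circle:
  "g \<in> Grp S \<Longrightarrow> walk S (gsrc S g) es \<Longrightarrow> cmod (twE_list S g es) = 1"
proof (induction es arbitrary: g)
  case (Cons e es)
  then show ?case
    using Cons.IH[of "sect S g e"] by (simp add: norm_mult twE_circle sect_closed gsrc_sect)
qed auto

lemma twE_list_unit: "walk S v es \<Longrightarrow> twE_list S v es = 1"
  by (induction es arbitrary: v) (auto simp: twE_unit sect_unit)

lemma unimodular_cnj: "cmod z = 1 \<Longrightarrow> cnj z * z = 1" "cmod z = 1 \<Longrightarrow> z * cnj z = 1"
  by (simp_all add: complex_norm_square[symmetric] mult.commute)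

text \<open>Telescoping: the conjugate \<open>twG\<close> value left over by the first edge cancels
  the \<open>twG\<close> value contributed by the rest of the path, so only the values at the two
  ends survive.\<close>

lemma twE_list_gmult:
  assumes "g \<in> Grp S" "h \<in> Grp S" "gsrc S g = grng S h" "walk S (gsrc S h) es"
  shows "twE_list S h es * cnj (twE_list S (gmult S g h) es) * twE_list S g (act_list S h es)
    = cnj (twG S (sect_list S g (act_list S h es)) (sect_list S h es)) * twG S g h"
  using assms
proof (induction es arbitrary: g h)
  case Nil
  then show ?case by (simp add: unimodular_cnj twG_circle)
next
  case (Cons e es)
  let ?g = "sect S g (act S h e)" and ?h = "sect S h e"
  have gh: "?g \<in> Grp S" "?h \<in> Grp S" "gsrc S ?g = grng S ?h" "walk S (gsrc S ?h) es"
    using Cons.prems by (auto simp: sect_closed gsrc_sect grng_sect act_closed erng_act)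
  have e: "twE S h e * cnj (twE S (gmult S g h) e) * twE S g (act S h e) = cnj (twG S ?g ?h) * twG S g h"
    using Cons.prems by (intro twE_gmult) auto
  have "twE_list S h (e # es) * cnj (twE_list S (gmult S g h) (e # es)) * twE_list S g (act_list S h (e # es))
    = (twE S h e * cnj (twE S (gmult S g h) e) * twE S g (act S h e)) *
      (twE_list S ?h es * cnj (twE_list S (gmult S ?g ?h) es) * twE_list S ?g (act_list S ?h es))"
    using Cons.prems by (simp add: sect_gmult mult_ac)
  also have "\<dots> = (cnj (twG S ?g ?h) * twG S ?g ?h) * (cnj (twG S (sect_list S ?g (act_list S ?h es)) (sect_list S ?h es)) * twG S g h)"
    unfolding e Cons.IH[OF gh] by (simp add: mult_ac)
  finally show ?case using gh by (simp add: unimodular_cnj twG_circle)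
qed

lemma twE_list_gmult':
  assumes "g \<in> Grp S" "h \<in> Grp S" "gsrc S g = grng S h" "walk S (gsrc S h) es"
  shows "twE_list S h es * twE_list S g (act_list S h es)
      * twG S (sect_list S g (act_list S h es)) (sect_list S h es)
    = twG S g h * twE_list S (gmult S g h) es"
proof -
  let ?a = "twE_list S h es" and ?b = "twE_list S (gmult S g h) es"
    and ?c = "twE_list S g (act_list S h es)"
    and ?d = "twG S (sect_list S g (act_list S h es)) (sect_list S h es)"
  note gh = gmult_closed[OF assms(1-3)] gsrc_gmult[OF assms(1-3)]
  have b: "cnj ?b * ?b = 1" using assms gh by (intro unimodular_cnj twE_list_circle) auto
  have h: "walk S (gsrc S g) (act_list S h es)" using walk_act_list[OF assms(2,4)] assms by simp
  have "gsrc S (sect_list S g (act_list S h es)) = grng S (sect_list S h es)"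
    using walk_act_list[OF assms(1) h] walk_act_list[OF assms(2,4)] assms(3) by simp
  then have d: "cnj ?d * ?d = 1"
    using walk_act_list[OF assms(1) h] walk_act_list[OF assms(2,4)]
    by (intro unimodular_cnj twG_circle) auto
  have "?a * ?c * ?d = (?a * cnj ?b * ?c) * ?d * ?b" using b by (simp add: mult_ac)
  also have "\<dots> = twG S g h * ?b * (cnj ?d * ?d)"
    unfolding twE_list_gmult[OF assms] by (simp add: mult_ac)
  finally show ?thesis using d by simp
qed

end

section \<open>Finite and infinite paths\<close>

text \<open>Finite and infinite paths are handled alike through their prefixes. Beyond the end of a
  finite path \<open>pre\<close> returns the whole path, so the prefix has length \<open>n\<close>
  only under \<open>reaches\<close>. The range of an infinite path is read off its first edge, also
  for \<open>n = 0\<close>.\<close>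

fun pre :: "('g, 'e, 'z) action_scheme \<Rightarrow> ('g, 'e) xpath \<Rightarrow> nat \<Rightarrow> ('g, 'e) path" where
  "pre S (FinP \<mu>) n = (fst \<mu>, take n (snd \<mu>))"
| "pre S (InfP x) n = (erng S (x 0), map x [0..<n])"

fun reaches :: "('g, 'e) xpath \<Rightarrow> nat \<Rightarrow> bool" where
  "reaches (FinP \<mu>) n \<longleftrightarrow> n \<le> length (snd \<mu>)"
| "reaches (InfP x) n \<longleftrightarrow> True"

lemma reaches_mono: "reaches \<xi> n \<Longrightarrow> m \<le> n \<Longrightarrow> reaches \<xi> m"
  by (cases \<xi>) auto

lemma reaches_0 [simp]: "reaches \<xi> 0"
  by (cases \<xi>) auto

lemma length_pre: "reaches \<xi> n \<Longrightarrow> length (snd (pre S \<xi> n)) = n"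
  by (cases \<xi>) auto

lemma plen_pre: "reaches \<xi> n \<Longrightarrow> plen (pre S \<xi> n) = n"
  by (simp add: length_pre plen_def)

lemma pre_take: "m \<le> n \<Longrightarrow> pre S \<xi> m = (fst (pre S \<xi> n), take m (snd (pre S \<xi> n)))"
  by (cases \<xi>) (auto simp: take_map min_def)

lemma fst_pre: "fst (pre S \<xi> n) = fst (pre S \<xi> 0)"
  by (cases \<xi>) auto

lemma pre_drop:
  assumes "m \<le> n"
  shows "pre S \<xi> n = (fst (pre S \<xi> m), snd (pre S \<xi> m) @ drop m (snd (pre S \<xi> n)))"
  using pre_take[OF assms, of S \<xi>] by (metis append_take_drop_id fst_conv prod.collapse snd_conv)

lemma xpath_eqI:
  assumes "\<And>n. reaches \<xi> n \<longleftrightarrow> reaches \<eta> n" "\<And>n. reaches \<xi> n \<Longrightarrow> pre S \<xi> n = pre S \<eta> n"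
  shows "\<xi> = \<eta>"
proof (cases \<xi>)
  case (FinP \<mu>)
  show ?thesis
  proof (cases \<eta>)
    case (FinP \<nu>)
    have "length (snd \<mu>) = length (snd \<nu>)"
      using assms(1)[of "length (snd \<mu>)"] assms(1)[of "length (snd \<nu>)"] FinP \<open>\<xi> = _\<close> by auto
    then show ?thesis using assms(2)[of "length (snd \<mu>)"] FinP \<open>\<xi> = _\<close> by (simp add: prod_eq_iff)
  next
    case (InfP y)
    then show ?thesis using assms(1)[of "Suc (length (snd \<mu>))"] \<open>\<xi> = _\<close> by auto
  qed
next
  case (InfP x)
  show ?thesis
  proof (cases \<eta>)
    case (FinP \<mu>)
    then show ?thesis using assms(1)[of "Suc (length (snd \<mu>))"] InfP by auto
  next
    case (InfP y)
    have "x n = y n" for n using assms(2)[of "Suc n"] InfP \<open>\<xi> = _\<close> by simp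
    then show ?thesis using InfP \<open>\<xi> = _\<close> by auto
  qed
qed

context self_similar_action
begin

lemma inf_paths_iff: "x \<in> inf_paths S \<longleftrightarrow> (\<forall>n. walk S (erng S (x 0)) (map x [0..<n]))"
proof
  assume x: "x \<in> inf_paths S"
  have "walk S (erng S (x 0)) (map x [0..<n]) \<and> psrc S (erng S (x 0), map x [0..<n]) = erng S (x n)" for n
    using x by (induction n) (auto simp: inf_paths_def walk_append psrc_append erng_Vert esrc_Vert)
  then show "\<forall>n. walk S (erng S (x 0)) (map x [0..<n])" by blast
next
  assume w: "\<forall>n. walk S (erng S (x 0)) (map x [0..<n])"
  have "x n \<in> Edges S \<and> esrc S (x n) = erng S (x (Suc n))" for n
    using spec[OF w, of "Suc (Suc n)"] by (auto simp: walk_append psrc_append)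
  then show "x \<in> inf_paths S" by (simp add: inf_paths_def)
qed

lemma walk_take: "walk S v es \<Longrightarrow> walk S v (take n es)"
  by (metis append_take_drop_id walk_append)

lemma path_space_iff: "\<xi> \<in> path_space S \<longleftrightarrow> (\<forall>n. pre S \<xi> n \<in> paths S)"
proof (cases \<xi>)
  case (FinP \<mu>)
  then show ?thesis
    by (cases \<mu>) (auto simp: path_space_def walk_take intro!: imageI dest: spec[of _ "length (snd \<mu>)"])
next
  case (InfP x)
  then show ?thesis by (auto simp: path_space_def inf_paths_iff)
qed

lemma pre_paths: "\<xi> \<in> path_space S \<Longrightarrow> pre S \<xi> n \<in> paths S"
  by (simp add: path_space_iff)

text \<open>Shorter prefixes are truncations of tested ones. For \<open>n\<close> beyond the end of
  a finite path the prefix is the whole path, which is tested because \<open>m\<close> is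
  reached.\<close>

lemma path_spaceI:
  assumes "reaches \<xi> m" "\<And>k. reaches \<xi> (m + k) \<Longrightarrow> pre S \<xi> (m + k) \<in> paths S"
  shows "\<xi> \<in> path_space S"
  unfolding path_space_iff
proof
  fix n
  have sub: "pre S \<xi> n' \<in> paths S" if "n' \<le> n" "pre S \<xi> n \<in> paths S" for n n'
    using that pre_take[OF that(1), of S \<xi>]
    by (metis paths_iff prod.collapse walk_take)
  show "pre S \<xi> n \<in> paths S"
  proof (cases "reaches \<xi> n")
    case True
    then show ?thesis
      using assms sub[of n m] by (cases "n \<le> m") (metis add_0_right, metis le_add_diff_inverse nat_le_linear)
  next
    case False
    then obtain \<mu> where \<mu>: "\<xi> = FinP \<mu>" "length (snd \<mu>) < n" by (cases \<xi>) auto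
    then have "pre S \<xi> n = pre S \<xi> (length (snd \<mu>))" by simp
    moreover have "m \<le> length (snd \<mu>)" using assms(1) \<mu> by simp
    then have "pre S \<xi> (m + (length (snd \<mu>) - m)) \<in> paths S" using \<mu> by (intro assms(2)) auto
    ultimately show ?thesis using \<open>m \<le> _\<close> by simp
  qed
qed

lemma xprefix_iff:
  assumes "\<xi> \<in> path_space S"
  shows "xprefix S \<alpha> \<xi> \<longleftrightarrow> reaches \<xi> (plen \<alpha>) \<and> pre S \<xi> (plen \<alpha>) = \<alpha>"
proof (cases \<xi>)
  case (InfP x)
  then show ?thesis by (cases \<alpha>) auto
next
  case (FinP \<mu>)
  obtain v es where \<mu>: "\<mu> = (v, es)" by fastforce
  obtain w fs where \<alpha>: "\<alpha> = (w, fs)" by fastforce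
  have walk: "walk S v es" using assms FinP \<mu> by (auto simp: path_space_def)
  show ?thesis
  proof
    assume "xprefix S \<alpha> \<xi>"
    then show "reaches \<xi> (plen \<alpha>) \<and> pre S \<xi> (plen \<alpha>) = \<alpha>"
      using FinP \<mu> \<alpha> by (auto simp: pprefix_def)
  next
    assume "reaches \<xi> (plen \<alpha>) \<and> pre S \<xi> (plen \<alpha>) = \<alpha>"
    then have eq: "w = v" "fs = take (length fs) es" using FinP \<mu> \<alpha> by auto
    then have "es = fs @ drop (length fs) es" by (metis append_take_drop_id)
    moreover from this have "walk S (psrc S (v, fs)) (drop (length fs) es)"
      using walk walk_append by metis
    ultimately show "xprefix S \<alpha> \<xi>"
      using FinP \<mu> \<alpha> eq
      by (auto simp: pprefix_def intro!: bexI[of _ "(psrc S (v, fs), drop (length fs) es)"])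
  qed
qed

lemma cylinder_iff:
  "\<xi> \<in> cylinder S \<alpha> \<longleftrightarrow> \<xi> \<in> path_space S \<and> reaches \<xi> (plen \<alpha>) \<and> pre S \<xi> (plen \<alpha>) = \<alpha>"
  using xprefix_iff unfolding cylinder_def by blast

text \<open>For a finite path the only \<open>n\<close> that is reached while \<open>Suc n\<close>
  is not is its length; an infinite path has none. So one condition covers both kinds of boundary
  paths.\<close>

lemma boundary_paths_iff:
  "\<xi> \<in> boundary_paths S \<longleftrightarrow> \<xi> \<in> path_space S \<and>
    (\<forall>n. reaches \<xi> n \<and> \<not> reaches \<xi> (Suc n) \<longrightarrow> singular_vertex S (psrc S (pre S \<xi> n)))"
proof (cases \<xi>)
  case (FinP \<mu>)
  then have "reaches \<xi> n \<and> \<not> reaches \<xi> (Suc n) \<longleftrightarrow> n = length (snd \<mu>)" for n by auto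
  then show ?thesis using FinP by (auto simp: boundary_paths_def path_space_def)
next
  case (InfP x)
  then show ?thesis by (auto simp: boundary_paths_def path_space_def)
qed

lemma boundary_subset: "boundary_paths S \<subseteq> path_space S"
  using boundary_paths_iff by blast

lemma cylinder_segment:
  assumes "\<xi> \<in> cylinder S \<beta>" "plen \<beta> \<le> n"
  shows "pre S \<xi> n = (fst \<beta>, snd \<beta> @ drop (plen \<beta>) (snd (pre S \<xi> n)))"
    "walk S (psrc S \<beta>) (drop (plen \<beta>) (snd (pre S \<xi> n)))"
proof -
  show eq: "pre S \<xi> n = (fst \<beta>, snd \<beta> @ drop (plen \<beta>) (snd (pre S \<xi> n)))"
    using pre_drop[OF assms(2), of S \<xi>] assms(1) by (metis cylinder_iff)
  have "pre S \<xi> n \<in> paths S" using assms(1) by (simp add: cylinder_iff pre_paths)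
  then have "walk S (fst \<beta>) (snd \<beta> @ drop (plen \<beta>) (snd (pre S \<xi> n)))" using eq by (metis paths_iff)
  then show "walk S (psrc S \<beta>) (drop (plen \<beta>) (snd (pre S \<xi> n)))"
    by (simp add: walk_append)
qed

end

section \<open>Germs\<close>

fun refinable :: "('g, 'e) germ_rep \<Rightarrow> nat \<Rightarrow> bool" where
  "refinable (\<alpha>, g, \<beta>, \<xi>) n \<longleftrightarrow> plen \<beta> \<le> n \<and> reaches \<xi> n"

text \<open>A representative determines one representative of the same germ for each longer prefix of
  its source; two representatives give the same germ iff these agree for some common prefix.\<close>

fun refine :: "('g, 'e, 'z) action_scheme \<Rightarrow> ('g, 'e) germ_rep \<Rightarrow> nat \<Rightarrow> ('g, 'e) germ_rep" where
  "refine S (\<alpha>, g, \<beta>, \<xi>) n =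
    (let w = drop (plen \<beta>) (snd (pre S \<xi> n))
     in ((fst \<alpha>, snd \<alpha> @ act_list S g w), sect_list S g w, pre S \<xi> n, \<xi>))"

text \<open>The twist value by which the unit vector of a representative differs from that of its
  refinement.\<close>

fun refine_phase :: "('g, 'e, 'z) twisted_action_scheme \<Rightarrow> ('g, 'e) germ_rep \<Rightarrow> nat \<Rightarrow> complex" where
  "refine_phase S (\<alpha>, g, \<beta>, \<xi>) n = twE_list S g (drop (plen \<beta>) (snd (pre S \<xi> n)))"

lemma rep_source_refine [simp]: "rep_source (refine S p n) = rep_source p"
  by (cases p) (simp add: Let_def)

context self_similar_action
begin

lemma germ_reps_iff:
  "(\<alpha>, g, \<beta>, \<xi>) \<in> germ_reps S \<longleftrightarrow> \<alpha> \<in> paths S \<and> g \<in> Grp S \<and> \<beta> \<in> paths S \<and>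
     grng S g = psrc S \<alpha> \<and> gsrc S g = psrc S \<beta> \<and> \<xi> \<in> cylinder S \<beta>"
  by (auto simp: germ_reps_def)

lemma refinable_self: "(\<alpha>, g, \<beta>, \<xi>) \<in> germ_reps S \<Longrightarrow> refinable (\<alpha>, g, \<beta>, \<xi>) (plen \<beta>)"
  by (simp add: germ_reps_iff cylinder_iff)

lemma refine_germ_reps:
  assumes "p \<in> germ_reps S" "refinable p n"
  shows "refine S p n \<in> germ_reps S"
proof -
  obtain a as g \<beta> \<xi> where p: "p = ((a, as), g, \<beta>, \<xi>)" by (metis prod.collapse)
  let ?w = "drop (plen \<beta>) (snd (pre S \<xi> n))"
  have r: "walk S a as" "g \<in> Grp S" "grng S g = psrc S (a, as)" "gsrc S g = psrc S \<beta>" "\<xi> \<in> cylinder S \<beta>"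
    using assms p by (auto simp: germ_reps_iff)
  have n: "plen \<beta> \<le> n" "reaches \<xi> n" using assms p by auto
  note c = cylinder_segment[OF r(5) n(1)]
  have w: "walk S (gsrc S g) ?w" using c r by simp
  have "psrc S (pre S \<xi> n) = psrc S (psrc S \<beta>, ?w)"
    using c(1) psrc_append by (metis prod.collapse)
  moreover have "\<xi> \<in> cylinder S (pre S \<xi> n)" using r n by (simp add: cylinder_iff plen_pre)
  moreover have "pre S \<xi> n \<in> paths S" using r by (simp add: cylinder_iff pre_paths)
  ultimately show ?thesis
    using r walk_act_list[OF r(2) w] by (simp add: p Let_def germ_reps_iff walk_append psrc_append)
qed

lemma refinable_refine: "refinable (refine S p n) m \<Longrightarrow> refinable p n \<Longrightarrow> n \<le> m \<and> refinable p m"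
  by (cases p) (auto simp: Let_def plen_pre)

lemma refinable_refineI: "refinable p n \<Longrightarrow> n \<le> m \<Longrightarrow> refinable p m \<Longrightarrow> refinable (refine S p n) m"
  by (cases p) (auto simp: Let_def plen_pre)

lemma segment_append:
  assumes "b \<le> n" "n \<le> m" "reaches \<xi> n"
  shows "drop b (snd (pre S \<xi> m)) = drop b (snd (pre S \<xi> n)) @ drop n (snd (pre S \<xi> m))"
proof -
  have "snd (pre S \<xi> m) = snd (pre S \<xi> n) @ drop n (snd (pre S \<xi> m))"
    using pre_drop[OF assms(2), of S \<xi>] by (metis snd_conv)
  then have "drop b (snd (pre S \<xi> m)) = drop b (snd (pre S \<xi> n) @ drop n (snd (pre S \<xi> m)))" by simp
  then show ?thesis using assms by (simp add: length_pre)
qed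

lemma refine_refine:
  assumes "refinable p n" "n \<le> m"
  shows "refine S (refine S p n) m = refine S p m"
proof -
  obtain \<alpha> g \<beta> \<xi> where p: "p = (\<alpha>, g, \<beta>, \<xi>)" by (cases p)
  show ?thesis
    using assms segment_append[of "plen \<beta>" n m \<xi>]
    by (simp add: p Let_def plen_pre act_list_append sect_list_append)
qed

lemma refine_ext:
  assumes "(\<alpha>, g, \<beta>, \<xi>) \<in> germ_reps S" "\<beta>' \<in> paths S" "prng \<beta>' = psrc S \<beta>" "xprefix S (pcat \<beta> \<beta>') \<xi>"
  shows "refinable (\<alpha>, g, \<beta>, \<xi>) (plen (pcat \<beta> \<beta>'))"
    "refine S (\<alpha>, g, \<beta>, \<xi>) (plen (pcat \<beta> \<beta>')) = (pcat \<alpha> (pact S g \<beta>'), psect S g \<beta>', pcat \<beta> \<beta>', \<xi>)"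
proof -
  have "\<xi> \<in> path_space S" using assms by (simp add: germ_reps_iff cylinder_iff)
  then have x: "reaches \<xi> (plen (pcat \<beta> \<beta>'))" "pre S \<xi> (plen (pcat \<beta> \<beta>')) = pcat \<beta> \<beta>'"
    using assms xprefix_iff by auto
  then show "refinable (\<alpha>, g, \<beta>, \<xi>) (plen (pcat \<beta> \<beta>'))" by (simp add: plen_def pcat_def)
  show "refine S (\<alpha>, g, \<beta>, \<xi>) (plen (pcat \<beta> \<beta>')) = (pcat \<alpha> (pact S g \<beta>'), psect S g \<beta>', pcat \<beta> \<beta>', \<xi>)"
    using x(2) by (cases \<alpha>, cases \<beta>, cases \<beta>') (simp add: Let_def)
qed

definition segment :: "('a, 'b) germ_rep \<Rightarrow> nat \<Rightarrow> ('a, 'b) path" where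
  "segment p n = (case p of (\<alpha>, g, \<beta>, \<xi>) \<Rightarrow> (psrc S \<beta>, drop (plen \<beta>) (snd (pre S \<xi> n))))"

lemma segment:
  assumes "(\<alpha>, g, \<beta>, \<xi>) \<in> germ_reps S" "refinable (\<alpha>, g, \<beta>, \<xi>) n"
  defines "\<kappa> \<equiv> segment (\<alpha>, g, \<beta>, \<xi>) n"
  shows "\<kappa> \<in> paths S" "prng \<kappa> = psrc S \<beta>" "xprefix S (pcat \<beta> \<kappa>) \<xi>" "plen (pcat \<beta> \<kappa>) = n"
proof -
  have \<xi>: "\<xi> \<in> cylinder S \<beta>" and n: "plen \<beta> \<le> n" "reaches \<xi> n"
    using assms by (auto simp: germ_reps_iff)
  note c = cylinder_segment[OF \<xi> n(1)]
  show "\<kappa> \<in> paths S" using c by (simp add: \<kappa>_def segment_def)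
  show "prng \<kappa> = psrc S \<beta>" by (simp add: \<kappa>_def segment_def)
  have eq: "pcat \<beta> \<kappa> = pre S \<xi> n" using c(1) by (simp add: \<kappa>_def segment_def pcat_def)
  then show "plen (pcat \<beta> \<kappa>) = n" using n by (simp add: plen_pre)
  then show "xprefix S (pcat \<beta> \<kappa>) \<xi>" using n \<xi> eq by (simp add: xprefix_iff cylinder_iff)
qed

text \<open>The definition asks for two extensions \<open>\<beta>'\<close> and
  \<open>\<delta>'\<close>, but \<open>pcat \<beta> \<beta>'\<close> and
  \<open>pcat \<delta> \<delta>'\<close> are the same prefix of the source, which is determined by
  its length. The relation thus becomes equality of refinements at one number.\<close>

lemma germ_rel_iff:
  assumes "p \<in> germ_reps S" "q \<in> germ_reps S"
  shows "(p, q) \<in> germ_rel S \<longleftrightarrow>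
    (\<exists>n. refinable p n \<and> refinable q n \<and> refine S p n = refine S q n)"
proof -
  obtain \<alpha> g \<beta> \<xi> where p: "p = (\<alpha>, g, \<beta>, \<xi>)" by (cases p)
  obtain \<gamma> h \<delta> \<eta> where q: "q = (\<gamma>, h, \<delta>, \<eta>)" by (cases q)
  note pr = assms(1)[unfolded p] and qr = assms(2)[unfolded q]
  show ?thesis
  proof
    assume "(p, q) \<in> germ_rel S"
    then obtain \<beta>' \<delta>' where eq: "\<xi> = \<eta>" "\<beta>' \<in> paths S" "\<delta>' \<in> paths S"
      "prng \<beta>' = psrc S \<beta>" "prng \<delta>' = psrc S \<delta>" "pcat \<beta> \<beta>' = pcat \<delta> \<delta>'" "xprefix S (pcat \<beta> \<beta>') \<xi>"
      "pcat \<alpha> (pact S g \<beta>') = pcat \<gamma> (pact S h \<delta>')" "psect S g \<beta>' = psect S h \<delta>'"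
      by (auto simp: p q germ_rel_def)
    note a = refine_ext[OF pr eq(2,4,7)]
    have "xprefix S (pcat \<delta> \<delta>') \<eta>" using eq by simp
    note b = refine_ext[OF qr eq(3,5) this]
    show "\<exists>n. refinable p n \<and> refinable q n \<and> refine S p n = refine S q n"
      using a b eq(1,6,8,9) unfolding p q by (intro exI[of _ "plen (pcat \<beta> \<beta>')"]) simp
  next
    assume "\<exists>n. refinable p n \<and> refinable q n \<and> refine S p n = refine S q n"
    then obtain n where n: "refinable p n" "refinable q n" "refine S p n = refine S q n" by blast
    note a = segment[OF pr n(1)[unfolded p]] and b = segment[OF qr n(2)[unfolded q]]
    note a' = refine_ext(2)[OF pr a(1-3), unfolded a(4)] and b' = refine_ext(2)[OF qr b(1-3), unfolded b(4)]
    let ?\<kappa> = "segment (\<alpha>, g, \<beta>, \<xi>) n" and ?\<mu> = "segment (\<gamma>, h, \<delta>, \<eta>) n"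
    have eqs: "pcat \<alpha> (pact S g ?\<kappa>) = pcat \<gamma> (pact S h ?\<mu>)" "psect S g ?\<kappa> = psect S h ?\<mu>"
      "pcat \<beta> ?\<kappa> = pcat \<delta> ?\<mu>" "\<xi> = \<eta>"
      using n(3)[unfolded p q a' b' prod.inject] by blast+
    have "\<exists>\<beta>'\<in>paths S. \<exists>\<delta>'\<in>paths S.
        prng \<beta>' = psrc S \<beta> \<and> prng \<delta>' = psrc S \<delta> \<and>
        pcat \<beta> \<beta>' = pcat \<delta> \<delta>' \<and> xprefix S (pcat \<beta> \<beta>') \<xi> \<and>
        pcat \<alpha> (pact S g \<beta>') = pcat \<gamma> (pact S h \<delta>') \<and>
        psect S g \<beta>' = psect S h \<delta>'"
      by (rule bexI[OF _ a(1)], rule bexI[OF _ b(1)], intro conjI) (fact a b eqs)+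
    then show "(p, q) \<in> germ_rel S"
      unfolding p q germ_rel_def using pr qr eqs(4) by simp
  qed
qed

lemma germ_rel_subset: "germ_rel S \<subseteq> germ_reps S \<times> germ_reps S"
  by (auto simp: germ_rel_def)

lemma rep_source_eq: "(p, q) \<in> germ_rel S \<Longrightarrow> rep_source p = rep_source q"
  by (cases p, cases q) (auto simp: germ_rel_def)

lemma refine_eq_mono:
  assumes "refinable p n" "refinable q n" "refine S p n = refine S q n" "n \<le> m"
  shows "refine S p m = refine S q m"
  using assms refine_refine by metis

lemma refinable_mono: "refinable p n \<Longrightarrow> n \<le> m \<Longrightarrow> reaches (rep_source p) m \<Longrightarrow> refinable p m"
  by (cases p) auto

lemma refinable_reaches: "refinable p n \<Longrightarrow> reaches (rep_source p) n"
  by (cases p) auto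

lemma equiv_germ_rel: "equiv (germ_reps S) (germ_rel S)"
proof (rule equivI)
  show "refl_on (germ_reps S) (germ_rel S)"
  proof (rule refl_onI)
    fix p assume p: "p \<in> germ_reps S"
    then obtain n where "refinable p n" using refinable_self by (cases p) blast
    then show "(p, p) \<in> germ_rel S" unfolding germ_rel_iff[OF p p] by blast
  qed
  show "sym (germ_rel S)"
  proof (rule symI)
    fix p q assume pq: "(p, q) \<in> germ_rel S"
    then have R: "p \<in> germ_reps S" "q \<in> germ_reps S" using germ_rel_subset by auto
    obtain n where n: "refinable p n" "refinable q n" "refine S p n = refine S q n"
      using pq unfolding germ_rel_iff[OF R] by blast
    then show "(q, p) \<in> germ_rel S"
      unfolding germ_rel_iff[OF R(2,1)] using n(3)[symmetric] by blast
  qed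
  show "trans (germ_rel S)"
  proof (rule transI)
    fix p q r assume pq: "(p, q) \<in> germ_rel S" and qr: "(q, r) \<in> germ_rel S"
    then have R: "p \<in> germ_reps S" "q \<in> germ_reps S" "r \<in> germ_reps S" using germ_rel_subset by auto
    obtain n where n: "refinable p n" "refinable q n" "refine S p n = refine S q n"
      using pq unfolding germ_rel_iff[OF R(1,2)] by blast
    obtain m where m: "refinable q m" "refinable r m" "refine S q m = refine S r m"
      using qr unfolding germ_rel_iff[OF R(2,3)] by blast
    have s: "rep_source p = rep_source q" "rep_source q = rep_source r" using pq qr rep_source_eq by auto
    \<comment> \<open>Equality of refinements persists for longer prefixes, so both equalities can
      be compared at the larger length; it is reached because it is \<open>n\<close> or
      \<open>m\<close>.\<close>
    let ?k = "max n m"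
    have "reaches (rep_source q) ?k"
      using refinable_reaches[OF n(2)] refinable_reaches[OF m(1)] by (simp add: max_def)
    then have "refinable p ?k" "refinable r ?k"
      using refinable_mono[OF n(1), of ?k] refinable_mono[OF m(2), of ?k] s by auto
    moreover have "refine S p ?k = refine S r ?k"
      using refine_eq_mono[OF n] refine_eq_mono[OF m] by simp
    ultimately show "(p, r) \<in> germ_rel S" unfolding germ_rel_iff[OF R(1,3)] by blast
  qed
qed (use germ_rel_subset in auto)

lemma germ_of_eq_iff:
  assumes "p \<in> germ_reps S" "q \<in> germ_reps S"
  shows "germ_of S p = germ_of S q \<longleftrightarrow>
    (\<exists>n. refinable p n \<and> refinable q n \<and> refine S p n = refine S q n)"
  using eq_equiv_class_iff[OF equiv_germ_rel assms] germ_rel_iff[OF assms] by (simp add: germ_of_def)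

lemma germ_of_refine:
  assumes "p \<in> germ_reps S" "refinable p n"
  shows "germ_of S (refine S p n) = germ_of S p"
  using assms refine_germ_reps refinable_refineI[OF assms(2) order_refl assms(2)]
    refine_refine[OF assms(2) order_refl]
  by (subst germ_of_eq_iff) auto

lemma germ_of_source:
  assumes "p \<in> germ_reps S" "q \<in> germ_reps S" "germ_of S p = germ_of S q"
  shows "rep_source p = rep_source q"
  using assms eq_equiv_class_iff[OF equiv_germ_rel assms(1,2)] rep_source_eq by (simp add: germ_of_def)

lemma toeplitz_groupoid_eq: "toeplitz_groupoid S = germ_of S ` germ_reps S"
  by (auto simp: toeplitz_groupoid_def quotient_def germ_of_def)

subsection \<open>Ranges of germs\<close>

lemma pre_xtail:
  assumes "\<xi> \<in> cylinder S \<beta>"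
  shows "pre S (xtail S \<beta> \<xi>) k = (psrc S \<beta>, drop (plen \<beta>) (snd (pre S \<xi> (plen \<beta> + k))))"
    "reaches (xtail S \<beta> \<xi>) k \<longleftrightarrow> reaches \<xi> (plen \<beta> + k)"
proof -
  have c: "reaches \<xi> (plen \<beta>)" "pre S \<xi> (plen \<beta>) = \<beta>" "\<xi> \<in> path_space S" using assms by (auto simp: cylinder_iff)
  show "pre S (xtail S \<beta> \<xi>) k = (psrc S \<beta>, drop (plen \<beta>) (snd (pre S \<xi> (plen \<beta> + k))))"
  proof (cases \<xi>)
    case (FinP \<mu>)
    then show ?thesis using c by (simp add: drop_take)
  next
    case (InfP x)
    have "walk S (erng S (x 0)) (map x [0..<plen \<beta> + 1])"
      using pre_paths[OF c(3), of "plen \<beta> + 1"] InfP by simp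
    moreover have "\<beta> = (erng S (x 0), map x [0..<plen \<beta>])" using c InfP by simp
    ultimately have "erng S (x (plen \<beta>)) = psrc S \<beta>" by (auto simp: walk_append)
    moreover have "map (\<lambda>n. x (n + plen \<beta>)) [0..<k] = drop (plen \<beta>) (map x [0..<plen \<beta> + k])"
      by (rule nth_equalityI) (auto simp: add.commute)
    ultimately show ?thesis using InfP by simp
  qed
  show "reaches (xtail S \<beta> \<xi>) k \<longleftrightarrow> reaches \<xi> (plen \<beta> + k)"
    using c by (cases \<xi>) auto
qed

lemma pre_xact:
  assumes "g \<in> Grp S" "\<And>k. walk S (gsrc S g) (snd (pre S \<eta> k))"
  shows "pre S (xact S g \<eta>) k = (grng S g, act_list S g (snd (pre S \<eta> k)))"
    "reaches (xact S g \<eta>) k \<longleftrightarrow> reaches \<eta> k"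
proof -
  show "pre S (xact S g \<eta>) k = (grng S g, act_list S g (snd (pre S \<eta> k)))"
  proof (cases \<eta>)
    case (FinP \<mu>)
    then show ?thesis by (cases \<mu>) (simp add: take_act_list)
  next
    case (InfP x)
    have "map (\<lambda>n. act S (sect_list S g (map x [0..<n])) (x n)) [0..<k] = act_list S g (map x [0..<k])"
      by (induction k) (auto simp: act_list_append)
    moreover have "erng S (act S g (x 0)) = grng S g"
      using assms(2)[of 1] assms(1) InfP by (simp add: erng_act)
    ultimately show ?thesis using InfP by simp
  qed
  show "reaches (xact S g \<eta>) k \<longleftrightarrow> reaches \<eta> k" by (cases \<eta>) (auto simp: pact_def)
qed

text \<open>The hypothesis on the first edge of \<open>\<eta>\<close> is for a vertex
  \<open>\<alpha>\<close> followed by an infinite path: there \<open>pre\<close> reads the range off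
  that edge.\<close>

lemma pre_xcat:
  assumes "walk S (psrc S \<alpha>) (snd (pre S \<eta> 1))" "\<alpha> \<in> paths S"
  shows "pre S (xcat \<alpha> \<eta>) (plen \<alpha> + k) = (fst \<alpha>, snd \<alpha> @ snd (pre S \<eta> k))"
    "reaches (xcat \<alpha> \<eta>) (plen \<alpha> + k) \<longleftrightarrow> reaches \<eta> k"
proof -
  show "pre S (xcat \<alpha> \<eta>) (plen \<alpha> + k) = (fst \<alpha>, snd \<alpha> @ snd (pre S \<eta> k))"
  proof (cases \<eta>)
    case (FinP \<mu>)
    then show ?thesis by (simp add: pcat_def plen_def)
  next
    case (InfP x)
    let ?y = "\<lambda>n. if n < plen \<alpha> then snd \<alpha> ! n else x (n - plen \<alpha>)"
    have "map ?y [0..<plen \<alpha> + k] = snd \<alpha> @ map x [0..<k]"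
      by (rule nth_equalityI) (auto simp: plen_def nth_append)
    moreover have "erng S (?y 0) = fst \<alpha>"
    proof (cases "snd \<alpha>")
      case Nil
      then show ?thesis using assms InfP by (cases \<alpha>) (auto simp: psrc_def)
    next
      case (Cons e es)
      then show ?thesis using assms(2) by (cases \<alpha>) auto
    qed
    ultimately show ?thesis using InfP by simp
  qed
  show "reaches (xcat \<alpha> \<eta>) (plen \<alpha> + k) \<longleftrightarrow> reaches \<eta> k"
    by (cases \<eta>) (auto simp: pcat_def plen_def)
qed

lemma rep_range_pre:
  assumes "(\<alpha>, g, \<beta>, \<xi>) \<in> germ_reps S"
  shows "pre S (rep_range S (\<alpha>, g, \<beta>, \<xi>)) (plen \<alpha> + k) =
      (fst \<alpha>, snd \<alpha> @ act_list S g (drop (plen \<beta>) (snd (pre S \<xi> (plen \<beta> + k)))))"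
    "reaches (rep_range S (\<alpha>, g, \<beta>, \<xi>)) (plen \<alpha> + k) \<longleftrightarrow> reaches \<xi> (plen \<beta> + k)"
proof -
  have r: "\<alpha> \<in> paths S" "g \<in> Grp S" "grng S g = psrc S \<alpha>" "gsrc S g = psrc S \<beta>" "\<xi> \<in> cylinder S \<beta>"
    using assms by (auto simp: germ_reps_iff)
  note t = pre_xtail[OF r(5)]
  have w: "walk S (gsrc S g) (snd (pre S (xtail S \<beta> \<xi>) k))" for k
    using cylinder_segment(2)[OF r(5), of "plen \<beta> + k"] r(4) by (simp add: t)
  note a = pre_xact[OF r(2) w]
  have "walk S (psrc S \<alpha>) (snd (pre S (xact S g (xtail S \<beta> \<xi>)) 1))"
    using walk_act_list(1)[OF r(2) w[of 1]] r(3) by (simp add: a del: One_nat_def)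
  note c = pre_xcat[OF this r(1)]
  show "pre S (rep_range S (\<alpha>, g, \<beta>, \<xi>)) (plen \<alpha> + k) =
      (fst \<alpha>, snd \<alpha> @ act_list S g (drop (plen \<beta>) (snd (pre S \<xi> (plen \<beta> + k)))))"
    by (simp add: c a t)
  show "reaches (rep_range S (\<alpha>, g, \<beta>, \<xi>)) (plen \<alpha> + k) \<longleftrightarrow> reaches \<xi> (plen \<beta> + k)"
    by (simp add: c a t)
qed

lemma rep_range_refine_pre:
  assumes "(\<alpha>, g, \<beta>, \<xi>) \<in> germ_reps S" "refinable (\<alpha>, g, \<beta>, \<xi>) n"
  shows "pre S (rep_range S (\<alpha>, g, \<beta>, \<xi>)) (plen \<alpha> + (n - plen \<beta>)) = fst (refine S (\<alpha>, g, \<beta>, \<xi>) n)"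
    "plen (fst (refine S (\<alpha>, g, \<beta>, \<xi>) n)) = plen \<alpha> + (n - plen \<beta>)"
  using assms rep_range_pre(1)[OF assms(1), of "n - plen \<beta>"]
  by (auto simp: Let_def plen_def length_pre)

lemma rep_range_path_space:
  assumes "p \<in> germ_reps S"
  shows "rep_range S p \<in> path_space S"
proof -
  obtain \<alpha> g \<beta> \<xi> where p: "p = (\<alpha>, g, \<beta>, \<xi>)" by (cases p)
  note r = rep_range_pre[OF assms[unfolded p]]
  show ?thesis unfolding p
  proof (rule path_spaceI[of _ "plen \<alpha>"])
    show "reaches (rep_range S (\<alpha>, g, \<beta>, \<xi>)) (plen \<alpha>)"
      using r(2)[of 0] assms p by (simp add: germ_reps_iff cylinder_iff)
    fix k assume "reaches (rep_range S (\<alpha>, g, \<beta>, \<xi>)) (plen \<alpha> + k)"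
    then have "refinable p (plen \<beta> + k)" using r p by simp
    from refine_germ_reps[OF assms this] rep_range_refine_pre[OF assms[unfolded p] this[unfolded p]]
    show "pre S (rep_range S (\<alpha>, g, \<beta>, \<xi>)) (plen \<alpha> + k) \<in> paths S"
      by (simp add: p Let_def germ_reps_iff)
  qed
qed

text \<open>From the length of the refined left path on, both ranges have the same prefixes, because
  acting on a concatenation is acting on its first part and then by the restriction on the second.
  Shorter prefixes are truncations.\<close>

lemma rep_range_refine:
  assumes "p \<in> germ_reps S" "refinable p n"
  shows "rep_range S (refine S p n) = rep_range S p"
proof -
  obtain \<alpha> g \<beta> \<xi> where p: "p = (\<alpha>, g, \<beta>, \<xi>)" by (cases p)
  obtain \<alpha>' g' \<beta>' \<xi>' where q: "refine S p n = (\<alpha>', g', \<beta>', \<xi>')" by (cases "refine S p n")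
  have qr: "(\<alpha>', g', \<beta>', \<xi>') \<in> germ_reps S" using refine_germ_reps[OF assms] q by simp
  have n: "plen \<beta> \<le> n" "reaches \<xi> n" using assms p by auto
  have q': "plen \<beta>' = n" "\<xi>' = \<xi>" "plen \<alpha>' = plen \<alpha> + (n - plen \<beta>)"
    using q assms(2) by (auto simp: p Let_def plen_pre) (auto simp: plen_def length_pre)
  note a = rep_range_pre[OF assms(1)[unfolded p], folded p] and b = rep_range_pre[OF qr, folded q]
  define m where "m = plen \<alpha>'"
  have re: "reaches (rep_range S (refine S p n)) (m + k) \<longleftrightarrow> reaches (rep_range S p) (m + k)" for k
    using a(2)[of "(n - plen \<beta>) + k"] b(2)[of k] q' n by (simp add: m_def add.assoc del: rep_range.simps)
  have pr: "pre S (rep_range S (refine S p n)) (m + k) = pre S (rep_range S p) (m + k)" for k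
  proof -
    have "pre S (rep_range S p) (m + k) =
      (fst \<alpha>, snd \<alpha> @ act_list S g (drop (plen \<beta>) (snd (pre S \<xi> (n + k)))))"
      using a(1)[of "(n - plen \<beta>) + k"] q' n by (simp add: m_def add.assoc del: rep_range.simps)
    also have "\<dots> = pre S (rep_range S (refine S p n)) (m + k)"
      using b(1)[of k] q' n q segment_append[of "plen \<beta>" n "n + k" \<xi>]
      by (simp add: m_def del: rep_range.simps) (auto simp: p Let_def act_list_append)
    finally show ?thesis by simp
  qed
  show ?thesis
  proof (rule xpath_eqI)
    have m: "reaches (rep_range S (refine S p n)) m" "reaches (rep_range S p) m"
      using re[of 0] b(2)[of 0] q q' n by (auto simp: m_def)
    show "reaches (rep_range S (refine S p n)) k \<longleftrightarrow> reaches (rep_range S p) k" for k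
      using re[of "k - m"] m reaches_mono by (cases "k \<le> m") auto
    show "pre S (rep_range S (refine S p n)) k = pre S (rep_range S p) k" for k
    proof (cases "k \<le> m")
      case True
      then show ?thesis using pr[of 0] pre_take by (metis add_0_right)
    qed (use pr[of "k - m"] in auto)
  qed
qed

lemma germ_of_range:
  assumes "p \<in> germ_reps S" "q \<in> germ_reps S" "germ_of S p = germ_of S q"
  shows "rep_range S p = rep_range S q"
  using assms germ_of_eq_iff[OF assms(1,2)] rep_range_refine by metis

lemma rep_range_cylinder:
  assumes "(\<alpha>, g, \<beta>, \<xi>) \<in> germ_reps S" "n \<le> plen \<alpha>"
  shows "pre S (rep_range S (\<alpha>, g, \<beta>, \<xi>)) n = (fst \<alpha>, take n (snd \<alpha>))"
    "reaches (rep_range S (\<alpha>, g, \<beta>, \<xi>)) n"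
proof -
  have r: "pre S (rep_range S (\<alpha>, g, \<beta>, \<xi>)) (plen \<alpha>) = \<alpha>" "reaches (rep_range S (\<alpha>, g, \<beta>, \<xi>)) (plen \<alpha>)"
    using rep_range_pre[OF assms(1), of 0] assms(1) by (auto simp: germ_reps_iff cylinder_iff plen_def)
  then show "pre S (rep_range S (\<alpha>, g, \<beta>, \<xi>)) n = (fst \<alpha>, take n (snd \<alpha>))"
    using pre_take[OF assms(2)] by metis
  show "reaches (rep_range S (\<alpha>, g, \<beta>, \<xi>)) n" using r assms(2) reaches_mono by blast
qed

lemma rep_range_in_pcat:
  assumes "(pcat \<mu> \<kappa>, g, \<beta>, \<xi>) \<in> germ_reps S"
  shows "rep_range S (pcat \<mu> \<kappa>, g, \<beta>, \<xi>) \<in> cylinder S \<mu>"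
  using rep_range_cylinder[OF assms, of "plen \<mu>"] rep_range_path_space[OF assms]
  by (auto simp: cylinder_iff pcat_def plen_def)

lemma rep_range_cylinderE:
  assumes "p \<in> germ_reps S" "rep_range S p \<in> cylinder S \<mu>"
  obtains n \<kappa> h \<beta> where "refinable p n" "refine S p n = (pcat \<mu> \<kappa>, h, \<beta>, rep_source p)"
    "\<kappa> \<in> paths S" "prng \<kappa> = psrc S \<mu>"
proof -
  obtain \<alpha> g \<beta> \<xi> where p: "p = (\<alpha>, g, \<beta>, \<xi>)" by (cases p)
  \<comment> \<open>Refining to this length makes the left path at least as long as
    \<open>\<mu>\<close>. The subtraction is truncated: if \<open>\<alpha>\<close> is long enough
    already, nothing is extended.\<close>
  define n where "n = plen \<beta> + (plen \<mu> - plen \<alpha>)"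
  have c: "reaches (rep_range S p) (plen \<mu>)" "pre S (rep_range S p) (plen \<mu>) = \<mu>"
    using assms(2) by (auto simp: cylinder_iff)
  have "reaches (rep_range S p) (plen \<alpha>)"
    using rep_range_cylinder(2)[OF assms(1)[unfolded p] order_refl] p by simp
  then have "reaches (rep_range S p) (plen \<alpha> + (plen \<mu> - plen \<alpha>))"
    using c by (cases "plen \<mu> \<le> plen \<alpha>") auto
  then have n: "refinable p n" using rep_range_pre(2)[OF assms(1)[unfolded p]] by (simp add: p n_def)
  obtain \<alpha>' h \<beta>' \<xi>' where q: "refine S p n = (\<alpha>', h, \<beta>', \<xi>')" by (cases "refine S p n")
  have qr: "(\<alpha>', h, \<beta>', \<xi>') \<in> germ_reps S" using refine_germ_reps[OF assms(1) n] q by simp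
  have l: "plen \<mu> \<le> plen \<alpha>'"
    using rep_range_refine_pre(2)[OF assms(1)[unfolded p] n[unfolded p]] q by (simp add: p n_def)
  have \<mu>: "\<mu> = (fst \<alpha>', take (plen \<mu>) (snd \<alpha>'))"
    using rep_range_cylinder(1)[OF qr l] rep_range_refine[OF assms(1) n] q c by simp
  let ?\<kappa> = "(psrc S \<mu>, drop (plen \<mu>) (snd \<alpha>'))"
  have \<alpha>': "\<alpha>' = pcat \<mu> ?\<kappa>" by (subst \<mu>) (simp add: pcat_def)
  have "walk S (fst \<alpha>') (snd \<alpha>')" using qr by (cases \<alpha>') (auto simp: germ_reps_iff)
  then have "walk S (fst \<alpha>') (take (plen \<mu>) (snd \<alpha>') @ drop (plen \<mu>) (snd \<alpha>'))" by simp
  then have "?\<kappa> \<in> paths S" unfolding walk_append using \<mu> by (metis paths_iff)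
  moreover have "\<xi>' = rep_source p" using q rep_source_refine by (metis rep_source.simps)
  ultimately show thesis using that[OF n, of ?\<kappa>] q \<alpha>' by simp
qed

text \<open>Prefix lengths of source and range correspond by the shift from
  \<open>plen \<beta>\<close> to \<open>plen \<alpha>\<close>, and the end vertices of corresponding
  prefixes are source and range of one restriction of \<open>g\<close>; hence they are singular
  together.\<close>

lemma rep_range_boundary:
  assumes "p \<in> germ_reps S"
  shows "rep_range S p \<in> boundary_paths S \<longleftrightarrow> rep_source p \<in> boundary_paths S"
proof -
  obtain \<alpha> g \<beta> \<xi> where p: "p = (\<alpha>, g, \<beta>, \<xi>)" by (cases p)
  note a = rep_range_pre[OF assms[unfolded p], folded p]
  have c: "\<xi> \<in> cylinder S \<beta>" "g \<in> Grp S" "gsrc S g = psrc S \<beta>" "grng S g = psrc S \<alpha>"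
    using assms p by (auto simp: germ_reps_iff)
  have sing: "singular_vertex S (psrc S (pre S (rep_range S p) (plen \<alpha> + k))) \<longleftrightarrow>
      singular_vertex S (psrc S (pre S \<xi> (plen \<beta> + k)))" for k
  proof -
    let ?w = "drop (plen \<beta>) (snd (pre S \<xi> (plen \<beta> + k)))"
    note s = cylinder_segment[OF c(1), of "plen \<beta> + k", simplified]
    have w: "walk S (gsrc S g) ?w" using s c by simp
    note l = walk_act_list[OF c(2) w]
    have "psrc S (pre S \<xi> (plen \<beta> + k)) = gsrc S (sect_list S g ?w)"
      using l c s(1) by (metis psrc_append prod.collapse)
    moreover have "psrc S (pre S (rep_range S p) (plen \<alpha> + k)) = grng S (sect_list S g ?w)"
      using l c by (simp add: a psrc_append)
    ultimately show ?thesis using singular_transport[OF l(2)] by simp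
  qed
  have end_range: "\<exists>k. n = plen \<alpha> + k" if "reaches (rep_range S p) n" "\<not> reaches (rep_range S p) (Suc n)" for n
    using that rep_range_cylinder(2)[OF assms[unfolded p], folded p]
    by (metis le_Suc_ex nat_le_linear not_less_eq_eq)
  have end_source: "\<exists>k. n = plen \<beta> + k" if "reaches \<xi> n" "\<not> reaches \<xi> (Suc n)" for n
    using that c(1) reaches_mono unfolding cylinder_iff by (metis le_Suc_ex nat_le_linear not_less_eq_eq)
  have aS: "reaches (rep_range S p) (Suc (plen \<alpha> + k)) \<longleftrightarrow> reaches \<xi> (Suc (plen \<beta> + k))" for k
    using a(2)[of "Suc k"] by simp
  show ?thesis
  proof
    assume "rep_range S p \<in> boundary_paths S"
    then show "rep_source p \<in> boundary_paths S"
      using c(1) end_source sing a(2) aS unfolding boundary_paths_iff cylinder_iff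
      by (auto simp: p) blast
  next
    assume "rep_source p \<in> boundary_paths S"
    then show "rep_range S p \<in> boundary_paths S"
      using rep_range_path_space[OF assms] end_range sing a(2) aS unfolding boundary_paths_iff
      by (auto simp: p) blast
  qed
qed

end

section \<open>The operators of a twisted action\<close>

context twisted_self_similar_action
begin

section \<open>Unit vectors attached to representatives of germs\<close>

lemma refine_phase_circle:
  assumes "p \<in> germ_reps S" "refinable p n"
  shows "cmod (refine_phase S p n) = 1"
proof -
  obtain \<alpha> g \<beta> \<xi> where p: "p = (\<alpha>, g, \<beta>, \<xi>)" by (cases p)
  then show ?thesis
    using assms cylinder_segment(2)[of \<xi> \<beta> n] by (auto simp: germ_reps_iff intro!: twE_list_circle)
qed

lemma refine_phase_refine:
  assumes "refinable p n" "n \<le> m"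
  shows "refine_phase S p m = refine_phase S p n * refine_phase S (refine S p n) m"
proof -
  obtain \<alpha> g \<beta> \<xi> where p: "p = (\<alpha>, g, \<beta>, \<xi>)" by (cases p)
  then show ?thesis
    using assms segment_append[of "plen \<beta>" n m \<xi>] by (simp add: p Let_def plen_pre twE_list_append)
qed

definition rep_phase :: "('a, 'b) germ_rep \<Rightarrow> ('a, 'b) germ_rep \<Rightarrow> complex" where
  "rep_phase p q = (SOME c. \<exists>n. refinable p n \<and> refinable q n \<and> refine S p n = refine S q n \<and>
     c = refine_phase S p n * cnj (refine_phase S q n))"

text \<open>A longer prefix multiplies both phases by the same unimodular number, which cancels
  against its conjugate. So the value does not depend on the \<open>n\<close> chosen in
  \<open>rep_phase\<close>.\<close>

lemma rep_phase_eq: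
  assumes pq: "p \<in> germ_reps S" "q \<in> germ_reps S"
    and n: "refinable p n" "refinable q n" "refine S p n = refine S q n"
  shows "rep_phase p q = refine_phase S p n * cnj (refine_phase S q n)"
proof -
  let ?f = "\<lambda>n. refine_phase S p n * cnj (refine_phase S q n)"
  have mono: "?f m = ?f n"
    if n: "refinable p n" "refinable q n" "refine S p n = refine S q n"
      and m: "refinable p m" "refinable q m" "refine S p m = refine S q m" and le: "n \<le> m" for n m
  proof -
    have "refinable (refine S q n) m" using n m le by (metis refinable_refineI)
    then have "cmod (refine_phase S (refine S q n) m) = 1"
      using refine_phase_circle refine_germ_reps pq n by blast
    then have "refine_phase S (refine S q n) m * cnj (refine_phase S (refine S q n) m) = 1"
      by (rule unimodular_cnj)
    then show ?thesis
      using refine_phase_refine[OF n(1) le] refine_phase_refine[OF n(2) le] n(3) by (simp add: mult_ac)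
  qed
  have ex: "\<exists>c n. refinable p n \<and> refinable q n \<and> refine S p n = refine S q n \<and> c = ?f n"
    using n by blast
  obtain m where "refinable p m" "refinable q m" "refine S p m = refine S q m" "rep_phase p q = ?f m"
    using someI_ex[OF ex] unfolding rep_phase_def by blast
  then show ?thesis using mono[OF n, of m] mono[of m n] n by (metis nat_le_linear)
qed

end

text \<open>\<open>Y\<close> is the set of admissible sources of germs: the path space for the
  Toeplitz algebras, the boundary for the others.\<close>

locale twisted_rep = twisted_self_similar_action S
  for S :: "('g, 'e) twisted_action" +
  fixes Y :: "('g, 'e) xpath set"
  assumes Y_subset: "Y \<subseteq> path_space S"
begin

text \<open>Fix one representative \<open>r\<close> of each germ and let the unit vector of any
  representative be the basis vector times its phase relative to the fixed one. Compatibility with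
  refinement is multiplicativity of phases along prefixes.\<close>

lemma delta_system_exists: "\<exists>d. delta_system S d"
proof -
  define r where "r x = (SOME q. q \<in> germ_reps S \<and> germ_of S q = x)" for x
  have r: "r (germ_of S p) \<in> germ_reps S" "germ_of S (r (germ_of S p)) = germ_of S p"
    if "p \<in> germ_reps S" for p
    using someI_ex[of "\<lambda>q. q \<in> germ_reps S \<and> germ_of S q = germ_of S p"] that
    unfolding r_def by blast+
  define d where "d p = cscale (rep_phase p (r (germ_of S p))) (ket (germ_of S p))" for p
  have "delta_system S d"
    unfolding delta_system_def
  proof (intro conjI ballI allI impI)
    fix p assume p: "p \<in> germ_reps S"
    note rp = r[OF p]
    obtain n where n: "refinable p n" "refinable (r (germ_of S p)) n" "refine S p n = refine S (r (germ_of S p)) n"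
      using rp(2)[symmetric] unfolding germ_of_eq_iff[OF p rp(1)] by blast
    have "cmod (rep_phase p (r (germ_of S p))) = 1"
      using rep_phase_eq[OF p rp(1) n] refine_phase_circle p rp n by (simp add: norm_mult)
    then show "\<exists>c. cmod c = 1 \<and> d p = cscale c (ket (germ_of S p))" by (auto simp: d_def)
  next
    fix \<alpha> g \<beta> \<xi> \<beta>'
    assume p: "(\<alpha>, g, \<beta>, \<xi>) \<in> germ_reps S" and \<beta>': "\<beta>' \<in> paths S"
      and "prng \<beta>' = psrc S \<beta> \<and> xprefix S (pcat \<beta> \<beta>') \<xi>"
    then have \<beta>'2: "prng \<beta>' = psrc S \<beta>" "xprefix S (pcat \<beta> \<beta>') \<xi>" by auto
    let ?p = "(\<alpha>, g, \<beta>, \<xi>)" and ?n = "plen (pcat \<beta> \<beta>')"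
    let ?q = "r (germ_of S ?p)" and ?p' = "refine S ?p ?n"
    note e = refine_ext[OF p \<beta>' \<beta>'2]
    have p': "?p' \<in> germ_reps S" by (rule refine_germ_reps[OF p e(1)])
    have g: "germ_of S ?p' = germ_of S ?p" by (rule germ_of_refine[OF p e(1)])
    note q = r[OF p]
    obtain m where m: "refinable ?p' m" "refinable ?q m" "refine S ?p' m = refine S ?q m"
      using germ_of_eq_iff[OF p' q(1)] g q(2) by metis
    have m': "?n \<le> m" "refinable ?p m" using refinable_refine[OF m(1) e(1)] by auto
    then have "refine S ?p m = refine S ?q m" using refine_refine[OF e(1) m'(1)] m by simp
    then have "rep_phase ?p ?q = refine_phase S ?p m * cnj (refine_phase S ?q m)"
      using rep_phase_eq[OF p q(1) m'(2) m(2)] by simp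
    also have "\<dots> = refine_phase S ?p ?n * (refine_phase S ?p' m * cnj (refine_phase S ?q m))"
      using refine_phase_refine[OF e(1) m'(1)] by simp
    also have "\<dots> = refine_phase S ?p ?n * rep_phase ?p' ?q"
      using rep_phase_eq[OF p' q(1) m] by simp
    also have "refine_phase S ?p ?n = ptw S g \<beta>'"
      using e(2) \<beta>'2 p xprefix_iff[of \<xi> "pcat \<beta> \<beta>'"]
      by (cases \<beta>, cases \<beta>') (simp add: germ_reps_iff cylinder_iff)
    finally have "rep_phase ?p ?q = ptw S g \<beta>' * rep_phase ?p' ?q" .
    then have "d ?p = cscale (ptw S g \<beta>') (d ?p')" by (simp add: d_def g del: refine.simps)
    then show "d ?p = cscale (ptw S g \<beta>') (d (pcat \<alpha> (pact S g \<beta>'), psect S g \<beta>', pcat \<beta> \<beta>', \<xi>))"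
      unfolding e(2) .
  qed
  then show ?thesis by blast
qed

lemma delta_system_delta: "delta_system S (delta S)"
  unfolding delta_def using delta_system_exists by (rule someI_ex)

lemma delta_ket:
  assumes "p \<in> germ_reps S"
  obtains c where "cmod c = 1" "delta S p = cscale c (ket (germ_of S p))"
  using assms delta_system_delta unfolding delta_system_def by blast

lemma ket_delta:
  assumes "p \<in> germ_reps S"
  obtains c where "cmod c = 1" "ket (germ_of S p) = cscale c (delta S p)"
proof -
  obtain c where c: "cmod c = 1" "delta S p = cscale c (ket (germ_of S p))" using delta_ket[OF assms] .
  then show thesis using that[of "cnj c"] unimodular_cnj[of c] by simp
qed

lemma norm_delta: "p \<in> germ_reps S \<Longrightarrow> norm (delta S p) = 1"
  by (erule delta_ket) simp

lemma delta_refine: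
  assumes "p \<in> germ_reps S" "refinable p n"
  shows "delta S p = cscale (refine_phase S p n) (delta S (refine S p n))"
proof -
  obtain \<alpha> g \<beta> \<xi> where p: "p = (\<alpha>, g, \<beta>, \<xi>)" by (cases p)
  let ?\<kappa> = "segment p n"
  note s = segment[OF assms[unfolded p], folded p]
  note e = refine_ext[OF assms(1)[unfolded p] s(1-3), folded p, unfolded s(4)]
  have "delta S p = cscale (ptw S g ?\<kappa>) (delta S (refine S p n))"
    using delta_system_delta assms(1) s(1-3) e(2) unfolding delta_system_def p by metis
  moreover have "ptw S g ?\<kappa> = refine_phase S p n" by (simp add: p segment_def)
  ultimately show ?thesis by simp
qed

lemma ket_source_cases:
  obtains "x \<notin> toeplitz_groupoid S" | p where "p \<in> germ_reps S" "x = germ_of S p"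
  using toeplitz_groupoid_eq by blast

subsection \<open>Operators given on representatives\<close>

text \<open>The common shape of the definite descriptions in \<open>W_op\<close> and
  \<open>T_op\<close>: \<open>D\<close> is the domain on representatives, \<open>\<phi>\<close> the
  phase, \<open>F\<close> the map of representatives.\<close>

definition rep_op :: "(('g, 'e) germ_rep \<Rightarrow> bool) \<Rightarrow> (('g, 'e) germ_rep \<Rightarrow> complex) \<Rightarrow>
    (('g, 'e) germ_rep \<Rightarrow> ('g, 'e) germ_rep) \<Rightarrow> ('g, 'e) germ oper \<Rightarrow> bool" where
  "rep_op D \<phi> F A \<longleftrightarrow> clinear_op A \<and>
    (\<forall>x. x \<notin> toeplitz_groupoid S \<longrightarrow> blinfun_apply A (ket x) = 0) \<and>
    (\<forall>p\<in>germ_reps S. blinfun_apply A (delta S p) = (if D p then cscale (\<phi> p) (delta S (F p)) else 0))"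

lemma rep_op_unique: "rep_op D \<phi> F A \<Longrightarrow> rep_op D \<phi> F B \<Longrightarrow> A = B"
proof (rule clinear_op_eqI)
  fix x assume A: "rep_op D \<phi> F A" and B: "rep_op D \<phi> F B"
  show "blinfun_apply A (ket x) = blinfun_apply B (ket x)"
  proof (rule ket_source_cases[of x])
    assume "x \<notin> toeplitz_groupoid S"
    then show ?thesis using A B by (simp add: rep_op_def)
  next
    fix p assume p: "p \<in> germ_reps S" "x = germ_of S p"
    obtain c where "ket x = cscale c (delta S p)" using ket_delta p by metis
    then show ?thesis using A B p by (simp add: rep_op_def clinear_opD)
  qed
qed (auto simp: rep_op_def)

text \<open>The operator is prescribed on one representative per germ. Domain, map and phase are
  compatible with refinement, so the formula \<open>Q\<close> passes from a representative to its
  refinements and back, and thus to every representative. Injectivity on germs makes the operator a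
  contraction.\<close>

lemma rep_op_exists:
  assumes F: "\<And>p. p \<in> germ_reps S \<Longrightarrow> D p \<Longrightarrow> F p \<in> germ_reps S"
    and \<phi>: "\<And>p. p \<in> germ_reps S \<Longrightarrow> D p \<Longrightarrow> cmod (\<phi> p) = 1"
    and D: "\<And>p n. p \<in> germ_reps S \<Longrightarrow> refinable p n \<Longrightarrow> D (refine S p n) \<longleftrightarrow> D p"
    and rF: "\<And>p n. p \<in> germ_reps S \<Longrightarrow> refinable p n \<Longrightarrow> D p \<Longrightarrow>
          refinable (F p) n \<and> refine S (F p) n = F (refine S p n)"
    and r\<phi>: "\<And>p n. p \<in> germ_reps S \<Longrightarrow> refinable p n \<Longrightarrow> D p \<Longrightarrow>
          \<phi> p * refine_phase S (F p) n = refine_phase S p n * \<phi> (refine S p n)"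
    and inj: "\<And>p q. p \<in> germ_reps S \<Longrightarrow> q \<in> germ_reps S \<Longrightarrow> D p \<Longrightarrow> D q \<Longrightarrow>
          germ_of S (F p) = germ_of S (F q) \<Longrightarrow> germ_of S p = germ_of S q"
  obtains A where "rep_op D \<phi> F A" "norm A \<le> 1"
proof -
  define r where "r x = (SOME q. q \<in> germ_reps S \<and> germ_of S q = x)" for x
  have r: "r x \<in> germ_reps S" "germ_of S (r x) = x" if "x \<in> toeplitz_groupoid S" for x
    using someI_ex[of "\<lambda>q. q \<in> germ_reps S \<and> germ_of S q = x"] that
    unfolding r_def toeplitz_groupoid_eq by blast+
  define u where "u p = (SOME c. cmod c = 1 \<and> delta S p = cscale c (ket (germ_of S p)))" for p
  have u: "cmod (u p) = 1" "delta S p = cscale (u p) (ket (germ_of S p))" if "p \<in> germ_reps S" for p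
    using someI_ex[of "\<lambda>c. cmod c = 1 \<and> delta S p = cscale c (ket (germ_of S p))"] delta_ket[OF that]
    unfolding u_def by metis+
  let ?D = "{x \<in> toeplitz_groupoid S. D (r x)}"
  \<comment> \<open>The factors \<open>u\<close> translate between the unit vectors of
    representatives and the basis vectors of germs.\<close>
  let ?f = "\<lambda>x. germ_of S (F (r x))" and ?c = "\<lambda>x. cnj (u (r x)) * \<phi> (r x) * u (F (r x))"
  have "inj_on ?f ?D"
  proof (rule inj_onI)
    fix x y assume "x \<in> ?D" "y \<in> ?D" "?f x = ?f y"
    then show "x = y" using inj[of "r x" "r y"] r by force
  qed
  moreover have "cmod (?c x) \<le> 1" if "x \<in> ?D" for x
    using that r u \<phi> F by (simp add: norm_mult)
  ultimately obtain A where A: "clinear_op A" "norm A \<le> 1"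
    "\<And>x. blinfun_apply A (ket x) = (if x \<in> ?D then cscale (?c x) (ket (?f x)) else 0)"
    using monomial_op_exists[of ?f ?D ?c 1] by auto
  define Q where "Q p \<longleftrightarrow> blinfun_apply A (delta S p) = (if D p then cscale (\<phi> p) (delta S (F p)) else 0)" for p
  have Qr: "Q (r x)" if x: "x \<in> toeplitz_groupoid S" for x
  proof -
    note rx = r[OF x]
    have "u (r x) * cnj (u (r x)) = 1" using u(1)[OF rx(1)] by (rule unimodular_cnj)
    then have c: "u (r x) * (cnj (u (r x)) * z) = z" for z by (simp add: mult.assoc[symmetric])
    have "blinfun_apply A (delta S (r x)) = cscale (u (r x)) (blinfun_apply A (ket x))"
      using u(2)[OF rx(1)] rx(2) A(1) by (simp add: clinear_opD)
    then show ?thesis using x u(2)[OF F[OF rx(1)]] by (simp add: Q_def A(3) mult.assoc c)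
  qed
  have Q_refine: "Q p \<longleftrightarrow> Q (refine S p n)" if p: "p \<in> germ_reps S" "refinable p n" for p n
  proof -
    have nz: "refine_phase S p n \<noteq> 0" using refine_phase_circle[OF p] by auto
    have l: "blinfun_apply A (delta S p) = cscale (refine_phase S p n) (blinfun_apply A (delta S (refine S p n)))"
      using delta_refine[OF p] A(1) by (simp add: clinear_opD)
    show ?thesis
    proof (cases "D p")
      case True
      have "cscale (\<phi> p) (delta S (F p)) = cscale (\<phi> p * refine_phase S (F p) n) (delta S (F (refine S p n)))"
        using delta_refine[OF F[OF p(1) True], of n] rF[OF p True] by simp
      then have "cscale (\<phi> p) (delta S (F p)) =
          cscale (refine_phase S p n) (cscale (\<phi> (refine S p n)) (delta S (F (refine S p n))))"
        using r\<phi>[OF p True] by simp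
      then show ?thesis using True D[OF p] by (simp only: Q_def l if_True cscale_cancel[OF nz])
    next
      case False
      then show ?thesis using D[OF p] cscale_cancel[OF nz, of _ 0] by (simp add: Q_def l)
    qed
  qed
  have "Q p" if p: "p \<in> germ_reps S" for p
  proof -
    have x: "germ_of S p \<in> toeplitz_groupoid S" using p by (auto simp: toeplitz_groupoid_eq)
    note rx = r[OF x]
    obtain n where n: "refinable p n" "refinable (r (germ_of S p)) n" "refine S p n = refine S (r (germ_of S p)) n"
      using rx(2)[symmetric] unfolding germ_of_eq_iff[OF p rx(1)] by blast
    then show ?thesis using Q_refine[OF p n(1)] Q_refine[OF rx(1) n(2)] Qr[OF x] by simp
  qed
  then have "rep_op D \<phi> F A" using A by (auto simp: rep_op_def Q_def)
  then show thesis using A(2) that by blast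
qed

definition W_dom :: "'g \<Rightarrow> ('g, 'e) germ_rep \<Rightarrow> bool" where
  "W_dom g p \<longleftrightarrow> (case p of (\<alpha>, h, \<beta>, \<xi>) \<Rightarrow> gsrc S g = prng \<alpha>)"

definition W_phase :: "'g \<Rightarrow> ('g, 'e) germ_rep \<Rightarrow> complex" where
  "W_phase g p = (case p of (\<alpha>, h, \<beta>, \<xi>) \<Rightarrow> ptw S g \<alpha> * twG S (psect S g \<alpha>) h)"

definition W_map :: "'g \<Rightarrow> ('g, 'e) germ_rep \<Rightarrow> ('g, 'e) germ_rep" where
  "W_map g p = (case p of (\<alpha>, h, \<beta>, \<xi>) \<Rightarrow> (pact S g \<alpha>, gmult S (psect S g \<alpha>) h, \<beta>, \<xi>))"

lemma W_map_facts:
  assumes g: "g \<in> Grp S" and p: "p \<in> germ_reps S" and D: "W_dom g p"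
  shows "W_map g p \<in> germ_reps S" "cmod (W_phase g p) = 1"
    "refinable p n \<Longrightarrow> W_dom g (refine S p n)"
    "refinable p n \<Longrightarrow> refinable (W_map g p) n"
    "refinable p n \<Longrightarrow> refine S (W_map g p) n = W_map g (refine S p n)"
    "refinable p n \<Longrightarrow> W_phase g p * refine_phase S (W_map g p) n = refine_phase S p n * W_phase g (refine S p n)"
    "W_dom (ginv S g) (W_map g p)" "W_map (ginv S g) (W_map g p) = p"
proof -
  obtain a as h \<beta> \<xi> where pp: "p = ((a, as), h, \<beta>, \<xi>)" by (metis prod.collapse)
  have r: "walk S a as" "h \<in> Grp S" "grng S h = psrc S (a, as)" "gsrc S h = psrc S \<beta>" "\<xi> \<in> cylinder S \<beta>" "\<beta> \<in> paths S"
    using p pp by (auto simp: germ_reps_iff)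
  have w: "walk S (gsrc S g) as" and a: "gsrc S g = a" using r D by (auto simp: W_dom_def pp)
  note l = walk_act_list[OF g w]
  let ?k = "sect_list S g as"
  have kh: "gsrc S ?k = grng S h" using l r a by simp
  note m = gmult_closed[OF l(2) r(2) kh] grng_gmult[OF l(2) r(2) kh] gsrc_gmult[OF l(2) r(2) kh]
  show "W_map g p \<in> germ_reps S"
    using r l m by (simp add: pp W_map_def germ_reps_iff)
  show "cmod (W_phase g p) = 1"
    using twE_list_circle[OF g w] twG_circle[OF l(2) r(2) kh] by (simp add: pp W_phase_def norm_mult)
  show "W_dom g (refine S p n)" using a by (simp add: pp W_dom_def Let_def)
  show "refinable p n \<Longrightarrow> refinable (W_map g p) n" by (simp add: pp W_map_def)
  have seg: "walk S (gsrc S h) (drop (plen \<beta>) (snd (pre S \<xi> n)))" if "refinable p n"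
    using cylinder_segment(2)[OF r(5), of n] r that pp by simp
  show "refine S (W_map g p) n = W_map g (refine S p n)" if "refinable p n"
    using act_list_gmult[OF l(2) r(2) kh seg[OF that]] sect_list_gmult[OF l(2) r(2) kh seg[OF that]]
    by (simp add: pp W_map_def Let_def act_list_append sect_list_append)
  show "W_phase g p * refine_phase S (W_map g p) n = refine_phase S p n * W_phase g (refine S p n)"
    if "refinable p n"
    using twE_list_gmult'[OF l(2) r(2) kh seg[OF that]]
    by (simp add: pp W_map_def W_phase_def Let_def twE_list_append sect_list_append mult_ac)
  show "W_dom (ginv S g) (W_map g p)" by (simp add: pp W_dom_def W_map_def gsrc_ginv[OF g])
  show "W_map (ginv S g) (W_map g p) = p"
    using act_list_ginv[OF g w] left_cancel[OF l(2) r(2) kh] a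
    by (simp add: pp W_map_def grng_ginv[OF g])
qed

lemma W_dom_refine:
  assumes "p \<in> germ_reps S" "refinable p n"
  shows "W_dom g (refine S p n) \<longleftrightarrow> W_dom g p"
  by (cases p) (auto simp: W_dom_def Let_def prng_def)

text \<open>Injectivity on germs: \<open>W_map (ginv S g)\<close> undoes \<open>W_map g\<close> on
  representatives and commutes with refinement, so a common refinement of the images pulls back to
  one of the originals.\<close>

lemma
  assumes g: "g \<in> Grp S"
  shows rep_op_W: "rep_op (W_dom g) (W_phase g) (W_map g) (W_op S g)"
    and norm_W_op: "norm (W_op S g) \<le> 1"
proof -
  have inj: "germ_of S p = germ_of S q"
    if pq: "p \<in> germ_reps S" "q \<in> germ_reps S" "W_dom g p" "W_dom g q"
      "germ_of S (W_map g p) = germ_of S (W_map g q)" for p q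
  proof -
    note P = W_map_facts[OF g pq(1,3)] and Q = W_map_facts[OF g pq(2,4)]
    obtain n where n: "refinable (W_map g p) n" "refinable (W_map g q) n"
      "refine S (W_map g p) n = refine S (W_map g q) n"
      using pq(5) unfolding germ_of_eq_iff[OF P(1) Q(1)] by blast
    have gi: "ginv S g \<in> Grp S" using g by (rule ginv_closed)
    note P' = W_map_facts[OF gi P(1) P(7)] and Q' = W_map_facts[OF gi Q(1) Q(7)]
    have "refinable p n" "refinable q n" using P'(4)[OF n(1)] Q'(4)[OF n(2)] P(8) Q(8) by auto
    moreover have "refine S p n = refine S q n"
      using P'(5)[OF n(1)] Q'(5)[OF n(2)] P(8) Q(8) n(3) by simp
    ultimately show ?thesis unfolding germ_of_eq_iff[OF pq(1,2)] by blast
  qed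
  have "\<exists>A. rep_op (W_dom g) (W_phase g) (W_map g) A \<and> norm A \<le> 1"
  proof (rule rep_op_exists[of "W_dom g" "W_map g" "W_phase g"], goal_cases)
    case (1 p) then show ?case by (rule W_map_facts(1)[OF g])
  next
    case (2 p) then show ?case by (rule W_map_facts(2)[OF g])
  next
    case (3 p n) then show ?case by (rule W_dom_refine)
  next
    case (4 p n)
    then show ?case using W_map_facts(4)[OF g 4(1,3,2)] W_map_facts(5)[OF g 4(1,3,2)] by blast
  next
    case (5 p n) then show ?case by (intro W_map_facts(6)[OF g])
  next
    case (6 p q) then show ?case by (rule inj)
  next
    case (7 A) then show ?case by blast
  qed
  then obtain A where A: "rep_op (W_dom g) (W_phase g) (W_map g) A" "norm A \<le> 1" by blast
  have iff: "rep_op (W_dom g) (W_phase g) (W_map g) B \<longleftrightarrow> clinear_op B \<and>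
    (\<forall>x. x \<notin> toeplitz_groupoid S \<longrightarrow> blinfun_apply B (ket x) = 0) \<and>
    (\<forall>\<alpha> h \<beta> \<xi>. (\<alpha>, h, \<beta>, \<xi>) \<in> germ_reps S \<longrightarrow>
      blinfun_apply B (delta S (\<alpha>, h, \<beta>, \<xi>)) =
        (if gsrc S g = prng \<alpha>
         then cscale (ptw S g \<alpha> * twG S (psect S g \<alpha>) h)
                (delta S (pact S g \<alpha>, gmult S (psect S g \<alpha>) h, \<beta>, \<xi>))
         else 0))" for B
    by (auto simp: rep_op_def W_dom_def W_phase_def W_map_def)
  have "W_op S g = A"
    unfolding W_op_def iff[symmetric] using A(1) rep_op_unique by blast
  then show "rep_op (W_dom g) (W_phase g) (W_map g) (W_op S g)" "norm (W_op S g) \<le> 1" using A by auto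
qed

definition T_dom :: "'e \<Rightarrow> ('g, 'e) germ_rep \<Rightarrow> bool" where
  "T_dom e p \<longleftrightarrow> (case p of (\<alpha>, h, \<beta>, \<xi>) \<Rightarrow> esrc S e = prng \<alpha>)"

definition T_map :: "'e \<Rightarrow> ('g, 'e) germ_rep \<Rightarrow> ('g, 'e) germ_rep" where
  "T_map e p = (case p of (\<alpha>, h, \<beta>, \<xi>) \<Rightarrow> (pcat (erng S e, [e]) \<alpha>, h, \<beta>, \<xi>))"

lemma T_map_facts:
  assumes e: "e \<in> Edges S" and p: "p \<in> germ_reps S" and D: "T_dom e p"
  shows "T_map e p \<in> germ_reps S"
    "T_dom e (refine S p n)"
    "refinable (T_map e p) n \<longleftrightarrow> refinable p n"
    "refine S (T_map e p) n = T_map e (refine S p n)"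
    "refine_phase S (T_map e p) n = refine_phase S p n"
  using assms by (cases p; cases "fst p"; simp add: T_map_def T_dom_def Let_def germ_reps_iff)+

lemma T_map_inj:
  assumes "T_dom e p" "T_dom e q" "T_map e p = T_map e q"
  shows "p = q"
  using assms by (cases p; cases "fst p"; cases q; cases "fst q") (auto simp: T_map_def T_dom_def)

lemma
  assumes e: "e \<in> Edges S"
  shows rep_op_T: "rep_op (T_dom e) (\<lambda>_. 1) (T_map e) (T_op S e)"
    and norm_T_op: "norm (T_op S e) \<le> 1"
proof -
  have dom: "T_dom e (refine S p n) \<longleftrightarrow> T_dom e p" for p n
    by (cases p) (auto simp: T_dom_def Let_def prng_def)
  have inj: "germ_of S p = germ_of S q"
    if pq: "p \<in> germ_reps S" "q \<in> germ_reps S" "T_dom e p" "T_dom e q"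
      "germ_of S (T_map e p) = germ_of S (T_map e q)" for p q
  proof -
    note P = T_map_facts[OF e pq(1,3)] and Q = T_map_facts[OF e pq(2,4)]
    obtain n where n: "refinable (T_map e p) n" "refinable (T_map e q) n"
      "refine S (T_map e p) n = refine S (T_map e q) n"
      using pq(5) unfolding germ_of_eq_iff[OF P(1) Q(1)] by blast
    then have "refine S p n = refine S q n" using P Q T_map_inj by metis
    then show ?thesis unfolding germ_of_eq_iff[OF pq(1,2)] using n P Q by blast
  qed
  have "\<exists>A. rep_op (T_dom e) (\<lambda>_. 1) (T_map e) A \<and> norm A \<le> 1"
  proof (rule rep_op_exists[of "T_dom e" "T_map e" "\<lambda>_. 1"], goal_cases)
    case (1 p) then show ?case by (rule T_map_facts(1)[OF e])
  next
    case 2 show ?case by simp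
  next
    case (3 p n) show ?case by (rule dom)
  next
    case (4 p n)
    then show ?case using T_map_facts(3)[OF e 4(1,3)] T_map_facts(4)[OF e 4(1,3)] by blast
  next
    case (5 p n) then show ?case using T_map_facts(5)[OF e 5(1,3)] by simp
  next
    case (6 p q) then show ?case by (rule inj)
  next
    case (7 A) then show ?case by blast
  qed
  then obtain A where A: "rep_op (T_dom e) (\<lambda>_. 1) (T_map e) A" "norm A \<le> 1" by blast
  have iff: "rep_op (T_dom e) (\<lambda>_. 1) (T_map e) B \<longleftrightarrow> clinear_op B \<and>
    (\<forall>x. x \<notin> toeplitz_groupoid S \<longrightarrow> blinfun_apply B (ket x) = 0) \<and>
    (\<forall>\<alpha> h \<beta> \<xi>. (\<alpha>, h, \<beta>, \<xi>) \<in> germ_reps S \<longrightarrow>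
      blinfun_apply B (delta S (\<alpha>, h, \<beta>, \<xi>)) =
        (if esrc S e = prng \<alpha> then delta S (pcat (erng S e, [e]) \<alpha>, h, \<beta>, \<xi>) else 0))" for B
    by (auto simp: rep_op_def T_dom_def T_map_def)
  have "T_op S e = A"
    unfolding T_op_def iff[symmetric] using A(1) rep_op_unique by blast
  then show "rep_op (T_dom e) (\<lambda>_. 1) (T_map e) (T_op S e)" "norm (T_op S e) \<le> 1" using A by auto
qed

end

subsection \<open>Restriction to germs with prescribed sources\<close>

lemma comp_id [simp]: "A o\<^sub>L id_blinfun = (A :: 'a oper)"
  by (rule blinfun_eqI) simp

context twisted_rep
begin

definition X :: "('g, 'e) germ set" where
  "X = {germ_of S p | p. p \<in> germ_reps S \<and> rep_source p \<in> Y}"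

definition reps :: "('g, 'e) germ_rep set" where
  "reps = {p \<in> germ_reps S. rep_source p \<in> Y}"

abbreviation "W \<equiv> W_on S X"
abbreviation "T \<equiv> T_on S X"
abbreviation "Tp \<equiv> T_path S X"

lemma reps_germ_reps: "p \<in> reps \<Longrightarrow> p \<in> germ_reps S"
  by (simp add: reps_def)

lemma germ_in_X:
  assumes "p \<in> germ_reps S"
  shows "germ_of S p \<in> X \<longleftrightarrow> p \<in> reps"
proof
  assume "germ_of S p \<in> X"
  then obtain q where "germ_of S p = germ_of S q" "q \<in> germ_reps S" "rep_source q \<in> Y"
    unfolding X_def by blast
  then show "p \<in> reps" using germ_of_source[OF assms] assms by (auto simp: reps_def)
next
  assume "p \<in> reps"
  then show "germ_of S p \<in> X" unfolding X_def reps_def by blast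
qed

lemma X_E:
  assumes "x \<in> X"
  obtains p where "p \<in> reps" "x = germ_of S p"
  using assms by (auto simp: X_def reps_def)

lemma X_subset: "X \<subseteq> toeplitz_groupoid S"
  by (auto simp: X_def toeplitz_groupoid_eq)

lemma refine_reps: "p \<in> reps \<Longrightarrow> refinable p n \<Longrightarrow> refine S p n \<in> reps"
  by (simp add: reps_def refine_germ_reps)

text \<open>The operators on the subspace over \<open>X\<close>, extended by zero; in this form all
  the algebras sit in one space of operators.\<close>

definition on_X :: "('g, 'e) germ oper \<Rightarrow> bool" where
  "on_X A \<longleftrightarrow> clinear_op A \<and> (\<forall>x y. x \<notin> X \<or> y \<notin> X \<longrightarrow> entry A x y = 0)"

lemma on_X_clinear: "on_X A \<Longrightarrow> clinear_op A"
  by (simp add: on_X_def)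

lemma on_X_ket: "on_X A \<Longrightarrow> y \<notin> X \<Longrightarrow> blinfun_apply A (ket y) = 0"
  by (rule ell2_eqI) (auto simp: on_X_def entry_def)

lemma on_X_adj: "on_X A \<Longrightarrow> on_X (adj A)"
  by (auto simp: on_X_def)

lemma on_X_comp:
  assumes A: "on_X A" and B: "on_X B"
  shows "on_X (A o\<^sub>L B)"
proof -
  have c: "clinear_op A" "clinear_op B" using assms by (auto simp: on_X_def)
  have 1: "entry (C o\<^sub>L D) x y = 0" if "on_X D" "y \<notin> X" for C D x y
    using on_X_ket[OF that] by (simp add: entry_def)
  have "entry (A o\<^sub>L B) x y = 0" if "x \<notin> X" for x y
  proof -
    have "entry (A o\<^sub>L B) x y = cnj (entry (adj (A o\<^sub>L B)) y x)" using c by (simp add: clinear_op_comp)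
    also have "\<dots> = 0" using c 1[OF on_X_adj[OF A] that] by (simp add: adj_comp)
    finally show ?thesis .
  qed
  then show ?thesis using c 1[OF B] by (auto simp: on_X_def clinear_op_comp)
qed

lemma on_X_oscale: "on_X A \<Longrightarrow> on_X (oscale c A)"
  by (auto simp: on_X_def clinear_op_oscale)

lemma on_X_add: "on_X A \<Longrightarrow> on_X B \<Longrightarrow> on_X (A + B)"
  by (auto simp: on_X_def clinear_op_add)

lemma on_X_zero [simp]: "on_X 0"
  by (auto simp: on_X_def)

lemma on_X_closed_span:
  assumes "a \<in> closed_span M" "\<And>b. b \<in> M \<Longrightarrow> on_X b"
  shows "on_X a"
  using assms(1)
proof (induction rule: closed_span_induct)
  case (limit f x)
  have "entry x i j = 0" if "i \<notin> X \<or> j \<notin> X" for i j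
  proof -
    have "(\<lambda>n. entry (f n) i j) \<longlonglongrightarrow> entry x i j"
      by (rule bounded_linear.tendsto[OF bounded_linear_entry limit(2)])
    moreover have "entry (f n) i j = 0" for n using limit(1) that by (auto simp: on_X_def)
    ultimately show ?thesis using LIMSEQ_unique[OF _ tendsto_const] by simp
  qed
  then show ?case using clinear_op_limit[OF _ limit(2)] limit(1) by (simp add: on_X_def)
qed (auto intro: on_X_add on_X_oscale assms(2))

lemma on_X_eqI:
  assumes "on_X A" "on_X B" "\<And>p. p \<in> reps \<Longrightarrow> blinfun_apply A (delta S p) = blinfun_apply B (delta S p)"
  shows "A = B"
proof (rule clinear_op_eqI)
  fix x
  show "blinfun_apply A (ket x) = blinfun_apply B (ket x)"
  proof (cases "x \<in> X")
    case True
    then obtain p where p: "p \<in> reps" "x = germ_of S p" by (rule X_E)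
    obtain c where "ket x = cscale c (delta S p)" using ket_delta[OF reps_germ_reps[OF p(1)]] p by metis
    then show ?thesis using assms p by (simp add: on_X_def clinear_opD)
  qed (simp add: on_X_ket assms)
qed (use assms in \<open>auto simp: on_X_def\<close>)

lemma delta_in_kernel_refine:
  assumes "p \<in> germ_reps S" "refinable p n" "clinear_op A"
  shows "blinfun_apply A (delta S (refine S p n)) = 0 \<longleftrightarrow> blinfun_apply A (delta S p) = 0"
proof -
  have nz: "refine_phase S p n \<noteq> 0" using refine_phase_circle[OF assms(1,2)] by auto
  have "blinfun_apply A (delta S p) = cscale (refine_phase S p n) (blinfun_apply A (delta S (refine S p n)))"
    using delta_refine[OF assms(1,2)] clinear_opD[OF assms(3)] by metis
  then show ?thesis
    using cscale_cancel[OF nz, of "blinfun_apply A (delta S (refine S p n))" 0] by simp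
qed

lemma apply_delta_eq_refine:
  assumes "p \<in> germ_reps S" "refinable p n" "clinear_op A" "clinear_op B"
    "blinfun_apply A (delta S (refine S p n)) = blinfun_apply B (delta S (refine S p n))"
  shows "blinfun_apply A (delta S p) = blinfun_apply B (delta S p)"
  using delta_in_kernel_refine[OF assms(1,2) clinear_op_diff[OF assms(3,4)]] assms(5)
  by (simp add: blinfun.diff_left)

lemma restrict_rep_op:
  assumes A: "rep_op D \<phi> F A" "norm A \<le> 1"
    and F: "\<And>p. p \<in> germ_reps S \<Longrightarrow> D p \<Longrightarrow> F p \<in> germ_reps S \<and> rep_source (F p) = rep_source p"
  shows "on_X (restrict_op X A)" "norm (restrict_op X A) \<le> 1"
    "\<And>p. p \<in> reps \<Longrightarrow> blinfun_apply (restrict_op X A) (delta S p) =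
        (if D p then cscale (\<phi> p) (delta S (F p)) else 0)"
proof -
  have cA: "clinear_op A" using A by (simp add: rep_op_def)
  have c: "clinear_op (restrict_op X A)"
    unfolding restrict_op_def using cA by (intro clinear_op_comp) auto
  show del: "blinfun_apply (restrict_op X A) (delta S p) =
        (if D p then cscale (\<phi> p) (delta S (F p)) else 0)" if p: "p \<in> reps" for p
  proof -
    obtain c where c: "delta S p = cscale c (ket (germ_of S p))"
      using delta_ket[OF reps_germ_reps[OF p]] by metis
    have "blinfun_apply (proj X) (delta S p) = delta S p"
      using p germ_in_X[OF reps_germ_reps[OF p]] by (simp add: c clinear_opD proj_ket)
    then show ?thesis using A(1) p by (simp add: restrict_op_def rep_op_def reps_def)
  qed
  have z: "blinfun_apply (restrict_op X A) (ket y) = 0" if "y \<notin> X" for y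
    using that by (simp add: restrict_op_def proj_ket)
  have "entry (restrict_op X A) x y = 0" if x: "x \<notin> X" for x y
  proof (cases "y \<in> X")
    case True
    then obtain p where p: "p \<in> reps" "y = germ_of S p" by (rule X_E)
    obtain c where c1: "ket (germ_of S p) = cscale c (delta S p)"
      using ket_delta[OF reps_germ_reps[OF p(1)]] by metis
    show ?thesis
    proof (cases "D p")
      case True
      have Fp: "F p \<in> reps" using F[OF reps_germ_reps[OF p(1)] True] p by (simp add: reps_def)
      obtain d where "delta S (F p) = cscale d (ket (germ_of S (F p)))"
        using delta_ket[OF reps_germ_reps[OF Fp]] by metis
      moreover have "germ_of S (F p) \<noteq> x" using Fp x germ_in_X reps_germ_reps by blast
      ultimately show ?thesis
        using True p c by (simp add: entry_def c1 clinear_opD del coef_ket)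
    next
      case False
      then show ?thesis using p c by (simp add: entry_def c1 clinear_opD del)
    qed
  qed (simp add: z entry_def)
  then show "on_X (restrict_op X A)" using z c by (auto simp: on_X_def entry_def)
  have "norm (proj X) \<le> 1"
  proof (rule norm_diagonal_le)
    show "diagonal (proj X)" by (auto simp: diagonal_def entry_def proj_ket coef_ket)
    show "cmod (entry (proj X) i i) \<le> 1" for i by (auto simp: entry_def proj_ket coef_ket)
  qed
  then show "norm (restrict_op X A) \<le> 1"
    unfolding restrict_op_def
    using norm_blinfun_compose[of A "proj X"] A(2) mult_le_one[of "norm A" "norm (proj X)"] by simp
qed

lemma
  assumes g: "g \<in> Grp S"
  shows on_X_W: "on_X (W g)" and norm_W: "norm (W g) \<le> 1"
    and W_delta: "(\<alpha>, h, \<beta>, \<xi>) \<in> reps \<Longrightarrow> blinfun_apply (W g) (delta S (\<alpha>, h, \<beta>, \<xi>)) =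
      (if gsrc S g = prng \<alpha> then cscale (ptw S g \<alpha> * twG S (psect S g \<alpha>) h)
          (delta S (pact S g \<alpha>, gmult S (psect S g \<alpha>) h, \<beta>, \<xi>)) else 0)"
    and W_reps: "(\<alpha>, h, \<beta>, \<xi>) \<in> reps \<Longrightarrow> gsrc S g = prng \<alpha> \<Longrightarrow>
      (pact S g \<alpha>, gmult S (psect S g \<alpha>) h, \<beta>, \<xi>) \<in> reps"
    and W_phase_circle: "(\<alpha>, h, \<beta>, \<xi>) \<in> reps \<Longrightarrow> gsrc S g = prng \<alpha> \<Longrightarrow>
      cmod (ptw S g \<alpha> * twG S (psect S g \<alpha>) h) = 1"
proof -
  have F: "W_map g p \<in> germ_reps S \<and> rep_source (W_map g p) = rep_source p"
    if "p \<in> germ_reps S" "W_dom g p" for p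
    using W_map_facts(1)[OF g that] by (cases p) (simp add: W_map_def)
  note r = restrict_rep_op[OF rep_op_W[OF g] norm_W_op[OF g] F, folded W_on_def]
  show "on_X (W g)" "norm (W g) \<le> 1" by (rule r, assumption, assumption)+
  show "blinfun_apply (W g) (delta S (\<alpha>, h, \<beta>, \<xi>)) =
      (if gsrc S g = prng \<alpha> then cscale (ptw S g \<alpha> * twG S (psect S g \<alpha>) h)
          (delta S (pact S g \<alpha>, gmult S (psect S g \<alpha>) h, \<beta>, \<xi>)) else 0)"
    if "(\<alpha>, h, \<beta>, \<xi>) \<in> reps"
    using r(3)[OF _ _ that] by (simp add: W_dom_def W_phase_def W_map_def)
  show "(pact S g \<alpha>, gmult S (psect S g \<alpha>) h, \<beta>, \<xi>) \<in> reps"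
    if "(\<alpha>, h, \<beta>, \<xi>) \<in> reps" "gsrc S g = prng \<alpha>"
    using F[of "(\<alpha>, h, \<beta>, \<xi>)"] that by (simp add: W_dom_def W_map_def reps_def)
  show "cmod (ptw S g \<alpha> * twG S (psect S g \<alpha>) h) = 1"
    if "(\<alpha>, h, \<beta>, \<xi>) \<in> reps" "gsrc S g = prng \<alpha>"
    using W_map_facts(2)[OF g reps_germ_reps[OF that(1)]] that by (simp add: W_dom_def W_phase_def)
qed

lemma
  assumes e: "e \<in> Edges S"
  shows on_X_T: "on_X (T e)" and norm_T: "norm (T e) \<le> 1"
    and T_delta: "(\<alpha>, h, \<beta>, \<xi>) \<in> reps \<Longrightarrow> blinfun_apply (T e) (delta S (\<alpha>, h, \<beta>, \<xi>)) =
      (if esrc S e = prng \<alpha> then delta S (pcat (erng S e, [e]) \<alpha>, h, \<beta>, \<xi>) else 0)"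
    and T_reps: "(\<alpha>, h, \<beta>, \<xi>) \<in> reps \<Longrightarrow> esrc S e = prng \<alpha> \<Longrightarrow>
      (pcat (erng S e, [e]) \<alpha>, h, \<beta>, \<xi>) \<in> reps"
proof -
  have F: "T_map e p \<in> germ_reps S \<and> rep_source (T_map e p) = rep_source p"
    if "p \<in> germ_reps S" "T_dom e p" for p
    using T_map_facts(1)[OF e that] by (cases p) (simp add: T_map_def)
  note r = restrict_rep_op[OF rep_op_T[OF e] norm_T_op[OF e] F, folded T_on_def]
  show "on_X (T e)" "norm (T e) \<le> 1" by (rule r, assumption, assumption)+
  show "blinfun_apply (T e) (delta S (\<alpha>, h, \<beta>, \<xi>)) =
      (if esrc S e = prng \<alpha> then delta S (pcat (erng S e, [e]) \<alpha>, h, \<beta>, \<xi>) else 0)"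
    if "(\<alpha>, h, \<beta>, \<xi>) \<in> reps"
    using r(3)[OF _ _ that] by (simp add: T_dom_def T_map_def)
  show "(pcat (erng S e, [e]) \<alpha>, h, \<beta>, \<xi>) \<in> reps"
    if "(\<alpha>, h, \<beta>, \<xi>) \<in> reps" "esrc S e = prng \<alpha>"
    using F[of "(\<alpha>, h, \<beta>, \<xi>)"] that by (simp add: T_dom_def T_map_def reps_def)
qed

lemma reps_iff: "(\<alpha>, g, \<beta>, \<xi>) \<in> reps \<longleftrightarrow> \<alpha> \<in> paths S \<and> g \<in> Grp S \<and> \<beta> \<in> paths S \<and>
     grng S g = psrc S \<alpha> \<and> gsrc S g = psrc S \<beta> \<and> \<xi> \<in> cylinder S \<beta> \<and> \<xi> \<in> Y"
  by (auto simp: reps_def germ_reps_iff)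

lemma W_vertex_delta:
  assumes "v \<in> Vert S" "(\<alpha>, h, \<beta>, \<xi>) \<in> reps"
  shows "blinfun_apply (W v) (delta S (\<alpha>, h, \<beta>, \<xi>)) = (if v = prng \<alpha> then delta S (\<alpha>, h, \<beta>, \<xi>) else 0)"
proof (cases "v = prng \<alpha>")
  case True
  have w: "walk S v (snd \<alpha>)" using True assms by (cases \<alpha>) (auto simp: reps_iff)
  have r: "h \<in> Grp S" "grng S h = psrc S \<alpha>" using assms by (auto simp: reps_iff)
  have "pact S v \<alpha> = \<alpha>" "psect S v \<alpha> = psrc S \<alpha>" "ptw S v \<alpha> = 1"
    using True assms(1) act_list_unit[OF w] twE_list_unit[OF w] by (cases \<alpha>; simp add: grng_unit)+
  moreover have "twG S (psrc S \<alpha>) h = 1" "gmult S (psrc S \<alpha>) h = h"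
    using r twG_unit_left unit_left by metis+
  ultimately show ?thesis
    using True W_delta[OF Vert_Grp[OF assms(1)] assms(2)] assms(1) by (simp add: gsrc_unit)
next
  case False
  then show ?thesis using W_delta[OF Vert_Grp[OF assms(1)] assms(2)] assms(1) by (simp add: gsrc_unit)
qed

text \<open>A vertex gives \<open>W v\<close>, a longer path a product of edge operators. The
  statements are bundled because the induction over the edges uses all of them.\<close>

lemma Tp_facts:
  assumes "\<mu> \<in> paths S"
  shows "on_X (Tp \<mu>) \<and> norm (Tp \<mu>) \<le> 1 \<and> (\<forall>\<alpha> h \<beta> \<xi>. (\<alpha>, h, \<beta>, \<xi>) \<in> reps \<longrightarrow>
    (psrc S \<mu> = prng \<alpha> \<longrightarrow> (pcat \<mu> \<alpha>, h, \<beta>, \<xi>) \<in> reps) \<and>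
    blinfun_apply (Tp \<mu>) (delta S (\<alpha>, h, \<beta>, \<xi>)) =
      (if psrc S \<mu> = prng \<alpha> then delta S (pcat \<mu> \<alpha>, h, \<beta>, \<xi>) else 0))"
proof -
  obtain v es where \<mu>: "\<mu> = (v, es)" by fastforce
  let ?F = "\<lambda>es. foldr (\<lambda>e A. T e o\<^sub>L A) es id_blinfun"
  show ?thesis
  proof (cases "es = []")
    case True
    then have v: "v \<in> Vert S" using assms \<mu> by simp
    have "pcat (prng \<alpha>, []) \<alpha> = \<alpha>" for \<alpha> :: "('g, 'e) path" by (simp add: pcat_def prng_def)
    then show ?thesis
      using True \<mu> on_X_W[OF Vert_Grp[OF v]] norm_W[OF Vert_Grp[OF v]] W_vertex_delta[OF v]
      by (auto simp: T_path_def)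
  next
    case False
    have "es \<noteq> [] \<Longrightarrow> walk S v es \<Longrightarrow> on_X (?F es) \<and> norm (?F es) \<le> 1 \<and>
      (\<forall>\<alpha> h \<beta> \<xi>. (\<alpha>, h, \<beta>, \<xi>) \<in> reps \<longrightarrow>
        (psrc S (v, es) = prng \<alpha> \<longrightarrow> (pcat (v, es) \<alpha>, h, \<beta>, \<xi>) \<in> reps) \<and>
        blinfun_apply (?F es) (delta S (\<alpha>, h, \<beta>, \<xi>)) =
        (if psrc S (v, es) = prng \<alpha> then delta S (pcat (v, es) \<alpha>, h, \<beta>, \<xi>) else 0))"
    proof (induction es arbitrary: v)
      case (Cons e es)
      have e: "e \<in> Edges S" and v: "erng S e = v" and w: "walk S (esrc S e) es" using Cons.prems by auto
      show ?case
      \<comment> \<open>The induction starts at a single edge: the empty product is the identity of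
        the whole space rather than of the subspace over \<open>X\<close>.\<close>
      proof (cases "es = []")
        case True
        have "pcat (v, [e]) \<alpha> = pcat (erng S e, [e]) \<alpha>" for \<alpha> :: "('g, 'e) path" by (simp add: v)
        then show ?thesis
          using True on_X_T[OF e] norm_T[OF e] T_delta[OF e] T_reps[OF e] by auto
      next
        case False
        note IH = Cons.IH[OF False w]
        have p: "pcat (erng S e, [e]) (pcat (esrc S e, es) \<alpha>) = pcat (v, e # es) \<alpha>"
          "prng (pcat (esrc S e, es) \<alpha>) = esrc S e" for \<alpha> :: "('g, 'e) path"
          by (auto simp: pcat_def v prng_def)
        have "norm (T e o\<^sub>L ?F es) \<le> 1"
          using norm_blinfun_compose[of "T e" "?F es"] norm_T[OF e] IH mult_le_one[of "norm (T e)" "norm (?F es)"]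
          by simp
        moreover have "on_X (T e o\<^sub>L ?F es)" using on_X_T[OF e] IH on_X_comp by blast
        moreover have "(psrc S (v, e # es) = prng \<alpha> \<longrightarrow> (pcat (v, e # es) \<alpha>, h, \<beta>, \<xi>) \<in> reps) \<and>
            blinfun_apply (T e o\<^sub>L ?F es) (delta S (\<alpha>, h, \<beta>, \<xi>)) =
              (if psrc S (v, e # es) = prng \<alpha> then delta S (pcat (v, e # es) \<alpha>, h, \<beta>, \<xi>) else 0)"
          if r: "(\<alpha>, h, \<beta>, \<xi>) \<in> reps" for \<alpha> h \<beta> \<xi>
        proof (cases "psrc S (v, e # es) = prng \<alpha>")
          case True
          then have r': "(pcat (esrc S e, es) \<alpha>, h, \<beta>, \<xi>) \<in> reps"
            and a: "blinfun_apply (?F es) (delta S (\<alpha>, h, \<beta>, \<xi>)) = delta S (pcat (esrc S e, es) \<alpha>, h, \<beta>, \<xi>)"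
            using IH[THEN conjunct2, THEN conjunct2, rule_format, OF r] by auto
          show ?thesis using True T_reps[OF e r'] T_delta[OF e r'] by (simp add: a p)
        next
          case False
          then have "blinfun_apply (?F es) (delta S (\<alpha>, h, \<beta>, \<xi>)) = 0"
            using IH[THEN conjunct2, THEN conjunct2, rule_format, OF r] by auto
          then show ?thesis using False by simp
        qed
        ultimately show ?thesis by simp
      qed
    qed simp
    moreover have "Tp \<mu> = ?F es" using False by (simp add: T_path_def \<mu>)
    ultimately show ?thesis using assms False unfolding \<mu> by simp
  qed
qed

lemma
  assumes "\<mu> \<in> paths S"
  shows on_X_Tp: "on_X (Tp \<mu>)" and norm_Tp: "norm (Tp \<mu>) \<le> 1"
    and Tp_reps: "(\<alpha>, h, \<beta>, \<xi>) \<in> reps \<Longrightarrow> psrc S \<mu> = prng \<alpha> \<Longrightarrow> (pcat \<mu> \<alpha>, h, \<beta>, \<xi>) \<in> reps"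
    and Tp_delta: "(\<alpha>, h, \<beta>, \<xi>) \<in> reps \<Longrightarrow> blinfun_apply (Tp \<mu>) (delta S (\<alpha>, h, \<beta>, \<xi>)) =
      (if psrc S \<mu> = prng \<alpha> then delta S (pcat \<mu> \<alpha>, h, \<beta>, \<xi>) else 0)"
  using Tp_facts[OF assms] by blast+

lemma clinear_Tp [simp]: "\<mu> \<in> paths S \<Longrightarrow> clinear_op (Tp \<mu>)"
  using on_X_Tp by (simp add: on_X_def)

lemma clinear_W [simp]: "g \<in> Grp S \<Longrightarrow> clinear_op (W g)"
  using on_X_W by (simp add: on_X_def)

lemma reps_pcatD:
  assumes "(pcat \<mu> \<kappa>, h, \<beta>, \<xi>) \<in> reps" "\<mu> \<in> paths S" "\<kappa> \<in> paths S" "prng \<kappa> = psrc S \<mu>"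
  shows "(\<kappa>, h, \<beta>, \<xi>) \<in> reps"
  using assms by (cases \<mu>; cases \<kappa>) (auto simp: reps_iff psrc_append)

text \<open>\<open>Tp \<mu>\<close> is a contraction that maps one unit vector to the other, so its
  adjoint has to map back.\<close>

lemma adj_Tp_delta:
  assumes "(pcat \<mu> \<kappa>, h, \<beta>, \<xi>) \<in> reps" "\<mu> \<in> paths S" "\<kappa> \<in> paths S" "prng \<kappa> = psrc S \<mu>"
  shows "blinfun_apply (adj (Tp \<mu>)) (delta S (pcat \<mu> \<kappa>, h, \<beta>, \<xi>)) = delta S (\<kappa>, h, \<beta>, \<xi>)"
proof (rule contraction_adj_apply)
  note r = reps_pcatD[OF assms]
  show "clinear_op (Tp \<mu>)" "norm (Tp \<mu>) \<le> 1" using assms norm_Tp by auto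
  show "blinfun_apply (Tp \<mu>) (delta S (\<kappa>, h, \<beta>, \<xi>)) = delta S (pcat \<mu> \<kappa>, h, \<beta>, \<xi>)"
    using Tp_delta[OF assms(2) r] assms by simp
  show "norm (delta S (\<kappa>, h, \<beta>, \<xi>)) = norm (delta S (pcat \<mu> \<kappa>, h, \<beta>, \<xi>))"
    using norm_delta reps_germ_reps r assms by metis
qed

text \<open>Every basis vector hit by \<open>Tp \<mu>\<close> belongs to a germ with range in the
  cylinder of \<open>\<mu>\<close>, so the row of the germ of \<open>p\<close> vanishes.\<close>

lemma adj_Tp_delta_zero:
  assumes "p \<in> reps" "\<mu> \<in> paths S" "rep_range S p \<notin> cylinder S \<mu>"
  shows "blinfun_apply (adj (Tp \<mu>)) (delta S p) = 0"
proof -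
  have "blinfun_apply (adj (Tp \<mu>)) (ket (germ_of S p)) = 0"
  proof (rule adj_ket_eq_0)
    show "clinear_op (Tp \<mu>)" using assms by simp
    fix y
    show "entry (Tp \<mu>) (germ_of S p) y = 0"
    proof (cases "y \<in> X")
      case True
      then obtain q where q: "q \<in> reps" "y = germ_of S q" by (rule X_E)
      obtain \<alpha> h \<beta> \<xi> where qq: "q = (\<alpha>, h, \<beta>, \<xi>)" by (cases q)
      have qr: "(\<alpha>, h, \<beta>, \<xi>) \<in> reps" using q qq by simp
      obtain c where c: "ket y = cscale c (delta S (\<alpha>, h, \<beta>, \<xi>))"
        using ket_delta[OF reps_germ_reps[OF q(1)]] q qq by metis
      show ?thesis
      proof (cases "psrc S \<mu> = prng \<alpha>")
        case True
        let ?r = "(pcat \<mu> \<alpha>, h, \<beta>, \<xi>)"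
        have r: "?r \<in> reps" using Tp_reps[OF assms(2)] q qq True by blast
        obtain d where d: "delta S ?r = cscale d (ket (germ_of S ?r))"
          using delta_ket[OF reps_germ_reps[OF r]] by metis
        have "germ_of S ?r \<noteq> germ_of S p"
          using germ_of_range[OF reps_germ_reps[OF r] reps_germ_reps[OF assms(1)]]
            rep_range_in_pcat[OF reps_germ_reps[OF r]] assms(3) by auto
        then show ?thesis
          using True Tp_delta[OF assms(2) qr] assms(2) by (simp add: entry_def c clinear_opD d coef_ket)
      next
        case False
        then show ?thesis
          using Tp_delta[OF assms(2) qr] assms(2) by (simp add: entry_def c clinear_opD)
      qed
    qed (use on_X_Tp[OF assms(2)] in \<open>auto simp: on_X_def\<close>)
  qed
  moreover obtain c where "delta S p = cscale c (ket (germ_of S p))"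
    using delta_ket[OF reps_germ_reps[OF assms(1)]] by metis
  ultimately show ?thesis using assms by (simp add: clinear_opD)
qed

subsection \<open>Relations\<close>

lemma Tp_zero:
  assumes "\<mu> \<in> paths S" "on_X A"
    "\<And>\<alpha> h \<beta> \<xi>. (\<alpha>, h, \<beta>, \<xi>) \<in> reps \<Longrightarrow> psrc S \<mu> = prng \<alpha> \<Longrightarrow>
       blinfun_apply A (delta S (pcat \<mu> \<alpha>, h, \<beta>, \<xi>)) = 0"
  shows "A o\<^sub>L Tp \<mu> = 0"
  by (rule on_X_eqI) (auto simp: on_X_comp on_X_Tp assms Tp_delta split: prod.splits)

text \<open>On the unit vector of a germ the phases match in two steps:
  \<open>twE_list_gmult'\<close> along the left path, then the cocycle identity of
  \<open>twG\<close> for the two restrictions and \<open>k\<close>.\<close>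

lemma W_W:
  assumes "g \<in> Grp S" "h \<in> Grp S"
  shows "W g o\<^sub>L W h = (if gsrc S g = grng S h then oscale (twG S g h) (W (gmult S g h)) else 0)"
proof (rule on_X_eqI)
  show "on_X (W g o\<^sub>L W h)" using assms by (intro on_X_comp on_X_W)
  show "on_X (if gsrc S g = grng S h then oscale (twG S g h) (W (gmult S g h)) else 0)"
    using assms by (auto intro!: on_X_oscale on_X_W gmult_closed)
  fix p assume "p \<in> reps"
  then obtain a as k \<beta> \<xi> where p: "p = ((a, as), k, \<beta>, \<xi>)" "((a, as), k, \<beta>, \<xi>) \<in> reps" by (metis prod.collapse)
  have r: "walk S a as" "k \<in> Grp S" "grng S k = psrc S (a, as)" using p by (auto simp: reps_iff)
  show "blinfun_apply (W g o\<^sub>L W h) (delta S p) =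
    blinfun_apply (if gsrc S g = grng S h then oscale (twG S g h) (W (gmult S g h)) else 0) (delta S p)"
  proof (cases "gsrc S h = a")
    case a: True
    note r1 = W_reps[OF assms(2) p(2), simplified, OF a]
    have w: "walk S (gsrc S h) as" using a r by simp
    note l = walk_act_list[OF assms(2) w]
    show ?thesis
    proof (cases "gsrc S g = grng S h")
      case gh: True
      have w2: "walk S (gsrc S g) (act_list S h as)" using l gh by simp
      note l2 = walk_act_list[OF assms(1) w2]
      let ?b = "sect_list S h as" and ?a = "sect_list S g (act_list S h as)"
      have ab: "gsrc S ?a = grng S ?b" "gsrc S ?b = grng S k" using l l2 gh r a by auto
      note gm = gsrc_gmult[OF assms gh] gmult_closed[OF assms gh]
      note s = act_list_gmult[OF assms gh w] sect_list_gmult[OF assms gh w]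
      have tw: "twE_list S h as * twE_list S g (act_list S h as) * twG S ?a ?b = twG S g h * twE_list S (gmult S g h) as"
        by (rule twE_list_gmult'[OF assms gh w])
      have co: "twG S ?a ?b * twG S (gmult S ?a ?b) k = twG S ?b k * twG S ?a (gmult S ?b k)"
        using l l2 ab r by (intro twG_cocycle) auto
      have as: "gmult S (gmult S ?a ?b) k = gmult S ?a (gmult S ?b k)"
        using l l2 ab r by (intro gmult_assoc) auto
      have "(twE_list S h as * twG S ?b k) * (twE_list S g (act_list S h as) * twG S ?a (gmult S ?b k))
        = twE_list S h as * twE_list S g (act_list S h as) * (twG S ?b k * twG S ?a (gmult S ?b k))"
        by (simp add: mult_ac)
      also have "\<dots> = twG S g h * (twE_list S (gmult S g h) as * twG S (gmult S ?a ?b) k)"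
        unfolding co[symmetric] by (simp add: tw mult.assoc[symmetric])
      finally have ph: "(twE_list S h as * twG S ?b k) * (twE_list S g (act_list S h as) * twG S ?a (gmult S ?b k))
        = twG S g h * (twE_list S (gmult S g h) as * twG S (gmult S ?a ?b) k)" .
      show ?thesis
        using W_delta[OF assms(2) p(2)] W_delta[OF assms(1) r1] W_delta[OF gm(2) p(2)] gh a gm assms
        by (simp add: p(1) clinear_opD s as ph grng_gmult mult.assoc[symmetric])
          (simp add: ph[unfolded mult.assoc[symmetric]])
    next
      case False
      then show ?thesis
        using W_delta[OF assms(2) p(2)] W_delta[OF assms(1) r1] a assms by (simp add: p(1) clinear_opD)
    qed
  next
    case False
    then show ?thesis
      using W_delta[OF assms(2) p(2)] W_delta[OF gmult_closed[OF assms] p(2)] gsrc_gmult[OF assms]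
      by (auto simp: p(1))
  qed
qed

lemma W_Tp:
  assumes "g \<in> Grp S" "\<mu> \<in> paths S" "gsrc S g = prng \<mu>"
  shows "W g o\<^sub>L Tp \<mu> = oscale (ptw S g \<mu>) (Tp (pact S g \<mu>) o\<^sub>L W (psect S g \<mu>))"
    "pact S g \<mu> \<in> paths S" "psect S g \<mu> \<in> Grp S" "gsrc S (psect S g \<mu>) = psrc S \<mu>"
    "grng S (psect S g \<mu>) = psrc S (pact S g \<mu>)" "prng (pact S g \<mu>) = grng S g"
proof -
  obtain m ms where \<mu>: "\<mu> = (m, ms)" by fastforce
  have w: "walk S (gsrc S g) ms" and m: "gsrc S g = m" using assms \<mu> by auto
  note l = walk_act_list[OF assms(1) w]
  show P: "pact S g \<mu> \<in> paths S" "psect S g \<mu> \<in> Grp S" "gsrc S (psect S g \<mu>) = psrc S \<mu>"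
    "grng S (psect S g \<mu>) = psrc S (pact S g \<mu>)" "prng (pact S g \<mu>) = grng S g"
    using l m by (auto simp: \<mu>)
  show "W g o\<^sub>L Tp \<mu> = oscale (ptw S g \<mu>) (Tp (pact S g \<mu>) o\<^sub>L W (psect S g \<mu>))"
  proof (rule on_X_eqI)
    show "on_X (W g o\<^sub>L Tp \<mu>)" using assms by (intro on_X_comp on_X_W on_X_Tp)
    show "on_X (oscale (ptw S g \<mu>) (Tp (pact S g \<mu>) o\<^sub>L W (psect S g \<mu>)))"
      using P by (intro on_X_comp on_X_W on_X_Tp on_X_oscale)
    fix p assume "p \<in> reps"
    then obtain a as k \<beta> \<xi> where p: "p = ((a, as), k, \<beta>, \<xi>)" "((a, as), k, \<beta>, \<xi>) \<in> reps" by (metis prod.collapse)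
    show "blinfun_apply (W g o\<^sub>L Tp \<mu>) (delta S p) =
      blinfun_apply (oscale (ptw S g \<mu>) (Tp (pact S g \<mu>) o\<^sub>L W (psect S g \<mu>))) (delta S p)"
    proof (cases "psrc S \<mu> = a")
      case True
      note r1 = Tp_reps[OF assms(2) p(2), simplified, OF True]
      note r2 = W_reps[OF P(2) p(2), unfolded P(3), simplified, OF True]
      have W1: "blinfun_apply (W g) (delta S (pcat \<mu> (a, as), k, \<beta>, \<xi>)) =
          cscale (ptw S g (pcat \<mu> (a, as)) * twG S (psect S g (pcat \<mu> (a, as))) k)
            (delta S (pact S g (pcat \<mu> (a, as)), gmult S (psect S g (pcat \<mu> (a, as))) k, \<beta>, \<xi>))"
        using W_delta[OF assms(1) r1] assms(3) \<mu> by simp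
      have W2: "blinfun_apply (W (psect S g \<mu>)) (delta S ((a, as), k, \<beta>, \<xi>)) =
          cscale (ptw S (psect S g \<mu>) (a, as) * twG S (psect S (psect S g \<mu>) (a, as)) k)
            (delta S (pact S (psect S g \<mu>) (a, as), gmult S (psect S (psect S g \<mu>) (a, as)) k, \<beta>, \<xi>))"
        using W_delta[OF P(2) p(2)] P(3) True by simp
      have T2: "blinfun_apply (Tp (pact S g \<mu>))
          (delta S (pact S (psect S g \<mu>) (a, as), gmult S (psect S (psect S g \<mu>) (a, as)) k, \<beta>, \<xi>))
         = delta S (pcat (pact S g \<mu>) (pact S (psect S g \<mu>) (a, as)), gmult S (psect S (psect S g \<mu>) (a, as)) k, \<beta>, \<xi>)"
        using Tp_delta[OF P(1)] r2 P(4) by simp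
      have "blinfun_apply (W g o\<^sub>L Tp \<mu>) (delta S p) =
          cscale (ptw S g (pcat \<mu> (a, as)) * twG S (psect S g (pcat \<mu> (a, as))) k)
            (delta S (pact S g (pcat \<mu> (a, as)), gmult S (psect S g (pcat \<mu> (a, as))) k, \<beta>, \<xi>))"
        using Tp_delta[OF assms(2) p(2)] True
        by (simp add: p(1) W1 del: pact_pair psect_pair ptw_pair)
      moreover have "blinfun_apply (oscale (ptw S g \<mu>) (Tp (pact S g \<mu>) o\<^sub>L W (psect S g \<mu>))) (delta S p) =
          cscale (ptw S g \<mu> * (ptw S (psect S g \<mu>) (a, as) * twG S (psect S (psect S g \<mu>) (a, as)) k))
          (delta S (pcat (pact S g \<mu>) (pact S (psect S g \<mu>) (a, as)), gmult S (psect S (psect S g \<mu>) (a, as)) k, \<beta>, \<xi>))"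
        using P by (simp add: p(1) W2 T2 clinear_opD del: pact_pair psect_pair ptw_pair)
      ultimately show ?thesis
        by (simp add: \<mu> twE_list_append sect_list_append act_list_append mult.assoc)
    next
      case False
      then show ?thesis
        using Tp_delta[OF assms(2) p(2)] W_delta[OF P(2) p(2)] P(3) by (simp add: p(1))
    qed
  qed
qed

lemma W_Tp_zero:
  assumes "g \<in> Grp S" "\<mu> \<in> paths S" "gsrc S g \<noteq> prng \<mu>"
  shows "W g o\<^sub>L Tp \<mu> = 0"
  using assms
  by (intro Tp_zero on_X_W) (auto simp: W_delta Tp_reps, simp add: pcat_def prng_def)

lemma Tp_Tp:
  assumes "\<mu> \<in> paths S" "\<nu> \<in> paths S" "psrc S \<mu> = prng \<nu>"
  shows "Tp \<mu> o\<^sub>L Tp \<nu> = Tp (pcat \<mu> \<nu>)" "pcat \<mu> \<nu> \<in> paths S" "psrc S (pcat \<mu> \<nu>) = psrc S \<nu>"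
proof -
  show P: "pcat \<mu> \<nu> \<in> paths S" "psrc S (pcat \<mu> \<nu>) = psrc S \<nu>"
    using assms by (cases \<mu>; cases \<nu>; auto simp: walk_append psrc_append)+
  show "Tp \<mu> o\<^sub>L Tp \<nu> = Tp (pcat \<mu> \<nu>)"
  proof (rule on_X_eqI)
    show "on_X (Tp \<mu> o\<^sub>L Tp \<nu>)" "on_X (Tp (pcat \<mu> \<nu>))" using assms P by (auto intro: on_X_comp on_X_Tp)
    fix p assume "p \<in> reps"
    moreover obtain \<alpha> k \<beta> \<xi> where p: "p = (\<alpha>, k, \<beta>, \<xi>)" by (cases p)
    ultimately have r: "(\<alpha>, k, \<beta>, \<xi>) \<in> reps" by simp
    show "blinfun_apply (Tp \<mu> o\<^sub>L Tp \<nu>) (delta S p) = blinfun_apply (Tp (pcat \<mu> \<nu>)) (delta S p)"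
    proof (cases "psrc S \<nu> = prng \<alpha>")
      case True
      have "prng (pcat \<nu> \<alpha>) = prng \<nu>" "pcat \<mu> (pcat \<nu> \<alpha>) = pcat (pcat \<mu> \<nu>) \<alpha>"
        by (auto simp: pcat_def prng_def)
      then show ?thesis
        using True Tp_delta[OF assms(2) r] Tp_delta[OF P(1) r] Tp_delta[OF assms(1) Tp_reps[OF assms(2) r True]] assms(3) P(2)
        by (simp add: p)
    next
      case False
      then show ?thesis using Tp_delta[OF assms(2) r] Tp_delta[OF P(1) r] P(2) by (simp add: p)
    qed
  qed
qed

lemma Tp_unit: "v \<in> Vert S \<Longrightarrow> Tp (v, []) = W v"
  by (simp add: T_path_def)

lemma W_unit_adj:
  assumes "v \<in> Vert S"
  shows "adj (W v) = W v" "W v o\<^sub>L W v = W v" "diagonal (W v)"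
proof -
  have g: "v \<in> Grp S" using assms by (rule Vert_Grp)
  have e: "blinfun_apply (W v) (ket x) = 0 \<or> blinfun_apply (W v) (ket x) = ket x" for x
  proof (cases "x \<in> X")
    case True
    then obtain p where p: "p \<in> reps" "x = germ_of S p" by (rule X_E)
    obtain d where d: "ket x = cscale d (delta S p)" using ket_delta[OF reps_germ_reps[OF p(1)]] p by metis
    obtain \<alpha> k \<beta> \<xi> where pp: "p = (\<alpha>, k, \<beta>, \<xi>)" by (cases p)
    show ?thesis
      using W_vertex_delta[OF assms p(1)[unfolded pp]] g by (simp add: d clinear_opD pp split: if_splits)
  next
    case False
    then show ?thesis using on_X_ket[OF on_X_W[OF g]] by simp
  qed
  have en: "entry (W v) i j = 0 \<or> i = j \<and> entry (W v) i j = 1" for i j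
    using e[of j] by (elim disjE) (simp_all add: entry_def coef_ket)
  then show d: "diagonal (W v)" unfolding diagonal_def using clinear_W[OF g] by blast
  have "entry (W v) i i = 0 \<or> entry (W v) i i = 1" for i using en[of i i] by blast
  then have "cnj (entry (W v) i i) = entry (W v) i i" for i by (metis complex_cnj_one complex_cnj_zero)
  then show "adj (W v) = W v"
    using d g by (intro diagonal_eqI diagonal_adj) auto
  show "W v o\<^sub>L W v = W v"
    using W_W[OF g g] assms twG_unit_left[OF g] unit_left[OF g] by (auto simp: gsrc_unit grng_unit)
qed

text \<open>If the left path of \<open>q\<close> starts at the range of \<open>g\<close>, the
  contraction \<open>W g\<close> maps the vector of \<open>W_map (ginv S g) q\<close> to a
  unimodular multiple of that of \<open>q\<close>, which pins down the adjoint. On the other vectors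
  \<open>W (grng S g)\<close> is zero, and the adjoint factors through it.\<close>

lemma adj_W:
  assumes g: "g \<in> Grp S"
  shows "adj (W g) = oscale (cnj (twG S (ginv S g) g)) (W (ginv S g))"
proof -
  let ?i = "ginv S g" and ?c = "twG S (ginv S g) g"
  have i: "?i \<in> Grp S" "gsrc S ?i = grng S g" "grng S ?i = gsrc S g"
    using g by (auto simp: ginv_closed gsrc_ginv grng_ginv)
  have c: "cnj ?c * ?c = 1" using g i by (intro unimodular_cnj twG_circle) auto
  have Wi: "W ?i o\<^sub>L W g = oscale ?c (W (gsrc S g))" using W_W[OF i(1) g] i ginv_left[OF g] by simp
  have v: "grng S g \<in> Vert S" using g by (rule grng_Vert)
  have Wr: "W (grng S g) o\<^sub>L W g = W g"
    using W_W[OF Vert_Grp[OF v] g] v twG_unit_left[OF g] unit_left[OF g] by (simp add: gsrc_unit)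
  show ?thesis
  proof (rule on_X_eqI)
    show "on_X (adj (W g))" "on_X (oscale (cnj ?c) (W ?i))" using g i by (auto intro: on_X_adj on_X_W on_X_oscale)
    fix q assume "q \<in> reps"
    moreover obtain \<alpha> k \<beta> \<xi> where q: "q = (\<alpha>, k, \<beta>, \<xi>)" by (cases q)
    ultimately have r: "(\<alpha>, k, \<beta>, \<xi>) \<in> reps" by simp
    show "blinfun_apply (adj (W g)) (delta S q) = blinfun_apply (oscale (cnj ?c) (W ?i)) (delta S q)"
    proof (cases "grng S g = prng \<alpha>")
      case True
      define p where "p = W_map ?i q"
      define z where "z = W_phase ?i q"
      have Wq: "blinfun_apply (W ?i) (delta S q) = cscale z (delta S p)"
        using W_delta[OF i(1) r] True i by (simp add: p_def z_def W_map_def W_phase_def q)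
      have z: "cmod z = 1" using W_phase_circle[OF i(1) r] True i by (simp add: z_def W_phase_def q)
      have pr: "p \<in> reps" using W_reps[OF i(1) r] True i by (simp add: p_def W_map_def q)
      have "blinfun_apply (W g o\<^sub>L W ?i) (delta S q) = cscale (twG S g ?i) (delta S q)"
        using W_W[OF g i(1)] i ginv_right[OF g] W_vertex_delta[OF v r] True q by simp
      then have "cscale z (blinfun_apply (W g) (delta S p)) = cscale (twG S g ?i) (delta S q)"
        using g by (simp add: Wq clinear_opD)
      then have "cscale (cnj z) (cscale z (blinfun_apply (W g) (delta S p))) = cscale (cnj z) (cscale (twG S g ?i) (delta S q))"
        by (rule arg_cong)
      then have Wp: "blinfun_apply (W g) (delta S p) = cscale (cnj z * twG S g ?i) (delta S q)"
        using unimodular_cnj(1)[OF z] by simp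
      have n: "cmod (twG S g ?i) = 1" using g i by (intro twG_circle) auto
      have a: "blinfun_apply (adj (W g)) (cscale (cnj z * twG S g ?i) (delta S q)) = delta S p"
        using g norm_W Wp by (intro contraction_adj_apply) (auto simp: norm_mult z n norm_delta reps_germ_reps pr \<open>q \<in> reps\<close>)
      have "blinfun_apply (W ?i) (cscale (cnj z * twG S g ?i) (delta S q)) = blinfun_apply (W ?i o\<^sub>L W g) (delta S p)"
        using Wp by simp
      also have "\<dots> = cscale ?c (blinfun_apply (W (gsrc S g)) (delta S p))"
        unfolding Wi by simp
      also have "blinfun_apply (W (gsrc S g)) (delta S p) = delta S p"
        using W_vertex_delta[OF gsrc_Vert[OF g] pr[unfolded p_def W_map_def q prod.case]] i
        by (simp add: p_def W_map_def q pact_def)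
      finally have "blinfun_apply (oscale (cnj ?c) (W ?i)) (cscale (cnj z * twG S g ?i) (delta S q)) = delta S p"
        using c by simp
      with a have "cscale (cnj z * twG S g ?i) (blinfun_apply (adj (W g)) (delta S q)) =
          cscale (cnj z * twG S g ?i) (blinfun_apply (oscale (cnj ?c) (W ?i)) (delta S q))"
        using g i by (simp add: clinear_opD mult_ac)
      moreover have "cnj z * twG S g ?i \<noteq> 0" using z n by auto
      ultimately show ?thesis using cscale_cancel by blast
    next
      case False
      have "adj (W g) = adj (W g) o\<^sub>L W (grng S g)"
        using arg_cong[OF Wr, of adj] W_unit_adj[OF v] g Vert_Grp[OF v] by (simp add: adj_comp)
      then have "blinfun_apply (adj (W g)) (delta S q) = blinfun_apply (adj (W g)) (blinfun_apply (W (grng S g)) (delta S q))"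
        by (metis blinfun_apply_blinfun_compose)
      also have "\<dots> = 0" using W_vertex_delta[OF v r] False q by simp
      finally show ?thesis using W_delta[OF i(1) r] i False q by simp
    qed
  qed
qed

lemma adj_Tp_Tp:
  assumes "\<beta> \<in> paths S" "\<gamma> \<in> paths S" "prng \<gamma> = psrc S \<beta>"
  shows "adj (Tp \<beta>) o\<^sub>L Tp (pcat \<beta> \<gamma>) = Tp \<gamma>"
proof (rule on_X_eqI)
  note c = Tp_Tp[OF assms(1,2) assms(3)[symmetric]]
  show "on_X (adj (Tp \<beta>) o\<^sub>L Tp (pcat \<beta> \<gamma>))" "on_X (Tp \<gamma>)"
    using assms c by (auto intro: on_X_comp on_X_adj on_X_Tp)
  fix p assume "p \<in> reps"
  moreover obtain \<alpha> k \<delta> \<xi> where p: "p = (\<alpha>, k, \<delta>, \<xi>)" by (cases p)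
  ultimately have r: "(\<alpha>, k, \<delta>, \<xi>) \<in> reps" by simp
  show "blinfun_apply (adj (Tp \<beta>) o\<^sub>L Tp (pcat \<beta> \<gamma>)) (delta S p) = blinfun_apply (Tp \<gamma>) (delta S p)"
  proof (cases "psrc S \<gamma> = prng \<alpha>")
    case True
    have a: "pcat (pcat \<beta> \<gamma>) \<alpha> = pcat \<beta> (pcat \<gamma> \<alpha>)" "prng (pcat \<gamma> \<alpha>) = psrc S \<beta>"
      using assms(3) by (auto simp: pcat_def prng_def)
    have r1: "(pcat \<beta> (pcat \<gamma> \<alpha>), k, \<delta>, \<xi>) \<in> reps" using Tp_reps[OF c(2) r] True c(3) a by simp
    have "pcat \<gamma> \<alpha> \<in> paths S" using Tp_reps[OF assms(2) r True] by (simp add: reps_iff)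
    then have "blinfun_apply (adj (Tp \<beta>)) (delta S (pcat \<beta> (pcat \<gamma> \<alpha>), k, \<delta>, \<xi>)) = delta S (pcat \<gamma> \<alpha>, k, \<delta>, \<xi>)"
      using adj_Tp_delta[OF r1 assms(1) _ a(2)] by blast
    then show ?thesis using True Tp_delta[OF c(2) r] Tp_delta[OF assms(2) r] c(3) a p by simp
  next
    case False
    then show ?thesis using Tp_delta[OF c(2) r] Tp_delta[OF assms(2) r] c(3) p by simp
  qed
qed

lemma adj_Tp_Tp_self: "\<beta> \<in> paths S \<Longrightarrow> adj (Tp \<beta>) o\<^sub>L Tp \<beta> = W (psrc S \<beta>)"
  using adj_Tp_Tp[of \<beta> "(psrc S \<beta>, [])"] walk_psrc[of "fst \<beta>" "snd \<beta>"]
  by (cases \<beta>) (simp add: Tp_unit)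

lemma adj_Tp_Tp_zero:
  assumes "\<beta> \<in> paths S" "\<gamma> \<in> paths S" "cylinder S \<beta> \<inter> cylinder S \<gamma> = {}"
  shows "adj (Tp \<beta>) o\<^sub>L Tp \<gamma> = 0"
proof (rule Tp_zero[OF assms(2)])
  show "on_X (adj (Tp \<beta>))" using assms by (intro on_X_adj on_X_Tp)
  fix \<alpha> h \<delta> \<xi> assume "(\<alpha>, h, \<delta>, \<xi>) \<in> reps" "psrc S \<gamma> = prng \<alpha>"
  then have r: "(pcat \<gamma> \<alpha>, h, \<delta>, \<xi>) \<in> reps" by (intro Tp_reps[OF assms(2)])
  show "blinfun_apply (adj (Tp \<beta>)) (delta S (pcat \<gamma> \<alpha>, h, \<delta>, \<xi>)) = 0"
    using rep_range_in_pcat[OF reps_germ_reps[OF r]] assms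
    by (intro adj_Tp_delta_zero[OF r assms(1)]) blast
qed

end

section \<open>Structure of the algebras\<close>

context twisted_rep
begin

definition N :: "('g, 'e) path \<Rightarrow> 'g \<Rightarrow> ('g, 'e) path \<Rightarrow> ('g, 'e) germ oper" where
  "N \<alpha> g \<beta> = Tp \<alpha> o\<^sub>L W g o\<^sub>L adj (Tp \<beta>)"

definition Q :: "('g, 'e) path \<Rightarrow> ('g, 'e) germ oper" where
  "Q \<beta> = Tp \<beta> o\<^sub>L adj (Tp \<beta>)"

text \<open>Composability of the three factors of \<open>N\<close>; for other paths and groupoid
  elements the monomial vanishes by \<open>N_unmatched\<close>.\<close>

definition matched :: "('g, 'e) path \<Rightarrow> 'g \<Rightarrow> ('g, 'e) path \<Rightarrow> bool" where
  "matched \<alpha> g \<beta> \<longleftrightarrow> \<alpha> \<in> paths S \<and> g \<in> Grp S \<and> \<beta> \<in> paths S \<and> grng S g = psrc S \<alpha> \<and> gsrc S g = psrc S \<beta>"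

definition rng :: "('g, 'e) germ \<Rightarrow> ('g, 'e) xpath" where
  "rng x = rep_range S (SOME p. p \<in> germ_reps S \<and> germ_of S p = x)"

lemma rng_germ_of: "p \<in> germ_reps S \<Longrightarrow> rng (germ_of S p) = rep_range S p"
  unfolding rng_def by (rule someI2[of _ p]) (auto intro: germ_of_range)

lemma psrc_Vert: "\<mu> \<in> paths S \<Longrightarrow> psrc S \<mu> \<in> Vert S"
  by (cases \<mu>) (simp add: walk_psrc)

lemma prng_Vert: "\<mu> \<in> paths S \<Longrightarrow> prng \<mu> \<in> Vert S"
  by (cases \<mu>) (simp add: walk_Vert)

lemma comp_assoc4: "(a o\<^sub>L b o\<^sub>L c) o\<^sub>L (d o\<^sub>L e o\<^sub>L f) = a o\<^sub>L (b o\<^sub>L ((c o\<^sub>L d) o\<^sub>L (e o\<^sub>L (f :: 'a oper))))"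
  by (rule blinfun_eqI) simp

lemma Tp_W_src: "\<mu> \<in> paths S \<Longrightarrow> Tp \<mu> o\<^sub>L W (psrc S \<mu>) = Tp \<mu>"
  using Tp_Tp(1)[of \<mu> "(psrc S \<mu>, [])"] psrc_Vert[of \<mu>] by (simp add: Tp_unit pcat_def)

lemma W_Tp_rng:
  assumes "\<mu> \<in> paths S" "v \<in> Vert S"
  shows "W v o\<^sub>L Tp \<mu> = (if v = prng \<mu> then Tp \<mu> else 0)"
proof -
  have "pcat (prng \<mu>, []) \<mu> = \<mu>" by (cases \<mu>) simp
  then show ?thesis
    using Tp_Tp(1)[of "(v, [])" \<mu>] assms W_Tp_zero[of v \<mu>]
    by (auto simp: Tp_unit gsrc_unit Vert_Grp)
qed

lemma Tp_W_zero:
  assumes "\<alpha> \<in> paths S" "g \<in> Grp S" "grng S g \<noteq> psrc S \<alpha>"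
  shows "Tp \<alpha> o\<^sub>L W g = 0"
proof (rule on_X_eqI)
  show "on_X (Tp \<alpha> o\<^sub>L W g)" "on_X 0" using assms by (auto intro: on_X_comp on_X_Tp on_X_W)
  fix p assume "p \<in> reps"
  moreover obtain \<gamma> h \<beta> \<xi> where p: "p = (\<gamma>, h, \<beta>, \<xi>)" by (cases p)
  ultimately have r: "(\<gamma>, h, \<beta>, \<xi>) \<in> reps" by simp
  show "blinfun_apply (Tp \<alpha> o\<^sub>L W g) (delta S p) = blinfun_apply 0 (delta S p)"
    using W_delta[OF assms(2) r] Tp_delta[OF assms(1) W_reps[OF assms(2) r]] assms
    by (simp add: p clinear_opD) (simp add: pact_def)
qed

lemma W_adj_W: "g \<in> Grp S \<Longrightarrow> W g o\<^sub>L adj (W g) = W (grng S g)"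
  and adj_W_W: "g \<in> Grp S \<Longrightarrow> adj (W g) o\<^sub>L W g = W (gsrc S g)"
proof -
  have *: "adj (W g) o\<^sub>L W g = W (gsrc S g)" if g: "g \<in> Grp S" for g
  proof -
    have "cnj (twG S (ginv S g) g) * twG S (ginv S g) g = 1"
      using g by (intro unimodular_cnj twG_circle) (auto simp: ginv_closed gsrc_ginv)
    then show ?thesis
      using W_W[OF ginv_closed[OF g] g] g by (simp add: adj_W gsrc_ginv ginv_left)
  qed
  show "g \<in> Grp S \<Longrightarrow> adj (W g) o\<^sub>L W g = W (gsrc S g)" by (rule *)
  assume g: "g \<in> Grp S"
  let ?c = "twG S (ginv S g) g"
  show "W g o\<^sub>L adj (W g) = W (grng S g)"
  proof -
    have d: "twG S g (ginv S g) * cnj (twG S g (ginv S g)) = 1"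
      using g by (intro unimodular_cnj twG_circle) (auto simp: ginv_closed grng_ginv)
    \<comment> \<open>The cocycle identity for \<open>g\<close>, its inverse and \<open>g\<close>;
      the two remaining values involve a unit and are 1.\<close>
    have "?c = twG S g (ginv S g)"
      using twG_cocycle[of g "ginv S g" g] g twG_unit_left[OF g] twG_unit_right[OF g]
      by (simp add: ginv_closed gsrc_ginv grng_ginv ginv_right ginv_left)
    then show ?thesis
      using W_W[OF g ginv_closed[OF g]] g d
      by (simp add: adj_W oscale_comp_right grng_ginv ginv_right mult.commute)
  qed
qed

lemma matchedD:
  assumes "matched \<alpha> g \<beta>"
  shows "\<alpha> \<in> paths S" "g \<in> Grp S" "\<beta> \<in> paths S" "grng S g = psrc S \<alpha>" "gsrc S g = psrc S \<beta>"
  using assms by (auto simp: matched_def)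

lemma on_X_N: "\<alpha> \<in> paths S \<Longrightarrow> g \<in> Grp S \<Longrightarrow> \<beta> \<in> paths S \<Longrightarrow> on_X (N \<alpha> g \<beta>)"
  unfolding N_def by (intro on_X_comp on_X_Tp on_X_W on_X_adj)

lemma clinear_N: "matched \<alpha> g \<beta> \<Longrightarrow> clinear_op (N \<alpha> g \<beta>)"
  using on_X_N by (simp add: matched_def on_X_def)

lemma N_adj:
  assumes "matched \<alpha> g \<beta>"
  shows "adj (N \<alpha> g \<beta>) = oscale (cnj (twG S (ginv S g) g)) (N \<beta> (ginv S g) \<alpha>)"
    "matched \<beta> (ginv S g) \<alpha>"
proof -
  note m = matchedD[OF assms]
  show "adj (N \<alpha> g \<beta>) = oscale (cnj (twG S (ginv S g) g)) (N \<beta> (ginv S g) \<alpha>)"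
    using m by (simp add: N_def adj_comp clinear_op_comp adj_W oscale_comp_right comp_assoc)
  show "matched \<beta> (ginv S g) \<alpha>" using m by (simp add: matched_def ginv_closed gsrc_ginv grng_ginv)
qed

lemma N_unmatched:
  assumes "\<alpha> \<in> paths S" "g \<in> Grp S" "\<beta> \<in> paths S" "\<not> matched \<alpha> g \<beta>"
  shows "N \<alpha> g \<beta> = 0"
proof (cases "grng S g = psrc S \<alpha>")
  case False
  then show ?thesis using Tp_W_zero assms by (simp add: N_def)
next
  case True
  then have "Tp \<beta> o\<^sub>L W (ginv S g) = 0"
    using assms by (intro Tp_W_zero) (auto simp: matched_def ginv_closed grng_ginv)
  then have "adj (N \<alpha> g \<beta>) = 0"
    using assms by (simp add: N_def adj_comp clinear_op_comp adj_W oscale_comp_right comp_assoc)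
  then show ?thesis using adj_adj[of "N \<alpha> g \<beta>"] on_X_N[OF assms(1-3)] on_X_clinear by simp
qed

text \<open>\<open>adj_Tp_Tp\<close> cancels \<open>\<beta>\<close> and leaves
  \<open>Tp \<gamma>\<close>; then \<open>W_Tp\<close> moves \<open>W g\<close> across it.\<close>

lemma N_N_extend:
  assumes "matched \<alpha> g \<beta>" "matched (pcat \<beta> \<gamma>) h \<delta>" "\<gamma> \<in> paths S" "prng \<gamma> = psrc S \<beta>"
  shows "N \<alpha> g \<beta> o\<^sub>L N (pcat \<beta> \<gamma>) h \<delta> =
      oscale (ptw S g \<gamma> * twG S (psect S g \<gamma>) h) (N (pcat \<alpha> (pact S g \<gamma>)) (gmult S (psect S g \<gamma>) h) \<delta>)"
    "matched (pcat \<alpha> (pact S g \<gamma>)) (gmult S (psect S g \<gamma>) h) \<delta>"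
proof -
  note m = matchedD[OF assms(1)] and n = matchedD[OF assms(2)]
  have g: "gsrc S g = prng \<gamma>" using m assms by simp
  note w = W_Tp[OF m(2) assms(3) g]
  have a: "psrc S \<alpha> = prng (pact S g \<gamma>)" using w m by simp
  note t = Tp_Tp[OF m(1) w(2) a]
  have "psrc S (pcat \<beta> \<gamma>) = psrc S \<gamma>" using m assms Tp_Tp(3) by metis
  then have h: "gsrc S (psect S g \<gamma>) = grng S h" using w n by simp
  have "N \<alpha> g \<beta> o\<^sub>L N (pcat \<beta> \<gamma>) h \<delta> = Tp \<alpha> o\<^sub>L (W g o\<^sub>L (Tp \<gamma> o\<^sub>L (W h o\<^sub>L adj (Tp \<delta>))))"
    unfolding N_def comp_assoc4 by (simp add: adj_Tp_Tp m assms)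
  also have "\<dots> = Tp \<alpha> o\<^sub>L ((W g o\<^sub>L Tp \<gamma>) o\<^sub>L (W h o\<^sub>L adj (Tp \<delta>)))" by (simp only: comp_assoc)
  also have "\<dots> = oscale (ptw S g \<gamma>) ((Tp \<alpha> o\<^sub>L Tp (pact S g \<gamma>)) o\<^sub>L ((W (psect S g \<gamma>) o\<^sub>L W h) o\<^sub>L adj (Tp \<delta>)))"
    using m by (simp add: w(1) oscale_comp_right comp_assoc)
  also have "\<dots> = oscale (ptw S g \<gamma> * twG S (psect S g \<gamma>) h) (N (pcat \<alpha> (pact S g \<gamma>)) (gmult S (psect S g \<gamma>) h) \<delta>)"
    using t(2) by (simp add: t(1) W_W[OF w(3) n(2)] h oscale_comp_right N_def comp_assoc)
  finally show "N \<alpha> g \<beta> o\<^sub>L N (pcat \<beta> \<gamma>) h \<delta> =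
      oscale (ptw S g \<gamma> * twG S (psect S g \<gamma>) h) (N (pcat \<alpha> (pact S g \<gamma>)) (gmult S (psect S g \<gamma>) h) \<delta>)" .
  show "matched (pcat \<alpha> (pact S g \<gamma>)) (gmult S (psect S g \<gamma>) h) \<delta>"
    using t w n h by (simp add: matched_def gmult_closed grng_gmult gsrc_gmult)
qed

lemma paths_comparable:
  assumes "\<xi> \<in> cylinder S \<beta>" "\<xi> \<in> cylinder S \<gamma>" "plen \<beta> \<le> plen \<gamma>"
  obtains \<kappa> where "\<gamma> = pcat \<beta> \<kappa>" "\<kappa> \<in> paths S" "prng \<kappa> = psrc S \<beta>"
proof -
  let ?w = "drop (plen \<beta>) (snd (pre S \<xi> (plen \<gamma>)))"
  note c = cylinder_segment[OF assms(1,3)]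
  have "pre S \<xi> (plen \<gamma>) = \<gamma>" using assms(2) by (simp add: cylinder_iff)
  then have "\<gamma> = pcat \<beta> (psrc S \<beta>, ?w)" using c(1) by (simp add: pcat_def)
  then show thesis using c(2) that[of "(psrc S \<beta>, ?w)"] by simp
qed

text \<open>Two cylinders are disjoint or one of the two paths extends the other. If
  \<open>\<gamma>\<close> extends \<open>\<beta>\<close>, \<open>N_N_extend\<close> applies; the
  opposite case is obtained from it by taking adjoints. The clause on lengths is for the algebras
  with subscript \<open>0\<close>.\<close>

lemma N_mult:
  assumes "matched \<alpha> g \<beta>" "matched \<gamma> h \<delta>"
  shows "N \<alpha> g \<beta> o\<^sub>L N \<gamma> h \<delta> = 0 \<or>
    (\<exists>c \<alpha>' k \<delta>'. matched \<alpha>' k \<delta>' \<and> N \<alpha> g \<beta> o\<^sub>L N \<gamma> h \<delta> = oscale c (N \<alpha>' k \<delta>') \<and>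
       (plen \<alpha> = plen \<beta> \<longrightarrow> plen \<gamma> = plen \<delta> \<longrightarrow> plen \<alpha>' = plen \<delta>'))"
proof (cases "cylinder S \<beta> \<inter> cylinder S \<gamma> = {}")
  case True
  then have "N \<alpha> g \<beta> o\<^sub>L N \<gamma> h \<delta> = 0"
    unfolding N_def comp_assoc4 using assms by (simp add: adj_Tp_Tp_zero matched_def)
  then show ?thesis ..
next
  case False
  then obtain \<xi> where \<xi>: "\<xi> \<in> cylinder S \<beta>" "\<xi> \<in> cylinder S \<gamma>" by blast
  have len: "plen (pcat \<mu> \<nu>) = plen \<mu> + plen \<nu>" "plen (pact S k \<nu>) = plen \<nu>"
    for \<mu> \<nu> :: "('g, 'e) path" and k by (auto simp: plen_def pcat_def pact_def)
  show ?thesis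
  proof (cases "plen \<beta> \<le> plen \<gamma>")
    case True
    obtain \<kappa> where \<kappa>: "\<gamma> = pcat \<beta> \<kappa>" "\<kappa> \<in> paths S" "prng \<kappa> = psrc S \<beta>"
      using paths_comparable[OF \<xi> True] by blast
    show ?thesis
      using N_N_extend[OF assms(1) assms(2)[unfolded \<kappa>(1)] \<kappa>(2,3)] \<kappa>(1)
      by (intro disjI2 exI[of _ "ptw S g \<kappa> * twG S (psect S g \<kappa>) h"]
          exI[of _ "pcat \<alpha> (pact S g \<kappa>)"] exI[of _ "gmult S (psect S g \<kappa>) h"] exI[of _ \<delta>])
        (simp add: len)
  next
    case False
    then have "plen \<gamma> \<le> plen \<beta>" by simp
    then obtain \<kappa> where \<kappa>: "\<beta> = pcat \<gamma> \<kappa>" "\<kappa> \<in> paths S" "prng \<kappa> = psrc S \<gamma>"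
      using paths_comparable[OF \<xi>(2,1)] by blast
    let ?c = "cnj (twG S (ginv S g) g)" and ?d = "cnj (twG S (ginv S h) h)"
    note a = N_adj[OF assms(1)] and b = N_adj[OF assms(2)]
    note ext = N_N_extend[OF b(2) a(2)[unfolded \<kappa>(1)] \<kappa>(2,3), folded \<kappa>(1)]
    obtain z \<alpha>' k \<delta>' where z: "matched \<alpha>' k \<delta>'" "N \<delta> (ginv S h) \<gamma> o\<^sub>L N \<beta> (ginv S g) \<alpha> = oscale z (N \<alpha>' k \<delta>')"
      "plen \<alpha>' = plen \<delta> + plen \<kappa>" "\<delta>' = \<alpha>"
      by (rule that[OF ext(2,1)]) (simp_all add: len)
    have "adj (N \<alpha> g \<beta> o\<^sub>L N \<gamma> h \<delta>) = oscale (?d * ?c * z) (N \<alpha>' k \<delta>')"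
      using assms a(2) b(2) z
      by (simp add: adj_comp clinear_N a(1) b(1) oscale_comp_right)
    then have "adj (adj (N \<alpha> g \<beta> o\<^sub>L N \<gamma> h \<delta>)) = adj (oscale (?d * ?c * z) (N \<alpha>' k \<delta>'))" by simp
    then have "N \<alpha> g \<beta> o\<^sub>L N \<gamma> h \<delta> = oscale (cnj (?d * ?c * z) * cnj (twG S (ginv S k) k)) (N \<delta>' (ginv S k) \<alpha>')"
      using assms z by (simp add: adj_oscale clinear_N clinear_op_comp N_adj)
    moreover have "plen \<alpha> = plen \<beta> \<longrightarrow> plen \<gamma> = plen \<delta> \<longrightarrow> plen \<delta>' = plen \<alpha>'"
      using z \<kappa>(1) by (auto simp: len)
    ultimately show ?thesis using N_adj(2)[OF z(1)] by blast
  qed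
qed

subsection \<open>The diagonal\<close>

lemma on_X_Q: "\<beta> \<in> paths S \<Longrightarrow> on_X (Q \<beta>)"
  unfolding Q_def by (intro on_X_comp on_X_Tp on_X_adj)

lemma Q_delta:
  assumes "\<mu> \<in> paths S" "p \<in> reps"
  shows "blinfun_apply (Q \<mu>) (delta S p) = (if rep_range S p \<in> cylinder S \<mu> then delta S p else 0)"
proof (cases "rep_range S p \<in> cylinder S \<mu>")
  case False
  then show ?thesis using adj_Tp_delta_zero[OF assms(2,1)] by (simp add: Q_def)
next
  case True
  obtain n \<kappa> h \<beta> where n: "refinable p n" "refine S p n = (pcat \<mu> \<kappa>, h, \<beta>, rep_source p)"
    "\<kappa> \<in> paths S" "prng \<kappa> = psrc S \<mu>"
    using rep_range_cylinderE[OF reps_germ_reps[OF assms(2)] True] by metis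
  have r: "(pcat \<mu> \<kappa>, h, \<beta>, rep_source p) \<in> reps" using refine_reps[OF assms(2) n(1)] n(2) by simp
  have "blinfun_apply (Q \<mu>) (delta S p) = blinfun_apply id_blinfun (delta S p)"
  proof (rule apply_delta_eq_refine[OF reps_germ_reps[OF assms(2)] n(1)])
    show "clinear_op (Q \<mu>)" using on_X_Q[OF assms(1)] by (rule on_X_clinear)
    show "blinfun_apply (Q \<mu>) (delta S (refine S p n)) = blinfun_apply id_blinfun (delta S (refine S p n))"
      unfolding n(2) Q_def using adj_Tp_delta[OF r assms(1) n(3,4)] Tp_delta[OF assms(1) reps_pcatD[OF r assms(1) n(3,4)]] n(4)
      by simp
  qed simp
  then show ?thesis using True by simp
qed

lemma Q_ket: "\<mu> \<in> paths S \<Longrightarrow> blinfun_apply (Q \<mu>) (ket x) = (if x \<in> X \<and> rng x \<in> cylinder S \<mu> then ket x else 0)"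
proof (cases "x \<in> X")
  case True
  assume \<mu>: "\<mu> \<in> paths S"
  obtain p where p: "p \<in> reps" "x = germ_of S p" using True by (rule X_E)
  obtain c where "ket x = cscale c (delta S p)" using ket_delta[OF reps_germ_reps[OF p(1)]] p by metis
  then show ?thesis
    using Q_delta[OF \<mu> p(1)] p(2) True on_X_Q[OF \<mu>] rng_germ_of[OF reps_germ_reps[OF p(1)]]
    by (simp add: clinear_opD on_X_clinear)
qed (simp add: on_X_ket on_X_Q)

lemma diagonal_Q: "\<mu> \<in> paths S \<Longrightarrow> diagonal (Q \<mu>)"
  unfolding diagonal_def using on_X_Q on_X_clinear by (auto simp: entry_def Q_ket coef_ket)

lemma entry_Q: "\<mu> \<in> paths S \<Longrightarrow> entry (Q \<mu>) x x = (if x \<in> X \<and> rng x \<in> cylinder S \<mu> then 1 else 0)"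
  by (simp add: entry_def Q_ket coef_ket)

definition D :: "('g, 'e) germ oper set" where
  "D = diag_on S X"

lemma D_eq: "D = closed_span (Q ` paths S)"
  unfolding D_def diag_on_def Q_def image_def by (rule arg_cong[where f = closed_span]) blast

lemma Q_in_D: "\<mu> \<in> paths S \<Longrightarrow> Q \<mu> \<in> D"
  unfolding D_eq using closed_span_superset by blast

lemma Q_Q:
  assumes "\<mu> \<in> paths S" "\<nu> \<in> paths S"
  shows "Q \<mu> o\<^sub>L Q \<nu> = Q \<mu> \<or> Q \<mu> o\<^sub>L Q \<nu> = Q \<nu> \<or> Q \<mu> o\<^sub>L Q \<nu> = 0"
proof -
  have e: "entry (Q \<mu> o\<^sub>L Q \<nu>) x x = entry (Q \<mu>) x x * entry (Q \<nu>) x x" for x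
    using assms by (intro entry_comp_diagonal_right diagonal_Q on_X_clinear on_X_Q)
  have sub: "cylinder S \<beta> \<subseteq> cylinder S \<gamma>"
    if "\<xi> \<in> cylinder S \<beta>" "\<xi> \<in> cylinder S \<gamma>" "plen \<gamma> \<le> plen \<beta>" for \<beta> \<gamma> \<xi>
  proof
    fix \<eta> assume \<eta>: "\<eta> \<in> cylinder S \<beta>"
    have "\<gamma> = (fst \<beta>, take (plen \<gamma>) (snd \<beta>))"
      using that pre_take[OF that(3), of S \<xi>] by (metis cylinder_iff)
    moreover have "pre S \<eta> (plen \<gamma>) = (fst \<beta>, take (plen \<gamma>) (snd \<beta>))"
      using \<eta> pre_take[OF that(3), of S \<eta>] by (simp add: cylinder_iff)
    ultimately show "\<eta> \<in> cylinder S \<gamma>" using \<eta> that(3) reaches_mono by (metis cylinder_iff)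
  qed
  consider "cylinder S \<mu> \<inter> cylinder S \<nu> = {}" | "cylinder S \<mu> \<subseteq> cylinder S \<nu>" | "cylinder S \<nu> \<subseteq> cylinder S \<mu>"
    using sub[of _ \<mu> \<nu>] sub[of _ \<nu> \<mu>] nat_le_linear[of "plen \<mu>" "plen \<nu>"] by blast
  then show ?thesis
  proof cases
    case 1
    then have "Q \<mu> o\<^sub>L Q \<nu> = 0"
      using assms by (intro diagonal_eqI diagonal_comp diagonal_Q) (auto simp: e entry_Q)
    then show ?thesis by simp
  next
    case 2
    then have "Q \<mu> o\<^sub>L Q \<nu> = Q \<mu>"
      using assms by (intro diagonal_eqI diagonal_comp diagonal_Q) (auto simp: e entry_Q)
    then show ?thesis by simp
  next
    case 3
    then have "Q \<mu> o\<^sub>L Q \<nu> = Q \<nu>"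
      using assms by (intro diagonal_eqI diagonal_comp diagonal_Q) (auto simp: e entry_Q)
    then show ?thesis by simp
  qed
qed

lemma adj_Q: "\<mu> \<in> paths S \<Longrightarrow> adj (Q \<mu>) = Q \<mu>"
  unfolding Q_def by (simp add: adj_comp)

lemma cstar_D: "cstar_algebra D"
  unfolding D_eq
proof (rule cstar_algebra_closed_span)
  have z: "0 \<in> closed_span (Q ` paths S)" using subspace_closed_span oper.subspace_0 by blast
  have s: "Q ` paths S \<subseteq> closed_span (Q ` paths S)" by (rule closed_span_superset)
  show "clinear_op a" if "a \<in> Q ` paths S" for a using that on_X_Q on_X_clinear by blast
  show "a o\<^sub>L b \<in> closed_span (Q ` paths S)" if "a \<in> Q ` paths S" "b \<in> Q ` paths S" for a b
    using that Q_Q z s by fastforce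
  show "adj a \<in> closed_span (Q ` paths S)" if "a \<in> Q ` paths S" for a
    using that adj_Q s by auto
qed

lemma diagonal_limit:
  assumes "\<And>n::nat. diagonal (f n)" "f \<longlonglongrightarrow> x"
  shows "diagonal x"
proof -
  have "entry x i j = 0" if "i \<noteq> j" for i j
  proof (rule LIMSEQ_unique)
    show "(\<lambda>n. entry (f n) i j) \<longlonglongrightarrow> entry x i j"
      by (rule bounded_linear.tendsto[OF bounded_linear_entry assms(2)])
    show "(\<lambda>n. entry (f n) i j) \<longlonglongrightarrow> 0" using assms(1) that by (simp add: diagonal_def)
  qed
  moreover have "clinear_op x" using assms by (intro clinear_op_limit[OF _ assms(2)]) (simp add: diagonal_def)
  ultimately show ?thesis by (simp add: diagonal_def)
qed

lemma diagonal_D: "d \<in> D \<Longrightarrow> diagonal d"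
  unfolding D_eq
  by (induction rule: closed_span_induct)
    (auto intro: diagonal_add diagonal_oscale diagonal_limit diagonal_Q)

lemma on_X_D: "d \<in> D \<Longrightarrow> on_X d"
  unfolding D_eq by (erule on_X_closed_span) (auto intro: on_X_Q)

lemma diagonal_commute: "diagonal a \<Longrightarrow> diagonal b \<Longrightarrow> a o\<^sub>L b = b o\<^sub>L a"
  by (rule diagonal_eqI)
    (auto simp: diagonal_comp entry_comp_diagonal_right entry_comp_diagonal_left diagonal_def[of a] diagonal_def[of b])

lemma abelian_D: "abelian D"
  unfolding abelian_def using diagonal_D diagonal_commute by blast

subsection \<open>Generators\<close>

text \<open>Spanning sets closed under products and adjoints up to scalars and zero. In contrast to
  the definition of the algebras, only composable monomials occur.\<close>

fun gens :: "subscript \<Rightarrow> ('g, 'e) germ oper set" where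
  "gens NoSub = {N \<alpha> g \<beta> | \<alpha> g \<beta>. matched \<alpha> g \<beta>}"
| "gens Sub0 = {N \<alpha> g \<beta> | \<alpha> g \<beta>. matched \<alpha> g \<beta> \<and> plen \<alpha> = plen \<beta>}"
| "gens Sub00 = {W g o\<^sub>L Q \<beta> | g \<beta>. g \<in> Grp S \<and> \<beta> \<in> paths S \<and> gsrc S g = prng \<beta>}"

declare gens.simps [simp del]

lemma gensI:
  "matched \<alpha> g \<beta> \<Longrightarrow> N \<alpha> g \<beta> \<in> gens NoSub"
  "matched \<alpha> g \<beta> \<Longrightarrow> plen \<alpha> = plen \<beta> \<Longrightarrow> N \<alpha> g \<beta> \<in> gens Sub0"
  "g \<in> Grp S \<Longrightarrow> \<beta> \<in> paths S \<Longrightarrow> gsrc S g = prng \<beta> \<Longrightarrow> W g o\<^sub>L Q \<beta> \<in> gens Sub00"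
  unfolding gens.simps by blast+

lemma gensE:
  assumes "a \<in> gens k"
  obtains \<alpha> g \<beta> where "k = NoSub" "a = N \<alpha> g \<beta>" "matched \<alpha> g \<beta>"
  | \<alpha> g \<beta> where "k = Sub0" "a = N \<alpha> g \<beta>" "matched \<alpha> g \<beta>" "plen \<alpha> = plen \<beta>"
  | g \<beta> where "k = Sub00" "a = W g o\<^sub>L Q \<beta>" "g \<in> Grp S" "\<beta> \<in> paths S" "gsrc S g = prng \<beta>"
  using assms by (cases k) (simp_all only: gens.simps mem_Collect_eq, blast+)

lemma clinear_Q [simp]: "\<beta> \<in> paths S \<Longrightarrow> clinear_op (Q \<beta>)"
  using on_X_Q on_X_clinear by blast

lemma W_Q:
  assumes "g \<in> Grp S" "\<beta> \<in> paths S" "gsrc S g = prng \<beta>"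
  shows "W g o\<^sub>L Q \<beta> = oscale (ptw S g \<beta>) (N (pact S g \<beta>) (psect S g \<beta>) \<beta>)"
    "matched (pact S g \<beta>) (psect S g \<beta>) \<beta>" "plen (pact S g \<beta>) = plen \<beta>"
proof -
  note w = W_Tp[OF assms]
  have "W g o\<^sub>L Q \<beta> = (W g o\<^sub>L Tp \<beta>) o\<^sub>L adj (Tp \<beta>)" by (simp add: Q_def comp_assoc)
  then show "W g o\<^sub>L Q \<beta> = oscale (ptw S g \<beta>) (N (pact S g \<beta>) (psect S g \<beta>) \<beta>)"
    using w(1) by (simp add: N_def)
  show "matched (pact S g \<beta>) (psect S g \<beta>) \<beta>" using w assms by (simp add: matched_def)
  show "plen (pact S g \<beta>) = plen \<beta>" by (simp add: pact_def plen_def)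
qed

lemma gens_subset: "gens Sub0 \<subseteq> gens NoSub" "gens Sub00 \<subseteq> closed_span (gens Sub0)"
proof -
  show "gens Sub0 \<subseteq> gens NoSub" unfolding gens.simps by blast
  have "oscale c (N \<alpha> g \<beta>) \<in> closed_span (gens Sub0)" if "matched \<alpha> g \<beta>" "plen \<alpha> = plen \<beta>" for c \<alpha> g \<beta>
    using gensI(2)[OF that] closed_span_superset by (intro oper.subspace_scale[OF subspace_closed_span]) blast
  then show "gens Sub00 \<subseteq> closed_span (gens Sub0)" using W_Q by (auto elim!: gensE)
qed

text \<open>Conjugation by \<open>W h\<close> carries the projection of the path
  \<open>pact S (ginv S h) \<beta>\<close> to that of \<open>\<beta>\<close>: the twist value and
  the partial isometry of the restriction cancel against their adjoints. If the vertices do not fit,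
  already \<open>adj (Tp \<beta>) o\<^sub>L W h\<close> is zero.\<close>

lemma Q_commute_W:
  assumes "h \<in> Grp S" "\<beta> \<in> paths S"
  shows "Q \<beta> o\<^sub>L W h = (if prng \<beta> = grng S h then W h o\<^sub>L Q (pact S (ginv S h) \<beta>) else 0)"
    "prng \<beta> = grng S h \<Longrightarrow> pact S (ginv S h) \<beta> \<in> paths S \<and> prng (pact S (ginv S h) \<beta>) = gsrc S h"
proof -
  note hi = ginv_closed[OF assms(1)] gsrc_ginv[OF assms(1)] grng_ginv[OF assms(1)]
  show P: "prng \<beta> = grng S h \<Longrightarrow> pact S (ginv S h) \<beta> \<in> paths S \<and> prng (pact S (ginv S h) \<beta>) = gsrc S h"
    using W_Tp(2)[OF hi(1) assms(2)] hi by (simp add: pact_def prng_def)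
  show "Q \<beta> o\<^sub>L W h = (if prng \<beta> = grng S h then W h o\<^sub>L Q (pact S (ginv S h) \<beta>) else 0)"
  proof (cases "prng \<beta> = grng S h")
    case True
    let ?\<mu> = "pact S (ginv S h) \<beta>"
    have \<mu>: "?\<mu> \<in> paths S" "gsrc S h = prng ?\<mu>" using P[OF True] by auto
    have w: "walk S (gsrc S (ginv S h)) (snd \<beta>)" using True hi assms(2) by (cases \<beta>) auto
    have bk: "pact S h ?\<mu> = \<beta>"
      using act_list_ginv(1)[OF hi(1) w] ginv_ginv[OF assms(1)] True by (cases \<beta>) simp
    note t = W_Tp[OF assms(1) \<mu>, unfolded bk]
    let ?k = "psect S h ?\<mu>" and ?z = "ptw S h ?\<mu>"
    have z: "?z * cnj ?z = 1"
      using \<mu> by (intro unimodular_cnj, cases "?\<mu>") (auto intro!: twE_list_circle assms)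
    have "(W h o\<^sub>L Tp ?\<mu>) o\<^sub>L adj (W h o\<^sub>L Tp ?\<mu>) =
        oscale (?z * cnj ?z) ((Tp \<beta> o\<^sub>L W ?k) o\<^sub>L adj (Tp \<beta> o\<^sub>L W ?k))"
      unfolding t(1) using t by (simp add: adj_oscale clinear_op_comp oscale_comp_right assms)
    also have "\<dots> = Tp \<beta> o\<^sub>L ((W ?k o\<^sub>L adj (W ?k)) o\<^sub>L adj (Tp \<beta>))"
      using t assms by (simp add: z adj_comp comp_assoc)
    also have "\<dots> = Q \<beta>"
      using t assms by (simp add: W_adj_W Q_def comp_assoc[symmetric] Tp_W_src)
    finally have "Q \<beta> = (W h o\<^sub>L Q ?\<mu>) o\<^sub>L adj (W h)"
      using \<mu> assms by (simp add: adj_comp Q_def comp_assoc)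
    then have "Q \<beta> o\<^sub>L W h = (W h o\<^sub>L Q ?\<mu>) o\<^sub>L (adj (W h) o\<^sub>L W h)" by (simp add: comp_assoc)
    also have "\<dots> = W h o\<^sub>L (Q ?\<mu> o\<^sub>L W (gsrc S h))" using assms by (simp add: adj_W_W comp_assoc)
    also have "Q ?\<mu> o\<^sub>L W (gsrc S h) = Q ?\<mu>"
    proof -
      have "adj (W (gsrc S h) o\<^sub>L Tp ?\<mu>) = adj (Tp ?\<mu>)"
        using W_Tp_rng[OF \<mu>(1) gsrc_Vert[OF assms(1)]] \<mu>(2) by simp
      then have "adj (Tp ?\<mu>) o\<^sub>L W (gsrc S h) = adj (Tp ?\<mu>)"
        using \<mu> W_unit_adj(1)[OF gsrc_Vert[OF assms(1)]] Vert_Grp[OF gsrc_Vert[OF assms(1)]] by (simp add: adj_comp)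
      then show ?thesis by (simp add: Q_def comp_assoc)
    qed
    finally show ?thesis using True by simp
  next
    case False
    have "W (ginv S h) o\<^sub>L Tp \<beta> = 0" using False assms hi by (intro W_Tp_zero) auto
    then have "adj (W h) o\<^sub>L Tp \<beta> = 0" using assms by (simp add: adj_W)
    then have "adj (adj (W h) o\<^sub>L Tp \<beta>) = 0" by simp
    then have "adj (Tp \<beta>) o\<^sub>L W h = 0" using assms by (simp add: adj_comp)
    then show ?thesis using False by (simp add: Q_def comp_assoc)
  qed
qed

lemma clinear_gens: "a \<in> gens k \<Longrightarrow> clinear_op a"
  by (erule gensE) (simp_all add: clinear_N clinear_op_comp)

lemma cstar_gens: "cstar_algebra (closed_span (gens k))"
proof (rule cstar_algebra_closed_span)
  note s = closed_span_superset[of "gens k"]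
  note sp = oper.subspace_scale[OF subspace_closed_span[of "gens k"]] oper.subspace_0[OF subspace_closed_span[of "gens k"]]
  show "clinear_op a" if "a \<in> gens k" for a using that by (rule clinear_gens)
  show "a o\<^sub>L b \<in> closed_span (gens k)" if a: "a \<in> gens k" and b: "b \<in> gens k" for a b
  proof (cases k)
    case NoSub
    obtain \<alpha> g \<beta> where a': "a = N \<alpha> g \<beta>" "matched \<alpha> g \<beta>" using a NoSub by (auto elim!: gensE)
    obtain \<gamma> h \<delta> where b': "b = N \<gamma> h \<delta>" "matched \<gamma> h \<delta>" using b NoSub by (auto elim!: gensE)
    have "\<And>\<alpha> g \<beta>. matched \<alpha> g \<beta> \<Longrightarrow> N \<alpha> g \<beta> \<in> closed_span (gens k)" using s NoSub gensI(1) by blast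
    then show ?thesis using N_mult[OF a'(2) b'(2)] sp unfolding a'(1) b'(1) by metis
  next
    case Sub0
    obtain \<alpha> g \<beta> where a': "a = N \<alpha> g \<beta>" "matched \<alpha> g \<beta>" "plen \<alpha> = plen \<beta>" using a Sub0 by (auto elim!: gensE)
    obtain \<gamma> h \<delta> where b': "b = N \<gamma> h \<delta>" "matched \<gamma> h \<delta>" "plen \<gamma> = plen \<delta>" using b Sub0 by (auto elim!: gensE)
    have "\<And>\<alpha> g \<beta>. matched \<alpha> g \<beta> \<Longrightarrow> plen \<alpha> = plen \<beta> \<Longrightarrow> N \<alpha> g \<beta> \<in> closed_span (gens k)" using s Sub0 gensI(2) by blast
    then show ?thesis using N_mult[OF a'(2) b'(2)] a'(3) b'(3) sp unfolding a'(1) b'(1) by metis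
  next
    case Sub00
    obtain g \<beta> where a': "a = W g o\<^sub>L Q \<beta>" "g \<in> Grp S" "\<beta> \<in> paths S" "gsrc S g = prng \<beta>" using a Sub00 by (auto elim!: gensE)
    obtain h \<delta> where b': "b = W h o\<^sub>L Q \<delta>" "h \<in> Grp S" "\<delta> \<in> paths S" "gsrc S h = prng \<delta>" using b Sub00 by (auto elim!: gensE)
    have gen: "W g o\<^sub>L Q \<beta> \<in> closed_span (gens k)" if "g \<in> Grp S" "\<beta> \<in> paths S" "gsrc S g = prng \<beta>" for g \<beta>
      using gensI(3)[OF that] s Sub00 by blast
    have ab: "a o\<^sub>L b = W g o\<^sub>L (Q \<beta> o\<^sub>L W h) o\<^sub>L Q \<delta>" by (simp add: a'(1) b'(1) comp_assoc)
    show ?thesis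
    proof (cases "prng \<beta> = grng S h")
      case True
      let ?\<mu> = "pact S (ginv S h) \<beta>"
      note q = Q_commute_W[OF b'(2) a'(3)]
      have \<mu>: "?\<mu> \<in> paths S" "prng ?\<mu> = gsrc S h" using q(2)[OF True] by auto
      have gh: "gsrc S g = grng S h" using a' True by simp
      have "a o\<^sub>L b = W g o\<^sub>L W h o\<^sub>L (Q ?\<mu> o\<^sub>L Q \<delta>)" using True by (simp add: ab q(1) comp_assoc)
      also have "\<dots> = oscale (twG S g h) (W (gmult S g h) o\<^sub>L (Q ?\<mu> o\<^sub>L Q \<delta>))"
        using W_W[OF a'(2) b'(2)] gh by simp
      also have "W (gmult S g h) o\<^sub>L (Q ?\<mu> o\<^sub>L Q \<delta>) \<in> closed_span (gens k)"
        using Q_Q[OF \<mu>(1) b'(3)] gen[of "gmult S g h" ?\<mu>] gen[of "gmult S g h" \<delta>] sp(2) gmult_closed[OF a'(2) b'(2) gh]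
          gsrc_gmult[OF a'(2) b'(2) gh] \<mu> b' by auto
      then have "oscale (twG S g h) (W (gmult S g h) o\<^sub>L (Q ?\<mu> o\<^sub>L Q \<delta>)) \<in> closed_span (gens k)" by (rule sp)
      finally show ?thesis .
    next
      case False
      then show ?thesis using Q_commute_W(1)[OF b'(2) a'(3)] sp(2) by (simp add: ab)
    qed
  qed
  show "adj a \<in> closed_span (gens k)" if a: "a \<in> gens k" for a
  proof (cases k)
    case NoSub
    obtain \<alpha> g \<beta> where a': "a = N \<alpha> g \<beta>" "matched \<alpha> g \<beta>" using a NoSub by (auto elim!: gensE)
    then have "N \<beta> (ginv S g) \<alpha> \<in> gens k" using N_adj(2) NoSub gensI(1) by blast
    then show ?thesis using N_adj(1)[OF a'(2)] a'(1) s sp(1) by auto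
  next
    case Sub0
    obtain \<alpha> g \<beta> where a': "a = N \<alpha> g \<beta>" "matched \<alpha> g \<beta>" "plen \<alpha> = plen \<beta>" using a Sub0 by (auto elim!: gensE)
    then have "N \<beta> (ginv S g) \<alpha> \<in> gens k" using N_adj(2)[OF a'(2)] Sub0 gensI(2) by simp
    then show ?thesis using N_adj(1)[OF a'(2)] a'(1) s sp(1) by auto
  next
    case Sub00
    obtain g \<beta> where a': "a = W g o\<^sub>L Q \<beta>" "g \<in> Grp S" "\<beta> \<in> paths S" "gsrc S g = prng \<beta>" using a Sub00 by (auto elim!: gensE)
    note gi = ginv_closed[OF a'(2)] gsrc_ginv[OF a'(2)] grng_ginv[OF a'(2)]
    have p: "prng \<beta> = grng S (ginv S g)" using a' gi by simp
    note q = Q_commute_W[OF gi(1) a'(3)]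
    have "adj a = Q \<beta> o\<^sub>L adj (W g)" using a' by (simp add: adj_comp adj_Q on_X_clinear[OF on_X_Q])
    also have "\<dots> = oscale (cnj (twG S (ginv S g) g)) (Q \<beta> o\<^sub>L W (ginv S g))"
      using a' by (simp add: adj_W oscale_comp_right on_X_clinear[OF on_X_Q])
    also have "Q \<beta> o\<^sub>L W (ginv S g) = W (ginv S g) o\<^sub>L Q (pact S (ginv S (ginv S g)) \<beta>)" using q(1) p by simp
    also have "\<dots> \<in> gens k" using q(2)[OF p] gi Sub00 gensI(3) by simp
    then have "oscale (cnj (twG S (ginv S g) g)) (W (ginv S g) o\<^sub>L Q (pact S (ginv S (ginv S g)) \<beta>)) \<in> closed_span (gens k)"
      using s sp(1) by blast
    finally show ?thesis .
  qed
qed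

lemma W_in_gens:
  assumes "g \<in> Grp S"
  shows "W g \<in> gens Sub00" "W g \<in> gens NoSub"
proof -
  have v: "gsrc S g \<in> Vert S" "grng S g \<in> Vert S" using assms grng_Vert gsrc_Vert by auto
  have Wr: "W g o\<^sub>L W (gsrc S g) = W g"
    using W_W[OF assms Vert_Grp[OF v(1)]] v twG_unit_right[OF assms] unit_right[OF assms] by (simp add: grng_unit)
  have Wl: "W (grng S g) o\<^sub>L W g = W g"
    using W_W[OF Vert_Grp[OF v(2)] assms] v twG_unit_left[OF assms] unit_left[OF assms] by (simp add: gsrc_unit)
  have "W g o\<^sub>L Q (gsrc S g, []) = W g"
    using v W_unit_adj[OF v(1)] Wr by (simp add: Q_def Tp_unit)
  then show "W g \<in> gens Sub00"
    using gensI(3)[of g "(gsrc S g, [])"] assms v by simp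
  have "N (grng S g, []) g (gsrc S g, []) = W g"
    using v W_unit_adj[OF v(1)] Wr Wl by (simp add: N_def Tp_unit)
  moreover have "matched (grng S g, []) g (gsrc S g, [])" using assms v by (simp add: matched_def)
  ultimately show "W g \<in> gens NoSub" using gensI(1) by metis
qed

lemma T_in_gens:
  assumes "e \<in> Edges S"
  shows "T e \<in> gens NoSub"
proof -
  let ?\<mu> = "(erng S e, [e])" and ?v = "esrc S e"
  have v: "?v \<in> Vert S" "?\<mu> \<in> paths S" using assms esrc_Vert by auto
  have "Tp ?\<mu> = T e" by (simp add: T_path_def)
  moreover have "Tp ?\<mu> o\<^sub>L W ?v = Tp ?\<mu>" using Tp_W_src[OF v(2)] by simp
  ultimately have "N ?\<mu> ?v (?v, []) = T e"
    using v W_unit_adj[OF v(1)] by (simp add: N_def Tp_unit)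
  moreover have "matched ?\<mu> ?v (?v, [])" using v by (simp add: matched_def Vert_Grp grng_unit gsrc_unit)
  ultimately show ?thesis using gensI(1) by metis
qed

definition B :: "subscript \<Rightarrow> ('g, 'e) germ oper set" where
  "B k = alg_on S X k"

text \<open>For the full algebra, each monomial lies in every C*-algebra that contains the
  \<open>W\<close> and \<open>T\<close>. For subscript \<open>0\<close> the definition also admits
  unmatched monomials, but these vanish.\<close>

lemma B_eq: "B k = closed_span (gens k)"
proof (cases k)
  case NoSub
  have "alg_on S X NoSub = closed_span (gens NoSub)"
  proof
    have "W ` Grp S \<union> T ` Edges S \<subseteq> closed_span (gens NoSub)"
      using W_in_gens(2) T_in_gens closed_span_superset[of "gens NoSub"] by blast
    then show "alg_on S X NoSub \<subseteq> closed_span (gens NoSub)"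
      using cstar_gens by (simp add: cstar_generated_subset del: gens.simps)
    have gA: "gens NoSub \<subseteq> A" if A: "cstar_algebra A" "W ` Grp S \<union> T ` Edges S \<subseteq> A" for A
    proof -
      note Ad = cstar_algebraD[OF A(1)]
      have Wg: "W g \<in> A" if "g \<in> Grp S" for g using A that by blast
      have F: "es \<noteq> [] \<Longrightarrow> set es \<subseteq> Edges S \<Longrightarrow> foldr (\<lambda>e A. T e o\<^sub>L A) es id_blinfun \<in> A" for es
      proof (induction es)
        case (Cons e es)
        then have "T e \<in> A" using A by auto
        then show ?case using Cons Ad(4) by (cases "es = []") auto
      qed simp
      have walk_set: "walk S v es \<Longrightarrow> set es \<subseteq> Edges S" for v es by (induction es arbitrary: v) auto
      have Tp_A: "Tp \<mu> \<in> A" if "\<mu> \<in> paths S" for \<mu>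
        using that F[of "snd \<mu>"] walk_set Wg Vert_Grp by (cases \<mu>) (auto simp: T_path_def)
      have "N \<alpha> g \<beta> \<in> A" if "matched \<alpha> g \<beta>" for \<alpha> g \<beta>
        using matchedD[OF that] Wg Tp_A by (simp add: N_def Ad)
      then show ?thesis by (auto elim!: gensE)
    qed
    show "closed_span (gens NoSub) \<subseteq> alg_on S X NoSub"
      unfolding alg_on.simps cstar_generated_def
    proof (rule Inter_greatest)
      fix A assume "A \<in> {A. cstar_algebra A \<and> W ` Grp S \<union> T ` Edges S \<subseteq> A}"
      then have A: "cstar_algebra A" "W ` Grp S \<union> T ` Edges S \<subseteq> A" by auto
      show "closed_span (gens NoSub) \<subseteq> A"
        by (rule closed_span_minimal[OF gA[OF A] cstar_algebraD(2,3)[OF A(1)]])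
    qed
  qed
  then show ?thesis using NoSub by (simp add: B_def)
next
  case Sub0
  let ?M = "{T_path S X \<alpha> o\<^sub>L W_on S X g o\<^sub>L adj (T_path S X \<beta>) | \<alpha> g \<beta>.
        \<alpha> \<in> paths S \<and> g \<in> Grp S \<and> \<beta> \<in> paths S \<and> plen \<alpha> = plen \<beta>}"
  have z: "0 \<in> closed_span (gens Sub0)" using subspace_closed_span oper.subspace_0 by blast
  have g: "N \<alpha> g \<beta> \<in> closed_span (gens Sub0)"
    if "\<alpha> \<in> paths S" "g \<in> Grp S" "\<beta> \<in> paths S" "plen \<alpha> = plen \<beta>" for \<alpha> g \<beta>
    using that N_unmatched[of \<alpha> g \<beta>] z closed_span_superset[of "gens Sub0"] gensI(2)[of \<alpha> g \<beta>] by (cases "matched \<alpha> g \<beta>") auto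
  have "?M \<subseteq> closed_span (gens Sub0)" using g unfolding N_def by blast
  then have 1: "closed_span ?M \<subseteq> closed_span (gens Sub0)" by (rule closed_span_subsetI)
  have "gens Sub0 \<subseteq> ?M" using matchedD unfolding gens.simps N_def by blast
  then have "closed_span (gens Sub0) \<subseteq> closed_span ?M" by (rule closed_span_mono)
  with 1 have "closed_span ?M = closed_span (gens Sub0)" by (rule equalityI)
  moreover have "alg_on S X Sub0 = closed_span ?M" by (rule alg_on.simps)
  ultimately show ?thesis using Sub0 by (simp only: B_def)
next
  case Sub00
  have "alg_on S X Sub00 = closed_span (gens Sub00)" by (simp add: Q_def comp_assoc gens.simps)
  then show ?thesis using Sub00 by (simp add: B_def)
qed

lemma cstar_B: "cstar_algebra (B k)"
  unfolding B_eq by (rule cstar_gens)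

lemma B_chain: "B Sub00 \<subseteq> B Sub0" "B Sub0 \<subseteq> B NoSub" "B Sub00 \<subseteq> B k" "B k \<subseteq> B NoSub"
proof -
  show 1: "B Sub00 \<subseteq> B Sub0" unfolding B_eq using gens_subset(2) by (rule closed_span_subsetI)
  show 2: "B Sub0 \<subseteq> B NoSub" unfolding B_eq using gens_subset(1) by (rule closed_span_mono)
  show "B Sub00 \<subseteq> B k" "B k \<subseteq> B NoSub" using 1 2 by (cases k; auto)+
qed

lemma W_in_B: "g \<in> Grp S \<Longrightarrow> W g \<in> B k"
  using W_in_gens(1) closed_span_superset B_chain(3) unfolding B_eq by blast

lemma Q_in_B: "\<mu> \<in> paths S \<Longrightarrow> Q \<mu> \<in> B k"
proof -
  assume \<mu>: "\<mu> \<in> paths S"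
  then have v: "prng \<mu> \<in> Vert S" by (rule prng_Vert)
  have "W (prng \<mu>) o\<^sub>L Q \<mu> = Q \<mu>" using W_Tp_rng[OF \<mu> v] by (simp add: Q_def comp_assoc[symmetric])
  then have "Q \<mu> \<in> gens Sub00" using gensI(3)[of "prng \<mu>" \<mu>] \<mu> Vert_Grp[OF v] gsrc_unit[OF v] by simp
  then show ?thesis using closed_span_superset B_chain(3) unfolding B_eq by blast
qed

lemma D_subset_B: "D \<subseteq> B k"
  unfolding D_eq using Q_in_B cstar_algebraD(2,3)[OF cstar_B] by (intro closed_span_minimal) auto

lemma on_X_B: "b \<in> B k \<Longrightarrow> on_X b"
proof -
  assume "b \<in> B k"
  then have "b \<in> closed_span (gens NoSub)" using B_chain(4) B_eq by blast
  then show ?thesis by (rule on_X_closed_span) (elim gensE, simp_all add: matched_def on_X_N)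
qed

end

context twisted_rep
begin

subsection \<open>Approximate units and normalizers\<close>

lemma W_eq_Q: "v \<in> Vert S \<Longrightarrow> W v = Q (v, [])"
  using W_unit_adj[of v] by (simp add: Q_def Tp_unit)

lemma rng_cases:
  assumes "x \<in> X"
  shows "rng x \<in> path_space S"
  using assms by (elim X_E) (simp add: rng_germ_of reps_germ_reps rep_range_path_space)

lemma vertex_cylinder: "\<xi> \<in> cylinder S (v, []) \<longleftrightarrow> \<xi> \<in> path_space S \<and> fst (pre S \<xi> 0) = v"
  by (cases \<xi>) (auto simp: cylinder_iff)

lemma entry_sum_W:
  assumes "finite F" "F \<subseteq> Vert S"
  shows "diagonal (\<Sum>v\<in>F. W v)"
    "entry (\<Sum>v\<in>F. W v) x x = (if x \<in> X \<and> fst (pre S (rng x) 0) \<in> F then 1 else 0)"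
proof -
  show "diagonal (\<Sum>v\<in>F. W v)"
    using assms by (induction F) (auto intro: diagonal_add W_unit_adj(3))
  have "entry (\<Sum>v\<in>F. W v) x x = (\<Sum>v\<in>F. if x \<in> X \<and> fst (pre S (rng x) 0) = v then 1 else 0)"
    unfolding entry_sum using assms by (intro sum.cong) (auto simp: W_eq_Q entry_Q vertex_cylinder rng_cases)
  then show "entry (\<Sum>v\<in>F. W v) x x = (if x \<in> X \<and> fst (pre S (rng x) 0) \<in> F then 1 else 0)"
    using assms(1) by (cases "x \<in> X") auto
qed

lemma sum_W_in_D: "F \<subseteq> Vert S \<Longrightarrow> (\<Sum>v\<in>F. W v) \<in> D"
  by (rule cstar_algebra_sum[OF cstar_D]) (auto simp: subset_iff W_eq_Q intro!: Q_in_D)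

lemma comp_sum_left: "(\<Sum>i\<in>I. f i) o\<^sub>L (a :: 'a oper) = (\<Sum>i\<in>I. f i o\<^sub>L a)"
  by (induction I rule: infinite_finite_induct) (auto simp: comp_add_left)

lemma sum_W_N:
  assumes "finite F" "F \<subseteq> Vert S" "matched \<alpha> g \<beta>" "prng \<alpha> \<in> F"
  shows "(\<Sum>v\<in>F. W v) o\<^sub>L N \<alpha> g \<beta> = N \<alpha> g \<beta>"
proof -
  have "(\<Sum>v\<in>F. W v) o\<^sub>L N \<alpha> g \<beta> = (\<Sum>v\<in>F. if prng \<alpha> = v then N \<alpha> g \<beta> else 0)"
    unfolding comp_sum_left
  proof (rule sum.cong)
    fix v assume "v \<in> F"
    then have "W v o\<^sub>L Tp \<alpha> = (if v = prng \<alpha> then Tp \<alpha> else 0)"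
      using assms by (intro W_Tp_rng) (auto simp: matched_def)
    moreover have "W v o\<^sub>L N \<alpha> g \<beta> = (W v o\<^sub>L Tp \<alpha>) o\<^sub>L (W g o\<^sub>L adj (Tp \<beta>))" by (simp add: N_def comp_assoc)
    ultimately show "W v o\<^sub>L N \<alpha> g \<beta> = (if prng \<alpha> = v then N \<alpha> g \<beta> else 0)" by (auto simp: N_def comp_assoc)
  qed simp
  then show ?thesis using assms by simp
qed

lemma sum_W_proj:
  assumes "finite F" "F \<subseteq> Vert S"
  shows "adj (\<Sum>v\<in>F. W v) = (\<Sum>v\<in>F. W v)" "norm (\<Sum>v\<in>F. W v) \<le> 1"
    "(\<Sum>v\<in>F. W v) \<in> positives D"
proof -
  let ?u = "\<Sum>v\<in>F. W v"
  note e = entry_sum_W[OF assms]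
  have c: "clinear_op ?u" using e(1) by (simp add: diagonal_def)
  show a: "adj ?u = ?u" using e c by (intro diagonal_eqI diagonal_adj) (auto simp del: entry_sum)
  show "norm ?u \<le> 1" by (rule norm_diagonal_le[OF e(1)]) (simp add: e(2) del: entry_sum)
  have "?u = adj ?u o\<^sub>L ?u" unfolding a using e c
    by (intro diagonal_eqI diagonal_comp) (auto simp: entry_comp_diagonal_right simp del: entry_sum)
  then show "?u \<in> positives D" using sum_W_in_D[OF assms(2)] unfolding positives_def by blast
qed

text \<open>A generator is unchanged by the sum as soon as \<open>F\<close> contains the range of
  its left path. The sums are projections, so their norms are at most 1 and the convergence survives
  norm limits.\<close>

lemma tendsto_sum_W:
  assumes "b \<in> B NoSub"
  shows "((\<lambda>F. (\<Sum>v\<in>F. W v) o\<^sub>L b) \<longlongrightarrow> b) (finite_subsets_at_top (Vert S))"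
  using assms unfolding B_eq
proof (induction rule: closed_span_induct)
  case zero
  show ?case by simp
next
  case (add x y)
  then show ?case by (simp add: comp_add_right tendsto_add)
next
  case (scale c x)
  have "\<forall>\<^sub>F F in finite_subsets_at_top (Vert S).
      oscale c ((\<Sum>v\<in>F. W v) o\<^sub>L x) = (\<Sum>v\<in>F. W v) o\<^sub>L oscale c x"
  proof (rule eventually_finite_subsets_at_top_weakI)
    fix F assume "finite F" "F \<subseteq> Vert S"
    then have "clinear_op (\<Sum>v\<in>F. W v)" using entry_sum_W(1) by (simp add: diagonal_def)
    then show "oscale c ((\<Sum>v\<in>F. W v) o\<^sub>L x) = (\<Sum>v\<in>F. W v) o\<^sub>L oscale c x"
      by (simp add: oscale_comp_right)
  qed
  then show ?case using tendsto_oscale[OF scale, of c] by (rule Lim_transform_eventually[rotated])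
next
  case (limit f x)
  show ?case
  proof (rule tendstoI)
    fix e :: real assume e: "e > 0"
    then obtain n where n: "norm (f n - x) < e / 3"
      using limit(2) unfolding LIMSEQ_def dist_norm by (meson divide_pos_pos order_refl zero_less_numeral)
    have "\<forall>\<^sub>F F in finite_subsets_at_top (Vert S). dist ((\<Sum>v\<in>F. W v) o\<^sub>L f n) (f n) < e / 3"
      using limit(1)[of n] e by (intro tendstoD) auto
    moreover have "\<forall>\<^sub>F F in finite_subsets_at_top (Vert S). norm (\<Sum>v\<in>F. W v) \<le> 1"
      by (rule eventually_finite_subsets_at_top_weakI) (rule sum_W_proj)
    ultimately show "\<forall>\<^sub>F F in finite_subsets_at_top (Vert S). dist ((\<Sum>v\<in>F. W v) o\<^sub>L x) x < e"
    proof eventually_elim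
      case (elim F)
      let ?u = "\<Sum>v\<in>F. W v"
      have eq: "(?u o\<^sub>L x) - x = (?u o\<^sub>L (x - f n)) + ((?u o\<^sub>L f n) - f n) + (f n - x)"
        by (simp add: comp_diff_right)
      have "norm (?u o\<^sub>L (x - f n)) \<le> norm ?u * norm (x - f n)" by (rule norm_blinfun_compose)
      also have "\<dots> \<le> 1 * norm (x - f n)" using elim by (intro mult_right_mono) auto
      finally have 1: "norm (?u o\<^sub>L (x - f n)) < e / 3" using n by (simp add: norm_minus_commute)
      have "norm ((?u o\<^sub>L x) - x) \<le> norm (?u o\<^sub>L (x - f n)) + norm ((?u o\<^sub>L f n) - f n) + norm (f n - x)"
        unfolding eq by (rule order_trans[OF norm_triangle_ineq add_right_mono[OF norm_triangle_ineq]])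
      then show ?case using 1 n elim by (simp add: dist_norm)
    qed
  qed
next
  case (gen x)
  then obtain \<alpha> g \<beta> where x: "x = N \<alpha> g \<beta>" "matched \<alpha> g \<beta>" by (auto elim: gensE)
  have "\<forall>\<^sub>F F in finite_subsets_at_top (Vert S). x = (\<Sum>v\<in>F. W v) o\<^sub>L x"
    unfolding eventually_finite_subsets_at_top
    using x sum_W_N[OF _ _ x(2)] prng_Vert[OF matchedD(1)[OF x(2)]]
    by (intro exI[of _ "{prng \<alpha>}"]) auto
  then show ?case by (rule Lim_transform_eventually[OF tendsto_const])
qed

lemma tendsto_adj_filter:
  assumes "\<forall>\<^sub>F i in F. clinear_op (f i)" "(f \<longlongrightarrow> A) F" "clinear_op A"
  shows "((\<lambda>i. adj (f i)) \<longlongrightarrow> adj A) F"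
proof -
  have "((\<lambda>i. norm (f i - A)) \<longlongrightarrow> 0) F"
    using assms(2) by (simp add: LIM_zero_iff tendsto_norm_zero_iff)
  moreover have "\<forall>\<^sub>F i in F. norm (f i - A) = norm (adj (f i) - adj A)"
    using assms(1) by eventually_elim (simp add: assms(3) adj_diff[symmetric] norm_adj clinear_op_diff)
  ultimately have "((\<lambda>i. norm (adj (f i) - adj A)) \<longlongrightarrow> 0) F"
    by (rule Lim_transform_eventually)
  then show ?thesis using LIM_zero_cancel tendsto_norm_zero_iff by blast
qed

lemma approximate_unit: "contains_approximate_unit D (B k)"
proof -
  let ?u = "\<lambda>F. \<Sum>v\<in>F. W v" and ?G = "finite_subsets_at_top (Vert S)"
  have "((\<lambda>u. u o\<^sub>L b) \<longlongrightarrow> b) (filtermap ?u ?G)" "((\<lambda>u. b o\<^sub>L u) \<longlongrightarrow> b) (filtermap ?u ?G)"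
    if b: "b \<in> B k" for b
  proof -
    have b': "b \<in> B NoSub" using b B_chain(4) by blast
    show "((\<lambda>u. u o\<^sub>L b) \<longlongrightarrow> b) (filtermap ?u ?G)"
      using tendsto_sum_W[OF b'] by (simp add: filterlim_def filtermap_filtermap)
    have cb: "clinear_op b" and ab: "adj b \<in> B NoSub" using cstar_algebraD[OF cstar_B] b' by auto
    have cu: "\<forall>\<^sub>F F in ?G. clinear_op (?u F) \<and> adj (?u F) = ?u F"
      by (rule eventually_finite_subsets_at_top_weakI) (auto simp: sum_W_proj intro!: clinear_op_sum clinear_W Vert_Grp)
    \<comment> \<open>Convergence on the right is the adjoint of convergence on the left, as the
      sums are self-adjoint.\<close>
    have "((\<lambda>F. adj (?u F o\<^sub>L adj b)) \<longlongrightarrow> adj (adj b)) ?G"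
      using cu cb by (intro tendsto_adj_filter tendsto_sum_W[OF ab]) (auto elim: eventually_mono simp: clinear_op_comp)
    moreover have "\<forall>\<^sub>F F in ?G. adj (?u F o\<^sub>L adj b) = b o\<^sub>L ?u F"
      using cu by eventually_elim (simp add: adj_comp cb)
    ultimately have "((\<lambda>F. b o\<^sub>L ?u F) \<longlongrightarrow> b) ?G"
      using cb by (simp add: Lim_transform_eventually)
    then show "((\<lambda>u. b o\<^sub>L u) \<longlongrightarrow> b) (filtermap ?u ?G)"
      by (simp add: filterlim_def filtermap_filtermap)
  qed
  moreover have "eventually (\<lambda>u. u \<in> positives D \<and> norm u \<le> 1) (filtermap ?u ?G)"
    unfolding eventually_filtermap
    by (rule eventually_finite_subsets_at_top_weakI) (simp add: sum_W_proj)
  ultimately show ?thesis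
    unfolding contains_approximate_unit_def
    by (intro exI[of _ "filtermap ?u ?G"]) (simp add: filtermap_bot_iff)
qed

lemma Q_eq_N: "\<mu> \<in> paths S \<Longrightarrow> Q \<mu> = N \<mu> (psrc S \<mu>) \<mu>" "\<mu> \<in> paths S \<Longrightarrow> matched \<mu> (psrc S \<mu>) \<mu>"
  using psrc_Vert[of \<mu>] by (auto simp: Q_def N_def Tp_W_src matched_def Vert_Grp grng_unit gsrc_unit)

lemma N_adj_N: "matched \<alpha> g \<beta> \<Longrightarrow> N \<alpha> g \<beta> o\<^sub>L adj (N \<alpha> g \<beta>) = Q \<alpha>"
proof -
  assume m: "matched \<alpha> g \<beta>"
  note d = matchedD[OF m]
  have "N \<alpha> g \<beta> o\<^sub>L adj (N \<alpha> g \<beta>) = Tp \<alpha> o\<^sub>L ((W g o\<^sub>L ((adj (Tp \<beta>) o\<^sub>L Tp \<beta>) o\<^sub>L adj (W g))) o\<^sub>L adj (Tp \<alpha>))"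
    using d by (simp add: N_def adj_comp clinear_op_comp comp_assoc)
  also have "W g o\<^sub>L ((adj (Tp \<beta>) o\<^sub>L Tp \<beta>) o\<^sub>L adj (W g)) = W (grng S g)"
  proof -
    have "W g o\<^sub>L W (gsrc S g) = W g"
      using W_W[OF d(2) Vert_Grp[OF gsrc_Vert[OF d(2)]]] gsrc_Vert[OF d(2)] twG_unit_right[OF d(2)] unit_right[OF d(2)]
      by (simp add: grng_unit)
    then show ?thesis
      using adj_Tp_Tp_self[OF d(3)] d W_adj_W[OF d(2)] by (simp add: comp_assoc[symmetric])
  qed
  finally show ?thesis using d Tp_W_src[OF d(1)] by (simp add: Q_def comp_assoc[symmetric])
qed

text \<open>For \<open>a = Q \<mu>\<close> the product
  \<open>N \<alpha> g \<beta> o\<^sub>L Q \<mu>\<close> is zero or a multiple of a monomial, and a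
  monomial times its adjoint is a projection \<open>Q\<close>. Linear combinations and limits
  follow.\<close>

lemma N_conj_D:
  assumes m: "matched \<alpha> g \<beta>" and a: "a \<in> D"
  shows "N \<alpha> g \<beta> o\<^sub>L a o\<^sub>L adj (N \<alpha> g \<beta>) \<in> D"
  using a unfolding D_eq
proof (induction rule: closed_span_induct)
  case (limit f x)
  have "(\<lambda>n. N \<alpha> g \<beta> o\<^sub>L f n o\<^sub>L adj (N \<alpha> g \<beta>)) \<longlonglongrightarrow> (N \<alpha> g \<beta> o\<^sub>L x o\<^sub>L adj (N \<alpha> g \<beta>))"
    by (intro tendsto_comp limit(2) tendsto_const)
  then show ?case
    using limit(1) cstar_algebra_limit[OF cstar_D, of "\<lambda>n. N \<alpha> g \<beta> o\<^sub>L f n o\<^sub>L adj (N \<alpha> g \<beta>)"]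
    unfolding D_eq by blast
next
  case (gen x)
  then obtain \<mu> where x: "x = Q \<mu>" "\<mu> \<in> paths S" by blast
  have QQ: "Q \<mu> o\<^sub>L adj (Q \<mu>) = Q \<mu>"
    using x(2) by (intro diagonal_eqI) (auto simp: adj_Q diagonal_Q diagonal_comp entry_comp_diagonal_right entry_Q)
  then have eq: "N \<alpha> g \<beta> o\<^sub>L Q \<mu> o\<^sub>L adj (N \<alpha> g \<beta>) = (N \<alpha> g \<beta> o\<^sub>L Q \<mu>) o\<^sub>L adj (N \<alpha> g \<beta> o\<^sub>L Q \<mu>)"
  proof -
    have "(N \<alpha> g \<beta> o\<^sub>L Q \<mu>) o\<^sub>L adj (N \<alpha> g \<beta> o\<^sub>L Q \<mu>) =
        N \<alpha> g \<beta> o\<^sub>L (Q \<mu> o\<^sub>L adj (Q \<mu>)) o\<^sub>L adj (N \<alpha> g \<beta>)"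
      using x(2) m by (simp add: adj_comp clinear_N comp_assoc)
    then show ?thesis unfolding QQ by simp
  qed
  have "N \<alpha> g \<beta> o\<^sub>L Q \<mu> = 0 \<or> (\<exists>c \<alpha>' k \<delta>'. matched \<alpha>' k \<delta>' \<and> N \<alpha> g \<beta> o\<^sub>L Q \<mu> = oscale c (N \<alpha>' k \<delta>'))"
    using N_mult[OF m Q_eq_N(2)[OF x(2)]] Q_eq_N(1)[OF x(2)] by metis
  then have "N \<alpha> g \<beta> o\<^sub>L Q \<mu> o\<^sub>L adj (N \<alpha> g \<beta>) \<in> D"
  proof
    assume "N \<alpha> g \<beta> o\<^sub>L Q \<mu> = 0"
    then show ?thesis using cstar_algebraD(6)[OF cstar_D] by simp
  next
    assume "\<exists>c \<alpha>' k \<delta>'. matched \<alpha>' k \<delta>' \<and> N \<alpha> g \<beta> o\<^sub>L Q \<mu> = oscale c (N \<alpha>' k \<delta>')"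
    then obtain c \<alpha>' k \<delta>' where c: "matched \<alpha>' k \<delta>'" "N \<alpha> g \<beta> o\<^sub>L Q \<mu> = oscale c (N \<alpha>' k \<delta>')" by blast
    have "N \<alpha> g \<beta> o\<^sub>L Q \<mu> o\<^sub>L adj (N \<alpha> g \<beta>) = oscale (c * cnj c) (Q \<alpha>')"
      unfolding eq unfolding c(2) using clinear_N[OF c(1)] N_adj_N[OF c(1)] by (simp add: adj_oscale oscale_comp_right mult.commute)
    then show ?thesis using Q_in_D matchedD(1)[OF c(1)] cstar_algebraD(8)[OF cstar_D] by simp
  qed
  then show ?case using x(1) D_eq by simp
qed (use cstar_algebraD[OF cstar_D] m in \<open>auto simp: D_eq comp_add_left comp_add_right oscale_comp_right clinear_N\<close>)

lemma N_normalizes: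
  assumes m: "matched \<alpha> g \<beta>" and a: "a \<in> D"
  shows "adj (N \<alpha> g \<beta>) o\<^sub>L a o\<^sub>L N \<alpha> g \<beta> \<in> D"
proof -
  note n = N_adj[OF m]
  let ?c = "cnj (twG S (ginv S g) g)"
  have "adj (adj (N \<alpha> g \<beta>)) = adj (oscale ?c (N \<beta> (ginv S g) \<alpha>))" using n by simp
  then have N: "N \<alpha> g \<beta> = oscale (cnj ?c) (adj (N \<beta> (ginv S g) \<alpha>))"
    using m n(2) by (simp add: adj_oscale clinear_N)
  have "clinear_op a" using a cstar_algebraD(1)[OF cstar_D] by blast
  then have "adj (N \<alpha> g \<beta>) o\<^sub>L a o\<^sub>L N \<alpha> g \<beta> =
      oscale (?c * cnj ?c) (N \<beta> (ginv S g) \<alpha> o\<^sub>L a o\<^sub>L adj (N \<beta> (ginv S g) \<alpha>))"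
    unfolding n(1) by (subst N) (simp add: oscale_comp_right clinear_op_comp clinear_N[OF n(2)])
  then show ?thesis using N_conj_D[OF n(2) a] cstar_algebraD(8)[OF cstar_D] by simp
qed

lemma B_normalizers: "B k = closed_span (normalizers D (B k))"
proof
  have scale: "oscale c b \<in> normalizers D (B k)" if "b \<in> normalizers D (B k)" for c b
  proof -
    have cb: "clinear_op b" using that cstar_algebraD(1)[OF cstar_B] by (auto simp: normalizers_def)
    show ?thesis
      using that cb cstar_algebraD(8)[OF cstar_B] cstar_algebraD(8)[OF cstar_D] cstar_algebraD(1)[OF cstar_D]
      by (auto simp: normalizers_def adj_oscale oscale_comp_right clinear_op_comp)
  qed
  have N: "N \<alpha> g \<beta> \<in> normalizers D (B k)" if "N \<alpha> g \<beta> \<in> B k" "matched \<alpha> g \<beta>" for \<alpha> g \<beta>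
    using that N_conj_D N_normalizes by (auto simp: normalizers_def)
  have "gens k \<subseteq> normalizers D (B k)"
  proof
    fix a assume a: "a \<in> gens k"
    then have aB: "a \<in> B k" using closed_span_superset B_eq by blast
    from a show "a \<in> normalizers D (B k)"
    proof (cases rule: gensE)
      case (3 g \<beta>)
      note w = W_Q[OF 3(3-5)]
      let ?z = "ptw S g \<beta>"
      have z: "cmod ?z = 1" using 3 by (cases \<beta>) (auto intro!: twE_list_circle)
      have "N (pact S g \<beta>) (psect S g \<beta>) \<beta> = oscale (cnj ?z) a"
        using unimodular_cnj(1)[OF z] by (simp add: 3 w(1))
      moreover have "oscale (cnj ?z) a \<in> B k" using aB cstar_algebraD(8)[OF cstar_B] by blast
      ultimately have "N (pact S g \<beta>) (psect S g \<beta>) \<beta> \<in> B k" by simp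
      then show ?thesis using N[OF _ w(2)] scale by (simp add: 3 w(1))
    qed (use N aB in auto)
  qed
  then show "B k \<subseteq> closed_span (normalizers D (B k))" unfolding B_eq[of k] by (rule closed_span_mono)
  show "closed_span (normalizers D (B k)) \<subseteq> B k"
    by (rule closed_span_minimal) (auto simp: normalizers_def cstar_algebraD[OF cstar_B])
qed

text \<open>The approximate unit and the density of the span of normalizers hold for every twisted
  action. What remains to be studied is maximality, as a condition on the relative commutant, and
  the expectation.\<close>

lemma cartan_iff:
  "cartan_inclusion D (B k) \<longleftrightarrow> B k \<inter> commutant D \<subseteq> D \<and>
     (\<exists>P. conditional_expectation P D (B k) \<and> faithful_on P (B k))"
  unfolding cartan_inclusion_def
  using cstar_B maximal_abelian_iff[OF cstar_D abelian_D D_subset_B cstar_B] approximate_unit B_normalizers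
  by blast

end

section \<open>Local behaviour of germs\<close>

lemma pcat_assoc: "pcat (pcat \<alpha> \<beta>) \<gamma> = pcat \<alpha> (pcat \<beta> \<gamma>)"
  by (simp add: pcat_def)

lemma plen_pcat: "plen (pcat \<alpha> \<beta>) = plen \<alpha> + plen \<beta>"
  by (simp add: plen_def pcat_def)

context twisted_self_similar_action
begin

lemma cylinder_pcatD: "\<eta> \<in> cylinder S (pcat \<alpha> \<beta>) \<Longrightarrow> \<eta> \<in> cylinder S \<alpha>"
proof -
  assume \<eta>: "\<eta> \<in> cylinder S (pcat \<alpha> \<beta>)"
  have "pre S \<eta> (plen \<alpha>) = (fst (pcat \<alpha> \<beta>), take (plen \<alpha>) (snd (pcat \<alpha> \<beta>)))"
    using \<eta> pre_take[of "plen \<alpha>" "plen (pcat \<alpha> \<beta>)" S \<eta>] by (simp add: cylinder_iff plen_pcat)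
  then show ?thesis using \<eta> reaches_mono[of \<eta> "plen (pcat \<alpha> \<beta>)" "plen \<alpha>"]
    by (simp add: cylinder_iff plen_pcat) (simp add: pcat_def plen_def)
qed

lemma pre_cylinder: "\<xi> \<in> path_space S \<Longrightarrow> reaches \<xi> n \<Longrightarrow> \<xi> \<in> cylinder S (pre S \<xi> n)"
  by (simp add: cylinder_iff plen_pre)

lemma path_space_separated:
  assumes "\<xi> \<in> path_space S" "\<eta> \<in> path_space S" "\<And>\<mu>. \<mu> \<in> paths S \<Longrightarrow> \<xi> \<in> cylinder S \<mu> \<longleftrightarrow> \<eta> \<in> cylinder S \<mu>"
  shows "\<xi> = \<eta>"
proof -
  have *: "reaches \<eta> n \<and> pre S \<xi> n = pre S \<eta> n"
    if "\<xi> \<in> path_space S" "reaches \<xi> n" "\<And>\<mu>. \<mu> \<in> paths S \<Longrightarrow> \<xi> \<in> cylinder S \<mu> \<longleftrightarrow> \<eta> \<in> cylinder S \<mu>" for \<xi> \<eta> n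
    using that(3)[OF pre_paths[OF that(1)]] pre_cylinder[OF that(1,2)] plen_pre[OF that(2), of S]
    by (metis cylinder_iff)
  show ?thesis
    using *[OF assms(1) _ assms(3)] *[OF assms(2) _ assms(3)[symmetric]] by (intro xpath_eqI) blast+
qed

text \<open>Says that the germ of \<open>l\<close> at the tail of \<open>\<xi>\<close> behind
  \<open>\<beta>\<close> is a unit. Written with cylinders, it is visibly an open condition on
  \<open>\<xi>\<close>.\<close>

definition trivial_at :: "'a \<Rightarrow> ('a, 'b) path \<Rightarrow> ('a, 'b) xpath \<Rightarrow> bool" where
  "trivial_at l \<beta> \<xi> \<longleftrightarrow> (\<exists>\<mu>. strongly_fixed S l \<mu> \<and> \<xi> \<in> cylinder S (pcat \<beta> \<mu>))"

lemma strongly_fixed_iff: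
  "strongly_fixed S l (v, w) \<longleftrightarrow> walk S v w \<and> v = gsrc S l \<and> grng S l = v \<and> act_list S l w = w \<and>
     sect_list S l w = psrc S (v, w)"
  by (auto simp: strongly_fixed_def fixes_path_def)

text \<open>Equality of refinements at a prefix that extends \<open>\<beta>\<close> by a word
  \<open>w\<close> says that \<open>h\<close> and \<open>k\<close> act equally on \<open>w\<close>
  and restrict to the same element, that is, the inverse of \<open>h\<close> times \<open>k\<close>
  fixes \<open>w\<close> and restricts to a unit.\<close>

lemma germ_of_eq_iff_trivial:
  assumes p: "(\<alpha>, h, \<beta>, \<xi>) \<in> germ_reps S" and q: "(\<gamma>, k, \<beta>, \<xi>) \<in> germ_reps S"
  shows "germ_of S (\<alpha>, h, \<beta>, \<xi>) = germ_of S (\<gamma>, k, \<beta>, \<xi>) \<longleftrightarrow>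
    \<alpha> = \<gamma> \<and> trivial_at (gmult S (ginv S h) k) \<beta> \<xi>"
proof -
  have P: "\<alpha> \<in> paths S" "h \<in> Grp S" "grng S h = psrc S \<alpha>" "gsrc S h = psrc S \<beta>" "\<xi> \<in> cylinder S \<beta>"
    and K: "\<gamma> \<in> paths S" "k \<in> Grp S" "grng S k = psrc S \<gamma>" "gsrc S k = psrc S \<beta>"
    using p q by (auto simp: germ_reps_iff)
  note hi = ginv_closed[OF P(2)] gsrc_ginv[OF P(2)] grng_ginv[OF P(2)]
  let ?l = "gmult S (ginv S h) k"
  show ?thesis
  proof
    assume "germ_of S (\<alpha>, h, \<beta>, \<xi>) = germ_of S (\<gamma>, k, \<beta>, \<xi>)"
    then obtain n where n: "plen \<beta> \<le> n" "reaches \<xi> n"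
      "refine S (\<alpha>, h, \<beta>, \<xi>) n = refine S (\<gamma>, k, \<beta>, \<xi>) n"
      using germ_of_eq_iff[OF p q] by auto
    let ?w = "drop (plen \<beta>) (snd (pre S \<xi> n))"
    note c = cylinder_segment[OF P(5) n(1)]
    have w: "walk S (gsrc S h) ?w" "walk S (gsrc S k) ?w" using c P K by auto
    have eq: "fst \<alpha> = fst \<gamma>" "snd \<alpha> = snd \<gamma>" "act_list S h ?w = act_list S k ?w" "sect_list S h ?w = sect_list S k ?w"
      using n(3) by (simp_all add: Let_def append_eq_append_conv)
    then have \<alpha>: "\<alpha> = \<gamma>" by (simp add: prod_eq_iff)
    have gk: "gsrc S (ginv S h) = grng S k" using hi P K \<alpha> by simp
    have "act_list S ?l ?w = ?w"
      using act_list_gmult[OF hi(1) K(2) gk w(2)] act_list_ginv(1)[OF P(2) w(1)] eq(3) by simp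
    moreover have "sect_list S ?l ?w = gmult S (ginv S (sect_list S k ?w)) (sect_list S k ?w)"
      using sect_list_gmult[OF hi(1) K(2) gk w(2)] act_list_ginv(2)[OF P(2) w(1)] eq(3,4) by simp
    then have "sect_list S ?l ?w = psrc S (psrc S \<beta>, ?w)"
      using walk_act_list[OF K(2) w(2)] K by (simp add: ginv_left)
    moreover have "gsrc S ?l = psrc S \<beta>" "grng S ?l = psrc S \<beta>"
      using gsrc_gmult[OF hi(1) K(2) gk] grng_gmult[OF hi(1) K(2) gk] K P hi by auto
    ultimately have "strongly_fixed S ?l (psrc S \<beta>, ?w)" using c(2) by (simp add: strongly_fixed_iff)
    moreover have "pcat \<beta> (psrc S \<beta>, ?w) = pre S \<xi> n" using c(1) by (simp add: pcat_def)
    then have "\<xi> \<in> cylinder S (pcat \<beta> (psrc S \<beta>, ?w))"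
      using pre_cylinder n(2) P(5) by (simp add: cylinder_iff)
    ultimately show "\<alpha> = \<gamma> \<and> trivial_at ?l \<beta> \<xi>" using \<alpha> unfolding trivial_at_def by blast
  next
    assume R: "\<alpha> = \<gamma> \<and> trivial_at ?l \<beta> \<xi>"
    then obtain v w where vw: "strongly_fixed S ?l (v, w)" "\<xi> \<in> cylinder S (pcat \<beta> (v, w))"
      unfolding trivial_at_def by (metis prod.collapse)
    have gk: "gsrc S (ginv S h) = grng S k" using hi P K R by simp
    have l: "?l \<in> Grp S" "gsrc S ?l = psrc S \<beta>" "grng S ?l = psrc S \<beta>"
      using gmult_closed[OF hi(1) K(2) gk] gsrc_gmult[OF hi(1) K(2) gk] grng_gmult[OF hi(1) K(2) gk] K P hi by auto
    note sf = vw(1)[unfolded strongly_fixed_iff]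
    have v: "v = psrc S \<beta>" using sf l(2) by (elim conjE) (rule trans)
    have s: "v = psrc S \<beta>" "walk S (psrc S \<beta>) w" "act_list S ?l w = w" "sect_list S ?l w = psrc S (psrc S \<beta>, w)"
      using v sf[unfolded v] by blast+
    have hl: "gmult S h ?l = k" using left_cancel'[OF P(2) K(2)] P K R by simp
    have hl_src: "gsrc S h = grng S ?l" using P l by simp
    have "walk S (gsrc S ?l) w" using s l by simp
    note a = act_list_gmult[OF P(2) l(1) hl_src this] and b = sect_list_gmult[OF P(2) l(1) hl_src this]
    have wh: "walk S (gsrc S h) w" using s P by simp
    have "act_list S k w = act_list S h w" using a s(3) hl by simp
    moreover have "sect_list S k w = sect_list S h w"
      using b s hl walk_act_list[OF P(2) wh] P unit_right by metis
    moreover have "refinable (\<alpha>, h, \<beta>, \<xi>) (plen (pcat \<beta> (v, w)))" "drop (plen \<beta>) (snd (pre S \<xi> (plen (pcat \<beta> (v, w))))) = w"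
      using vw(2) by (auto simp: cylinder_iff plen_pcat) (simp add: pcat_def plen_def)
    ultimately show "germ_of S (\<alpha>, h, \<beta>, \<xi>) = germ_of S (\<gamma>, k, \<beta>, \<xi>)"
      unfolding germ_of_eq_iff[OF p q] using R
      by (intro exI[of _ "plen (pcat \<beta> (v, w))"]) (simp add: Let_def)
  qed
qed

lemma minimal_strongly_fixed_prefix:
  assumes "strongly_fixed S l \<mu>"
  obtains \<nu> \<kappa> where "minimal_strongly_fixed S l \<nu>" "\<mu> = pcat \<nu> \<kappa>"
proof -
  define P where "P n \<longleftrightarrow> strongly_fixed S l (prng \<mu>, take n (snd \<mu>))" for n
  have "P (plen \<mu>)" using assms by (simp add: P_def plen_def prng_def)
  then have P: "P (Least P)" by (rule LeastI)
  have Pm: "\<not> P m" if "m < Least P" for m using that by (rule not_less_Least)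
  let ?\<nu> = "(prng \<mu>, take (Least P) (snd \<mu>))"
  have "minimal_strongly_fixed S l ?\<nu>"
    unfolding minimal_strongly_fixed_def
  proof (intro conjI notI)
    show "strongly_fixed S l ?\<nu>" using P by (simp add: P_def)
    assume "\<exists>\<nu>'\<in>paths S. pprefix S \<nu>' ?\<nu> \<and> \<nu>' \<noteq> ?\<nu> \<and> strongly_fixed S l \<nu>'"
    then obtain \<nu>' \<kappa> where \<nu>': "?\<nu> = pcat \<nu>' \<kappa>" "\<nu>' \<noteq> ?\<nu>" "strongly_fixed S l \<nu>'" unfolding pprefix_def by blast
    have t: "fst \<nu>' = prng \<mu>" "take (Least P) (snd \<mu>) = snd \<nu>' @ snd \<kappa>" using \<nu>'(1) by (auto simp: pcat_def)
    have ne: "snd \<kappa> \<noteq> []"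
    proof
      assume "snd \<kappa> = []"
      then have "?\<nu> = \<nu>'" unfolding \<nu>'(1) by (simp add: pcat_def)
      then show False using \<nu>'(2) by simp
    qed
    have "length (snd \<kappa>) > 0" using ne by blast
    then have len: "length (snd \<nu>') < Least P" "length (snd \<nu>') \<le> length (snd \<mu>)"
      using arg_cong[OF t(2), of length] by (simp_all only: length_take length_append)
    have "snd \<nu>' = take (length (snd \<nu>')) (take (Least P) (snd \<mu>))" using t(2) by simp
    then have "snd \<nu>' = take (length (snd \<nu>')) (snd \<mu>)" using len by (simp add: min_def)
    then have "P (length (snd \<nu>'))" using \<nu>'(3) t(1) unfolding P_def by (metis prod.collapse)
    then show False using Pm len(1) by blast
  qed
  moreover have "\<mu> = pcat ?\<nu> (prng \<mu>, drop (Least P) (snd \<mu>))" by (simp add: pcat_def prng_def)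
  ultimately show thesis by (rule that)
qed

text \<open>Every strongly fixed path extends a minimal one. Under (Fin) this leaves a condition on
  finitely many cylinders, so triviality becomes a closed condition as well.\<close>

lemma trivial_at_iff_minimal:
  "trivial_at l \<beta> \<xi> \<longleftrightarrow> (\<exists>\<mu>\<in>{\<mu>. minimal_strongly_fixed S l \<mu>}. \<xi> \<in> cylinder S (pcat \<beta> \<mu>))"
proof
  assume "trivial_at l \<beta> \<xi>"
  then obtain \<mu> where \<mu>: "strongly_fixed S l \<mu>" "\<xi> \<in> cylinder S (pcat \<beta> \<mu>)" by (auto simp: trivial_at_def)
  obtain \<nu> \<kappa> where \<nu>: "minimal_strongly_fixed S l \<nu>" "\<mu> = pcat \<nu> \<kappa>"
    using minimal_strongly_fixed_prefix[OF \<mu>(1)] .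
  then have "\<xi> \<in> cylinder S (pcat \<beta> \<nu>)" using \<mu>(2) cylinder_pcatD by (metis pcat_assoc)
  then show "\<exists>\<mu>\<in>{\<mu>. minimal_strongly_fixed S l \<mu>}. \<xi> \<in> cylinder S (pcat \<beta> \<mu>)" using \<nu> by blast
next
  assume "\<exists>\<mu>\<in>{\<mu>. minimal_strongly_fixed S l \<mu>}. \<xi> \<in> cylinder S (pcat \<beta> \<mu>)"
  then show "trivial_at l \<beta> \<xi>" unfolding trivial_at_def minimal_strongly_fixed_def by blast
qed

text \<open>Links the filter \<open>near\<close> with the topology. The basic sets only remove
  extensions of a path, not arbitrary cylinders; so the condition includes the cylinder of the
  initial vertex of \<open>\<xi>\<close>, from which every relevant cylinder is an
  extension.\<close>

lemma openin_agree:
  assumes "finite F" "F \<subseteq> paths S" "\<xi> \<in> path_space S"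
  shows "openin (path_topology S)
    {\<eta> \<in> cylinder S (fst (pre S \<xi> 0), []). \<forall>\<mu>\<in>F. \<eta> \<in> cylinder S \<mu> \<longleftrightarrow> \<xi> \<in> cylinder S \<mu>}"
  using assms(1,2)
proof (induction F)
  case empty
  let ?v = "fst (pre S \<xi> 0)"
  have v: "(?v, []) \<in> paths S" using pre_paths[OF assms(3), of 0] by (cases "pre S \<xi> 0") (auto dest: walk_Vert)
  show ?case
    unfolding path_topology_def using v
    by (intro topology_generated_by_Basis) (auto intro!: exI[of _ ?v] exI[of _ "[]"] exI[of _ "{}"])
next
  case (insert \<mu> F)
  let ?v = "fst (pre S \<xi> 0)"
  let ?A = "{\<eta> \<in> cylinder S (?v, []). \<forall>\<mu>\<in>F. \<eta> \<in> cylinder S \<mu> \<longleftrightarrow> \<xi> \<in> cylinder S \<mu>}"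
  have \<mu>: "\<mu> \<in> paths S" and A: "openin (path_topology S) ?A" using insert by auto
  have v: "(?v, []) \<in> paths S" using pre_paths[OF assms(3), of 0] by (cases "pre S \<xi> 0") (auto dest: walk_Vert)
  have base: "openin (path_topology S) (cylinder S \<alpha> - (\<Union>\<beta>\<in>F. cylinder S (pcat \<alpha> \<beta>)))"
    if "\<alpha> \<in> paths S" "finite F" "F \<subseteq> {\<beta> \<in> paths S. prng \<beta> = psrc S \<alpha>}" for \<alpha> F
    unfolding path_topology_def using that by (intro topology_generated_by_Basis) blast
  have cyl_v: "\<eta> \<in> cylinder S (prng \<mu>, [])" if "\<eta> \<in> cylinder S \<mu>" for \<eta>
    using cylinder_pcatD[of \<eta> "(prng \<mu>, [])" \<mu>] that by (simp add: pcat_def prng_def)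
  show ?case
  proof (cases "\<xi> \<in> cylinder S \<mu>")
    case True
    have "openin (path_topology S) (cylinder S \<mu>)" using base[OF \<mu>, of "{}"] by simp
    then have "openin (path_topology S) (?A \<inter> cylinder S \<mu>)" using A by (rule openin_Int[rotated])
    moreover have "?A \<inter> cylinder S \<mu> = {\<eta> \<in> cylinder S (?v, []). \<forall>\<mu>\<in>insert \<mu> F. \<eta> \<in> cylinder S \<mu> \<longleftrightarrow> \<xi> \<in> cylinder S \<mu>}"
      using True by auto
    ultimately show ?thesis by simp
  next
    case False
    show ?thesis
    proof (cases "prng \<mu> = ?v")
      case True
      have "pcat (?v, []) \<mu> = \<mu>" using True by (simp add: pcat_def prng_def prod_eq_iff)
      then have "openin (path_topology S) (cylinder S (?v, []) - cylinder S \<mu>)"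
        using base[OF v, of "{\<mu>}"] \<mu> True by simp
      then have "openin (path_topology S) (?A \<inter> (cylinder S (?v, []) - cylinder S \<mu>))" using A by (rule openin_Int[rotated])
      moreover have "?A \<inter> (cylinder S (?v, []) - cylinder S \<mu>) =
          {\<eta> \<in> cylinder S (?v, []). \<forall>\<mu>\<in>insert \<mu> F. \<eta> \<in> cylinder S \<mu> \<longleftrightarrow> \<xi> \<in> cylinder S \<mu>}"
        using False by auto
      ultimately show ?thesis by simp
    next
      case neq: False
      have "\<eta> \<notin> cylinder S \<mu>" if "\<eta> \<in> cylinder S (?v, [])" for \<eta>
        using cyl_v[of \<eta>] that neq by (auto simp: cylinder_iff)
      then have "?A = {\<eta> \<in> cylinder S (?v, []). \<forall>\<mu>\<in>insert \<mu> F. \<eta> \<in> cylinder S \<mu> \<longleftrightarrow> \<xi> \<in> cylinder S \<mu>}"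
        using False by auto
      then show ?thesis using A by simp
    qed
  qed
qed

end

context twisted_rep
begin

text \<open>The trace on \<open>Y\<close> of the neighbourhood filter of a point.\<close>

definition near :: "('g, 'e) xpath \<Rightarrow> ('g, 'e) xpath filter" where
  "near \<xi> = (INF F\<in>{F. finite F \<and> F \<subseteq> paths S}.
     principal {\<eta> \<in> Y. \<forall>\<mu>\<in>F. \<eta> \<in> cylinder S \<mu> \<longleftrightarrow> \<xi> \<in> cylinder S \<mu>})"

lemma eventually_near:
  "eventually P (near \<xi>) \<longleftrightarrow> (\<exists>F. finite F \<and> F \<subseteq> paths S \<and>
     (\<forall>\<eta>\<in>Y. (\<forall>\<mu>\<in>F. \<eta> \<in> cylinder S \<mu> \<longleftrightarrow> \<xi> \<in> cylinder S \<mu>) \<longrightarrow> P \<eta>))"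
proof -
  let ?G = "\<lambda>F. principal {\<eta> \<in> Y. \<forall>\<mu>\<in>F. \<eta> \<in> cylinder S \<mu> \<longleftrightarrow> \<xi> \<in> cylinder S \<mu>}"
  have "eventually P (INF F\<in>{F. finite F \<and> F \<subseteq> paths S}. ?G F) \<longleftrightarrow>
      (\<exists>F\<in>{F. finite F \<and> F \<subseteq> paths S}. eventually P (?G F))"
  proof (rule eventually_INF_base)
    show "{F. finite F \<and> F \<subseteq> paths S} \<noteq> {}" by auto
    fix F F' assume "F \<in> {F. finite F \<and> F \<subseteq> paths S}" "F' \<in> {F. finite F \<and> F \<subseteq> paths S}"
    then show "\<exists>G\<in>{F. finite F \<and> F \<subseteq> paths S}. ?G G \<le> inf (?G F) (?G F')"
      by (intro bexI[of _ "F \<union> F'"]) auto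
  qed
  then show ?thesis by (auto simp: near_def eventually_principal)
qed

lemma eventually_near_Y: "eventually (\<lambda>\<eta>. \<eta> \<in> Y) (near \<xi>)"
  unfolding eventually_near by (intro exI[of _ "{}"]) auto

lemma eventually_near_cylinder:
  "\<mu> \<in> paths S \<Longrightarrow> eventually (\<lambda>\<eta>. \<eta> \<in> cylinder S \<mu> \<longleftrightarrow> \<xi> \<in> cylinder S \<mu>) (near \<xi>)"
  unfolding eventually_near by (intro exI[of _ "{\<mu>}"]) auto

lemma eventually_near_cylinder':
  "eventually (\<lambda>\<eta>. \<eta> \<in> cylinder S \<mu> \<longleftrightarrow> \<xi> \<in> cylinder S \<mu>) (near \<xi>)"
proof (cases "\<mu> \<in> paths S")
  case False
  then have "\<eta> \<notin> cylinder S \<mu>" for \<eta> using pre_paths by (metis cylinder_iff)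
  then show ?thesis by simp
qed (rule eventually_near_cylinder)

lemma eventually_near_self: "eventually P (near \<xi>) \<Longrightarrow> \<xi> \<in> Y \<Longrightarrow> P \<xi>"
  unfolding eventually_near by blast

lemma eventually_trivial_at:
  assumes "cond_Fin S" "l \<in> Grp S"
  shows "eventually (\<lambda>\<eta>. trivial_at l \<beta> \<eta> \<longleftrightarrow> trivial_at l \<beta> \<xi>) (near \<xi>)"
proof -
  let ?M = "{\<mu>. minimal_strongly_fixed S l \<mu>}"
  have "finite ?M" using assms by (simp add: cond_Fin_def)
  then have "eventually (\<lambda>\<eta>. \<forall>\<mu>\<in>?M. \<eta> \<in> cylinder S (pcat \<beta> \<mu>) \<longleftrightarrow> \<xi> \<in> cylinder S (pcat \<beta> \<mu>)) (near \<xi>)"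
    by (intro eventually_ball_finite) (auto intro: eventually_near_cylinder')
  then show ?thesis
    by eventually_elim (auto simp: trivial_at_iff_minimal)
qed

text \<open>Germs over the same right path differ either by their left paths, then at every source,
  or by nontriviality of one groupoid element, which persists near \<open>\<xi>\<close> by
  (Fin).\<close>

lemma eventually_germ_neq:
  assumes Fin: "cond_Fin S" and p: "(\<alpha>, h, \<beta>, \<xi>) \<in> germ_reps S" and q: "(\<gamma>, k, \<beta>, \<xi>) \<in> germ_reps S"
    and neq: "germ_of S (\<alpha>, h, \<beta>, \<xi>) \<noteq> germ_of S (\<gamma>, k, \<beta>, \<xi>)"
  shows "eventually (\<lambda>\<eta>. (\<alpha>, h, \<beta>, \<eta>) \<in> germ_reps S \<and> (\<gamma>, k, \<beta>, \<eta>) \<in> germ_reps S \<and>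
    germ_of S (\<alpha>, h, \<beta>, \<eta>) \<noteq> germ_of S (\<gamma>, k, \<beta>, \<eta>)) (near \<xi>)"
proof -
  let ?l = "gmult S (ginv S h) k"
  have c: "eventually (\<lambda>\<eta>. \<eta> \<in> cylinder S \<beta> \<longleftrightarrow> \<xi> \<in> cylinder S \<beta>) (near \<xi>)" by (rule eventually_near_cylinder')
  have P: "h \<in> Grp S" "k \<in> Grp S" "grng S h = psrc S \<alpha>" "grng S k = psrc S \<gamma>" using p q by (auto simp: germ_reps_iff)
  have reps: "(\<alpha>, h, \<beta>, \<eta>) \<in> germ_reps S" "(\<gamma>, k, \<beta>, \<eta>) \<in> germ_reps S"
    if "\<eta> \<in> cylinder S \<beta> \<longleftrightarrow> \<xi> \<in> cylinder S \<beta>" for \<eta> using that p q by (auto simp: germ_reps_iff)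
  show ?thesis
  proof (cases "\<alpha> = \<gamma>")
    case False
    show ?thesis using c
      by eventually_elim (use reps germ_of_eq_iff_trivial False in blast)
  next
    case True
    have l: "?l \<in> Grp S" using P True by (intro gmult_closed) (auto simp: ginv_closed gsrc_ginv)
    have "\<not> trivial_at ?l \<beta> \<xi>" using neq germ_of_eq_iff_trivial[OF p q] True by blast
    with eventually_trivial_at[OF Fin l, of \<beta> \<xi>]
    have "eventually (\<lambda>\<eta>. \<not> trivial_at ?l \<beta> \<eta>) (near \<xi>)" by simp
    with c show ?thesis
      by eventually_elim (use reps germ_of_eq_iff_trivial in blast)
  qed
qed

subsection \<open>Separation of germs\<close>

lemma topspace_toeplitz: "topspace (toeplitz_topology S) = toeplitz_groupoid S"
proof
  show "topspace (toeplitz_topology S) \<subseteq> toeplitz_groupoid S"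
    unfolding toeplitz_topology_def topology_generated_by_topspace toeplitz_groupoid_eq
    by (auto simp: germ_reps_def)
  show "toeplitz_groupoid S \<subseteq> topspace (toeplitz_topology S)"
  proof
    fix x assume "x \<in> toeplitz_groupoid S"
    then obtain \<alpha> g \<beta> \<xi> where p: "x = germ_of S (\<alpha>, g, \<beta>, \<xi>)" "(\<alpha>, g, \<beta>, \<xi>) \<in> germ_reps S"
      unfolding toeplitz_groupoid_eq by (metis imageE prod_cases4)
    have r: "\<alpha> \<in> paths S" "g \<in> Grp S" "\<beta> \<in> paths S" "grng S g = psrc S \<alpha>" "gsrc S g = psrc S \<beta>" "\<xi> \<in> cylinder S \<beta>"
      using p by (auto simp: germ_reps_iff)
    have "openin (path_topology S) (cylinder S \<beta> - (\<Union>\<mu>\<in>{}. cylinder S (pcat \<beta> \<mu>)))"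
      unfolding path_topology_def using r by (intro topology_generated_by_Basis) blast
    then have V: "openin (path_topology S) (cylinder S \<beta>)" by simp
    have "openin (toeplitz_topology S) {germ_of S (\<alpha>, g, \<beta>, \<eta>) | \<eta>. \<eta> \<in> cylinder S \<beta>}"
      unfolding toeplitz_topology_def using r V by (intro topology_generated_by_Basis) blast
    then show "x \<in> topspace (toeplitz_topology S)" using p r openin_subset by blast
  qed
qed

lemma openin_bisection:
  assumes "(\<alpha>, g, \<beta>, \<xi>) \<in> reps" "eventually P (near \<xi>)"
  obtains U where "openin (subtopology (toeplitz_topology S) X) U" "germ_of S (\<alpha>, g, \<beta>, \<xi>) \<in> U"
    "\<And>x. x \<in> U \<Longrightarrow> \<exists>\<eta>. P \<eta> \<and> (\<alpha>, g, \<beta>, \<eta>) \<in> reps \<and> x = germ_of S (\<alpha>, g, \<beta>, \<eta>)"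
proof -
  have r: "\<alpha> \<in> paths S" "g \<in> Grp S" "\<beta> \<in> paths S" "grng S g = psrc S \<alpha>" "gsrc S g = psrc S \<beta>" "\<xi> \<in> cylinder S \<beta>" "\<xi> \<in> Y"
    using assms by (auto simp: reps_iff)
  have ps: "\<xi> \<in> path_space S" using r by (simp add: cylinder_iff)
  obtain F where F: "finite F" "F \<subseteq> paths S"
    "\<And>\<eta>. \<eta> \<in> Y \<Longrightarrow> (\<forall>\<mu>\<in>F. \<eta> \<in> cylinder S \<mu> \<longleftrightarrow> \<xi> \<in> cylinder S \<mu>) \<Longrightarrow> P \<eta>"
    using assms(2) unfolding eventually_near by blast
  let ?F = "insert \<beta> F"
  let ?V = "{\<eta> \<in> cylinder S (fst (pre S \<xi> 0), []). \<forall>\<mu>\<in>?F. \<eta> \<in> cylinder S \<mu> \<longleftrightarrow> \<xi> \<in> cylinder S \<mu>}"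
  have V: "openin (path_topology S) ?V" using F r ps by (intro openin_agree) auto
  have sub: "?V \<subseteq> cylinder S \<beta>" using r by auto
  let ?U = "{germ_of S (\<alpha>, g, \<beta>, \<eta>) | \<eta>. \<eta> \<in> ?V}"
  have "openin (toeplitz_topology S) ?U"
    unfolding toeplitz_topology_def using r V sub by (intro topology_generated_by_Basis) blast
  then have "openin (subtopology (toeplitz_topology S) X) (?U \<inter> X)" by (auto simp: openin_subtopology)
  moreover have "germ_of S (\<alpha>, g, \<beta>, \<xi>) \<in> ?U \<inter> X"
  proof
    have "\<xi> \<in> ?V" using ps by (simp add: vertex_cylinder)
    then show "germ_of S (\<alpha>, g, \<beta>, \<xi>) \<in> ?U" by blast
    show "germ_of S (\<alpha>, g, \<beta>, \<xi>) \<in> X" using germ_in_X[OF reps_germ_reps[OF assms(1)]] assms(1) by blast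
  qed
  moreover have "\<exists>\<eta>. P \<eta> \<and> (\<alpha>, g, \<beta>, \<eta>) \<in> reps \<and> x = germ_of S (\<alpha>, g, \<beta>, \<eta>)" if x: "x \<in> ?U \<inter> X" for x
  proof -
    obtain \<eta> where \<eta>: "\<eta> \<in> ?V" "x = germ_of S (\<alpha>, g, \<beta>, \<eta>)" using x by blast
    have "(\<alpha>, g, \<beta>, \<eta>) \<in> germ_reps S" using r \<eta> sub by (auto simp: germ_reps_iff)
    moreover have "germ_of S (\<alpha>, g, \<beta>, \<eta>) \<in> X" using x \<eta>(2) by simp
    ultimately have "(\<alpha>, g, \<beta>, \<eta>) \<in> reps" using germ_in_X by blast
    then show ?thesis using F(3)[of \<eta>] \<eta> by (auto simp: reps_iff)
  qed
  ultimately show thesis by (rule that)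
qed

text \<open>Germs with different sources are separated by a cylinder. For a common source both are
  refined to the same right path; germs of the two basic sets over the same nearby source then
  differ, while a germ in both sets would have one source.\<close>

lemma hausdorff_points_X:
  assumes Fin: "cond_Fin S"
  shows "hausdorff_points (subtopology (toeplitz_topology S) X) = X"
proof -
  let ?T = "subtopology (toeplitz_topology S) X"
  have top: "topspace ?T = X" using X_subset by (auto simp: topspace_toeplitz)
  have "\<exists>U V. openin ?T U \<and> openin ?T V \<and> x \<in> U \<and> y \<in> V \<and> U \<inter> V = {}"
    if xy: "x \<in> X" "y \<in> X" "y \<noteq> x" for x y
  proof -
    obtain p where p: "p \<in> reps" "x = germ_of S p" using xy(1) by (rule X_E)
    obtain q where q: "q \<in> reps" "y = germ_of S q" using xy(2) by (rule X_E)
    show ?thesis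
    proof (cases "rep_source p = rep_source q")
      case False
      obtain \<alpha> h \<beta> \<xi> where pp: "p = (\<alpha>, h, \<beta>, \<xi>)" by (cases p)
      obtain \<gamma> k \<delta> \<eta> where qq: "q = (\<gamma>, k, \<delta>, \<eta>)" by (cases q)
      have "\<xi> \<noteq> \<eta>" using False pp qq by simp
      moreover have "\<xi> \<in> path_space S" "\<eta> \<in> path_space S" using p q pp qq by (auto simp: reps_iff cylinder_iff)
      ultimately obtain \<mu> where \<mu>: "\<mu> \<in> paths S" "(\<xi> \<in> cylinder S \<mu>) \<noteq> (\<eta> \<in> cylinder S \<mu>)"
        using path_space_separated by blast
      obtain U where U: "openin ?T U" "x \<in> U"
        "\<And>z. z \<in> U \<Longrightarrow> \<exists>\<zeta>. (\<zeta> \<in> cylinder S \<mu> \<longleftrightarrow> \<xi> \<in> cylinder S \<mu>) \<and> (\<alpha>, h, \<beta>, \<zeta>) \<in> reps \<and> z = germ_of S (\<alpha>, h, \<beta>, \<zeta>)"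
        using openin_bisection[OF p(1)[unfolded pp] eventually_near_cylinder[OF \<mu>(1)]] p(2) pp by metis
      obtain V where V: "openin ?T V" "y \<in> V"
        "\<And>z. z \<in> V \<Longrightarrow> \<exists>\<zeta>. (\<zeta> \<in> cylinder S \<mu> \<longleftrightarrow> \<eta> \<in> cylinder S \<mu>) \<and> (\<gamma>, k, \<delta>, \<zeta>) \<in> reps \<and> z = germ_of S (\<gamma>, k, \<delta>, \<zeta>)"
        using openin_bisection[OF q(1)[unfolded qq] eventually_near_cylinder[OF \<mu>(1)]] q(2) qq by metis
      have "U \<inter> V = {}"
      proof (rule ccontr)
        assume "U \<inter> V \<noteq> {}"
        then obtain z where z: "z \<in> U" "z \<in> V" by blast
        obtain \<zeta> where 1: "\<zeta> \<in> cylinder S \<mu> \<longleftrightarrow> \<xi> \<in> cylinder S \<mu>" "(\<alpha>, h, \<beta>, \<zeta>) \<in> reps" "z = germ_of S (\<alpha>, h, \<beta>, \<zeta>)"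
          using U(3)[OF z(1)] by blast
        obtain \<zeta>' where 2: "\<zeta>' \<in> cylinder S \<mu> \<longleftrightarrow> \<eta> \<in> cylinder S \<mu>" "(\<gamma>, k, \<delta>, \<zeta>') \<in> reps" "z = germ_of S (\<gamma>, k, \<delta>, \<zeta>')"
          using V(3)[OF z(2)] by blast
        have "\<zeta> = \<zeta>'"
          using germ_of_source[OF reps_germ_reps[OF 1(2)] reps_germ_reps[OF 2(2)]] 1(3) 2(3) by simp
        then show False using 1(1) 2(1) \<mu>(2) by blast
      qed
      then show ?thesis using U V by blast
    next
      case True
      obtain n where n: "refinable p n" using refinable_self reps_germ_reps[OF p(1)] by (cases p) blast
      obtain m where m: "refinable q m" using refinable_self reps_germ_reps[OF q(1)] by (cases q) blast
      have "reaches (rep_source p) (max n m)"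
        using refinable_reaches[OF n] refinable_reaches[OF m] True by (simp add: max_def)
      then have N: "refinable p (max n m)" "refinable q (max n m)"
        using refinable_mono[OF n, of "max n m"] refinable_mono[OF m, of "max n m"] True by auto
      obtain \<alpha> h \<beta> \<xi> where pp: "refine S p (max n m) = (\<alpha>, h, \<beta>, \<xi>)" by (cases "refine S p (max n m)")
      obtain \<gamma> k where qq: "refine S q (max n m) = (\<gamma>, k, \<beta>, \<xi>)"
        using pp True by (cases p; cases q) (auto simp: Let_def)
      have r: "(\<alpha>, h, \<beta>, \<xi>) \<in> reps" "(\<gamma>, k, \<beta>, \<xi>) \<in> reps"
        using refine_reps[OF p(1) N(1)] refine_reps[OF q(1) N(2)] pp qq by auto
      have g: "x = germ_of S (\<alpha>, h, \<beta>, \<xi>)" "y = germ_of S (\<gamma>, k, \<beta>, \<xi>)"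
        using germ_of_refine[OF reps_germ_reps[OF p(1)] N(1)] germ_of_refine[OF reps_germ_reps[OF q(1)] N(2)] p q pp qq by auto
      have ev: "eventually (\<lambda>\<eta>. germ_of S (\<alpha>, h, \<beta>, \<eta>) \<noteq> germ_of S (\<gamma>, k, \<beta>, \<eta>)) (near \<xi>)"
      proof -
        have "germ_of S (\<alpha>, h, \<beta>, \<xi>) \<noteq> germ_of S (\<gamma>, k, \<beta>, \<xi>)" using xy(3) g by metis
        from eventually_germ_neq[OF Fin reps_germ_reps[OF r(1)] reps_germ_reps[OF r(2)] this]
        show ?thesis by (rule eventually_mono) blast
      qed
      obtain U where U: "openin ?T U" "x \<in> U"
        "\<And>z. z \<in> U \<Longrightarrow> \<exists>\<eta>. germ_of S (\<alpha>, h, \<beta>, \<eta>) \<noteq> germ_of S (\<gamma>, k, \<beta>, \<eta>) \<and> (\<alpha>, h, \<beta>, \<eta>) \<in> reps \<and> z = germ_of S (\<alpha>, h, \<beta>, \<eta>)"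
        using openin_bisection[OF r(1) ev] g(1) by metis
      obtain V where V: "openin ?T V" "y \<in> V"
        "\<And>z. z \<in> V \<Longrightarrow> \<exists>\<eta>. germ_of S (\<alpha>, h, \<beta>, \<eta>) \<noteq> germ_of S (\<gamma>, k, \<beta>, \<eta>) \<and> (\<gamma>, k, \<beta>, \<eta>) \<in> reps \<and> z = germ_of S (\<gamma>, k, \<beta>, \<eta>)"
        using openin_bisection[OF r(2) ev] g(2) by metis
      have "U \<inter> V = {}"
      proof (rule ccontr)
        assume "U \<inter> V \<noteq> {}"
        then obtain z where z: "z \<in> U" "z \<in> V" by blast
        obtain \<eta> where 1: "germ_of S (\<alpha>, h, \<beta>, \<eta>) \<noteq> germ_of S (\<gamma>, k, \<beta>, \<eta>)" "(\<alpha>, h, \<beta>, \<eta>) \<in> reps" "z = germ_of S (\<alpha>, h, \<beta>, \<eta>)"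
          using U(3)[OF z(1)] by blast
        obtain \<eta>' where 2: "(\<gamma>, k, \<beta>, \<eta>') \<in> reps" "z = germ_of S (\<gamma>, k, \<beta>, \<eta>')"
          using V(3)[OF z(2)] by blast
        have "\<eta> = \<eta>'"
          using germ_of_source[OF reps_germ_reps[OF 1(2)] reps_germ_reps[OF 2(1)]] 1(3) 2(2) by simp
        then show False using 1 2 by blast
      qed
      then show ?thesis using U V by blast
    qed
  qed
  then show ?thesis unfolding hausdorff_points_def top by blast
qed

lemma restrict_op_on_X: "on_X A \<Longrightarrow> restrict_op X A = A"
  by (rule clinear_op_eqI) (auto simp: restrict_op_def proj_ket on_X_ket on_X_clinear intro: clinear_op_comp)

text \<open>Once all germs are Hausdorff points, the canonical map restricts to \<open>X\<close>
  itself, which is the identity on operators that already live there.\<close>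

lemma cstar_isomorphism_restrict: "cstar_isomorphism (restrict_op X) (B k) (B k)"
proof -
  have id: "restrict_op X b = b" if "b \<in> B k" for b using that on_X_B restrict_op_on_X by blast
  have "bij_betw (restrict_op X) (B k) (B k)"
    using bij_betw_cong[of "B k" "restrict_op X" id "B k"] id by (simp add: bij_betw_id_iff)
  then show ?thesis
    unfolding cstar_isomorphism_def using cstar_B[of k] id cstar_algebraD[OF cstar_B[of k]] by simp
qed

end

section \<open>The conditional expectation\<close>

lemma pinch_add: "pinch (a + b) = pinch a + pinch b"
  by (rule diagonal_eqI) (auto simp: pinch diagonal_add)

lemma pinch_oscale: "pinch (oscale c a) = oscale c (pinch a)"
  by (rule diagonal_eqI) (auto simp: pinch diagonal_oscale)

lemma pinch_diagonal: "diagonal a \<Longrightarrow> pinch a = a"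
  by (rule diagonal_eqI) (auto simp: pinch)

lemma pinch_diff: "pinch (a - b) = pinch a - pinch b"
  using pinch_add[of "a - b" b] by simp

lemma pinch_zero [simp]: "pinch 0 = 0"
  by (simp add: pinch_diagonal)

lemma tendsto_pinch:
  assumes "f \<longlonglongrightarrow> x"
  shows "(\<lambda>n. pinch (f n)) \<longlonglongrightarrow> pinch x"
proof (rule LIM_zero_cancel, rule Lim_null_comparison)
  show "\<forall>\<^sub>F n in sequentially. norm (pinch (f n) - pinch x) \<le> norm (f n - x)"
    by (simp add: pinch_diff[symmetric] pinch(2))
  show "(\<lambda>n. norm (f n - x)) \<longlonglongrightarrow> 0"
    using assms by (simp add: LIM_zero_iff tendsto_norm_zero_iff)
qed

text \<open>By polynomial approximation of the square root function.\<close>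

lemma sqrt_of_diagonal:
  fixes A :: "'a oper set"
  assumes A: "cstar_algebra A" and d: "d \<in> A" "diagonal d"
    and pos: "\<And>x. entry d x x = of_real (r x)" "\<And>x. r x \<ge> 0"
  obtains s where "s \<in> A" "adj s o\<^sub>L s = d"
proof -
  define M where "M = norm d"
  have r: "r x \<le> M" for x
    using norm_entry_le[of d x x] pos unfolding M_def by simp
  have M: "M \<ge> 0" by (simp add: M_def)
  have "cmod (of_real (sqrt (r x))) \<le> sqrt M" for x using r pos(2) by simp
  then obtain s where s: "diagonal s" "\<And>x. entry s x x = of_real (sqrt (r x))"
    using diag_op_exists[of "\<lambda>x. of_real (sqrt (r x))" "sqrt M"] by blast
  \<comment> \<open>\<open>pw i\<close> is the power of \<open>d\<close> with exponent
    \<open>Suc i\<close>; the power zero is avoided because \<open>A\<close> need not contain the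
    identity.\<close>
  define pw where "pw i = ((\<lambda>y. d o\<^sub>L y) ^^ i) d" for i
  have pw: "pw i \<in> A \<and> diagonal (pw i) \<and> (\<forall>x. entry (pw i) x x = of_real (r x) ^ Suc i)" for i
  proof (induction i)
    case (Suc i)
    have "pw (Suc i) = d o\<^sub>L pw i" by (simp add: pw_def)
    then show ?case
      using Suc d cstar_algebraD(4)[OF A] pos(1) diagonal_comp[OF d(2)] entry_comp_diagonal_left[OF _ d(2), of "pw i"]
      by (simp add: diagonal_def)
  qed (use d pos in \<open>simp add: pw_def\<close>)
  have "s \<in> A"
  proof -
    have "\<exists>q\<in>A. dist q s < e" if e: "e > 0" for e
    proof -
      obtain g where g: "polynomial_function g" "\<And>t. t \<in> {0..M} \<Longrightarrow> norm (sqrt t - g t) < e / 4"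
      proof -
        have "continuous_on {0..M} sqrt" by (intro continuous_intros)
        then have "\<exists>g. polynomial_function g \<and> (\<forall>t\<in>{0..M}. norm (sqrt t - g t) < e / 4)"
          using e by (intro Stone_Weierstrass_polynomial_function) auto
        then show thesis using that by blast
      qed
      have "real_polynomial_function g" using g(1) by (simp add: real_polynomial_function_eq)
      then obtain a n where a: "g = (\<lambda>t. \<Sum>i\<le>n. a i * t ^ i)"
        unfolding real_polynomial_function_iff_sum by blast
      \<comment> \<open>The constant term of the polynomial is dropped to stay inside
        \<open>A\<close>. Since the square root vanishes at 0, the value \<open>g 0\<close> is
        itself below \<open>e / 4\<close>, so the two errors add up to at most
        \<open>e / 2\<close>.\<close>
      define q where "q = (\<Sum>i<n. oscale (of_real (a (Suc i))) (pw i))"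
      have qA: "q \<in> A" unfolding q_def using pw cstar_algebraD(8)[OF A] by (intro cstar_algebra_sum[OF A]) blast
      have dq: "diagonal q" unfolding q_def using pw
        by (induction n) (auto intro: diagonal_add diagonal_oscale)
      have eq: "entry q x x = of_real (g (r x) - g 0)" for x
      proof -
        have "g t - g 0 = (\<Sum>i<n. a (Suc i) * t ^ Suc i)" for t
          unfolding a by (simp add: sum.atMost_shift)
        moreover have "entry q x x = (\<Sum>i<n. of_real (a (Suc i)) * of_real (r x) ^ Suc i)"
          unfolding q_def using pw by simp
        ultimately show ?thesis by simp
      qed
      have "norm (q - s) \<le> e / 2"
      proof (rule norm_diagonal_le)
        show "diagonal (q - s)"
          using diagonal_add[OF dq diagonal_oscale[OF s(1), of "-1"]] by (simp add: oper.scale_minus_left)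
        fix x
        have "entry (q - s) x x = of_real (g (r x) - g 0 - sqrt (r x))" by (simp add: eq s(2))
        then have "cmod (entry (q - s) x x) = \<bar>g (r x) - g 0 - sqrt (r x)\<bar>" by (simp only: norm_of_real)
        moreover have "\<bar>sqrt (r x) - g (r x)\<bar> < e / 4" using g(2)[of "r x"] r pos(2) by simp
        moreover have "\<bar>g 0\<bar> < e / 4" using g(2)[of 0] M by simp
        ultimately show "cmod (entry (q - s) x x) \<le> e / 2" by linarith
      qed
      then show ?thesis using qA e by (intro bexI[of _ q]) (auto simp: dist_norm)
    qed
    then have "s \<in> closure A" by (simp add: closure_approachable)
    then show ?thesis using cstar_algebraD(3)[OF A] by simp
  qed
  moreover have "adj s o\<^sub>L s = d"
  proof (rule diagonal_eqI)
    show "diagonal (adj s o\<^sub>L s)" "diagonal d" using s d by (auto intro: diagonal_comp diagonal_adj)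
    show "entry (adj s o\<^sub>L s) x x = entry d x x" for x
    proof -
      have cs: "clinear_op s" using s(1) by (simp add: diagonal_def)
      have sq: "sqrt (r x) * sqrt (r x) = r x" using pos(2) by simp
      have "entry (adj s o\<^sub>L s) x x = of_real (sqrt (r x)) * of_real (sqrt (r x))"
        using entry_comp_diagonal_right[OF clinear_op_adj[OF cs] s(1), of x x] s(2)[of x] cs by simp
      also have "\<dots> = of_real (sqrt (r x) * sqrt (r x))" by (simp only: of_real_mult)
      finally show ?thesis unfolding sq pos(1) .
    qed
  qed
  ultimately show thesis by (rule that)
qed

context twisted_rep
begin

section \<open>Diagonal entries of monomials\<close>

lemma N_apply:
  assumes m: "matched \<alpha> g \<beta>" and r: "(pcat \<beta> \<kappa>, h, \<delta>, \<xi>) \<in> reps" and \<kappa>: "\<kappa> \<in> paths S" "prng \<kappa> = psrc S \<beta>"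
  shows "blinfun_apply (N \<alpha> g \<beta>) (delta S (pcat \<beta> \<kappa>, h, \<delta>, \<xi>)) =
      cscale (ptw S g \<kappa> * twG S (psect S g \<kappa>) h) (delta S (pcat \<alpha> (pact S g \<kappa>), gmult S (psect S g \<kappa>) h, \<delta>, \<xi>))"
    "(pcat \<alpha> (pact S g \<kappa>), gmult S (psect S g \<kappa>) h, \<delta>, \<xi>) \<in> reps"
    "cmod (ptw S g \<kappa> * twG S (psect S g \<kappa>) h) = 1"
proof -
  note d = matchedD[OF m]
  have r0: "(\<kappa>, h, \<delta>, \<xi>) \<in> reps" using reps_pcatD[OF r d(3) \<kappa>] .
  have g: "gsrc S g = prng \<kappa>" using d \<kappa> by simp
  have r1: "(pact S g \<kappa>, gmult S (psect S g \<kappa>) h, \<delta>, \<xi>) \<in> reps" using W_reps[OF d(2) r0 g] .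
  have p: "psrc S \<alpha> = prng (pact S g \<kappa>)" using d by (simp add: pact_def prng_def)
  show "blinfun_apply (N \<alpha> g \<beta>) (delta S (pcat \<beta> \<kappa>, h, \<delta>, \<xi>)) =
      cscale (ptw S g \<kappa> * twG S (psect S g \<kappa>) h) (delta S (pcat \<alpha> (pact S g \<kappa>), gmult S (psect S g \<kappa>) h, \<delta>, \<xi>))"
    using adj_Tp_delta[OF r d(3) \<kappa>] W_delta[OF d(2) r0] Tp_delta[OF d(1) r1] g p d
    by (simp add: N_def clinear_opD)
  show "(pcat \<alpha> (pact S g \<kappa>), gmult S (psect S g \<kappa>) h, \<delta>, \<xi>) \<in> reps" using Tp_reps[OF d(1) r1 p] .
  show "cmod (ptw S g \<kappa> * twG S (psect S g \<kappa>) h) = 1" using W_phase_circle[OF d(2) r0 g] .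
qed

lemma N_apply_zero:
  assumes "matched \<alpha> g \<beta>" "p \<in> reps" "rep_range S p \<notin> cylinder S \<beta>"
  shows "blinfun_apply (N \<alpha> g \<beta>) (delta S p) = 0"
  using adj_Tp_delta_zero[OF assms(2) matchedD(3)[OF assms(1)] assms(3)] by (simp add: N_def)

lemma cinner_delta:
  assumes "p \<in> germ_reps S" "q \<in> germ_reps S"
  shows "germ_of S p \<noteq> germ_of S q \<Longrightarrow> cinner (delta S p) (delta S q) = 0" "cinner (delta S p) (delta S p) = 1"
proof -
  obtain c where c: "delta S p = cscale c (ket (germ_of S p))" using delta_ket[OF assms(1)] by metis
  obtain d where d: "delta S q = cscale d (ket (germ_of S q))" using delta_ket[OF assms(2)] by metis
  show "germ_of S p \<noteq> germ_of S q \<Longrightarrow> cinner (delta S p) (delta S q) = 0"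
    by (simp add: c d cinner_cscale_left cinner_cscale_right coef_ket)
  show "cinner (delta S p) (delta S p) = 1" by (simp add: cinner_self norm_delta[OF assms(1)])
qed

lemma entry_delta:
  assumes "clinear_op A" "p \<in> germ_reps S" "q \<in> germ_reps S"
  shows "cmod (entry A (germ_of S q) (germ_of S p)) = cmod (cinner (delta S q) (blinfun_apply A (delta S p)))"
    "entry A (germ_of S p) (germ_of S p) = cinner (delta S p) (blinfun_apply A (delta S p))"
proof -
  obtain c where c: "cmod c = 1" "delta S p = cscale c (ket (germ_of S p))" using delta_ket[OF assms(2)] .
  obtain d where d: "cmod d = 1" "delta S q = cscale d (ket (germ_of S q))" using delta_ket[OF assms(3)] .
  show "cmod (entry A (germ_of S q) (germ_of S p)) = cmod (cinner (delta S q) (blinfun_apply A (delta S p)))"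
    using c d assms(1) by (simp add: entry_def clinear_opD cinner_cscale_left cinner_cscale_right norm_mult)
  have "c * cnj c = 1" using c(1) by (rule unimodular_cnj)
  then have "c * (cnj c * z) = z" for z by (simp add: mult.assoc[symmetric])
  then show "entry A (germ_of S p) (germ_of S p) = cinner (delta S p) (blinfun_apply A (delta S p))"
    using assms(1) unfolding c(2) by (simp add: entry_def clinear_opD cinner_cscale_left cinner_cscale_right)
qed

text \<open>The hypothesis \<open>eq\<close> says that a monomial sends a germ to itself. At a
  common refinement with source segment \<open>?w\<close>, the element \<open>g\<close> fixes
  \<open>\<kappa>\<close> followed by the image of \<open>?w\<close> under \<open>h\<close>, and
  cancelling in the groupoid shows that it restricts to a unit there. Behind \<open>\<alpha>\<close>
  this path is a prefix of the range of the germ.\<close>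

lemma strongly_fixed_of_germ_eq:
  assumes g: "g \<in> Grp S" and \<alpha>: "\<alpha> \<in> paths S" "grng S g = psrc S \<alpha>" "gsrc S g = psrc S \<alpha>"
    and \<kappa>: "\<kappa> \<in> paths S" "prng \<kappa> = psrc S \<alpha>"
    and p: "(pcat \<alpha> \<kappa>, h, \<delta>, \<xi>) \<in> germ_reps S"
    and q: "(pcat \<alpha> (pact S g \<kappa>), gmult S (psect S g \<kappa>) h, \<delta>, \<xi>) \<in> germ_reps S"
    and eq: "germ_of S (pcat \<alpha> (pact S g \<kappa>), gmult S (psect S g \<kappa>) h, \<delta>, \<xi>) = germ_of S (pcat \<alpha> \<kappa>, h, \<delta>, \<xi>)"
  shows "\<exists>\<mu>. strongly_fixed S g \<mu> \<and> rep_range S (pcat \<alpha> \<kappa>, h, \<delta>, \<xi>) \<in> cylinder S (pcat \<alpha> \<mu>)"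
proof -
  obtain v ks where kk: "\<kappa> = (v, ks)" by fastforce
  have v: "gsrc S g = v" "walk S (gsrc S g) ks" using \<alpha> \<kappa> kk by auto
  note l = walk_act_list[OF g v(2)]
  let ?k = "sect_list S g ks"
  have H: "h \<in> Grp S" "gsrc S h = psrc S \<delta>" "grng S h = psrc S (pcat \<alpha> \<kappa>)" "\<xi> \<in> cylinder S \<delta>"
    using p by (auto simp: germ_reps_iff)
  have "psrc S (pcat \<alpha> \<kappa>) = psrc S \<kappa>" using \<alpha> \<kappa> Tp_Tp(3) by metis
  then have kh: "gsrc S ?k = grng S h" using l H v kk by simp
  obtain n where n: "plen \<delta> \<le> n" "reaches \<xi> n"
    "refine S (pcat \<alpha> (pact S g \<kappa>), gmult S ?k h, \<delta>, \<xi>) n = refine S (pcat \<alpha> \<kappa>, h, \<delta>, \<xi>) n"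
    using eq unfolding germ_of_eq_iff[OF q p] by (auto simp: kk)
  let ?w = "drop (plen \<delta>) (snd (pre S \<xi> n))"
  have w: "walk S (gsrc S h) ?w" using cylinder_segment(2)[OF H(4) n(1)] H by simp
  note s = act_list_gmult[OF l(2) H(1) kh w] sect_list_gmult[OF l(2) H(1) kh w]
  note lh = walk_act_list[OF H(1) w]
  have w2: "walk S (gsrc S ?k) (act_list S h ?w)" using lh kh by simp
  note lk = walk_act_list[OF l(2) w2]
  have e: "act_list S g ks = ks" "act_list S ?k (act_list S h ?w) = act_list S h ?w"
    "gmult S (sect_list S ?k (act_list S h ?w)) (sect_list S h ?w) = sect_list S h ?w"
    using n(3) s by (simp_all add: Let_def pcat_def kk append_eq_append_conv)
  have gc: "gsrc S (sect_list S ?k (act_list S h ?w)) = grng S (sect_list S h ?w)" using lk lh kh by simp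
  have "sect_list S ?k (act_list S h ?w) = grng S (sect_list S h ?w)"
  proof -
    let ?a = "sect_list S ?k (act_list S h ?w)" and ?b = "sect_list S h ?w"
    have "gmult S (gmult S ?a ?b) (ginv S ?b) = gmult S ?a (gmult S ?b (ginv S ?b))"
      using lk lh gc by (intro gmult_assoc) (auto simp: ginv_closed grng_ginv)
    then show ?thesis using e(3) lh lk gc unit_right by (simp add: ginv_right) (metis unit_right)
  qed
  then have unit: "sect_list S g (ks @ act_list S h ?w) = psrc S (v, ks @ act_list S h ?w)"
    using lh H l kh v by (simp add: sect_list_append psrc_append)
  have "walk S v (ks @ act_list S h ?w)" using v lh l kh by (simp add: walk_append)
  then have "strongly_fixed S g (v, ks @ act_list S h ?w)"
    using v \<alpha> e unit by (simp add: strongly_fixed_iff act_list_append)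
  moreover have "rep_range S (pcat \<alpha> \<kappa>, h, \<delta>, \<xi>) \<in> cylinder S (pcat \<alpha> (v, ks @ act_list S h ?w))"
  proof -
    have ref: "refinable (pcat \<alpha> \<kappa>, h, \<delta>, \<xi>) n" using n by simp
    have f: "fst (refine S (pcat \<alpha> \<kappa>, h, \<delta>, \<xi>) n) = pcat \<alpha> (v, ks @ act_list S h ?w)"
      by (simp add: Let_def pcat_def kk)
    obtain k' \<delta>' \<xi>' where q': "refine S (pcat \<alpha> \<kappa>, h, \<delta>, \<xi>) n = (pcat \<alpha> (v, ks @ act_list S h ?w), k', \<delta>', \<xi>')"
      using f by (cases "refine S (pcat \<alpha> \<kappa>, h, \<delta>, \<xi>) n") auto
    have "(pcat \<alpha> (v, ks @ act_list S h ?w), k', \<delta>', \<xi>') \<in> germ_reps S" using refine_germ_reps[OF p ref] q' by simp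
    then have "rep_range S (pcat \<alpha> (v, ks @ act_list S h ?w), k', \<delta>', \<xi>') \<in> cylinder S (pcat \<alpha> (v, ks @ act_list S h ?w))"
      using rep_range_in_pcat[of "pcat \<alpha> (v, ks @ act_list S h ?w)" "(undefined, [])"] by (simp add: pcat_def)
    then show ?thesis using rep_range_refine[OF p ref] q' by simp
  qed
  ultimately show ?thesis by blast
qed

lemma N_strongly_fixed:
  assumes m: "matched \<alpha> g \<alpha>" and \<mu>: "strongly_fixed S g \<mu>" and p: "p \<in> reps" "rep_range S p \<in> cylinder S (pcat \<alpha> \<mu>)"
  shows "blinfun_apply (N \<alpha> g \<alpha>) (delta S p) = cscale (ptw S g \<mu>) (delta S p)"
proof -
  note d = matchedD[OF m]
  obtain v ms where mm: "\<mu> = (v, ms)" by fastforce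
  have sf: "walk S v ms" "v = gsrc S g" "grng S g = v" "act_list S g ms = ms" "sect_list S g ms = psrc S (v, ms)"
    using \<mu> mm by (auto simp: strongly_fixed_iff)
  obtain n \<kappa> h \<beta> where n: "refinable p n" "refine S p n = (pcat (pcat \<alpha> \<mu>) \<kappa>, h, \<beta>, rep_source p)"
    "\<kappa> \<in> paths S" "prng \<kappa> = psrc S (pcat \<alpha> \<mu>)"
    using rep_range_cylinderE[OF reps_germ_reps[OF p(1)] p(2)] by metis
  have src: "psrc S (pcat \<alpha> \<mu>) = psrc S \<mu>" 
  proof (rule Tp_Tp(3)[OF d(1)])
    show "\<mu> \<in> paths S" using sf(1) mm by simp
    show "psrc S \<alpha> = prng \<mu>" using sf(2) d(5) mm by simp
  qed
  obtain ks where kk: "\<kappa> = (psrc S \<mu>, ks)" using n(4) src by (cases \<kappa>) auto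
  have ks: "walk S (psrc S (v, ms)) ks" using n(3) kk mm by simp
  let ?\<kappa> = "(v, ms @ ks)"
  have k2: "?\<kappa> \<in> paths S" "prng ?\<kappa> = psrc S \<alpha>" using sf ks d by (auto simp: walk_append)
  have eq: "pcat (pcat \<alpha> \<mu>) \<kappa> = pcat \<alpha> ?\<kappa>" by (simp add: pcat_def kk mm)
  have r: "(pcat \<alpha> ?\<kappa>, h, \<beta>, rep_source p) \<in> reps" using refine_reps[OF p(1) n(1)] n(2) eq by simp
  have h: "h \<in> Grp S" "grng S h = psrc S (pcat \<alpha> ?\<kappa>)" using r by (auto simp: reps_iff)
  have u: "psect S g ?\<kappa> = psrc S ?\<kappa>" "pact S g ?\<kappa> = ?\<kappa>" "ptw S g ?\<kappa> = ptw S g \<mu>"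
    using sf act_list_unit[OF ks] twE_list_unit[OF ks]
    by (auto simp: mm sect_list_append act_list_append twE_list_append psrc_append)
  have "psrc S (pcat \<alpha> ?\<kappa>) = psrc S ?\<kappa>" using d k2 Tp_Tp(3) by metis
  then have uh: "gmult S (psrc S ?\<kappa>) h = h" "twG S (psrc S ?\<kappa>) h = 1"
    using h unit_left[of h] twG_unit_left[of h] by auto
  have "blinfun_apply (N \<alpha> g \<alpha>) (delta S (refine S p n)) = blinfun_apply (oscale (ptw S g \<mu>) id_blinfun) (delta S (refine S p n))"
    unfolding n(2) eq using N_apply(1)[OF m r k2] u uh by simp
  then have "blinfun_apply (N \<alpha> g \<alpha>) (delta S p) = blinfun_apply (oscale (ptw S g \<mu>) id_blinfun) (delta S p)"
    by (rule apply_delta_eq_refine[OF reps_germ_reps[OF p(1)] n(1) clinear_N[OF m] clinear_op_oscale[OF clinear_op_id]])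
  then show ?thesis by simp
qed

text \<open>Both are prefixes of one path behind \<open>\<alpha>\<close>, so one is a prefix of the
  other and minimality makes them equal. The cylinders of minimal strongly fixed paths are thus
  disjoint.\<close>

lemma minimal_unique:
  assumes "minimal_strongly_fixed S g \<mu>" "minimal_strongly_fixed S g \<nu>"
    "\<xi> \<in> cylinder S (pcat \<alpha> \<mu>)" "\<xi> \<in> cylinder S (pcat \<alpha> \<nu>)"
  shows "\<mu> = \<nu>"
proof -
  have *: "\<mu> = \<nu>"
    if m: "minimal_strongly_fixed S g \<mu>" "minimal_strongly_fixed S g \<nu>"
      "\<xi> \<in> cylinder S (pcat \<alpha> \<mu>)" "\<xi> \<in> cylinder S (pcat \<alpha> \<nu>)" and le: "plen \<mu> \<le> plen \<nu>" for \<mu> \<nu>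
  proof -
    have f: "strongly_fixed S g \<mu>" "strongly_fixed S g \<nu>" using m by (auto simp: minimal_strongly_fixed_def)
    then have v: "fst \<mu> = fst \<nu>" "\<mu> \<in> paths S" "\<nu> \<in> paths S" "prng \<nu> = gsrc S g"
      by (auto simp: strongly_fixed_def fixes_path_def prng_def)
    have le': "plen (pcat \<alpha> \<mu>) \<le> plen (pcat \<alpha> \<nu>)" using le by (simp add: plen_pcat)
    have "pre S \<xi> (plen (pcat \<alpha> \<mu>)) = pcat \<alpha> \<mu>" "pre S \<xi> (plen (pcat \<alpha> \<nu>)) = pcat \<alpha> \<nu>"
      using m(3,4) unfolding cylinder_iff by blast+
    with pre_take[OF le', of S \<xi>]
    have "pcat \<alpha> \<mu> = (fst (pcat \<alpha> \<nu>), take (plen (pcat \<alpha> \<mu>)) (snd (pcat \<alpha> \<nu>)))" by (simp only:)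
    from arg_cong[OF this, of snd]
    have "snd (pcat \<alpha> \<mu>) = take (plen (pcat \<alpha> \<mu>)) (snd (pcat \<alpha> \<nu>))" by (simp only: snd_conv)
    then have t: "snd \<mu> = take (plen \<mu>) (snd \<nu>)" by (simp add: plen_def pcat_def)
    define \<kappa> where "\<kappa> = (psrc S \<mu>, drop (plen \<mu>) (snd \<nu>))"
    have \<nu>: "\<nu> = pcat \<mu> \<kappa>" using t v(1) by (simp add: pcat_def \<kappa>_def prod_eq_iff)
    have "snd \<nu> = snd \<mu> @ drop (plen \<mu>) (snd \<nu>)" using t by (metis append_take_drop_id)
    then have "walk S (fst \<mu>) (snd \<mu> @ drop (plen \<mu>) (snd \<nu>))"
      using v(1,3) by (metis paths_iff prod.collapse)
    then have \<kappa>: "\<kappa> \<in> paths S" by (simp add: \<kappa>_def walk_append)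
    have "prng \<kappa> = psrc S \<mu>" by (simp add: \<kappa>_def)
    then have "pprefix S \<mu> \<nu>" unfolding pprefix_def using \<nu> \<kappa> by blast
    then show ?thesis using m(2) f(1) v(2) unfolding minimal_strongly_fixed_def by blast
  qed
  show ?thesis using *[OF assms] *[OF assms(2,1,4,3)] nat_le_linear[of "plen \<mu>" "plen \<nu>"] by blast
qed

text \<open>If \<open>\<alpha> \<noteq> \<beta>\<close>, a germ and its image have different left
  paths over the same right path, so the diagonal is zero. Otherwise it is the sum, over the minimal
  strongly fixed \<open>\<mu>\<close>, of the twist value times
  \<open>Q (pcat \<alpha> \<mu>)\<close>: (Fin) makes the sum finite, and disjoint cylinders make at
  most one term nonzero at each germ.\<close>

lemma pinch_N:
  assumes Fin: "cond_Fin S" and m: "matched \<alpha> g \<beta>"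
  shows "pinch (N \<alpha> g \<beta>) \<in> D"
proof -
  note d = matchedD[OF m]
  have cN: "clinear_op (N \<alpha> g \<beta>)" by (rule clinear_N[OF m])
  have off: "entry (N \<alpha> g \<beta>) x x = 0" if "x \<notin> X" for x
    using on_X_N[OF d(1,2,3)] that by (simp add: on_X_def)
  show ?thesis
  proof (cases "\<alpha> = \<beta>")
    case False
    have "entry (N \<alpha> g \<beta>) x x = 0" for x
    proof (cases "x \<in> X")
      case True
      then obtain p where p: "p \<in> reps" "x = germ_of S p" by (rule X_E)
      show ?thesis
      proof (cases "rep_range S p \<in> cylinder S \<beta>")
        case True
        obtain n \<kappa> h \<delta> where n: "refinable p n" "refine S p n = (pcat \<beta> \<kappa>, h, \<delta>, rep_source p)"
          "\<kappa> \<in> paths S" "prng \<kappa> = psrc S \<beta>"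
          using rep_range_cylinderE[OF reps_germ_reps[OF p(1)] True] by metis
        let ?p = "(pcat \<beta> \<kappa>, h, \<delta>, rep_source p)"
          and ?q = "(pcat \<alpha> (pact S g \<kappa>), gmult S (psect S g \<kappa>) h, \<delta>, rep_source p)"
        have r: "?p \<in> reps" using refine_reps[OF p(1) n(1)] n(2) by simp
        note a = N_apply[OF m r n(3,4)]
        have x: "x = germ_of S ?p" using germ_of_refine[OF reps_germ_reps[OF p(1)] n(1)] n(2) p(2) by simp
        have "germ_of S ?p \<noteq> germ_of S ?q"
        proof
          assume "germ_of S ?p = germ_of S ?q"
          then have "pcat \<beta> \<kappa> = pcat \<alpha> (pact S g \<kappa>)"
            using germ_of_eq_iff_trivial[OF reps_germ_reps[OF r] reps_germ_reps[OF a(2)]] by blast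
          then have "\<beta> = \<alpha>" by (simp add: pcat_def pact_def prod_eq_iff append_eq_append_conv)
          then show False using False by simp
        qed
        then show ?thesis
          using entry_delta(2)[OF cN reps_germ_reps[OF r]] reps_germ_reps[OF r] cinner_delta(1)[OF reps_germ_reps[OF r] reps_germ_reps[OF a(2)]]
          by (simp add: x a(1) cinner_cscale_right)
      next
        case False
        then show ?thesis
          using N_apply_zero[OF m p(1)] entry_delta(2)[OF cN reps_germ_reps[OF p(1)]] reps_germ_reps[OF p(1)] p(2) by simp
      qed
    qed (rule off)
    then have "pinch (N \<alpha> g \<beta>) = 0" by (intro diagonal_eqI) (auto simp: pinch)
    then show ?thesis using cstar_algebraD(6)[OF cstar_D] by simp
  next
    case True
    let ?M = "{\<mu>. minimal_strongly_fixed S g \<mu>}"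
    have m': "matched \<alpha> g \<alpha>" using m True by simp
    have fM: "finite ?M" using Fin d by (simp add: cond_Fin_def)
    have M: "pcat \<alpha> \<mu> \<in> paths S" if "\<mu> \<in> ?M" for \<mu>
      using that d Tp_Tp(2)[of \<alpha> \<mu>] by (auto simp: minimal_strongly_fixed_def strongly_fixed_def fixes_path_def True)
    let ?R = "\<Sum>\<mu>\<in>?M. oscale (ptw S g \<mu>) (Q (pcat \<alpha> \<mu>))"
    have RD: "?R \<in> D" using M by (intro cstar_algebra_sum[OF cstar_D] cstar_algebraD(8)[OF cstar_D] Q_in_D)
    have eR: "entry ?R x x = (\<Sum>\<mu>\<in>?M. if x \<in> X \<and> rng x \<in> cylinder S (pcat \<alpha> \<mu>) then ptw S g \<mu> else 0)" for x
      unfolding entry_sum using M by (intro sum.cong) (auto simp: entry_Q)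
    have "entry (N \<alpha> g \<beta>) x x = entry ?R x x" for x
    proof (cases "x \<in> X")
      case False
      then show ?thesis using off by (simp add: eR del: entry_sum)
    next
      case X: True
      then obtain p where p: "p \<in> reps" "x = germ_of S p" by (rule X_E)
      have rx: "rng x = rep_range S p" using rng_germ_of reps_germ_reps p by blast
      note en = entry_delta(2)[OF cN reps_germ_reps[OF p(1)] reps_germ_reps[OF p(1)], folded p(2)]
      show ?thesis
      proof (cases "\<exists>\<mu>\<in>?M. rep_range S p \<in> cylinder S (pcat \<alpha> \<mu>)")
        case True
        then obtain \<mu> where \<mu>: "\<mu> \<in> ?M" "rep_range S p \<in> cylinder S (pcat \<alpha> \<mu>)" by blast
        have "strongly_fixed S g \<mu>" using \<mu>(1) by (simp add: minimal_strongly_fixed_def)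
        from N_strongly_fixed[OF m' this p(1) \<mu>(2)]
        have "entry (N \<alpha> g \<beta>) x x = ptw S g \<mu>"
          using en cinner_delta(2)[OF reps_germ_reps[OF p(1)] reps_germ_reps[OF p(1)]] \<open>\<alpha> = \<beta>\<close>
          by (simp add: cinner_cscale_right)
        moreover have "entry ?R x x = (\<Sum>\<nu>\<in>?M. if \<nu> = \<mu> then ptw S g \<mu> else 0)"
          unfolding eR rx
        proof (rule sum.cong[OF refl])
          fix \<nu> assume "\<nu> \<in> ?M"
          then have "rep_range S p \<in> cylinder S (pcat \<alpha> \<nu>) \<longleftrightarrow> \<nu> = \<mu>"
            using \<mu> minimal_unique[of g \<nu> \<mu> "rep_range S p" \<alpha>] by blast
          then show "(if x \<in> X \<and> rep_range S p \<in> cylinder S (pcat \<alpha> \<nu>) then ptw S g \<nu> else 0) =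
              (if \<nu> = \<mu> then ptw S g \<mu> else 0)" using X by simp
        qed
        ultimately show ?thesis using fM \<mu>(1) by simp
      next
        case False
        then have "entry ?R x x = 0" unfolding eR rx by (intro sum.neutral) auto
        moreover have "entry (N \<alpha> g \<beta>) x x = 0"
        proof (cases "rep_range S p \<in> cylinder S \<alpha>")
          case c: True
          obtain n \<kappa> h \<delta> where n: "refinable p n" "refine S p n = (pcat \<alpha> \<kappa>, h, \<delta>, rep_source p)"
            "\<kappa> \<in> paths S" "prng \<kappa> = psrc S \<alpha>"
            using rep_range_cylinderE[OF reps_germ_reps[OF p(1)] c] by metis
          let ?p = "(pcat \<alpha> \<kappa>, h, \<delta>, rep_source p)"
            and ?q = "(pcat \<alpha> (pact S g \<kappa>), gmult S (psect S g \<kappa>) h, \<delta>, rep_source p)"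
          have r: "?p \<in> reps" using refine_reps[OF p(1) n(1)] n(2) by simp
          note a = N_apply[OF m' r n(3,4)]
          have x: "x = germ_of S ?p" using germ_of_refine[OF reps_germ_reps[OF p(1)] n(1)] n(2) p(2) by simp
          have "germ_of S ?q \<noteq> germ_of S ?p"
          proof
            assume "germ_of S ?q = germ_of S ?p"
            from strongly_fixed_of_germ_eq[OF d(2,1,4) _ n(3,4) reps_germ_reps[OF r] reps_germ_reps[OF a(2)] this]
            obtain \<mu> where \<mu>: "strongly_fixed S g \<mu>" "rep_range S ?p \<in> cylinder S (pcat \<alpha> \<mu>)"
              using d True by auto
            have "rep_range S ?p = rep_range S p" using rep_range_refine[OF reps_germ_reps[OF p(1)] n(1)] n(2) by simp
            then have "trivial_at g \<alpha> (rep_range S p)" using \<mu> unfolding trivial_at_def by metis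
            then show False using False trivial_at_iff_minimal by blast
          qed
          then show ?thesis
            using entry_delta(2)[OF cN reps_germ_reps[OF r] reps_germ_reps[OF r]]
              cinner_delta(1)[OF reps_germ_reps[OF r] reps_germ_reps[OF a(2)]] a(1) True
            by (simp add: x cinner_cscale_right)
        next
          case False
          then show ?thesis using N_apply_zero[OF m' p(1)] en True by simp
        qed
        ultimately show ?thesis by simp
      qed
    qed
    then have "pinch (N \<alpha> g \<beta>) = ?R"
      using RD diagonal_D by (intro diagonal_eqI) (auto simp: pinch simp del: entry_sum)
    then show ?thesis using RD by simp
  qed
qed

lemma pinch_B:
  assumes "cond_Fin S" "b \<in> B NoSub"
  shows "pinch b \<in> D"
  using assms(2) unfolding B_eq
proof (induction rule: closed_span_induct)
  case (limit f x)
  then show ?case using cstar_algebra_limit[OF cstar_D _ tendsto_pinch] by blast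
next
  case (gen x)
  then show ?case using pinch_N[OF assms(1)] by (auto elim: gensE)
qed (auto simp: pinch_add pinch_oscale intro: cstar_algebraD[OF cstar_D])

text \<open>The diagonal entries of \<open>adj b o\<^sub>L b\<close> are the squared norms of the
  columns of \<open>b\<close>. This gives faithfulness, and with \<open>sqrt_of_diagonal\<close>
  also positivity in the sense of \<open>positives\<close>, which asks for a factorisation inside
  \<open>D\<close>.\<close>

lemma expectation_exists:
  assumes Fin: "cond_Fin S"
  shows "conditional_expectation pinch D (B k)" "faithful_on pinch (B k)"
proof -
  have sub: "b \<in> B NoSub" if "b \<in> B k" for b using that B_chain(4) by blast
  note Bd = cstar_algebraD[OF cstar_B[of k]]
  have pe: "entry (pinch (adj b o\<^sub>L b)) x x = of_real ((norm (blinfun_apply b (ket x)))\<^sup>2)" if "b \<in> B k" for b x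
    using entry_adj_comp_self[OF Bd(1)[OF that]] by (simp add: pinch)
  have pos: "pinch (adj b o\<^sub>L b) \<in> positives D" if b: "b \<in> B k" for b
  proof -
    have "adj b o\<^sub>L b \<in> B k" using b Bd by blast
    then have "pinch (adj b o\<^sub>L b) \<in> D" using pinch_B[OF Fin] sub by blast
    from sqrt_of_diagonal[OF cstar_D this pinch(1) pe[OF b]]
    show ?thesis unfolding positives_def by (metis (mono_tags, lifting) mem_Collect_eq zero_le_power2)
  qed
  have bim: "pinch (a o\<^sub>L x) = a o\<^sub>L pinch x \<and> pinch (x o\<^sub>L a) = pinch x o\<^sub>L a" if "a \<in> D" "x \<in> B k" for a x
  proof -
    have da: "diagonal a" and cx: "clinear_op x" and ca: "clinear_op a" and cp: "clinear_op (pinch x)"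
      using that diagonal_D Bd pinch(1)[of x] by (auto simp: diagonal_def)
    show ?thesis
      using da cx cp by (auto intro!: diagonal_eqI diagonal_comp
          simp: pinch entry_comp_diagonal_left[OF _ da] entry_comp_diagonal_right[OF _ da])
  qed
  show "conditional_expectation pinch D (B k)"
    unfolding conditional_expectation_def
    using pinch_B[OF Fin] sub pinch_diagonal diagonal_D pinch_add pinch_oscale pinch(2) pos bim
    by (auto simp: positives_def[of "B k"])
  show "faithful_on pinch (B k)"
    unfolding faithful_on_def
  proof (intro ballI impI)
    fix x assume "x \<in> positives (B k)" "pinch x = 0"
    then obtain b where b: "b \<in> B k" "x = adj b o\<^sub>L b" by (auto simp: positives_def)
    have "entry (pinch (adj b o\<^sub>L b)) z z = 0" for z using \<open>pinch x = 0\<close> b by simp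
    then have "blinfun_apply b (ket z) = 0" for z using pe[OF b(1)] by simp
    then have "b = 0" using Bd(1)[OF b(1)] by (intro clinear_op_eqI) auto
    then show "x = 0" using b by simp
  qed
qed

end

section \<open>Maximality of the diagonal\<close>

declare rep_range.simps [simp del]

context twisted_rep
begin

lemma cinner_sum_right: "cinner x (sum f I) = (\<Sum>i\<in>I. cinner x (f i))"
  by (induction I rule: infinite_finite_induct) (auto simp: cinner_add_right)

lemma blinfun_sum_apply: "blinfun_apply (\<Sum>i\<in>I. f i) x = (\<Sum>i\<in>I. blinfun_apply (f i) x)"
  by (induction I rule: infinite_finite_induct) (auto simp: blinfun.add_left)

text \<open>\<open>Q \<mu>\<close> acts on the unit vector of a germ by 1 or 0, according to whether
  its range lies in the cylinder of \<open>\<mu>\<close>. Commuting with \<open>b\<close> forces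
  equal values at both ends of a nonzero entry, for every \<open>\<mu>\<close>.\<close>

lemma commutant_D_range:
  assumes b: "b \<in> commutant D" and p: "p \<in> reps" and q: "q \<in> reps"
    and nz: "cinner (delta S q) (blinfun_apply b (delta S p)) \<noteq> 0"
  shows "rep_range S p = rep_range S q"
proof (rule path_space_separated)
  show "rep_range S p \<in> path_space S" "rep_range S q \<in> path_space S"
    using p q rep_range_path_space reps_germ_reps by auto
  fix \<mu> assume \<mu>: "\<mu> \<in> paths S"
  let ?e = "\<lambda>p. (if rep_range S p \<in> cylinder S \<mu> then 1 else 0 :: complex)"
  have Qe: "blinfun_apply (Q \<mu>) (delta S p) = cscale (?e p) (delta S p)" if "p \<in> reps" for p
    using Q_delta[OF \<mu> that] by simp
  have "?e p * cinner (delta S q) (blinfun_apply b (delta S p)) = cinner (delta S q) (blinfun_apply (b o\<^sub>L Q \<mu>) (delta S p))"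
    using Qe[OF p] commutantD(1)[OF b] by (simp add: clinear_opD cinner_cscale_right)
  also have "\<dots> = cinner (delta S q) (blinfun_apply (Q \<mu>) (blinfun_apply b (delta S p)))"
    using commutantD(2)[OF b Q_in_D[OF \<mu>]] by simp
  also have "\<dots> = cinner (blinfun_apply (Q \<mu>) (delta S q)) (blinfun_apply b (delta S p))"
    using cinner_adj[OF clinear_Q[OF \<mu>], of "delta S q"] adj_Q[OF \<mu>] by simp
  also have "\<dots> = ?e q * cinner (delta S q) (blinfun_apply b (delta S p))"
    using Qe[OF q] by (simp add: cinner_cscale_left)
  finally have "?e p = ?e q" using nz by simp
  then show "rep_range S p \<in> cylinder S \<mu> \<longleftrightarrow> rep_range S q \<in> cylinder S \<mu>" by (simp split: if_splits)
qed

section \<open>Ranges and generators near a germ\<close>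

lemma rep_range_self: "(\<alpha>, h, \<delta>, \<eta>) \<in> germ_reps S \<Longrightarrow> rep_range S (\<alpha>, h, \<delta>, \<eta>) \<in> cylinder S \<alpha>"
  using rep_range_in_pcat[of \<alpha> "(undefined, [])"] by (simp add: pcat_def)

lemma reps_source: "(\<alpha>, h, \<delta>, \<zeta>) \<in> reps \<Longrightarrow> (\<alpha>, h, \<delta>, \<eta>) \<in> reps \<longleftrightarrow> \<eta> \<in> cylinder S \<delta> \<and> \<eta> \<in> Y"
  by (auto simp: reps_iff)

lemma eventually_reps:
  assumes "(\<alpha>, h, \<delta>, \<zeta>) \<in> reps"
  shows "eventually (\<lambda>\<eta>. (\<alpha>, h, \<delta>, \<eta>) \<in> reps) (near \<zeta>)"
proof -
  have "\<zeta> \<in> cylinder S \<delta>" using assms by (simp add: reps_iff)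
  then have "eventually (\<lambda>\<eta>. \<eta> \<in> cylinder S \<delta>) (near \<zeta>)"
    using eventually_near_cylinder'[of \<delta> \<zeta>] by simp
  with eventually_near_Y[of \<zeta>] show ?thesis
    by eventually_elim (simp add: reps_source[OF assms])
qed

text \<open>Continuity of the range for fixed \<open>\<alpha>\<close>, \<open>h\<close> and
  \<open>\<delta>\<close>. If \<open>\<beta>\<close> is not longer than \<open>\<alpha>\<close>, the
  condition does not involve \<open>\<eta>\<close>. Otherwise injectivity of \<open>h\<close> on
  words makes the sources in question those of a single cylinder, unless there are none.\<close>

lemma eventually_range_cylinder:
  assumes r: "(\<alpha>, h, \<delta>, \<zeta>) \<in> reps"
  shows "eventually (\<lambda>\<eta>. rep_range S (\<alpha>, h, \<delta>, \<eta>) \<in> cylinder S \<beta> \<longleftrightarrow>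
    rep_range S (\<alpha>, h, \<delta>, \<zeta>) \<in> cylinder S \<beta>) (near \<zeta>)"
proof (cases "plen \<beta> \<le> plen \<alpha>")
  case True
  have *: "rep_range S (\<alpha>, h, \<delta>, \<eta>) \<in> cylinder S \<beta> \<longleftrightarrow> \<beta> = (fst \<alpha>, take (plen \<beta>) (snd \<alpha>))"
    if "(\<alpha>, h, \<delta>, \<eta>) \<in> reps" for \<eta>
    using rep_range_cylinder[OF reps_germ_reps[OF that] True] rep_range_path_space[OF reps_germ_reps[OF that]]
    unfolding cylinder_iff by simp metis
  from eventually_reps[OF r] show ?thesis
    by eventually_elim (simp only: *[OF r] *)
next
  case False
  define k where "k = plen \<beta> - plen \<alpha>"
  have k: "plen \<beta> = plen \<alpha> + k" using False by (simp add: k_def)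
  have iff: "rep_range S (\<alpha>, h, \<delta>, \<eta>) \<in> cylinder S \<beta> \<longleftrightarrow> reaches \<eta> (plen \<delta> + k) \<and>
      (fst \<alpha>, snd \<alpha> @ act_list S h (drop (plen \<delta>) (snd (pre S \<eta> (plen \<delta> + k))))) = \<beta>"
    if "(\<alpha>, h, \<delta>, \<eta>) \<in> reps" for \<eta>
    using rep_range_pre[OF reps_germ_reps[OF that], of k] rep_range_path_space[OF reps_germ_reps[OF that]]
    unfolding cylinder_iff k by simp
  show ?thesis
  proof (cases "\<exists>\<eta>\<^sub>0. (\<alpha>, h, \<delta>, \<eta>\<^sub>0) \<in> reps \<and> rep_range S (\<alpha>, h, \<delta>, \<eta>\<^sub>0) \<in> cylinder S \<beta>")
    case True
    then obtain \<eta>\<^sub>0 where r0: "(\<alpha>, h, \<delta>, \<eta>\<^sub>0) \<in> reps" "rep_range S (\<alpha>, h, \<delta>, \<eta>\<^sub>0) \<in> cylinder S \<beta>" by blast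
    let ?\<gamma> = "pre S \<eta>\<^sub>0 (plen \<delta> + k)"
    note i0 = iff[OF r0(1), THEN iffD1, OF r0(2)]
    have "rep_range S (\<alpha>, h, \<delta>, \<eta>) \<in> cylinder S \<beta> \<longleftrightarrow> \<eta> \<in> cylinder S ?\<gamma>" if q: "(\<alpha>, h, \<delta>, \<eta>) \<in> reps" for \<eta>
    proof
      assume "rep_range S (\<alpha>, h, \<delta>, \<eta>) \<in> cylinder S \<beta>"
      note i = iff[OF q, THEN iffD1, OF this]
      have c: "\<eta>\<^sub>0 \<in> cylinder S \<delta>" "\<eta> \<in> cylinder S \<delta>" "h \<in> Grp S" "gsrc S h = psrc S \<delta>" using r0 q by (auto simp: reps_iff)
      note s0 = cylinder_segment[OF c(1), of "plen \<delta> + k", OF le_add1] and s = cylinder_segment[OF c(2), of "plen \<delta> + k", OF le_add1]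
      have "act_list S h (drop (plen \<delta>) (snd (pre S \<eta>\<^sub>0 (plen \<delta> + k)))) = act_list S h (drop (plen \<delta>) (snd (pre S \<eta> (plen \<delta> + k))))"
      proof -
        have "(fst \<alpha>, snd \<alpha> @ act_list S h (drop (plen \<delta>) (snd (pre S \<eta>\<^sub>0 (plen \<delta> + k))))) =
            (fst \<alpha>, snd \<alpha> @ act_list S h (drop (plen \<delta>) (snd (pre S \<eta> (plen \<delta> + k)))))"
          by (rule trans[OF conjunct2[OF i0] conjunct2[OF i, symmetric]])
        then show ?thesis by simp
      qed
      then have "drop (plen \<delta>) (snd (pre S \<eta>\<^sub>0 (plen \<delta> + k))) = drop (plen \<delta>) (snd (pre S \<eta> (plen \<delta> + k)))"
        by (rule act_list_inj[OF c(3) s0(2)[folded c(4)] s(2)[folded c(4)]])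
      then have "pre S \<eta> (plen \<delta> + k) = ?\<gamma>" using s0(1) s(1) by metis
      then show "\<eta> \<in> cylinder S ?\<gamma>" using i c(2) pre_cylinder[of \<eta> "plen \<delta> + k"] by (simp add: cylinder_iff)
    next
      assume "\<eta> \<in> cylinder S ?\<gamma>"
      then have "reaches \<eta> (plen \<delta> + k)" "pre S \<eta> (plen \<delta> + k) = ?\<gamma>"
        using i0 plen_pre[of \<eta>\<^sub>0 "plen \<delta> + k" S] by (auto simp: cylinder_iff)
      then show "rep_range S (\<alpha>, h, \<delta>, \<eta>) \<in> cylinder S \<beta>" unfolding iff[OF q] using i0 by simp
    qed
    note * = this
    from eventually_reps[OF r] eventually_near_cylinder'[of ?\<gamma> \<zeta>] show ?thesis
      by eventually_elim (simp only: * r)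
  next
    case F: False
    from eventually_reps[OF r] show ?thesis
      by eventually_elim (use F r in blast)
  qed
qed

text \<open>A finite source cannot be refined past its end, but there the left path is the whole
  range. Either alternative lets \<open>deep_prefix\<close> read prefixes of the range off the left
  path.\<close>

lemma deep_refinement:
  assumes p: "p \<in> germ_reps S"
  obtains n where "refinable p n" "L \<le> plen (fst (refine S p n)) \<or> \<not> reaches (rep_source p) (Suc n)"
proof -
  obtain \<alpha> g \<beta> \<xi> where pp: "p = (\<alpha>, g, \<beta>, \<xi>)" by (cases p)
  show thesis
  proof (cases "reaches \<xi> (plen \<beta> + L)")
    case True
    then have "refinable p (plen \<beta> + L)" by (simp add: pp)
    then show ?thesis
      using that[of "plen \<beta> + L"] rep_range_refine_pre(2)[OF p[unfolded pp], of "plen \<beta> + L"] by (simp add: pp)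
  next
    case False
    then obtain \<mu> where \<mu>: "\<xi> = FinP \<mu>" by (cases \<xi>) auto
    have "plen \<beta> \<le> length (snd \<mu>)" using p by (auto simp: pp \<mu> germ_reps_iff cylinder_iff)
    then show ?thesis using that[of "length (snd \<mu>)"] by (simp add: pp \<mu>)
  qed
qed

lemma deep_prefix:
  assumes r: "(\<alpha>, h, \<delta>, \<zeta>) \<in> reps" and deep: "L \<le> plen \<alpha> \<or> \<not> reaches \<zeta> (Suc (plen \<delta>))"
    and \<beta>: "plen \<beta> \<le> L" "rep_range S (\<alpha>, h, \<delta>, \<zeta>) \<in> cylinder S \<beta>"
  obtains \<kappa> where "\<alpha> = pcat \<beta> \<kappa>" "\<kappa> \<in> paths S" "prng \<kappa> = psrc S \<beta>"
proof -
  have "plen \<beta> \<le> plen \<alpha>"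
  proof (rule ccontr)
    assume "\<not> plen \<beta> \<le> plen \<alpha>"
    then have "plen \<alpha> + 1 \<le> plen \<beta>" by simp
    moreover have "reaches (rep_range S (\<alpha>, h, \<delta>, \<zeta>)) (plen \<beta>)" using \<beta>(2) unfolding cylinder_iff by blast
    ultimately have "reaches (rep_range S (\<alpha>, h, \<delta>, \<zeta>)) (plen \<alpha> + 1)" by (rule reaches_mono[rotated])
    then have "reaches \<zeta> (plen \<delta> + 1)" using rep_range_pre(2)[OF reps_germ_reps[OF r], of 1] by blast
    then show False using deep \<beta>(1) \<open>\<not> _\<close> by simp
  qed
  then show thesis using paths_comparable[OF \<beta>(2) rep_range_self[OF reps_germ_reps[OF r]]] that by blast
qed

text \<open>The refinement that identifies the two germs depends on \<open>\<eta>\<close> only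
  through its prefix of length \<open>n\<close>, so near \<open>\<xi>\<close> the same quotient
  \<open>?z\<close> of twist values works.\<close>

lemma delta_proportional:
  assumes p: "(\<alpha>, h, \<beta>, \<xi>) \<in> reps" and q: "(\<gamma>, k, \<beta>, \<xi>) \<in> reps"
    and eq: "germ_of S (\<alpha>, h, \<beta>, \<xi>) = germ_of S (\<gamma>, k, \<beta>, \<xi>)"
  obtains z where "eventually (\<lambda>\<eta>. delta S (\<alpha>, h, \<beta>, \<eta>) = cscale z (delta S (\<gamma>, k, \<beta>, \<eta>))) (near \<xi>)"
proof -
  obtain n where n: "plen \<beta> \<le> n" "reaches \<xi> n" "refine S (\<alpha>, h, \<beta>, \<xi>) n = refine S (\<gamma>, k, \<beta>, \<xi>) n"
    using eq unfolding germ_of_eq_iff[OF reps_germ_reps[OF p] reps_germ_reps[OF q]] by auto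
  let ?w = "drop (plen \<beta>) (snd (pre S \<xi> n))"
  let ?z = "twE_list S h ?w * cnj (twE_list S k ?w)"
  have \<xi>: "\<xi> \<in> path_space S" using p by (simp add: reps_iff cylinder_iff)
  have ev: "eventually (\<lambda>\<eta>. \<eta> \<in> cylinder S (pre S \<xi> n)) (near \<xi>)"
    using eventually_near_cylinder'[of "pre S \<xi> n" \<xi>] pre_cylinder[OF \<xi> n(2)] by simp
  have "eventually (\<lambda>\<eta>. delta S (\<alpha>, h, \<beta>, \<eta>) = cscale ?z (delta S (\<gamma>, k, \<beta>, \<eta>))) (near \<xi>)"
    using ev eventually_reps[OF p] eventually_reps[OF q]
  proof eventually_elim
    case (elim \<eta>)
    have \<eta>: "pre S \<eta> n = pre S \<xi> n" "reaches \<eta> n" using elim(1) plen_pre[OF n(2), of S] by (auto simp: cylinder_iff)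
    have ref: "refinable (\<alpha>, h, \<beta>, \<eta>) n" "refinable (\<gamma>, k, \<beta>, \<eta>) n" using n(1) \<eta> by auto
    have R: "refine S (\<alpha>, h, \<beta>, \<eta>) n = refine S (\<gamma>, k, \<beta>, \<eta>) n"
      using n(3) \<eta>(1) by (simp add: Let_def)
    have ph: "refine_phase S (\<alpha>, h, \<beta>, \<eta>) n = twE_list S h ?w" "refine_phase S (\<gamma>, k, \<beta>, \<eta>) n = twE_list S k ?w"
      using \<eta>(1) by auto
    have "cmod (twE_list S k ?w) = 1" using refine_phase_circle[OF reps_germ_reps[OF elim(3)] ref(2)] ph by simp
    then have "cnj (twE_list S k ?w) * twE_list S k ?w = 1" by (rule unimodular_cnj)
    then show ?case
      using delta_refine[OF reps_germ_reps[OF elim(2)] ref(1)] delta_refine[OF reps_germ_reps[OF elim(3)] ref(2)] R ph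
      by (simp del: refine.simps add: mult.assoc)
  qed
  then show thesis by (rule that)
qed

text \<open>After sufficient refinement, a generator acts on all nearby germs by one formula.\<close>

definition local_action :: "subscript \<Rightarrow> ('g, 'e) germ oper \<Rightarrow> ('g, 'e) path \<Rightarrow> 'g \<Rightarrow> ('g, 'e) path \<Rightarrow> ('g, 'e) xpath \<Rightarrow> bool" where
  "local_action K a \<alpha> h \<delta> \<zeta> \<longleftrightarrow>
     eventually (\<lambda>\<eta>. blinfun_apply a (delta S (\<alpha>, h, \<delta>, \<eta>)) = 0) (near \<zeta>) \<or>
     (\<exists>\<phi> \<gamma> k. (K = Sub0 \<longrightarrow> plen \<gamma> = plen \<alpha>) \<and> (\<gamma>, k, \<delta>, \<zeta>) \<in> reps \<and>
        eventually (\<lambda>\<eta>. blinfun_apply a (delta S (\<alpha>, h, \<delta>, \<eta>)) = cscale \<phi> (delta S (\<gamma>, k, \<delta>, \<eta>))) (near \<zeta>))"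

text \<open>The bound \<open>L\<close> is the length of \<open>\<beta>\<close>: beyond it, either
  \<open>\<beta>\<close> is a prefix of the left path, with a remainder \<open>\<kappa>\<close>
  independent of \<open>\<eta>\<close>, or the range avoids the cylinder of \<open>\<beta>\<close>,
  also for nearby sources.\<close>

lemma gens_local_action:
  assumes a: "a \<in> gens K" "K \<noteq> Sub00"
  shows "\<exists>L. \<forall>\<alpha> h \<delta> \<zeta>. (\<alpha>, h, \<delta>, \<zeta>) \<in> reps \<longrightarrow> L \<le> plen \<alpha> \<or> \<not> reaches \<zeta> (Suc (plen \<delta>)) \<longrightarrow>
     local_action K a \<alpha> h \<delta> \<zeta>"
proof -
  obtain \<alpha>' g \<beta> where N: "a = N \<alpha>' g \<beta>" "matched \<alpha>' g \<beta>" "K = Sub0 \<longrightarrow> plen \<alpha>' = plen \<beta>"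
    using a by (auto elim: gensE)
  have "local_action K a \<alpha> h \<delta> \<zeta>"
    if r: "(\<alpha>, h, \<delta>, \<zeta>) \<in> reps" and deep: "plen \<beta> \<le> plen \<alpha> \<or> \<not> reaches \<zeta> (Suc (plen \<delta>))" for \<alpha> h \<delta> \<zeta>
  proof (cases "rep_range S (\<alpha>, h, \<delta>, \<zeta>) \<in> cylinder S \<beta>")
    case False
    from eventually_reps[OF r] eventually_range_cylinder[OF r, of \<beta>]
    have "eventually (\<lambda>\<eta>. blinfun_apply a (delta S (\<alpha>, h, \<delta>, \<eta>)) = 0) (near \<zeta>)"
      by eventually_elim (use False N_apply_zero[OF N(2)] N(1) in blast)
    then show ?thesis unfolding local_action_def ..
  next
    case True
    obtain \<kappa> where \<kappa>: "\<alpha> = pcat \<beta> \<kappa>" "\<kappa> \<in> paths S" "prng \<kappa> = psrc S \<beta>"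
      using deep_prefix[OF r deep order_refl True] by blast
    let ?\<gamma> = "pcat \<alpha>' (pact S g \<kappa>)" and ?k = "gmult S (psect S g \<kappa>) h"
      and ?\<phi> = "ptw S g \<kappa> * twG S (psect S g \<kappa>) h"
    have "K = Sub0 \<longrightarrow> plen ?\<gamma> = plen \<alpha>" using N(3) \<kappa>(1) by (simp add: plen_pcat) (simp add: pact_def plen_def)
    moreover have "(?\<gamma>, ?k, \<delta>, \<zeta>) \<in> reps" using N_apply(2)[OF N(2) r[unfolded \<kappa>(1)] \<kappa>(2,3)] .
    moreover from eventually_reps[OF r]
    have "eventually (\<lambda>\<eta>. blinfun_apply a (delta S (\<alpha>, h, \<delta>, \<eta>)) = cscale ?\<phi> (delta S (?\<gamma>, ?k, \<delta>, \<eta>))) (near \<zeta>)"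
    proof eventually_elim
      case (elim \<eta>)
      show ?case unfolding N(1) \<kappa>(1) using N_apply(1)[OF N(2) elim[unfolded \<kappa>(1)] \<kappa>(2,3)] .
    qed
    ultimately show ?thesis unfolding local_action_def by blast
  qed
  then show ?thesis by blast
qed

text \<open>Suppose that \<open>b\<close> commutes with \<open>D\<close> and has an off-diagonal
  entry of modulus \<open>e\<close>. Approximate \<open>b\<close> within \<open>e / 2\<close> by a
  finite combination \<open>c\<close> of generators. After refinement, the corresponding entries of
  \<open>c\<close> are constant near \<open>\<zeta>\<close> and of modulus above
  \<open>e / 2\<close>, so those of \<open>b\<close> stay nonzero. Then
  \<open>commutant_D_range\<close> yields equal ranges near \<open>\<zeta>\<close>, and
  \<open>eff\<close> equality of the two germs.\<close>

lemma masa_of_effective: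
  assumes Fin: "cond_Fin S" and K: "K \<noteq> Sub00"
    and eff: "\<And>\<alpha> \<gamma> h k \<beta> \<zeta>. (\<alpha>, h, \<beta>, \<zeta>) \<in> reps \<Longrightarrow> (\<gamma>, k, \<beta>, \<zeta>) \<in> reps \<Longrightarrow> (K = Sub0 \<Longrightarrow> plen \<gamma> = plen \<alpha>) \<Longrightarrow>
        eventually (\<lambda>\<eta>. rep_range S (\<alpha>, h, \<beta>, \<eta>) = rep_range S (\<gamma>, k, \<beta>, \<eta>)) (near \<zeta>) \<Longrightarrow>
        germ_of S (\<alpha>, h, \<beta>, \<zeta>) = germ_of S (\<gamma>, k, \<beta>, \<zeta>)"
  shows "B K \<inter> commutant D \<subseteq> D"
proof
  fix b assume "b \<in> B K \<inter> commutant D"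
  then have b: "b \<in> B K" "b \<in> commutant D" by auto
  have ob: "on_X b" using on_X_B[OF b(1)] .
  then have cb: "clinear_op b" by (rule on_X_clinear)
  have "entry b x y = 0" if xy: "x \<noteq> y" for x y
  proof (rule ccontr)
    assume nz: "entry b x y \<noteq> 0"
    define e where "e = cmod (entry b x y)"
    have e: "e > 0" using nz by (simp add: e_def)
    have "y \<in> X" using nz ob by (auto simp: on_X_def)
    then obtain p0 where p0: "p0 \<in> reps" "y = germ_of S p0" by (rule X_E)
    obtain c where c: "c \<in> oper.span (gens K)" "norm (b - c) < e / 2"
      using closed_span_approx[of b "gens K" "e / 2"] b(1) e unfolding B_eq by auto
    obtain t r where t: "finite t" "t \<subseteq> gens K" "c = (\<Sum>a\<in>t. oscale (r a) a)"
      using c(1) unfolding oper.span_explicit by blast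
    have "\<forall>a\<in>t. \<exists>L. \<forall>\<alpha> h \<delta> \<zeta>. (\<alpha>, h, \<delta>, \<zeta>) \<in> reps \<longrightarrow> L \<le> plen \<alpha> \<or> \<not> reaches \<zeta> (Suc (plen \<delta>)) \<longrightarrow>
      local_action K a \<alpha> h \<delta> \<zeta>"
      using gens_local_action[OF subsetD[OF t(2)] K] by (intro ballI)
    from bchoice[OF this] obtain L where L: "\<And>a \<alpha> h \<delta> \<zeta>. a \<in> t \<Longrightarrow> (\<alpha>, h, \<delta>, \<zeta>) \<in> reps \<Longrightarrow>
      L a \<le> plen \<alpha> \<or> \<not> reaches \<zeta> (Suc (plen \<delta>)) \<Longrightarrow> local_action K a \<alpha> h \<delta> \<zeta>"
      by blast
    \<comment> \<open>The sum of the finitely many bounds \<open>L a\<close> serves as a common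
      bound.\<close>
    obtain n where n: "refinable p0 n" "sum L t \<le> plen (fst (refine S p0 n)) \<or> \<not> reaches (rep_source p0) (Suc n)"
      using deep_refinement[OF reps_germ_reps[OF p0(1)]] by blast
    obtain \<alpha> h \<delta> \<zeta> where p: "refine S p0 n = (\<alpha>, h, \<delta>, \<zeta>)" by (cases "refine S p0 n")
    let ?p = "\<lambda>\<eta>. (\<alpha>, h, \<delta>, \<eta>)"
    have pr: "?p \<zeta> \<in> reps" using refine_reps[OF p0(1) n(1)] p by simp
    have \<zeta>Y: "\<zeta> \<in> Y" using pr by (simp add: reps_iff)
    have yp: "y = germ_of S (?p \<zeta>)" using germ_of_refine[OF reps_germ_reps[OF p0(1)] n(1)] p p0(2) by simp
    have "\<zeta> = rep_source p0" using p rep_source_refine by (metis rep_source.simps)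
    moreover have "plen \<delta> = n" using p n(1) refinable_reaches[OF n(1)] by (cases p0) (auto simp: Let_def plen_pre)
    ultimately have deep: "L a \<le> plen \<alpha> \<or> \<not> reaches \<zeta> (Suc (plen \<delta>))" if "a \<in> t" for a
      using n(2) p member_le_sum[OF that _ t(1), of L] by auto
    have La: "\<forall>a\<in>t. eventually (\<lambda>\<eta>. blinfun_apply a (delta S (?p \<eta>)) = 0) (near \<zeta>) \<or>
      (\<exists>\<phi> \<gamma> k. (K = Sub0 \<longrightarrow> plen \<gamma> = plen \<alpha>) \<and> (\<gamma>, k, \<delta>, \<zeta>) \<in> reps \<and>
        eventually (\<lambda>\<eta>. blinfun_apply a (delta S (?p \<eta>)) = cscale \<phi> (delta S (\<gamma>, k, \<delta>, \<eta>))) (near \<zeta>))"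
      using L[OF _ pr] deep unfolding local_action_def by blast
    have cc: "clinear_op c" using t clinear_gens by (auto intro!: clinear_op_sum clinear_op_oscale)
    have ca: "clinear_op a" if "a \<in> t" for a using that t(2) clinear_gens by blast
    have c_apply: "blinfun_apply c v = (\<Sum>a\<in>t. cscale (r a) (blinfun_apply a v))" for v
      unfolding t(3) blinfun_sum_apply by simp
    have e2: "cmod (entry c x y) > e / 2"
    proof -
      have "cmod (entry b x y - entry c x y) \<le> norm (b - c)" using norm_entry_le[of "b - c" x y] by simp
      moreover have "cmod (entry b x y) \<le> cmod (entry b x y - entry c x y) + cmod (entry c x y)"
        using norm_triangle_ineq[of "entry b x y - entry c x y" "entry c x y"] by simp
      ultimately show ?thesis using c(2) by (simp add: e_def)
    qed
    have xX: "x \<in> X" using nz ob by (auto simp: on_X_def)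
    then obtain q0 where q0: "q0 \<in> reps" "x = germ_of S q0" by (rule X_E)
    have ec: "cmod (entry c x y) = cmod (cinner (delta S q0) (blinfun_apply c (delta S (?p \<zeta>))))"
      unfolding q0(2) yp by (rule entry_delta(1)[OF cc reps_germ_reps[OF pr] reps_germ_reps[OF q0(1)]])
    have "\<exists>a\<in>t. cinner (delta S q0) (blinfun_apply a (delta S (?p \<zeta>))) \<noteq> 0"
    proof (rule ccontr)
      assume "\<not> ?thesis"
      then have "cinner (delta S q0) (blinfun_apply c (delta S (?p \<zeta>))) = 0"
        unfolding c_apply cinner_sum_right cinner_cscale_right by (intro sum.neutral) auto
      then show False using ec e2 e by simp
    qed
    then obtain a0 where a0: "a0 \<in> t" "cinner (delta S q0) (blinfun_apply a0 (delta S (?p \<zeta>))) \<noteq> 0" by blast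
    \<comment> \<open>A generator that contributes to the entry supplies a representative of the
      germ \<open>x\<close> over the right path \<open>\<delta>\<close>, and with it nearby germs
      \<open>?q \<eta>\<close> to compare with.\<close>
    have "\<not> eventually (\<lambda>\<eta>. blinfun_apply a0 (delta S (?p \<eta>)) = 0) (near \<zeta>)"
      using a0(2) eventually_near_self[OF _ \<zeta>Y] by force
    then obtain \<phi>0 \<gamma> k where q: "K = Sub0 \<longrightarrow> plen \<gamma> = plen \<alpha>" "(\<gamma>, k, \<delta>, \<zeta>) \<in> reps"
      "eventually (\<lambda>\<eta>. blinfun_apply a0 (delta S (?p \<eta>)) = cscale \<phi>0 (delta S (\<gamma>, k, \<delta>, \<eta>))) (near \<zeta>)"
      using La a0(1) by blast
    let ?q = "\<lambda>\<eta>. (\<gamma>, k, \<delta>, \<eta>)"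
    have "blinfun_apply a0 (delta S (?p \<zeta>)) = cscale \<phi>0 (delta S (?q \<zeta>))"
      using eventually_near_self[OF q(3) \<zeta>Y] .
    then have "cinner (delta S q0) (delta S (?q \<zeta>)) \<noteq> 0" using a0(2) by (auto simp: cinner_cscale_right)
    then have xq: "x = germ_of S (?q \<zeta>)"
      using cinner_delta(1)[OF reps_germ_reps[OF q0(1)] reps_germ_reps[OF q(2)]] q0(2) by blast
    \<comment> \<open>Generators that send the germ at \<open>\<zeta>\<close> to that of
      \<open>?q\<close> contribute a constant by \<open>delta_proportional\<close>; by (Fin) the
      others miss \<open>?q \<eta>\<close> for all nearby \<open>\<eta>\<close>.\<close>
    have const: "\<exists>z. eventually (\<lambda>\<eta>. cinner (delta S (?q \<eta>)) (blinfun_apply a (delta S (?p \<eta>))) = z) (near \<zeta>)"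
      if a: "a \<in> t" for a
    proof (cases "eventually (\<lambda>\<eta>. blinfun_apply a (delta S (?p \<eta>)) = 0) (near \<zeta>)")
      case True
      then have "eventually (\<lambda>\<eta>. cinner (delta S (?q \<eta>)) (blinfun_apply a (delta S (?p \<eta>))) = 0) (near \<zeta>)"
        by eventually_elim simp
      then show ?thesis by blast
    next
      case False
      then obtain \<phi> \<gamma>' k' where q': "(\<gamma>', k', \<delta>, \<zeta>) \<in> reps"
        "eventually (\<lambda>\<eta>. blinfun_apply a (delta S (?p \<eta>)) = cscale \<phi> (delta S (\<gamma>', k', \<delta>, \<eta>))) (near \<zeta>)"
        using La a by blast
      show ?thesis
      proof (cases "germ_of S (\<gamma>', k', \<delta>, \<zeta>) = germ_of S (?q \<zeta>)")
        case True
        obtain z where "eventually (\<lambda>\<eta>. delta S (\<gamma>', k', \<delta>, \<eta>) = cscale z (delta S (?q \<eta>))) (near \<zeta>)"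
          using delta_proportional[OF q'(1) q(2) True] .
        with q'(2) eventually_reps[OF q(2)]
        have "eventually (\<lambda>\<eta>. cinner (delta S (?q \<eta>)) (blinfun_apply a (delta S (?p \<eta>))) = \<phi> * z) (near \<zeta>)"
        proof eventually_elim
          case (elim \<eta>)
          then show ?case
            using cinner_delta(2)[OF reps_germ_reps[OF elim(2)] reps_germ_reps[OF elim(2)]] by (simp add: cinner_cscale_right)
        qed
        then show ?thesis by blast
      next
        case False
        from eventually_germ_neq[OF Fin reps_germ_reps[OF q'(1)] reps_germ_reps[OF q(2)] False] q'(2)
        have "eventually (\<lambda>\<eta>. cinner (delta S (?q \<eta>)) (blinfun_apply a (delta S (?p \<eta>))) = 0) (near \<zeta>)"
        proof eventually_elim
          case (elim \<eta>)
          then have "cinner (delta S (?q \<eta>)) (delta S (\<gamma>', k', \<delta>, \<eta>)) = 0" by (intro cinner_delta(1)) auto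
          then show ?case using elim by (simp add: cinner_cscale_right)
        qed
        then show ?thesis by blast
      qed
    qed
    then have "\<forall>a\<in>t. \<exists>z. eventually (\<lambda>\<eta>. cinner (delta S (?q \<eta>)) (blinfun_apply a (delta S (?p \<eta>))) = z) (near \<zeta>)"
      by (intro ballI)
    from bchoice[OF this] obtain l where l: "\<And>a. a \<in> t \<Longrightarrow> eventually (\<lambda>\<eta>. cinner (delta S (?q \<eta>)) (blinfun_apply a (delta S (?p \<eta>))) = l a) (near \<zeta>)"
      by blast
    let ?l = "\<Sum>a\<in>t. r a * l a"
    have "eventually (\<lambda>\<eta>. \<forall>a\<in>t. cinner (delta S (?q \<eta>)) (blinfun_apply a (delta S (?p \<eta>))) = l a) (near \<zeta>)"
      using l t(1) by (intro eventually_ball_finite) auto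
    then have ev: "eventually (\<lambda>\<eta>. cinner (delta S (?q \<eta>)) (blinfun_apply c (delta S (?p \<eta>))) = ?l) (near \<zeta>)"
      by eventually_elim (simp add: c_apply cinner_sum_right cinner_cscale_right)
    have "cmod ?l = cmod (entry c x y)"
      unfolding xq yp entry_delta(1)[OF cc reps_germ_reps[OF pr] reps_germ_reps[OF q(2)]]
      using eventually_near_self[OF ev \<zeta>Y] by simp
    then have l2: "cmod ?l > e / 2" using e2 by simp
    from ev eventually_reps[OF pr] eventually_reps[OF q(2)]
    have "eventually (\<lambda>\<eta>. rep_range S (?p \<eta>) = rep_range S (?q \<eta>)) (near \<zeta>)"
    proof eventually_elim
      case (elim \<eta>)
      have "cmod (cinner (delta S (?q \<eta>)) (blinfun_apply (b - c) (delta S (?p \<eta>)))) \<le>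
          norm (delta S (?q \<eta>)) * norm (blinfun_apply (b - c) (delta S (?p \<eta>)))" by (rule norm_cinner_le)
      also have "\<dots> \<le> norm (b - c)"
        using norm_blinfun[of "b - c" "delta S (?p \<eta>)"] norm_delta[OF reps_germ_reps[OF elim(2)]] norm_delta[OF reps_germ_reps[OF elim(3)]] by simp
      finally have "cmod (cinner (delta S (?q \<eta>)) (blinfun_apply (b - c) (delta S (?p \<eta>)))) < e / 2" using c(2) by simp
      moreover have "blinfun_apply b (delta S (?p \<eta>)) = blinfun_apply (b - c) (delta S (?p \<eta>)) + blinfun_apply c (delta S (?p \<eta>))"
        by (simp add: blinfun.diff_left)
      then have "cinner (delta S (?q \<eta>)) (blinfun_apply b (delta S (?p \<eta>))) =
          cinner (delta S (?q \<eta>)) (blinfun_apply (b - c) (delta S (?p \<eta>))) + ?l"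
        using elim(1) by (simp add: cinner_add_right)
      ultimately have "cmod (cinner (delta S (?q \<eta>)) (blinfun_apply b (delta S (?p \<eta>))) - ?l) < e / 2" by simp
      then have "cinner (delta S (?q \<eta>)) (blinfun_apply b (delta S (?p \<eta>))) \<noteq> 0"
        using l2 by (intro notI) simp
      then show ?case using commutant_D_range[OF b(2) elim(2,3)] by blast
    qed
    then have "germ_of S (?p \<zeta>) = germ_of S (?q \<zeta>)" using eff[OF pr q(2)] q(1) by blast
    then show False using xy xq yp by simp
  qed
  then have "diagonal b" using cb by (simp add: diagonal_def)
  then have "b = pinch b" by (simp add: pinch_diagonal)
  moreover have "pinch b \<in> D" using pinch_B[OF Fin] b(1) B_chain(4) by blast
  ultimately show "b \<in> D" by simp
qed

end

section \<open>Effectivity\<close>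

context twisted_self_similar_action
begin

lemma xcat_inf:
  assumes \<mu>: "\<mu> \<in> paths S" and y: "InfP y \<in> path_space S" "erng S (y 0) = psrc S \<mu>"
  shows "xcat \<mu> (InfP y) \<in> boundary_paths S" "xcat \<mu> (InfP y) \<in> cylinder S \<mu>"
proof -
  have w: "walk S (psrc S \<mu>) (map y [0..<n])" for n using pre_paths[OF y(1), of n] y(2) by simp
  have "walk S (psrc S \<mu>) (snd (pre S (InfP y) 1))" using w[of 1] by simp
  note c = pre_xcat[OF this \<mu>]
  have "xcat \<mu> (InfP y) \<in> path_space S"
  proof (rule path_spaceI[of _ "plen \<mu>"])
    show "reaches (xcat \<mu> (InfP y)) (plen \<mu>)" by simp
    show "pre S (xcat \<mu> (InfP y)) (plen \<mu> + k) \<in> paths S" for k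
      unfolding c using \<mu> w[of k] by (cases \<mu>) (simp add: walk_append)
  qed
  then show "xcat \<mu> (InfP y) \<in> boundary_paths S" "xcat \<mu> (InfP y) \<in> cylinder S \<mu>"
    using c(1)[of 0] by (auto simp: boundary_paths_iff cylinder_iff)
qed

text \<open>If some continuation of \<open>\<mu>\<close> ends at a singular vertex, it gives a
  finite boundary path. Otherwise every vertex that is reached is regular, and edges can be chosen
  forever.\<close>

lemma boundary_extension:
  assumes \<mu>: "\<mu> \<in> paths S"
  obtains \<xi> where "\<xi> \<in> boundary_paths S" "\<xi> \<in> cylinder S \<mu>"
proof (cases "\<exists>\<kappa>\<in>paths S. prng \<kappa> = psrc S \<mu> \<and> singular_vertex S (psrc S \<kappa>)")
  case True
  then obtain \<kappa> where \<kappa>: "\<kappa> \<in> paths S" "prng \<kappa> = psrc S \<mu>" "singular_vertex S (psrc S \<kappa>)" by blast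
  have p: "pcat \<mu> \<kappa> \<in> paths S" "psrc S (pcat \<mu> \<kappa>) = psrc S \<kappa>"
    using \<mu> \<kappa> by (cases \<mu>; cases \<kappa>; auto simp: walk_append psrc_append)+
  then have "FinP (pcat \<mu> \<kappa>) \<in> boundary_paths S" using \<kappa>(3) by (auto simp: boundary_paths_def)
  moreover from this have "FinP (pcat \<mu> \<kappa>) \<in> cylinder S \<mu>"
    using boundary_subset by (auto simp: cylinder_iff) (auto simp: pcat_def plen_def)
  ultimately show thesis by (rule that)
next
  case False
  define v where "v = rec_nat (psrc S \<mu>) (\<lambda>_ w. esrc S (SOME e. e \<in> edges_into S w))"
  define y where "y n = (SOME e. e \<in> edges_into S (v n))" for n
  have v0: "v 0 = psrc S \<mu>" and vS: "v (Suc n) = esrc S (y n)" for n by (simp_all add: v_def y_def)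
  have reg: "\<exists>es. walk S (psrc S \<mu>) es \<and> psrc S (psrc S \<mu>, es) = v n \<and> y n \<in> edges_into S (v n)" for n
  proof (induction n)
    case 0
    have w: "walk S (psrc S \<mu>) []" using \<mu> walk_psrc by (cases \<mu>) auto
    have "(psrc S \<mu>, []) \<in> paths S" "prng (psrc S \<mu>, [] :: 'b list) = psrc S \<mu>" "psrc S (psrc S \<mu>, []) = psrc S \<mu>"
      using w by simp_all
    then have "\<not> singular_vertex S (psrc S \<mu>)" using False by metis
    then have "edges_into S (v 0) \<noteq> {}" using w by (auto simp: singular_vertex_def regular_vertex_def v0)
    then have "y 0 \<in> edges_into S (v 0)" by (simp add: y_def some_in_eq)
    moreover have "psrc S (psrc S \<mu>, []) = v 0" using v0 by simp
    ultimately show ?case using w by blast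
  next
    case (Suc n)
    then obtain es where es: "walk S (psrc S \<mu>) es" "psrc S (psrc S \<mu>, es) = v n" "y n \<in> edges_into S (v n)" by blast
    have w: "walk S (psrc S \<mu>) (es @ [y n])" "psrc S (psrc S \<mu>, es @ [y n]) = v (Suc n)"
      using es by (auto simp: walk_append psrc_append vS edges_into_def esrc_Vert)
    have "(psrc S \<mu>, es @ [y n]) \<in> paths S" "prng (psrc S \<mu>, es @ [y n]) = psrc S \<mu>" using w(1) by simp_all
    then have "\<not> singular_vertex S (v (Suc n))" using False w(2) by metis
    moreover have "v (Suc n) \<in> Vert S" using es by (simp add: vS edges_into_def esrc_Vert)
    ultimately have "edges_into S (v (Suc n)) \<noteq> {}" by (auto simp: singular_vertex_def regular_vertex_def)
    then have "y (Suc n) \<in> edges_into S (v (Suc n))" by (simp add: y_def some_in_eq)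
    then show ?case using w by blast
  qed
  have "y n \<in> Edges S" "erng S (y n) = v n" for n using reg[of n] by (auto simp: edges_into_def)
  then have "y \<in> inf_paths S" "erng S (y 0) = psrc S \<mu>" by (auto simp: inf_paths_def vS v0)
  then show thesis using xcat_inf[OF \<mu>] that by (auto simp: path_space_def)
qed

lemma cylinder_edges:
  assumes \<eta>: "\<eta> \<in> cylinder S \<mu>"
  shows "\<eta> = FinP \<mu> \<or> (\<exists>e\<in>edges_into S (psrc S \<mu>). \<eta> \<in> cylinder S (pcat \<mu> (psrc S \<mu>, [e])))"
proof (cases "reaches \<eta> (Suc (plen \<mu>))")
  case True
  let ?d = "drop (plen \<mu>) (snd (pre S \<eta> (Suc (plen \<mu>))))"
  note s = cylinder_segment[OF \<eta>, of "Suc (plen \<mu>)"]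
  have "length ?d = 1" using length_pre[OF True, of S] by simp
  then obtain e where e: "?d = [e]" by (metis One_nat_def length_0_conv length_Suc_conv)
  then have "e \<in> edges_into S (psrc S \<mu>)" using s(2) by (auto simp: edges_into_def)
  moreover have "\<eta> \<in> cylinder S (pcat \<mu> (psrc S \<mu>, [e]))"
    using \<eta> s(1) True e by (simp add: cylinder_iff plen_pcat) (simp add: pcat_def)
  ultimately show ?thesis by blast
next
  case False
  moreover have "reaches \<eta> (plen \<mu>)" "pre S \<eta> (plen \<mu>) = \<mu>" using \<eta> by (auto simp: cylinder_iff)
  ultimately show ?thesis by (cases \<eta>) (auto simp: plen_def prod_eq_iff)
qed

lemma cylinder_pre: "\<eta> \<in> path_space S \<Longrightarrow> \<eta> \<in> cylinder S (pre S \<eta> n)"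
  by (cases \<eta>) (auto simp: cylinder_iff plen_def min_def)

lemma cylinder_restrict:
  assumes "\<zeta> \<in> path_space S" "reaches \<zeta> n" "\<eta> \<in> cylinder S (pre S \<zeta> n)" "plen \<mu> \<le> n"
  shows "\<eta> \<in> cylinder S \<mu> \<longleftrightarrow> \<zeta> \<in> cylinder S \<mu>"
proof -
  have \<eta>: "\<eta> \<in> path_space S" "reaches \<eta> n" "pre S \<eta> n = pre S \<zeta> n"
    using assms plen_pre[OF assms(2), of S] by (auto simp: cylinder_iff)
  then have "pre S \<eta> (plen \<mu>) = pre S \<zeta> (plen \<mu>)"
    using pre_take[OF assms(4), of S \<eta>] pre_take[OF assms(4), of S \<zeta>] by simp
  then show ?thesis using \<eta> assms reaches_mono[OF \<eta>(2) assms(4)] reaches_mono[OF assms(2,4)] by (simp add: cylinder_iff)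
qed

text \<open>The restriction of \<open>l\<close> to \<open>ks\<close> fixes every continuation of
  \<open>ks\<close>, so (Evr) applies to this restriction; prepending \<open>ks\<close> gives a path
  strongly fixed by \<open>l\<close>.\<close>

lemma evr_strongly_fixed:
  assumes Evr: "cond_Evr S" and l: "l \<in> Grp S" "grng S l = gsrc S l" and k: "walk S (gsrc S l) ks"
    and fix_all: "\<And>ns. walk S (psrc S (gsrc S l, ks)) ns \<Longrightarrow> act_list S l (ks @ ns) = ks @ ns"
  shows "\<exists>ns. walk S (psrc S (gsrc S l, ks)) ns \<and> strongly_fixed S l (gsrc S l, ks @ ns)"
proof -
  let ?m = "sect_list S l ks" and ?w = "psrc S (gsrc S l, ks)"
  note w = walk_act_list[OF l(1) k]
  have ak: "act_list S l ks = ks"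
    using fix_all[of "[]"] walk_psrc[OF k] by simp
  then have m: "gsrc S ?m = ?w" "grng S ?m = ?w" using w l by auto
  have "fixes_path S ?m \<mu>" if "\<mu> \<in> paths S" "prng \<mu> = gsrc S ?m" for \<mu>
    using that fix_all[of "snd \<mu>"] ak m by (cases \<mu>) (auto simp: fixes_path_def act_list_append)
  then obtain \<mu> where \<mu>: "\<mu> \<in> paths S" "strongly_fixed S ?m \<mu>"
    using Evr w(2) unfolding cond_Evr_def by blast
  obtain v ns where mm: "\<mu> = (v, ns)" by fastforce
  have s: "walk S ?w ns" "v = ?w" "act_list S ?m ns = ns" "sect_list S ?m ns = psrc S (?w, ns)"
    using \<mu>(2) m unfolding mm strongly_fixed_iff by metis+
  have "strongly_fixed S l (gsrc S l, ks @ ns)"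
    unfolding strongly_fixed_iff
    using s(1,3,4) k l ak by (simp add: walk_append act_list_append sect_list_append psrc_append)
  then show ?thesis using s(1) by blast
qed

end

text \<open>Both the path space and the boundary qualify. Containing the boundary makes
  \<open>Y\<close> meet the cylinder of every path; invariance lets conditions on points of
  \<open>Y\<close> be applied to ranges of germs.\<close>

locale boundary_rep = twisted_rep +
  assumes boundary_Y: "boundary_paths S \<subseteq> Y"
    and range_Y: "p \<in> germ_reps S \<Longrightarrow> rep_source p \<in> Y \<Longrightarrow> rep_range S p \<in> Y"
begin

lemma near_deep:
  assumes "eventually P (near \<zeta>)" "\<zeta> \<in> path_space S"
  obtains L where "\<And>n \<eta>. L \<le> n \<Longrightarrow> reaches \<zeta> n \<Longrightarrow> \<eta> \<in> Y \<Longrightarrow> \<eta> \<in> cylinder S (pre S \<zeta> n) \<Longrightarrow> P \<eta>"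
proof -
  obtain F where F: "finite F" "F \<subseteq> paths S"
    "\<And>\<eta>. \<eta> \<in> Y \<Longrightarrow> (\<forall>\<mu>\<in>F. \<eta> \<in> cylinder S \<mu> \<longleftrightarrow> \<zeta> \<in> cylinder S \<mu>) \<Longrightarrow> P \<eta>"
    using assms(1) unfolding eventually_near by blast
  show thesis
  proof (rule that[of "sum plen F"])
    fix n \<eta> assume n: "sum plen F \<le> n" "reaches \<zeta> n" and \<eta>: "\<eta> \<in> Y" "\<eta> \<in> cylinder S (pre S \<zeta> n)"
    have "plen \<mu> \<le> n" if "\<mu> \<in> F" for \<mu> using member_le_sum[OF that _ F(1), of plen] n(1) by simp
    then show "P \<eta>" using F(3)[OF \<eta>(1)] cylinder_restrict[OF assms(2) n(2) \<eta>(2)] by blast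
  qed
qed

lemma near_FinP:
  assumes "eventually P (near (FinP \<nu>))" "\<nu> \<in> paths S"
  obtains A where "finite A" "\<And>e \<eta>. e \<notin> A \<Longrightarrow> \<eta> \<in> Y \<Longrightarrow> \<eta> \<in> cylinder S (pcat \<nu> (psrc S \<nu>, [e])) \<Longrightarrow> P \<eta>"
proof -
  obtain F where F: "finite F" "F \<subseteq> paths S"
    "\<And>\<eta>. \<eta> \<in> Y \<Longrightarrow> (\<forall>\<mu>\<in>F. \<eta> \<in> cylinder S \<mu> \<longleftrightarrow> FinP \<nu> \<in> cylinder S \<mu>) \<Longrightarrow> P \<eta>"
    using assms(1) unfolding eventually_near by blast
  have \<nu>: "FinP \<nu> \<in> path_space S" "reaches (FinP \<nu>) (plen \<nu>)" "pre S (FinP \<nu>) (plen \<nu>) = \<nu>"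
    using assms(2) by (auto simp: path_space_def plen_def)
  \<comment> \<open>The excluded edges are those by which paths in \<open>F\<close> continue beyond
    \<open>\<nu>\<close>. For a path in \<open>F\<close> that is too short the indexed value is
    arbitrary and only enlarges the finite set.\<close>
  show thesis
  proof (rule that[of "(\<lambda>\<mu>. snd \<mu> ! plen \<nu>) ` F"])
    show "finite ((\<lambda>\<mu>. snd \<mu> ! plen \<nu>) ` F)" using F(1) by simp
    fix e \<eta> assume e: "e \<notin> (\<lambda>\<mu>. snd \<mu> ! plen \<nu>) ` F" and \<eta>: "\<eta> \<in> Y" "\<eta> \<in> cylinder S (pcat \<nu> (psrc S \<nu>, [e]))"
    have \<eta>\<nu>: "\<eta> \<in> cylinder S (pre S (FinP \<nu>) (plen \<nu>))" using cylinder_pcatD[OF \<eta>(2)] \<nu>(3) by simp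
    have "\<eta> \<in> cylinder S \<mu> \<longleftrightarrow> FinP \<nu> \<in> cylinder S \<mu>" if \<mu>: "\<mu> \<in> F" for \<mu>
    proof (cases "plen \<mu> \<le> plen \<nu>")
      case True
      then show ?thesis using cylinder_restrict[OF \<nu>(1,2) \<eta>\<nu>] by blast
    next
      case False
      then have "FinP \<nu> \<notin> cylinder S \<mu>" by (auto simp: cylinder_iff plen_def)
      moreover have "\<eta> \<notin> cylinder S \<mu>"
      proof
        assume "\<eta> \<in> cylinder S \<mu>"
        then have "pre S \<eta> (plen \<mu>) = \<mu>" by (simp add: cylinder_iff)
        moreover have "pre S \<eta> (Suc (plen \<nu>)) = pcat \<nu> (psrc S \<nu>, [e])" using \<eta>(2) by (simp add: cylinder_iff plen_pcat)
        moreover have "Suc (plen \<nu>) \<le> plen \<mu>" using False by simp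
        ultimately have "(fst \<mu>, take (Suc (plen \<nu>)) (snd \<mu>)) = pcat \<nu> (psrc S \<nu>, [e])"
          using pre_take[of "Suc (plen \<nu>)" "plen \<mu>" S \<eta>] by simp
        from arg_cong[OF this, of snd] have "snd (pcat \<nu> (psrc S \<nu>, [e])) = take (Suc (plen \<nu>)) (snd \<mu>)" by simp
        then have "(snd \<nu> @ [e]) ! plen \<nu> = take (Suc (plen \<nu>)) (snd \<mu>) ! plen \<nu>" by (simp add: pcat_def)
        then have "e = snd \<mu> ! plen \<nu>" by (simp add: plen_def)
        then show False using e \<mu> by blast
      qed
      ultimately show ?thesis by simp
    qed
    then show "P \<eta>" using F(3)[OF \<eta>(1)] by blast
  qed
qed

text \<open>A neighbourhood in \<open>Y\<close> of a point other than the end of a path at a regular vertex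
  contains the trace of a cylinder.\<close>

lemma near_cases:
  assumes ev: "eventually P (near \<zeta>)" and \<zeta>: "\<zeta> \<in> cylinder S \<beta>"
  obtains \<mu> where "\<zeta> = FinP \<mu>" "finite_receiver S (psrc S \<mu>)" "edges_into S (psrc S \<mu>) \<noteq> {}"
  | ks where "walk S (psrc S \<beta>) ks" "\<And>\<eta>. \<eta> \<in> Y \<Longrightarrow> \<eta> \<in> cylinder S (pcat \<beta> (psrc S \<beta>, ks)) \<Longrightarrow> P \<eta>"
proof -
  have ps: "\<zeta> \<in> path_space S" using \<zeta> by (simp add: cylinder_iff)
  obtain L where L: "\<And>n \<eta>. L \<le> n \<Longrightarrow> reaches \<zeta> n \<Longrightarrow> \<eta> \<in> Y \<Longrightarrow> \<eta> \<in> cylinder S (pre S \<zeta> n) \<Longrightarrow> P \<eta>"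
    by (rule near_deep[OF ev ps]) blast
  have seg: "walk S (psrc S \<beta>) (drop (plen \<beta>) (snd (pre S \<zeta> n)))"
    "pcat \<beta> (psrc S \<beta>, drop (plen \<beta>) (snd (pre S \<zeta> n))) = pre S \<zeta> n" if "plen \<beta> \<le> n" for n
    using cylinder_segment[OF \<zeta> that] by (auto simp: pcat_def)
  show thesis
  proof (cases "reaches \<zeta> (plen \<beta> + L)")
    case True
    then show thesis using that(2)[OF seg(1)[of "plen \<beta> + L"]] L[of "plen \<beta> + L"] seg(2)[of "plen \<beta> + L"] by simp
  next
    case False
    then obtain \<mu> where \<mu>: "\<zeta> = FinP \<mu>" by (cases \<zeta>) auto
    have mp: "\<mu> \<in> paths S" using ps \<mu> by (auto simp: path_space_def)
    have m: "reaches \<zeta> (plen \<mu>)" "pre S \<zeta> (plen \<mu>) = \<mu>" "plen \<beta> \<le> plen \<mu>" using \<zeta> \<mu> by (auto simp: plen_def cylinder_iff)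
    note sm = seg[OF m(3), unfolded m(2)]
    show thesis
    proof (cases "finite (edges_into S (psrc S \<mu>))")
      case True
      show thesis
      proof (cases "edges_into S (psrc S \<mu>) = {}")
        case False
        then show thesis using that(1)[OF \<mu>] True psrc_Vert[OF mp] by (simp add: finite_receiver_def)
      next
        case True
        have "P \<eta>" if \<eta>: "\<eta> \<in> Y" "\<eta> \<in> cylinder S \<mu>" for \<eta>
          using cylinder_edges[OF \<eta>(2)] True \<mu> eventually_near_self[OF ev] \<eta>(1) by auto
        then show thesis using that(2)[OF sm(1)] sm(2) by simp
      qed
    next
      case False
      \<comment> \<open>At an infinite receiver some incoming edge avoids the finite exceptional
        set, and the trace of its cylinder lies in the neighbourhood.\<close>
      obtain A where A: "finite A" "\<And>e \<eta>. e \<notin> A \<Longrightarrow> \<eta> \<in> Y \<Longrightarrow> \<eta> \<in> cylinder S (pcat \<mu> (psrc S \<mu>, [e])) \<Longrightarrow> P \<eta>"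
        by (rule near_FinP[OF ev[unfolded \<mu>] mp]) blast
      obtain e where e: "e \<in> edges_into S (psrc S \<mu>)" "e \<notin> A" using False A(1) by (meson finite_subset subsetI)
      let ?ks = "drop (plen \<beta>) (snd \<mu>)"
      have src: "psrc S (psrc S \<beta>, ?ks) = psrc S \<mu>" using sm(2) psrc_append[of S "fst \<beta>" "snd \<beta>" ?ks] by (simp add: pcat_def)
      have "walk S (psrc S \<beta>) (?ks @ [e])"
        using sm(1) e(1) by (simp add: walk_append src edges_into_def esrc_Vert)
      moreover have "pcat \<beta> (psrc S \<beta>, ?ks @ [e]) = pcat \<mu> (psrc S \<mu>, [e])"
        using sm(2) by (simp add: pcat_def prod_eq_iff)
      ultimately show thesis using that(2) A(2)[OF e(2)] by metis
    qed
  qed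
qed

text \<open>Equal lengths force \<open>\<alpha> = \<gamma>\<close>, and the inverse of
  \<open>h\<close> times \<open>k\<close> fixes all words below some cylinder within the
  neighbourhood. (Evr) finds a strongly fixed path there, and by (Fin) triviality is constant on the
  neighbourhood, so it holds at \<open>\<zeta>\<close>. If \<open>\<zeta>\<close> ends at a regular
  vertex, \<open>near_cases\<close> may offer no cylinder; (Rec) settles this case, which does not
  occur on the boundary.\<close>

lemma effective_same_length:
  assumes Fin: "cond_Fin S" and Evr: "cond_Evr S"
    and p: "(\<alpha>, h, \<beta>, \<zeta>) \<in> reps" and q: "(\<gamma>, k, \<beta>, \<zeta>) \<in> reps" and len: "plen \<gamma> = plen \<alpha>"
    and ev: "eventually (\<lambda>\<eta>. rep_range S (\<alpha>, h, \<beta>, \<eta>) = rep_range S (\<gamma>, k, \<beta>, \<eta>)) (near \<zeta>)"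
    and Rec: "cond_Rec S \<or> Y \<subseteq> boundary_paths S"
  shows "germ_of S (\<alpha>, h, \<beta>, \<zeta>) = germ_of S (\<gamma>, k, \<beta>, \<zeta>)"
proof -
  have P: "\<alpha> \<in> paths S" "h \<in> Grp S" "grng S h = psrc S \<alpha>" "gsrc S h = psrc S \<beta>" "\<zeta> \<in> cylinder S \<beta>" "\<zeta> \<in> Y"
    and K: "\<gamma> \<in> paths S" "k \<in> Grp S" "grng S k = psrc S \<gamma>" "gsrc S k = psrc S \<beta>" and \<beta>: "\<beta> \<in> paths S"
    using p q by (auto simp: reps_iff)
  have "rep_range S (\<alpha>, h, \<beta>, \<zeta>) = rep_range S (\<gamma>, k, \<beta>, \<zeta>)" using eventually_near_self[OF ev P(6)] .
  then have \<alpha>\<gamma>: "\<alpha> = \<gamma>"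
    using rep_range_self[OF reps_germ_reps[OF p]] rep_range_self[OF reps_germ_reps[OF q]] len
    unfolding cylinder_iff by metis
  let ?l = "gmult S (ginv S h) k"
  note hi = ginv_closed[OF P(2)] gsrc_ginv[OF P(2)] grng_ginv[OF P(2)]
  have gk: "gsrc S (ginv S h) = grng S k" using hi P K \<alpha>\<gamma> by simp
  have l: "?l \<in> Grp S" "gsrc S ?l = psrc S \<beta>" "grng S ?l = psrc S \<beta>"
    using gmult_closed[OF hi(1) K(2) gk] gsrc_gmult[OF hi(1) K(2) gk] grng_gmult[OF hi(1) K(2) gk] K P hi by auto
  have lfix: "act_list S ?l ns = ns"
    if eq: "rep_range S (\<alpha>, h, \<beta>, \<eta>) = rep_range S (\<gamma>, k, \<beta>, \<eta>)" and \<eta>: "\<eta> \<in> Y"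
      "\<eta> \<in> cylinder S (pcat \<beta> (psrc S \<beta>, ns))" and ns: "walk S (psrc S \<beta>) ns" for \<eta> ns
  proof -
    have c: "\<eta> \<in> cylinder S \<beta>" using cylinder_pcatD[OF \<eta>(2)] .
    have r: "(\<alpha>, h, \<beta>, \<eta>) \<in> germ_reps S" "(\<gamma>, k, \<beta>, \<eta>) \<in> germ_reps S"
      using reps_source[OF p] reps_source[OF q] c \<eta> reps_germ_reps by blast+
    have "pre S \<eta> (plen \<beta> + length ns) = pcat \<beta> (psrc S \<beta>, ns)" using \<eta>(2) by (simp add: cylinder_iff plen_pcat)
    then have d: "drop (plen \<beta>) (snd (pre S \<eta> (plen \<beta> + length ns))) = ns" by (simp add: pcat_def plen_def)
    have "act_list S h ns = act_list S k ns"
      using rep_range_pre(1)[OF r(1), of "length ns"] rep_range_pre(1)[OF r(2), of "length ns"] eq \<alpha>\<gamma> unfolding d by simp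
    moreover have "walk S (gsrc S k) ns" "walk S (gsrc S h) ns" using ns K P by auto
    ultimately show ?thesis
      using act_list_gmult[OF hi(1) K(2) gk] act_list_ginv(1)[OF P(2)] by metis
  qed
  have "trivial_at ?l \<beta> \<zeta>"
  proof (rule near_cases[OF eventually_conj[OF ev eventually_trivial_at[OF Fin l(1), of \<beta> \<zeta>]] P(5)])
    fix \<mu> assume \<mu>: "\<zeta> = FinP \<mu>" "finite_receiver S (psrc S \<mu>)" "edges_into S (psrc S \<mu>) \<noteq> {}"
    have mp: "\<mu> \<in> paths S" using P(5) \<mu>(1) by (auto simp: cylinder_iff path_space_def)
    have "\<zeta> \<notin> boundary_paths S"
      using \<mu> psrc_Vert[OF mp] by (auto simp: boundary_paths_def singular_vertex_def regular_vertex_def finite_receiver_def)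
    then have Rec: "cond_Rec S" using Rec P(6) by blast
    let ?ns = "drop (plen \<beta>) (snd \<mu>)"
    have m: "pre S \<zeta> (plen \<mu>) = \<mu>" "plen \<beta> \<le> plen \<mu>" using P(5) \<mu>(1) by (auto simp: cylinder_iff plen_def)
    note s = cylinder_segment[OF P(5) m(2), unfolded m(1)]
    have \<mu>2: "\<mu> = pcat \<beta> (psrc S \<beta>, ?ns)" using s(1) by (simp add: pcat_def)
    have src: "psrc S (psrc S \<beta>, ?ns) = psrc S \<mu>" using s(1) psrc_append[of S "fst \<beta>" "snd \<beta>" ?ns] by (metis prod.collapse)
    have c: "\<zeta> \<in> cylinder S (pcat \<beta> (psrc S \<beta>, ?ns))"
      unfolding \<mu>2[symmetric] using P(5) \<mu>(1) by (auto simp: cylinder_iff plen_def)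
    have "act_list S ?l ?ns = ?ns"
      using lfix[OF eventually_near_self[OF ev P(6)] P(6) c s(2)] .
    then have "fixes_path S ?l (psrc S \<beta>, ?ns)" using s(2) l by (simp add: fixes_path_def)
    then have "strongly_fixed S ?l (psrc S \<beta>, ?ns)"
      using Rec l(1) s(2) src \<mu>(2) unfolding cond_Rec_def by (metis paths_iff)
    then show ?thesis using c unfolding trivial_at_def by blast
  next
    fix ks assume ks: "walk S (psrc S \<beta>) ks"
      "\<And>\<eta>. \<eta> \<in> Y \<Longrightarrow> \<eta> \<in> cylinder S (pcat \<beta> (psrc S \<beta>, ks)) \<Longrightarrow>
        rep_range S (\<alpha>, h, \<beta>, \<eta>) = rep_range S (\<gamma>, k, \<beta>, \<eta>) \<and> (trivial_at ?l \<beta> \<eta> \<longleftrightarrow> trivial_at ?l \<beta> \<zeta>)"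
    have ext: "\<exists>\<eta>\<in>Y. \<eta> \<in> cylinder S (pcat \<beta> (psrc S \<beta>, ks @ ns)) \<and> \<eta> \<in> cylinder S (pcat \<beta> (psrc S \<beta>, ks))"
      if ns: "walk S (psrc S (psrc S \<beta>, ks)) ns" for ns
    proof -
      have "pcat \<beta> (psrc S \<beta>, ks @ ns) \<in> paths S"
        using \<beta> ks(1) ns by (cases \<beta>) (simp add: walk_append psrc_append)
      then obtain \<eta> where \<eta>: "\<eta> \<in> boundary_paths S" "\<eta> \<in> cylinder S (pcat \<beta> (psrc S \<beta>, ks @ ns))"
        using boundary_extension by blast
      have "pcat \<beta> (psrc S \<beta>, ks @ ns) = pcat (pcat \<beta> (psrc S \<beta>, ks)) (undefined, ns)" by (simp add: pcat_def)
      then have "\<eta> \<in> cylinder S (pcat \<beta> (psrc S \<beta>, ks))" using \<eta>(2) cylinder_pcatD[of \<eta> "pcat \<beta> (psrc S \<beta>, ks)" "(undefined, ns)"] by simp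
      then show ?thesis using \<eta> boundary_Y by blast
    qed
    have "act_list S ?l (ks @ ns) = ks @ ns" if ns: "walk S (psrc S (gsrc S ?l, ks)) ns" for ns
    proof -
      have ns': "walk S (psrc S (psrc S \<beta>, ks)) ns" using ns unfolding l(2) .
      obtain \<eta> where \<eta>: "\<eta> \<in> Y" "\<eta> \<in> cylinder S (pcat \<beta> (psrc S \<beta>, ks @ ns))" "\<eta> \<in> cylinder S (pcat \<beta> (psrc S \<beta>, ks))"
        using ext[OF ns'] by blast
      show ?thesis using lfix[OF conjunct1[OF ks(2)[OF \<eta>(1,3)]] \<eta>(1,2)] ks(1) ns' by (simp add: walk_append)
    qed
    then obtain ns where ns: "walk S (psrc S (gsrc S ?l, ks)) ns" "strongly_fixed S ?l (gsrc S ?l, ks @ ns)"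
      using evr_strongly_fixed[OF Evr l(1) _ _, of ks] l ks(1) by metis
    obtain \<eta> where \<eta>: "\<eta> \<in> Y" "\<eta> \<in> cylinder S (pcat \<beta> (psrc S \<beta>, ks @ ns))" "\<eta> \<in> cylinder S (pcat \<beta> (psrc S \<beta>, ks))"
      using ext ns(1) unfolding l(2) by blast
    have "trivial_at ?l \<beta> \<eta>" using ns(2) \<eta>(2) unfolding trivial_at_def l(2) by blast
    then show ?thesis using ks(2)[OF \<eta>(1,3)] by blast
  qed
  then show ?thesis using germ_of_eq_iff_trivial[OF reps_germ_reps[OF p] reps_germ_reps[OF q]] \<alpha>\<gamma> by blast
qed

text \<open>As the ranges agree, \<open>\<gamma>\<close> extends \<open>\<alpha>\<close> by a word
  \<open>ds\<close>, and every path that can follow \<open>\<alpha>\<close> is comparable with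
  \<open>ds\<close>. So there is no choice of edges along \<open>ds\<close>, which is a cycle for
  \<open>h\<close> times the inverse of \<open>k\<close> and thus has no entrance.\<close>

lemma cycle_no_entrance:
  assumes h: "h \<in> Grp S" "gsrc S h = psrc S \<beta>" "grng S h = psrc S \<alpha>" and k: "k \<in> Grp S" "gsrc S k = psrc S \<beta>" "grng S k = psrc S \<gamma>"
    and \<alpha>\<beta>: "\<alpha> \<in> paths S" "\<beta> \<in> paths S" "\<gamma> \<in> paths S" and len: "plen \<alpha> < plen \<gamma>"
    and eq: "\<And>\<eta>. \<eta> \<in> boundary_paths S \<Longrightarrow> \<eta> \<in> cylinder S \<beta> \<Longrightarrow> rep_range S (\<alpha>, h, \<beta>, \<eta>) = rep_range S (\<gamma>, k, \<beta>, \<eta>)"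
    and Cyc: "cond_Cyc S"
  shows False
proof -
  have reps: "(\<alpha>, h, \<beta>, \<eta>) \<in> germ_reps S" "(\<gamma>, k, \<beta>, \<eta>) \<in> germ_reps S" if "\<eta> \<in> cylinder S \<beta>" for \<eta>
    using that h k \<alpha>\<beta> by (auto simp: germ_reps_iff)
  have ext: "\<exists>\<eta>\<in>boundary_paths S. \<eta> \<in> cylinder S (pcat \<beta> (psrc S \<beta>, ns))" if "walk S (psrc S \<beta>) ns" for ns
  proof -
    have "pcat \<beta> (psrc S \<beta>, ns) \<in> paths S" using that \<alpha>\<beta> by (cases \<beta>) (simp add: walk_append)
    then show ?thesis by (rule boundary_extension) blast
  qed
  have range_h: "rep_range S (\<alpha>, h, \<beta>, \<eta>) \<in> cylinder S (pcat \<alpha> (psrc S \<alpha>, act_list S h ns))"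
    if \<eta>: "\<eta> \<in> cylinder S (pcat \<beta> (psrc S \<beta>, ns))" for \<eta> ns
  proof -
    have c: "\<eta> \<in> cylinder S \<beta>" using cylinder_pcatD[OF \<eta>] .
    have e: "pre S \<eta> (plen \<beta> + length ns) = pcat \<beta> (psrc S \<beta>, ns)" "reaches \<eta> (plen \<beta> + length ns)"
      using \<eta> by (auto simp: cylinder_iff plen_pcat)
    have d: "drop (plen \<beta>) (snd (pre S \<eta> (plen \<beta> + length ns))) = ns" unfolding e by (simp add: pcat_def plen_def)
    show ?thesis
      using rep_range_pre[OF reps(1)[OF c], of "length ns"] e(2) rep_range_path_space[OF reps(1)[OF c]]
      unfolding d by (simp add: cylinder_iff plen_pcat) (simp add: pcat_def)
  qed
  obtain ds where ds: "walk S (psrc S \<alpha>) ds" "\<gamma> = pcat \<alpha> (psrc S \<alpha>, ds)"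
  proof -
    obtain \<eta> where \<eta>: "\<eta> \<in> boundary_paths S" "\<eta> \<in> cylinder S \<beta>" using boundary_extension[OF \<alpha>\<beta>(2)] .
    have "rep_range S (\<alpha>, h, \<beta>, \<eta>) \<in> cylinder S \<alpha>" "rep_range S (\<alpha>, h, \<beta>, \<eta>) \<in> cylinder S \<gamma>"
      using rep_range_self[OF reps(1)[OF \<eta>(2)]] rep_range_self[OF reps(2)[OF \<eta>(2)]] eq[OF \<eta>] by auto
    then obtain \<kappa> where "\<gamma> = pcat \<alpha> \<kappa>" "\<kappa> \<in> paths S" "prng \<kappa> = psrc S \<alpha>"
      using paths_comparable len by (metis less_imp_le)
    then show thesis using that[of "snd \<kappa>"] by (cases \<kappa>) auto
  qed
  have dl: "length ds > 0" using len ds(2) by (simp add: plen_pcat)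
  have comp: "take (length ds) (act_list S h ns) = take (length ns) ds" if ns: "walk S (psrc S \<beta>) ns" for ns
  proof -
    obtain \<eta> where \<eta>: "\<eta> \<in> boundary_paths S" "\<eta> \<in> cylinder S (pcat \<beta> (psrc S \<beta>, ns))" using ext[OF ns] by blast
    let ?R = "rep_range S (\<alpha>, h, \<beta>, \<eta>)"
    have c: "\<eta> \<in> cylinder S \<beta>" using cylinder_pcatD[OF \<eta>(2)] .
    have 1: "?R \<in> cylinder S (pcat \<alpha> (psrc S \<alpha>, act_list S h ns))" using range_h[OF \<eta>(2)] .
    have 2: "?R \<in> cylinder S (pcat \<alpha> (psrc S \<alpha>, ds))"
      using rep_range_self[OF reps(2)[OF c]] eq[OF \<eta>(1) c] ds(2) by simp
    have a: "snd (pre S ?R (plen \<alpha> + length ns)) = snd \<alpha> @ act_list S h ns"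
      and b: "snd (pre S ?R (plen \<alpha> + length ds)) = snd \<alpha> @ ds"
      using 1 2 by (auto simp: cylinder_iff plen_pcat) (auto simp: pcat_def)
    let ?m = "min (length ns) (length ds)"
    have "take (plen \<alpha> + ?m) (snd \<alpha> @ act_list S h ns) = snd (pre S ?R (plen \<alpha> + ?m))"
      using pre_take[of "plen \<alpha> + ?m" "plen \<alpha> + length ns" S ?R] a by simp
    moreover have "take (plen \<alpha> + ?m) (snd \<alpha> @ ds) = snd (pre S ?R (plen \<alpha> + ?m))"
      using pre_take[of "plen \<alpha> + ?m" "plen \<alpha> + length ds" S ?R] b by simp
    ultimately have "take (plen \<alpha> + ?m) (snd \<alpha> @ act_list S h ns) = take (plen \<alpha> + ?m) (snd \<alpha> @ ds)" by simp
    then have "take ?m (act_list S h ns) = take ?m ds" by (simp add: plen_def)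
    then show ?thesis by (cases "length ns \<le> length ds") (auto simp: min_def)
  qed
  have hinv: "walk S (psrc S \<beta>) (act_list S (ginv S h) es)" "act_list S h (act_list S (ginv S h) es) = es"
    if "walk S (psrc S \<alpha>) es" for es
    using walk_act_list(1)[OF ginv_closed[OF h(1)], of es] act_list_ginv(1)[OF ginv_closed[OF h(1)], of es] that h
    by (auto simp: gsrc_ginv grng_ginv ginv_ginv)
  have comp': "take (length ds) es = take (length es) ds" if "walk S (psrc S \<alpha>) es" for es
    using comp[OF hinv(1)[OF that]] hinv(2)[OF that] by simp
  have k_inv: "ginv S k \<in> Grp S" "gsrc S (ginv S k) = grng S k" "grng S (ginv S k) = psrc S \<beta>"
    using k by (auto simp: ginv_closed gsrc_ginv grng_ginv)
  let ?g = "gmult S h (ginv S k)" and ?\<delta> = "(psrc S \<alpha>, ds)"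
  have src: "psrc S ?\<delta> = psrc S \<gamma>" using ds(2) by (cases \<alpha>) (simp add: psrc_append)
  have g: "?g \<in> Grp S" "gsrc S ?g = psrc S ?\<delta>" "grng S ?g = psrc S \<alpha>"
    using gmult_closed[OF h(1) k_inv(1)] gsrc_gmult[OF h(1) k_inv(1)] grng_gmult[OF h(1) k_inv(1)] h k k_inv src by auto
  then have "g_cycle S ?g ?\<delta>" using ds(1) dl by (simp add: g_cycle_def)
  then have "has_entrance S ?\<delta>" using Cyc g(1) unfolding cond_Cyc_def by blast
  then obtain w e f where w: "w \<in> insert (psrc S ?\<delta>) (erng S ` set ds)" and ef: "e \<in> edges_into S w" "f \<in> edges_into S w" "e \<noteq> f"
    unfolding has_entrance_def by auto
  show False
  proof (cases "w \<in> erng S ` set ds")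
    case True
    then obtain i where i: "i < length ds" "w = erng S (ds ! i)" by (auto simp: in_set_conv_nth)
    have wk: "walk S (psrc S \<alpha>) (take i ds @ ds ! i # drop (Suc i) ds)" using ds(1) i(1) by (simp add: id_take_nth_drop[symmetric])
    have "x = ds ! i" if x: "x \<in> edges_into S w" for x
    proof -
      have "walk S (psrc S \<alpha>) (take i ds @ [x])"
        using wk x i(2) by (auto simp: walk_append edges_into_def esrc_Vert)
      from comp'[OF this] i(1) have "take i ds @ [x] = take (Suc i) ds" by simp
      then show ?thesis using i(1) by (simp add: take_Suc_conv_app_nth)
    qed
    then show False using ef by metis
  next
    case False
    \<comment> \<open>At the end of \<open>ds\<close>, incoming edges are carried injectively by the
      inverse of \<open>k\<close> and then by \<open>h\<close> to edges that follow
      \<open>\<alpha>\<close>, where only the first edge of \<open>ds\<close> is possible.\<close>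
    then have w: "w = grng S k" using w src k by simp
    have kx: "act S (ginv S k) x \<in> edges_into S (psrc S \<beta>)" "act S h (act S (ginv S k) x) = hd ds" if x: "x \<in> edges_into S w" for x
    proof -
      show ex: "act S (ginv S k) x \<in> edges_into S (psrc S \<beta>)"
        using x k_inv by (auto simp: edges_into_def w act_closed erng_act)
      then have "walk S (psrc S \<beta>) [act S (ginv S k) x]" by (auto simp: edges_into_def esrc_Vert)
      from comp[OF this] dl show "act S h (act S (ginv S k) x) = hd ds" by (cases ds) auto
    qed
    have "inj_on (act S h) (edges_into S (psrc S \<beta>))"
      using bij_betw_edges_into[OF h(1)] h(2) by (simp add: bij_betw_def)
    then have "act S (ginv S k) e = act S (ginv S k) f" using kx ef by (metis inj_onD)
    moreover have "inj_on (act S (ginv S k)) (edges_into S w)"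
      using bij_betw_edges_into[OF k_inv(1)] k_inv(2) w by (simp add: bij_betw_def)
    ultimately show False using ef by (metis inj_onD)
  qed
qed

text \<open>For different lengths the neighbourhood contains the trace of a cylinder, since no
  boundary path ends at a regular vertex. Refining both representatives to this cylinder turns local
  agreement of ranges into the agreement on all boundary paths of a cylinder that
  \<open>cycle_no_entrance\<close> asks for.\<close>

lemma effective_boundary:
  assumes Fin: "cond_Fin S" and Evr: "cond_Evr S" and Y: "Y = boundary_paths S" and Cyc: "cond_Cyc S"
    and p: "(\<alpha>, h, \<beta>, \<zeta>) \<in> reps" and q: "(\<gamma>, k, \<beta>, \<zeta>) \<in> reps"
    and ev: "eventually (\<lambda>\<eta>. rep_range S (\<alpha>, h, \<beta>, \<eta>) = rep_range S (\<gamma>, k, \<beta>, \<eta>)) (near \<zeta>)"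
  shows "germ_of S (\<alpha>, h, \<beta>, \<zeta>) = germ_of S (\<gamma>, k, \<beta>, \<zeta>)"
proof (cases "plen \<gamma> = plen \<alpha>")
  case True
  then show ?thesis using effective_same_length[OF Fin Evr p q True ev] Y by blast
next
  case False
  have P: "\<alpha> \<in> paths S" "h \<in> Grp S" "grng S h = psrc S \<alpha>" "gsrc S h = psrc S \<beta>" "\<zeta> \<in> cylinder S \<beta>" "\<zeta> \<in> Y"
    and K: "\<gamma> \<in> paths S" "k \<in> Grp S" "grng S k = psrc S \<gamma>" "gsrc S k = psrc S \<beta>" and \<beta>: "\<beta> \<in> paths S"
    using p q by (auto simp: reps_iff)
  have False
  proof (rule near_cases[OF ev P(5)])
    fix \<mu> assume \<mu>: "\<zeta> = FinP \<mu>" "finite_receiver S (psrc S \<mu>)" "edges_into S (psrc S \<mu>) \<noteq> {}"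
    have mp: "\<mu> \<in> paths S" using P(5) \<mu>(1) by (auto simp: cylinder_iff path_space_def)
    show False
      using \<mu> psrc_Vert[OF mp] P(6) Y by (auto simp: boundary_paths_def singular_vertex_def regular_vertex_def finite_receiver_def)
  next
    fix ks assume ks: "walk S (psrc S \<beta>) ks"
      "\<And>\<eta>. \<eta> \<in> Y \<Longrightarrow> \<eta> \<in> cylinder S (pcat \<beta> (psrc S \<beta>, ks)) \<Longrightarrow> rep_range S (\<alpha>, h, \<beta>, \<eta>) = rep_range S (\<gamma>, k, \<beta>, \<eta>)"
    let ?\<beta> = "pcat \<beta> (psrc S \<beta>, ks)" and ?n = "plen \<beta> + length ks"
    have b1: "?\<beta> \<in> paths S" using \<beta> ks(1) by (cases \<beta>) (simp add: walk_append)
    have b2: "psrc S ?\<beta> = psrc S (psrc S \<beta>, ks)" by (cases \<beta>) (simp add: psrc_append)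
    have one: "(pcat \<alpha> (psrc S \<alpha>, act_list S h ks)) \<in> paths S \<and> sect_list S h ks \<in> Grp S \<and>
        gsrc S (sect_list S h ks) = psrc S ?\<beta> \<and> grng S (sect_list S h ks) = psrc S (pcat \<alpha> (psrc S \<alpha>, act_list S h ks)) \<and>
        (\<forall>\<eta>\<in>cylinder S ?\<beta>. rep_range S (pcat \<alpha> (psrc S \<alpha>, act_list S h ks), sect_list S h ks, ?\<beta>, \<eta>) = rep_range S (\<alpha>, h, \<beta>, \<eta>))"
      if "\<alpha> \<in> paths S" "h \<in> Grp S" "grng S h = psrc S \<alpha>" "gsrc S h = psrc S \<beta>" for \<alpha> h
    proof -
      have w: "walk S (gsrc S h) ks" using that ks by simp
      note l = walk_act_list[OF that(2) w]
      have "rep_range S (pcat \<alpha> (psrc S \<alpha>, act_list S h ks), sect_list S h ks, ?\<beta>, \<eta>) = rep_range S (\<alpha>, h, \<beta>, \<eta>)"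
        if \<eta>: "\<eta> \<in> cylinder S ?\<beta>" for \<eta>
      proof -
        have r: "(\<alpha>, h, \<beta>, \<eta>) \<in> germ_reps S" using that \<open>\<alpha> \<in> _\<close> \<open>h \<in> _\<close> \<open>grng S h = _\<close> \<open>gsrc S h = _\<close> \<beta> cylinder_pcatD[OF \<eta>] by (simp add: germ_reps_iff)
        have n: "reaches \<eta> ?n" "pre S \<eta> ?n = ?\<beta>" using \<eta> by (auto simp: cylinder_iff plen_pcat)
        have "refinable (\<alpha>, h, \<beta>, \<eta>) ?n" using n by simp
        moreover have "drop (plen \<beta>) (snd (pre S \<eta> ?n)) = ks" unfolding n by (simp add: pcat_def plen_def)
        then have "refine S (\<alpha>, h, \<beta>, \<eta>) ?n = (pcat \<alpha> (psrc S \<alpha>, act_list S h ks), sect_list S h ks, ?\<beta>, \<eta>)"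
          using n by (simp add: Let_def) (simp add: pcat_def)
        ultimately show ?thesis using rep_range_refine[OF r] by metis
      qed
      then show ?thesis
        using that l b2 by (cases \<alpha>) (simp add: walk_append psrc_append)
    qed
    note A = one[OF P(1-4)] and C = one[OF K(1-4)]
    have eq: "rep_range S (pcat \<alpha> (psrc S \<alpha>, act_list S h ks), sect_list S h ks, ?\<beta>, \<eta>) =
        rep_range S (pcat \<gamma> (psrc S \<gamma>, act_list S k ks), sect_list S k ks, ?\<beta>, \<eta>)"
      if "\<eta> \<in> boundary_paths S" "\<eta> \<in> cylinder S ?\<beta>" for \<eta>
      using A C ks(2)[of \<eta>] that Y by simp
    show False
    proof (cases "plen \<alpha> < plen \<gamma>")
      case True
      show False
        by (rule cycle_no_entrance[of "sect_list S h ks" ?\<beta> "pcat \<alpha> (psrc S \<alpha>, act_list S h ks)"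
              "sect_list S k ks" "pcat \<gamma> (psrc S \<gamma>, act_list S k ks)"])
          (use A C True eq b1 Cyc in \<open>auto simp: plen_pcat\<close>)
    next
      case F: False
      show False
        by (rule cycle_no_entrance[of "sect_list S k ks" ?\<beta> "pcat \<gamma> (psrc S \<gamma>, act_list S k ks)"
              "sect_list S h ks" "pcat \<alpha> (psrc S \<alpha>, act_list S h ks)"])
          (use A C F False eq b1 Cyc in \<open>auto simp: plen_pcat\<close>)
    qed
  qed
  then show ?thesis ..
qed

text \<open>The neighbourhood contains a finite path. The length of its range is that of the left
  path plus that of its tail behind \<open>\<beta>\<close>, so equal ranges force left paths of
  equal length.\<close>

lemma effective_path_space:
  assumes Fin: "cond_Fin S" and Evr: "cond_Evr S" and Rec: "cond_Rec S" and Y: "Y = path_space S"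
    and p: "(\<alpha>, h, \<beta>, \<zeta>) \<in> reps" and q: "(\<gamma>, k, \<beta>, \<zeta>) \<in> reps"
    and ev: "eventually (\<lambda>\<eta>. rep_range S (\<alpha>, h, \<beta>, \<eta>) = rep_range S (\<gamma>, k, \<beta>, \<eta>)) (near \<zeta>)"
  shows "germ_of S (\<alpha>, h, \<beta>, \<zeta>) = germ_of S (\<gamma>, k, \<beta>, \<zeta>)"
proof -
  have \<zeta>: "\<zeta> \<in> cylinder S \<beta>" "\<zeta> \<in> Y" "\<beta> \<in> paths S" using p by (auto simp: reps_iff)
  have "plen \<gamma> = plen \<alpha>"
  proof -
    obtain \<mu> where \<mu>: "FinP \<mu> \<in> Y" "FinP \<mu> \<in> cylinder S \<beta>"
      "rep_range S (\<alpha>, h, \<beta>, FinP \<mu>) = rep_range S (\<gamma>, k, \<beta>, FinP \<mu>)"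
    proof (rule near_cases[OF ev \<zeta>(1)])
      fix \<mu> assume "\<zeta> = FinP \<mu>"
      then show thesis using that[of \<mu>] \<zeta> eventually_near_self[OF ev \<zeta>(2)] by simp
    next
      fix ks assume ks: "walk S (psrc S \<beta>) ks"
        "\<And>\<eta>. \<eta> \<in> Y \<Longrightarrow> \<eta> \<in> cylinder S (pcat \<beta> (psrc S \<beta>, ks)) \<Longrightarrow> rep_range S (\<alpha>, h, \<beta>, \<eta>) = rep_range S (\<gamma>, k, \<beta>, \<eta>)"
      let ?\<mu> = "pcat \<beta> (psrc S \<beta>, ks)"
      have "?\<mu> \<in> paths S" using \<zeta>(3) ks(1) by (cases \<beta>) (simp add: walk_append)
      then have m: "FinP ?\<mu> \<in> Y" using Y by (simp add: path_space_def)
      then have "FinP ?\<mu> \<in> cylinder S ?\<mu>" using Y by (simp add: cylinder_iff) (simp add: plen_def)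
      then show thesis using that[of ?\<mu>] m ks(2) cylinder_pcatD by blast
    qed
    have r: "(\<alpha>, h, \<beta>, FinP \<mu>) \<in> germ_reps S" "(\<gamma>, k, \<beta>, FinP \<mu>) \<in> germ_reps S"
      using reps_source[OF p] reps_source[OF q] \<mu> reps_germ_reps by blast+
    define j where "j = plen \<mu> - plen \<beta>"
    have j: "plen \<mu> = plen \<beta> + j" using \<mu>(2) by (simp add: j_def cylinder_iff) (simp add: plen_def)
    have len: "reaches (FinP \<mu>) n \<longleftrightarrow> n \<le> plen \<mu>" for n by (simp add: plen_def)
    let ?R = "rep_range S (\<alpha>, h, \<beta>, FinP \<mu>)"
    have "reaches ?R (plen \<alpha> + j)" "\<not> reaches ?R (plen \<alpha> + Suc j)" "reaches ?R (plen \<gamma> + j)" "\<not> reaches ?R (plen \<gamma> + Suc j)"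
      using rep_range_pre(2)[OF r(1), of j] rep_range_pre(2)[OF r(1), of "Suc j"]
        rep_range_pre(2)[OF r(2), of j] rep_range_pre(2)[OF r(2), of "Suc j"] j \<mu>(3)
      by (simp_all add: len del: reaches.simps add_Suc_right)
    then show ?thesis
      using reaches_mono[of ?R "plen \<gamma> + j" "plen \<alpha> + Suc j"] reaches_mono[of ?R "plen \<alpha> + j" "plen \<gamma> + Suc j"] by linarith
  qed
  then show ?thesis using effective_same_length[OF Fin Evr p q _ ev] Rec by blast
qed

text \<open>All three algebras contain the same diagonal, so both the bound on the relative
  commutant and the expectation pass to the smaller ones.\<close>

lemma cartan_of_masa:
  assumes "cond_Fin S" "B NoSub \<inter> commutant D \<subseteq> D"
  shows "cartan_inclusion D (B k)"
  unfolding cartan_iff using expectation_exists[OF assms(1)] assms(2) B_chain(4)[of k] by blast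

lemma cartan_of_masa0:
  assumes "cond_Fin S" "B Sub0 \<inter> commutant D \<subseteq> D" "k \<in> {Sub0, Sub00}"
  shows "cartan_inclusion D (B k)"
  unfolding cartan_iff using expectation_exists[OF assms(1)] assms(2,3) B_chain(1) by blast

end

section \<open>Consequences of the Cartan property\<close>

context boundary_rep
begin

lemma D_entry_rng:
  assumes "d \<in> D" "x \<in> X" "y \<in> X" "rng x = rng y"
  shows "entry d x x = entry d y y"
  using assms(1) unfolding D_eq
proof (induction rule: closed_span_induct)
  case (limit f a)
  have "(\<lambda>n. entry (f n) x x) \<longlonglongrightarrow> entry a x x" "(\<lambda>n. entry (f n) y y) \<longlonglongrightarrow> entry a y y"
    using bounded_linear.tendsto[OF bounded_linear_entry limit(2)] by blast+
  then show ?case using limit(1) by (simp add: LIMSEQ_unique)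
next
  case (gen a)
  then show ?case using assms(2-4) by (auto simp: entry_Q)
qed (simp_all)

text \<open>The converse of \<open>commutant_D_range\<close>, resting on
  \<open>D_entry_rng\<close>.\<close>

lemma commutantI:
  assumes b: "on_X b"
    and rr: "\<And>p. p \<in> reps \<Longrightarrow> blinfun_apply b (delta S p) = 0 \<or>
        (\<exists>c q. q \<in> reps \<and> blinfun_apply b (delta S p) = cscale c (delta S q) \<and> rep_range S q = rep_range S p)"
  shows "b \<in> commutant D"
proof -
  have cb: "clinear_op b" by (rule on_X_clinear[OF b])
  have same: "rng x = rng y" if nz: "entry b x y \<noteq> 0" and "x \<in> X" "y \<in> X" for x y
  proof -
    obtain p where p: "p \<in> reps" "y = germ_of S p" using X_E[OF \<open>y \<in> X\<close>] .
    obtain q where q: "q \<in> reps" "x = germ_of S q" using X_E[OF \<open>x \<in> X\<close>] .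
    note pq = reps_germ_reps[OF p(1)] reps_germ_reps[OF q(1)]
    have nz': "cinner (delta S q) (blinfun_apply b (delta S p)) \<noteq> 0"
      using nz entry_delta(1)[OF cb pq] p(2) q(2) by (metis norm_eq_zero)
    then obtain c r where r: "r \<in> reps" "blinfun_apply b (delta S p) = cscale c (delta S r)" "rep_range S r = rep_range S p"
      using rr[OF p(1)] by fastforce
    have "germ_of S q = germ_of S r"
      using nz' r(2) cinner_delta(1)[OF pq(2) reps_germ_reps[OF r(1)]] by (auto simp: cinner_cscale_right)
    then have "rep_range S q = rep_range S r" by (rule germ_of_range[OF pq(2) reps_germ_reps[OF r(1)]])
    then show ?thesis using r(3) p(2) q(2) by (simp add: rng_germ_of[OF pq(1)] rng_germ_of[OF pq(2)])
  qed
  have "b o\<^sub>L d = d o\<^sub>L b" if d: "d \<in> D" for d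
  proof (rule clinear_op_entry_eqI)
    have cd: "clinear_op d" using on_X_clinear[OF on_X_D[OF d]] .
    show "clinear_op (b o\<^sub>L d)" "clinear_op (d o\<^sub>L b)" using clinear_op_comp[OF cb cd] clinear_op_comp[OF cd cb] .
    fix x y
    have "entry b x y = 0 \<or> entry d x x = entry d y y"
    proof (cases "entry b x y = 0")
      case False
      then have "x \<in> X" "y \<in> X" using b unfolding on_X_def by blast+
      then show ?thesis using same[OF False] D_entry_rng[OF d] by blast
    qed simp
    then show "entry (b o\<^sub>L d) x y = entry (d o\<^sub>L b) x y"
      using entry_comp_diagonal_right[OF cb diagonal_D[OF d]] entry_comp_diagonal_left[OF cb diagonal_D[OF d]] by auto
  qed
  then show ?thesis using cb unfolding commutant_def by blast
qed

lemma D_apply: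
  assumes "d \<in> D" "p \<in> reps"
  shows "blinfun_apply d (delta S p) = cscale (entry d (germ_of S p) (germ_of S p)) (delta S p)"
proof -
  obtain c where c: "delta S p = cscale c (ket (germ_of S p))" using delta_ket[OF reps_germ_reps[OF assms(2)]] by blast
  show ?thesis
    unfolding c clinear_opD[OF on_X_clinear[OF on_X_D[OF assms(1)]]] diagonal_apply_ket[OF diagonal_D[OF assms(1)]]
    by (simp add: mult.commute)
qed

lemma germ_eq_of_D:
  assumes d: "d \<in> D" and p: "p \<in> reps" and q: "q \<in> reps"
    and eq: "blinfun_apply d (delta S p) = cscale c (delta S q)" and c: "c \<noteq> 0"
  shows "germ_of S q = germ_of S p"
proof -
  obtain a where a: "delta S p = cscale a (ket (germ_of S p))" using delta_ket[OF reps_germ_reps[OF p]] by blast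
  obtain b where b: "cmod b = 1" "delta S q = cscale b (ket (germ_of S q))" using delta_ket[OF reps_germ_reps[OF q]] by blast
  have "cscale (c * b) (ket (germ_of S q)) = cscale (entry d (germ_of S p) (germ_of S p) * a) (ket (germ_of S p))"
    using eq D_apply[OF d p] unfolding a b(2) by simp
  moreover have "c * b \<noteq> 0" using c b(1) by auto
  ultimately show ?thesis using cscale_ket_eq_iff[THEN iffD1] by metis
qed

text \<open>Represents the unit of the groupoid at \<open>\<zeta>\<close>; entries at these units
  turn diagonal operators into functions on \<open>Y\<close>.\<close>

definition unit_rep :: "('a, 'b) xpath \<Rightarrow> ('a, 'b) germ_rep" where
  "unit_rep \<zeta> = ((fst (pre S \<zeta> 0), []), fst (pre S \<zeta> 0), (fst (pre S \<zeta> 0), []), \<zeta>)"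

lemma unit_rep_eq: "\<zeta> \<in> cylinder S (v, []) \<Longrightarrow> unit_rep \<zeta> = ((v, []), v, (v, []), \<zeta>)"
  by (simp add: unit_rep_def vertex_cylinder)

lemma unit_rep:
  assumes "\<zeta> \<in> Y"
  shows "unit_rep \<zeta> \<in> reps" "rep_range S (unit_rep \<zeta>) = \<zeta>"
proof -
  let ?v = "fst (pre S \<zeta> 0)"
  have ps: "\<zeta> \<in> path_space S" using assms Y_subset by blast
  have w: "walk S ?v (snd (pre S \<zeta> n))" for n
    using pre_paths[OF ps, of n] fst_pre[of S \<zeta> n] by (metis paths_iff prod.collapse)
  have v: "?v \<in> Vert S" using walk_Vert[OF w] .
  have c: "\<zeta> \<in> cylinder S (?v, [])" using ps by (simp add: vertex_cylinder)
  then show r: "unit_rep \<zeta> \<in> reps"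
    using v assms by (simp add: unit_rep_def reps_iff Vert_Grp grng_unit gsrc_unit)
  note g = reps_germ_reps[OF r, unfolded unit_rep_def]
  show "rep_range S (unit_rep \<zeta>) = \<zeta>"
    unfolding unit_rep_def
  proof (rule xpath_eqI)
    fix n
    show "reaches (rep_range S ((?v, []), ?v, (?v, []), \<zeta>)) n \<longleftrightarrow> reaches \<zeta> n"
      using rep_range_pre(2)[OF g, of n] by simp
    have "pre S (rep_range S ((?v, []), ?v, (?v, []), \<zeta>)) n = (?v, snd (pre S \<zeta> n))"
      using rep_range_pre(1)[OF g, of n] act_list_unit(1)[OF w, of n] by simp
    then show "pre S (rep_range S ((?v, []), ?v, (?v, []), \<zeta>)) n = pre S \<zeta> n"
      using fst_pre[of S \<zeta> n] by (metis prod.collapse)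
  qed
qed

lemma rep_range_W:
  assumes g: "g \<in> Grp S" and p: "(\<alpha>, h, \<beta>, \<xi>) \<in> germ_reps S" and gs: "gsrc S g = prng \<alpha>"
    and q: "(pact S g \<alpha>, gmult S (psect S g \<alpha>) h, \<beta>, \<xi>) \<in> germ_reps S"
  shows "pre S (rep_range S (pact S g \<alpha>, gmult S (psect S g \<alpha>) h, \<beta>, \<xi>)) n =
      (grng S g, act_list S g (snd (pre S (rep_range S (\<alpha>, h, \<beta>, \<xi>)) n)))"
    "reaches (rep_range S (pact S g \<alpha>, gmult S (psect S g \<alpha>) h, \<beta>, \<xi>)) n \<longleftrightarrow> reaches (rep_range S (\<alpha>, h, \<beta>, \<xi>)) n"
proof -
  obtain v es where \<alpha>: "\<alpha> = (v, es)" by fastforce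
  have P: "walk S (gsrc S g) es" "h \<in> Grp S" "grng S h = psrc S (gsrc S g, es)" "gsrc S h = psrc S \<beta>" "\<xi> \<in> cylinder S \<beta>"
    using p gs by (auto simp: germ_reps_iff \<alpha>)
  note w = walk_act_list[OF g P(1)]
  have "pre S (rep_range S (pact S g \<alpha>, gmult S (psect S g \<alpha>) h, \<beta>, \<xi>)) n =
      (grng S g, act_list S g (snd (pre S (rep_range S (\<alpha>, h, \<beta>, \<xi>)) n))) \<and>
    (reaches (rep_range S (pact S g \<alpha>, gmult S (psect S g \<alpha>) h, \<beta>, \<xi>)) n \<longleftrightarrow> reaches (rep_range S (\<alpha>, h, \<beta>, \<xi>)) n)"
  proof (cases "plen \<alpha> \<le> n")
    case True
    then obtain k where k: "n = plen \<alpha> + k" using le_Suc_ex by blast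
    let ?d = "drop (plen \<beta>) (snd (pre S \<xi> (plen \<beta> + k)))"
    have "walk S (gsrc S h) ?d" using cylinder_segment(2)[OF P(5), of "plen \<beta> + k"] P(4) by simp
    then have "act_list S (gmult S (sect_list S g es) h) ?d = act_list S (sect_list S g es) (act_list S h ?d)"
      using act_list_gmult[OF w(2) P(2)] w(3) P(3) by simp
    then show ?thesis
      using rep_range_pre[OF p, of k] rep_range_pre[OF q, of k] unfolding k by (simp add: \<alpha> act_list_append)
  next
    case False
    then show ?thesis
      using rep_range_cylinder[OF p, of n] rep_range_cylinder[OF q, of n] by (simp add: \<alpha> take_act_list)
  qed
  then show "pre S (rep_range S (pact S g \<alpha>, gmult S (psect S g \<alpha>) h, \<beta>, \<xi>)) n =
      (grng S g, act_list S g (snd (pre S (rep_range S (\<alpha>, h, \<beta>, \<xi>)) n)))"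
    "reaches (rep_range S (pact S g \<alpha>, gmult S (psect S g \<alpha>) h, \<beta>, \<xi>)) n \<longleftrightarrow> reaches (rep_range S (\<alpha>, h, \<beta>, \<xi>)) n"
    by blast+
qed

text \<open>A projection of \<open>D\<close> cutting down to germs with range in a basic
  neighbourhood of \<open>\<zeta>\<close>. Complements of cylinders are formed as differences below
  \<open>Q \<nu>\<close>, so that they stay in \<open>D\<close>.\<close>

lemma neighbourhood_projection:
  assumes "finite F" "F \<subseteq> paths S" "\<nu> \<in> paths S"
  shows "\<exists>R\<in>D. \<forall>p\<in>reps. blinfun_apply R (delta S p) =
    (if rep_range S p \<in> cylinder S \<nu> \<and> (\<forall>\<mu>\<in>F. rep_range S p \<in> cylinder S \<mu> \<longleftrightarrow> \<zeta> \<in> cylinder S \<mu>) then delta S p else 0)"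
  using assms(1,2)
proof (induction F)
  case empty
  show ?case using Q_in_D[OF assms(3)] Q_delta[OF assms(3)] by (intro bexI[of _ "Q \<nu>"]) auto
next
  case (insert \<mu> F)
  then obtain R where R: "R \<in> D" "\<And>p. p \<in> reps \<Longrightarrow> blinfun_apply R (delta S p) =
    (if rep_range S p \<in> cylinder S \<nu> \<and> (\<forall>\<mu>\<in>F. rep_range S p \<in> cylinder S \<mu> \<longleftrightarrow> \<zeta> \<in> cylinder S \<mu>) then delta S p else 0)"
    by (metis (no_types, lifting) insert_subset)
  have \<mu>: "\<mu> \<in> paths S" using insert.prems by simp
  have RQ: "R o\<^sub>L Q \<mu> \<in> D" using cstar_algebraD(4)[OF cstar_D R(1) Q_in_D[OF \<mu>]] .
  show ?case
  proof (cases "\<zeta> \<in> cylinder S \<mu>")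
    case True
    then show ?thesis
      by (intro bexI[OF _ RQ] ballI) (simp add: Q_delta[OF \<mu>] R(2) blinfun.zero_right)
  next
    case False
    then show ?thesis
      by (intro bexI[OF _ cstar_algebraD(9)[OF cstar_D R(1) RQ]] ballI)
        (simp add: Q_delta[OF \<mu>] R(2) blinfun.zero_right blinfun.diff_left)
  qed
qed

text \<open>If \<open>g\<close> acts trivially near \<open>\<zeta>\<close>, then \<open>W g\<close> compressed to a neighbourhood of
  \<open>\<zeta>\<close> commutes with the diagonal.\<close>

lemma trivial_at_of_masa:
  assumes masa: "B K \<inter> commutant D \<subseteq> D" and g: "g \<in> Grp S" "grng S g = gsrc S g"
    and \<zeta>: "\<zeta> \<in> Y" "\<zeta> \<in> cylinder S (gsrc S g, [])"
    and ev: "eventually (\<lambda>\<eta>. \<eta> \<in> cylinder S (gsrc S g, []) \<longrightarrow> (\<forall>n. act_list S g (snd (pre S \<eta> n)) = snd (pre S \<eta> n))) (near \<zeta>)"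
  shows "trivial_at g (gsrc S g, []) \<zeta>"
proof -
  let ?v = "gsrc S g"
  have v: "(?v, []) \<in> paths S" using gsrc_Vert[OF g(1)] by simp
  obtain F where F: "finite F" "F \<subseteq> paths S"
    "\<forall>\<eta>\<in>Y. (\<forall>\<mu>\<in>F. \<eta> \<in> cylinder S \<mu> \<longleftrightarrow> \<zeta> \<in> cylinder S \<mu>) \<longrightarrow> \<eta> \<in> cylinder S (?v, []) \<longrightarrow>
      (\<forall>n. act_list S g (snd (pre S \<eta> n)) = snd (pre S \<eta> n))"
    using ev[unfolded eventually_near] by (elim exE conjE)
  obtain R where R: "R \<in> D" "\<And>p. p \<in> reps \<Longrightarrow> blinfun_apply R (delta S p) =
    (if rep_range S p \<in> cylinder S (?v, []) \<and> (\<forall>\<mu>\<in>F. rep_range S p \<in> cylinder S \<mu> \<longleftrightarrow> \<zeta> \<in> cylinder S \<mu>) then delta S p else 0)"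
    using neighbourhood_projection[OF F(1,2) v, of \<zeta>] by blast
  let ?b = "W g o\<^sub>L R"
  have "?b \<in> commutant D"
  proof (rule commutantI)
    show "on_X ?b" using on_X_comp[OF on_X_W[OF g(1)] on_X_D[OF R(1)]] .
    fix p assume p: "p \<in> reps"
    show "blinfun_apply ?b (delta S p) = 0 \<or>
        (\<exists>c q. q \<in> reps \<and> blinfun_apply ?b (delta S p) = cscale c (delta S q) \<and> rep_range S q = rep_range S p)"
    proof (cases "rep_range S p \<in> cylinder S (?v, []) \<and> (\<forall>\<mu>\<in>F. rep_range S p \<in> cylinder S \<mu> \<longleftrightarrow> \<zeta> \<in> cylinder S \<mu>)")
      case False
      have "blinfun_apply R (delta S p) = 0" by (subst R(2)[OF p]) (rule if_not_P[OF False])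
      then show ?thesis by (simp add: blinfun.zero_right)
    next
      case True
      obtain \<alpha> h \<beta> \<xi> where pp: "p = (\<alpha>, h, \<beta>, \<xi>)" by (cases p) blast
      note gr = reps_germ_reps[OF p[unfolded pp]]
      have "fst (pre S (rep_range S p) 0) = ?v" using True by (simp add: vertex_cylinder)
      then have gs: "?v = prng \<alpha>" using rep_range_cylinder(1)[OF gr, of 0] by (simp add: pp prng_def)
      let ?q = "(pact S g \<alpha>, gmult S (psect S g \<alpha>) h, \<beta>, \<xi>)"
      have q: "?q \<in> reps" using W_reps[OF g(1) p[unfolded pp] gs] .
      have Yr: "rep_range S p \<in> Y" using range_Y[OF reps_germ_reps[OF p]] p by (simp add: reps_def)
      have "rep_range S ?q = rep_range S (\<alpha>, h, \<beta>, \<xi>)"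
      proof (rule xpath_eqI)
        fix n
        note rw = rep_range_W[OF g(1) gr gs reps_germ_reps[OF q], of n]
        show "reaches (rep_range S ?q) n \<longleftrightarrow> reaches (rep_range S (\<alpha>, h, \<beta>, \<xi>)) n" by (rule rw(2))
        have "act_list S g (snd (pre S (rep_range S p) n)) = snd (pre S (rep_range S p) n)"
          using F(3)[rule_format, OF Yr] True by simp
        moreover have "fst (pre S (rep_range S p) n) = ?v" using True by (simp add: vertex_cylinder fst_pre[of S _ n])
        ultimately show "pre S (rep_range S ?q) n = pre S (rep_range S (\<alpha>, h, \<beta>, \<xi>)) n"
          using rw(1) g(2) unfolding pp by (simp add: prod_eq_iff)
      qed
      moreover have "blinfun_apply ?b (delta S p) = cscale (ptw S g \<alpha> * twG S (psect S g \<alpha>) h) (delta S ?q)"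
        using True W_delta[OF g(1) p[unfolded pp]] gs R(2)[OF p] unfolding pp by simp
      ultimately show ?thesis using q pp by blast
    qed
  qed
  moreover have "?b \<in> B K" using cstar_algebraD(4)[OF cstar_B W_in_B[OF g(1)]] R(1) D_subset_B by blast
  ultimately have bD: "?b \<in> D" using masa by blast
  \<comment> \<open>A diagonal operator maps a unit vector to a multiple of itself. Applied to the
    unit at \<open>\<zeta>\<close>, \<open>?b\<close> gives the germ of \<open>g\<close>, which must
    therefore be that unit.\<close>
  let ?p = "((?v, []), ?v, (?v, []), \<zeta>)" and ?q = "((?v, []), g, (?v, []), \<zeta>)"
  have p: "?p \<in> reps" "rep_range S ?p = \<zeta>" using unit_rep[OF \<zeta>(1)] unit_rep_eq[OF \<zeta>(2)] by auto
  have q: "?q \<in> reps" using g \<zeta> gsrc_Vert[OF g(1)] by (simp add: reps_iff)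
  have "blinfun_apply ?b (delta S ?p) = cscale 1 (delta S ?q)"
    using R(2)[OF p(1)] p(2) \<zeta>(2) W_delta[OF g(1) p(1)] g by (simp add: twG_unit_right unit_right)
  from germ_eq_of_D[OF bD p(1) q this] have "germ_of S ?p = germ_of S ?q" by simp
  then have "trivial_at (gmult S (ginv S ?v) g) (?v, []) \<zeta>"
    using germ_of_eq_iff_trivial[OF reps_germ_reps[OF p(1)] reps_germ_reps[OF q]] by blast
  moreover have "gmult S (ginv S ?v) g = g" using ginv_unit[OF gsrc_Vert[OF g(1)]] unit_left[OF g(1)] g(2) by simp
  ultimately show ?thesis by simp
qed

lemma masa_Evr:
  assumes masa: "B K \<inter> commutant D \<subseteq> D"
  shows "cond_Evr S"
  unfolding cond_Evr_def
proof (intro ballI impI)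
  fix g assume g: "g \<in> Grp S" and all: "\<forall>\<mu>\<in>paths S. prng \<mu> = gsrc S g \<longrightarrow> fixes_path S g \<mu>"
  have v: "(gsrc S g, []) \<in> paths S" using gsrc_Vert[OF g] by simp
  have "fixes_path S g (gsrc S g, [])" using all v by simp
  then have gg: "grng S g = gsrc S g" by (simp add: fixes_path_def)
  obtain \<zeta> where \<zeta>: "\<zeta> \<in> boundary_paths S" "\<zeta> \<in> cylinder S (gsrc S g, [])" using boundary_extension[OF v] .
  have "act_list S g (snd (pre S \<eta> n)) = snd (pre S \<eta> n)" if "\<eta> \<in> cylinder S (gsrc S g, [])" for \<eta> n
  proof -
    have \<eta>: "\<eta> \<in> path_space S" "fst (pre S \<eta> n) = gsrc S g" using that fst_pre[of S \<eta> n] by (auto simp: vertex_cylinder)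
    then have "fixes_path S g (pre S \<eta> n)" using all pre_paths[OF \<eta>(1)] by (simp add: prng_def)
    then show ?thesis by (metis fixes_path_def pact_def snd_conv)
  qed
  then have "trivial_at g (gsrc S g, []) \<zeta>"
    using \<zeta> boundary_Y by (intro trivial_at_of_masa[OF masa g gg]) auto
  then show "\<exists>\<mu>\<in>paths S. strongly_fixed S g \<mu>"
    unfolding trivial_at_def by (metis strongly_fixed_def fixes_path_def)
qed

text \<open>A finite path whose source is a finite receiver is isolated in the path space: within
  its cylinder it is the only point outside the finitely many cylinders of its one-edge extensions.
  So fixing \<open>\<mu>\<close> already means acting trivially near it. The strongly fixed path
  obtained is a prefix of \<open>\<mu>\<close>, and restrictions of units are units.\<close>

lemma masa_Rec:
  assumes masa: "B K \<inter> commutant D \<subseteq> D" and Y: "Y = path_space S"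
  shows "cond_Rec S"
  unfolding cond_Rec_def
proof (intro ballI impI)
  fix g \<mu> assume g: "g \<in> Grp S" and \<mu>: "\<mu> \<in> paths S" "fixes_path S g \<mu> \<and> finite_receiver S (psrc S \<mu>)"
  obtain es where es: "\<mu> = (gsrc S g, es)" "act_list S g es = es" "grng S g = gsrc S g" "walk S (gsrc S g) es"
    using \<mu> by (cases \<mu>) (auto simp: fixes_path_def)
  have fin: "finite (edges_into S (psrc S \<mu>))" using \<mu>(2) by (simp add: finite_receiver_def)
  have m: "FinP \<mu> \<in> path_space S" using \<mu>(1) by (simp add: path_space_def)
  have c: "FinP \<mu> \<in> cylinder S \<mu>" "FinP \<mu> \<in> cylinder S (gsrc S g, [])"
    using m es(1) by (auto simp: cylinder_iff)
  have n: "FinP \<mu> \<notin> cylinder S (pcat \<mu> (psrc S \<mu>, [e]))" for e by (simp add: cylinder_iff plen_pcat) (simp add: plen_def)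
  have "eventually (\<lambda>\<eta>. \<forall>e\<in>edges_into S (psrc S \<mu>). \<eta> \<notin> cylinder S (pcat \<mu> (psrc S \<mu>, [e]))) (near (FinP \<mu>))"
    using eventually_near_cylinder'[of "pcat \<mu> (psrc S \<mu>, [_])" "FinP \<mu>"] n by (intro eventually_ball_finite fin ballI) simp
  then have "eventually (\<lambda>\<eta>. \<eta> = FinP \<mu>) (near (FinP \<mu>))"
    using eventually_near_cylinder'[of \<mu> "FinP \<mu>"] by eventually_elim (use cylinder_edges c in blast)
  then have "eventually (\<lambda>\<eta>. \<eta> \<in> cylinder S (gsrc S g, []) \<longrightarrow> (\<forall>n. act_list S g (snd (pre S \<eta> n)) = snd (pre S \<eta> n))) (near (FinP \<mu>))"
    by eventually_elim (simp add: es take_act_list[symmetric])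
  then have "trivial_at g (gsrc S g, []) (FinP \<mu>)"
    using trivial_at_of_masa[OF masa g es(3) _ c(2)] m Y by blast
  then obtain \<nu> where \<nu>: "strongly_fixed S g \<nu>" "FinP \<mu> \<in> cylinder S (pcat (gsrc S g, []) \<nu>)" unfolding trivial_at_def by blast
  obtain u ns where uu: "\<nu> = (u, ns)" by fastforce
  note sf = \<nu>(1)[unfolded uu strongly_fixed_iff]
  have ns: "length ns \<le> length es" "take (length ns) es = ns" using \<nu>(2) by (auto simp: cylinder_iff es(1) uu)
  let ?k = "drop (length ns) es"
  have k: "es = ns @ ?k" using ns(2) append_take_drop_id by metis
  have "walk S (psrc S (gsrc S g, ns)) ?k" using es(4) k walk_append by metis
  then have "sect_list S (psrc S (gsrc S g, ns)) ?k = psrc S (psrc S (gsrc S g, ns), ?k)" by (rule act_list_unit(2))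
  then have "sect_list S g es = psrc S (gsrc S g, es)"
    using sf k sect_list_append psrc_append by metis
  then show "strongly_fixed S g \<mu>" unfolding es(1) strongly_fixed_iff using es by simp
qed

text \<open>A boundary path cannot stop at a vertex of \<open>R\<close>, which is regular, and has
  no choice of its next edge; the source of that edge is in \<open>R\<close> again.\<close>

lemma unique_boundary_path:
  assumes closed: "\<And>u e. u \<in> R \<Longrightarrow> e \<in> edges_into S u \<Longrightarrow> esrc S e \<in> R"
    and unique: "\<And>u. u \<in> R \<Longrightarrow> \<exists>!e. e \<in> edges_into S u"
    and \<xi>: "\<xi> \<in> boundary_paths S" "fst (pre S \<xi> 0) \<in> R"
    and \<eta>: "\<eta> \<in> boundary_paths S" "fst (pre S \<eta> 0) = fst (pre S \<xi> 0)"
  shows "\<xi> = \<eta>"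
proof -
  have step: "\<exists>e\<in>edges_into S (psrc S (pre S \<xi> n)). reaches \<xi> (Suc n) \<and> pre S \<xi> (Suc n) = pcat (pre S \<xi> n) (psrc S (pre S \<xi> n), [e])"
    if b: "\<xi> \<in> boundary_paths S" and r: "reaches \<xi> n" and R: "psrc S (pre S \<xi> n) \<in> R" for \<xi> n
  proof -
    have ps: "\<xi> \<in> path_space S" using b boundary_subset by blast
    obtain e where e: "edges_into S (psrc S (pre S \<xi> n)) = {e}" using unique[OF R] by blast
    have "regular_vertex S (psrc S (pre S \<xi> n))" using e psrc_Vert[OF pre_paths[OF ps]] by (simp add: regular_vertex_def)
    then have "reaches \<xi> (Suc n)" using b r by (auto simp: boundary_paths_iff singular_vertex_def)
    moreover have "\<xi> \<noteq> FinP (pre S \<xi> n)"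
    proof
      assume eq: "\<xi> = FinP (pre S \<xi> n)"
      have "reaches (FinP (pre S \<xi> n)) (Suc n)" using \<open>reaches \<xi> (Suc n)\<close> eq by metis
      then show False using length_pre[OF r, of S] by simp
    qed
    ultimately obtain f where f: "f \<in> edges_into S (psrc S (pre S \<xi> n))" "\<xi> \<in> cylinder S (pcat (pre S \<xi> n) (psrc S (pre S \<xi> n), [f]))"
      using cylinder_edges[OF pre_cylinder[OF ps r]] by blast
    then have "pre S \<xi> (Suc n) = pcat (pre S \<xi> n) (psrc S (pre S \<xi> n), [f])"
      using plen_pre[OF r, of S] by (simp add: cylinder_iff plen_pcat)
    then show ?thesis using f(1) \<open>reaches \<xi> (Suc n)\<close> by blast
  qed
  have *: "reaches \<xi> n \<and> reaches \<eta> n \<and> pre S \<xi> n = pre S \<eta> n \<and> psrc S (pre S \<xi> n) \<in> R" for n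
  proof (induction n)
    case 0
    have "snd (pre S \<xi> 0) = []" "snd (pre S \<eta> 0) = []" using length_pre[of _ 0 S] by auto
    then show ?case using \<xi>(2) \<eta>(2) by (simp add: prod_eq_iff psrc_def)
  next
    case (Suc n)
    obtain e where e: "e \<in> edges_into S (psrc S (pre S \<xi> n))" "reaches \<xi> (Suc n)"
        "pre S \<xi> (Suc n) = pcat (pre S \<xi> n) (psrc S (pre S \<xi> n), [e])"
      using step[OF \<xi>(1)] Suc by blast
    obtain f where f: "f \<in> edges_into S (psrc S (pre S \<eta> n))" "reaches \<eta> (Suc n)"
        "pre S \<eta> (Suc n) = pcat (pre S \<eta> n) (psrc S (pre S \<eta> n), [f])"
      using step[OF \<eta>(1), of n] Suc by auto
    have "e = f" using unique[of "psrc S (pre S \<xi> n)"] Suc e(1) f(1) by auto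
    moreover have "psrc S (pre S \<xi> (Suc n)) = esrc S e" unfolding e(3) by (simp add: pcat_def psrc_def)
    ultimately show ?case using Suc e f closed by auto
  qed
  show ?thesis by (rule xpath_eqI) (use * in auto)
qed

lemma masa_Cyc:
  assumes masa: "B NoSub \<inter> commutant D \<subseteq> D" and Y: "Y = boundary_paths S"
  shows "cond_Cyc S"
  unfolding cond_Cyc_def
proof (intro ballI allI impI, rule ccontr)
  fix g \<alpha> assume g: "g \<in> Grp S" and cyc: "g_cycle S g \<alpha>" and ne: "\<not> has_entrance S \<alpha>"
  let ?w = "prng \<alpha>"
  have \<alpha>: "\<alpha> \<in> paths S" "plen \<alpha> > 0" "psrc S \<alpha> = gsrc S g" "?w = grng S g" using cyc by (auto simp: g_cycle_def)
  \<comment> \<open>All vertices connected by the groupoid to a vertex of the cycle. The action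
    carries edges to edges, so uniqueness of incoming edges spreads from the cycle to
    \<open>R\<close>.\<close>
  define R where "R = {u. \<exists>k\<in>Grp S. gsrc S k = u \<and> grng S k \<in> erng S ` set (snd \<alpha>)}"
  have wk: "walk S ?w (snd \<alpha>)" using \<alpha>(1) by (cases \<alpha>) simp
  have w_in: "?w \<in> erng S ` set (snd \<alpha>)" using wk \<alpha>(2) by (cases \<alpha>; cases "snd \<alpha>") auto
  have in_edge: "e \<in> edges_into S (erng S e)" if e: "e \<in> set (snd \<alpha>)" for e
  proof -
    obtain xs ys where "snd \<alpha> = xs @ e # ys" using split_list[OF e] by blast
    then show ?thesis using wk by (simp add: walk_append edges_into_def)
  qed
  have out: "esrc S e \<in> erng S ` set (snd \<alpha>) \<or> esrc S e = gsrc S g" if e: "e \<in> set (snd \<alpha>)" for e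
  proof -
    obtain xs ys where s: "snd \<alpha> = xs @ e # ys" using split_list[OF e] by blast
    then have "walk S (esrc S e) ys" using wk by (simp add: walk_append)
    then show ?thesis using s \<alpha>(3) by (cases ys) (auto simp: psrc_def)
  qed
  have one: "e = f" if "t \<in> erng S ` set (snd \<alpha>)" "e \<in> edges_into S t" "f \<in> edges_into S t" for t e f
    using ne that unfolding has_entrance_def by blast
  have closed: "esrc S e \<in> R" if u: "u \<in> R" and e: "e \<in> edges_into S u" for u e
  proof -
    obtain k where k: "k \<in> Grp S" "gsrc S k = u" "grng S k \<in> erng S ` set (snd \<alpha>)" using u unfolding R_def by blast
    have e': "e \<in> Edges S" "gsrc S k = erng S e" using e k by (auto simp: edges_into_def)
    have "act S k e \<in> edges_into S (grng S k)" using act_closed[OF k(1) e'] erng_act[OF k(1) e'] by (simp add: edges_into_def)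
    moreover obtain f where f: "f \<in> set (snd \<alpha>)" "grng S k = erng S f" using k(3) by blast
    ultimately have a: "act S k e \<in> set (snd \<alpha>)" using one[OF k(3)] in_edge[OF f(1)] by metis
    note s = sect_closed[OF k(1) e'] gsrc_sect[OF k(1) e'] grng_sect[OF k(1) e']
    show ?thesis
    proof (cases "esrc S (act S k e) \<in> erng S ` set (snd \<alpha>)")
      case True
      then show ?thesis using s unfolding R_def by auto
    next
      \<comment> \<open>The end of the cycle is the source of \<open>g\<close>, so composing with
        \<open>g\<close> leads back to its first vertex.\<close>
      case False
      then have "gsrc S g = grng S (sect S k e)" using out[OF a] s(3) by simp
      then have "gmult S g (sect S k e) \<in> Grp S" "gsrc S (gmult S g (sect S k e)) = esrc S e"
          "grng S (gmult S g (sect S k e)) = ?w"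
        using gmult_closed[OF g s(1)] gsrc_gmult[OF g s(1)] grng_gmult[OF g s(1)] s(2) \<alpha>(4) by auto
      then show ?thesis using w_in unfolding R_def by (intro CollectI bexI[of _ "gmult S g (sect S k e)"]) simp_all
    qed
  qed
  have unique: "\<exists>!e. e \<in> edges_into S u" if u: "u \<in> R" for u
  proof -
    obtain k where k: "k \<in> Grp S" "gsrc S k = u" "grng S k \<in> erng S ` set (snd \<alpha>)" using u unfolding R_def by blast
    have bij: "bij_betw (act S k) (edges_into S u) (edges_into S (grng S k))" using bij_betw_edges_into[OF k(1)] k(2) by simp
    obtain t where t: "t \<in> edges_into S (grng S k)" using k(3) in_edge by (metis imageE)
    then obtain e where e: "e \<in> edges_into S u" using bij unfolding bij_betw_def by blast
    moreover have "f = e" if f: "f \<in> edges_into S u" for f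
    proof (rule inj_onD[OF bij_betw_imp_inj_on[OF bij] _ f e])
      show "act S k f = act S k e" using one[OF k(3)] bij_betwE[OF bij] e f by blast
    qed
    ultimately show ?thesis by blast
  qed
  have wV: "?w \<in> Vert S" using prng_Vert[OF \<alpha>(1)] .
  have wR: "?w \<in> R" unfolding R_def using w_in wV by (auto simp: gsrc_unit grng_unit intro!: bexI[of _ ?w] Vert_Grp)
  have same: "\<xi> = \<eta>" if "\<xi> \<in> Y" "\<eta> \<in> Y" "fst (pre S \<xi> 0) = ?w" "fst (pre S \<eta> 0) = ?w" for \<xi> \<eta>
    by (rule unique_boundary_path[of R]) (use that closed unique wR Y in auto)
  have m: "matched \<alpha> (ginv S g) (?w, [])"
    using \<alpha> g wV by (simp add: matched_def ginv_closed grng_ginv gsrc_ginv)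
  \<comment> \<open>By \<open>same\<close> only one point of \<open>Y\<close> has range
    \<open>?w\<close>, and it is the range both of every germ on which \<open>?b\<close> does not
    vanish and of its image; hence \<open>?b\<close> commutes with \<open>D\<close>. Membership in
    \<open>D\<close> would make the left path \<open>\<alpha>\<close> of the image of a unit
    empty.\<close>
  let ?b = "N \<alpha> (ginv S g) (?w, [])"
  have fst_rr: "fst (pre S (rep_range S (\<gamma>, h, \<delta>, \<xi>)) 0) = prng \<gamma>" if "(\<gamma>, h, \<delta>, \<xi>) \<in> reps" for \<gamma> h \<delta> \<xi>
    using rep_range_cylinder(1)[OF reps_germ_reps[OF that], of 0] by (simp add: prng_def)
  have rrY: "rep_range S p \<in> Y" if "p \<in> reps" for p using range_Y[OF reps_germ_reps[OF that]] that by (simp add: reps_def)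
  have bc: "?b \<in> commutant D"
  proof (rule commutantI)
    show "on_X ?b" using on_X_N \<alpha>(1) matchedD[OF m] by blast
    fix p assume p: "p \<in> reps"
    obtain \<kappa> h \<delta> \<xi> where pp: "p = (\<kappa>, h, \<delta>, \<xi>)" by (cases p) blast
    show "blinfun_apply ?b (delta S p) = 0 \<or>
        (\<exists>c q. q \<in> reps \<and> blinfun_apply ?b (delta S p) = cscale c (delta S q) \<and> rep_range S q = rep_range S p)"
    proof (cases "prng \<kappa> = ?w")
      case False
      then have "rep_range S p \<notin> cylinder S (?w, [])" using fst_rr p unfolding pp by (simp add: vertex_cylinder)
      then show ?thesis using N_apply_zero[OF m p] by simp
    next
      case True
      have \<kappa>: "\<kappa> \<in> paths S" "\<kappa> = pcat (?w, []) \<kappa>" using p True unfolding pp by (auto simp: reps_iff pcat_def prng_def prod_eq_iff)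
      have r: "(pcat (?w, []) \<kappa>, h, \<delta>, \<xi>) \<in> reps" using p \<kappa>(2) pp by simp
      have pk: "prng \<kappa> = psrc S (?w, [])" using True by simp
      note a = N_apply[OF m r \<kappa>(1) pk]
      let ?q = "(pcat \<alpha> (pact S (ginv S g) \<kappa>), gmult S (psect S (ginv S g) \<kappa>) h, \<delta>, \<xi>)"
      have "rep_range S ?q = rep_range S p"
        by (rule same[OF rrY[OF a(2)] rrY[OF p]])
          (use fst_rr[OF a(2)] fst_rr[OF p[unfolded pp]] True in \<open>simp_all add: pp prng_def pcat_def\<close>)
      moreover have "\<exists>c. blinfun_apply ?b (delta S p) = cscale c (delta S ?q)"
        using a(1) \<kappa>(2) pp by metis
      ultimately show ?thesis using a(2) by blast
    qed
  qed
  have "?b \<in> B NoSub" unfolding B_eq using gensI(1)[OF m] closed_span_superset by blast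
  then have bD: "?b \<in> D" using masa bc by blast
  obtain \<zeta> where \<zeta>: "\<zeta> \<in> boundary_paths S" "\<zeta> \<in> cylinder S (?w, [])" using boundary_extension[of "(?w, [])"] wV by auto
  have p: "((?w, []), ?w, (?w, []), \<zeta>) \<in> reps" using unit_rep(1)[of \<zeta>] unit_rep_eq[OF \<zeta>(2)] \<zeta>(1) Y by simp
  note a = N_apply[OF m, of "(?w, [])", simplified, OF p wV]
  have "twG S (ginv S g) ?w \<noteq> 0" using a(3) by auto
  from germ_eq_of_D[OF bD p a(2) _ this] a(1)
  have "germ_of S (pcat \<alpha> (grng S (ginv S g), []), gmult S (ginv S g) ?w, (?w, []), \<zeta>) = germ_of S ((?w, []), ?w, (?w, []), \<zeta>)" by simp
  then have "pcat \<alpha> (grng S (ginv S g), []) = (?w, [])"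
    using germ_of_eq_iff_trivial[OF reps_germ_reps[OF a(2)] reps_germ_reps[OF p]] by blast
  from arg_cong[OF this, of snd] have "snd \<alpha> = []" by (simp add: pcat_def)
  then show False using \<alpha>(2) by (simp add: plen_def)
qed

subsection \<open>Finiteness\<close>

text \<open>Read at the units, elements of \<open>D\<close> are continuous functions on
  \<open>Y\<close>: a projection \<open>Q \<mu>\<close> gives the locally constant indicator of a
  cylinder, and norm limits are uniform limits of entries.\<close>

lemma D_near:
  assumes d: "d \<in> D" and \<zeta>: "\<zeta> \<in> Y"
  shows "((\<lambda>\<eta>. entry d (germ_of S (unit_rep \<eta>)) (germ_of S (unit_rep \<eta>))) \<longlongrightarrow>
    entry d (germ_of S (unit_rep \<zeta>)) (germ_of S (unit_rep \<zeta>))) (near \<zeta>)"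
  using d unfolding D_eq
proof (induction rule: closed_span_induct)
  case (limit f a)
  let ?u = "\<lambda>\<eta>. germ_of S (unit_rep \<eta>)"
  show ?case
    unfolding tendsto_iff
  proof (intro allI impI)
    fix e :: real assume e: "0 < e"
    then obtain n where n: "norm (f n - a) < e / 3"
      using LIMSEQ_D[OF limit(2), of "e / 3"] by fastforce
    have c: "dist (entry (f n) x x) (entry a x x) < e / 3" for x
      using norm_entry_le[of "f n - a" x x] n by (simp add: dist_norm)
    have "eventually (\<lambda>\<eta>. dist (entry (f n) (?u \<eta>) (?u \<eta>)) (entry (f n) (?u \<zeta>) (?u \<zeta>)) < e / 3) (near \<zeta>)"
      using tendstoD[OF limit(1)[of n], of "e / 3"] e by simp
    then show "eventually (\<lambda>\<eta>. dist (entry a (?u \<eta>) (?u \<eta>)) (entry a (?u \<zeta>) (?u \<zeta>)) < e) (near \<zeta>)"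
    proof eventually_elim
      case (elim \<eta>)
      then show ?case
        using c[of "?u \<eta>"] c[of "?u \<zeta>"]
          dist_triangle[of "entry a (?u \<eta>) (?u \<eta>)" "entry a (?u \<zeta>) (?u \<zeta>)" "entry (f n) (?u \<eta>) (?u \<eta>)"]
          dist_triangle[of "entry (f n) (?u \<eta>) (?u \<eta>)" "entry a (?u \<zeta>) (?u \<zeta>)" "entry (f n) (?u \<zeta>) (?u \<zeta>)"]
        by (simp add: dist_commute)
    qed
  qed
next
  case (gen a)
  then obtain \<mu> where \<mu>: "\<mu> \<in> paths S" "a = Q \<mu>" by blast
  have u: "entry a (germ_of S (unit_rep \<eta>)) (germ_of S (unit_rep \<eta>)) = (if \<eta> \<in> cylinder S \<mu> then 1 else 0)" if "\<eta> \<in> Y" for \<eta>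
    using unit_rep[OF that] by (simp add: \<mu> entry_Q germ_in_X reps_germ_reps rng_germ_of)
  show ?case
    by (rule tendsto_eventually)
      (use eventually_near_Y[of \<zeta>] eventually_near_cylinder[OF \<mu>(1), of \<zeta>] in \<open>eventually_elim, simp add: u \<zeta>\<close>)
qed (auto intro: tendsto_add tendsto_mult_left)

text \<open>Koenig's lemma for the tree of prefixes of minimal strongly fixed paths.\<close>

lemma strongly_fixed_accumulate:
  assumes inf: "infinite {\<mu>. minimal_strongly_fixed S g \<mu>}"
  shows "\<exists>\<xi>\<in>Y. \<xi> \<in> cylinder S (gsrc S g, []) \<and> \<not> trivial_at g (gsrc S g, []) \<xi> \<and>
    (\<forall>P. eventually P (near \<xi>) \<longrightarrow> (\<exists>\<eta> \<mu>. \<eta> \<in> Y \<and> P \<eta> \<and> strongly_fixed S g \<mu> \<and> \<eta> \<in> cylinder S \<mu>))"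
proof -
  let ?v = "gsrc S g"
  define M where "M = {ys. minimal_strongly_fixed S g (?v, ys)}"
  have fst_v: "fst \<mu> = ?v" if "minimal_strongly_fixed S g \<mu>" for \<mu>
    using that by (simp add: minimal_strongly_fixed_def strongly_fixed_def fixes_path_def prng_def)
  have "{\<mu>. minimal_strongly_fixed S g \<mu>} \<subseteq> Pair ?v ` M"
  proof
    fix \<mu> assume "\<mu> \<in> {\<mu>. minimal_strongly_fixed S g \<mu>}"
    then show "\<mu> \<in> Pair ?v ` M" using fst_v[of \<mu>] by (cases \<mu>) (auto simp: M_def)
  qed
  then have infM: "infinite M" using inf finite_subset finite_imageI by metis
  have sf: "strongly_fixed S g (?v, ys)" "walk S ?v ys" if "ys \<in> M" for ys
    using that by (auto simp: M_def minimal_strongly_fixed_def strongly_fixed_def fixes_path_def)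
  \<comment> \<open>Heavy words are the nodes of the tree with infinitely many minimal paths above
    them. A path with only heavy prefixes has no minimal strongly fixed prefix, since such a word is
    its own only extension in \<open>M\<close>.\<close>
  define ext where "ext xs = {ys \<in> M. \<exists>zs. ys = xs @ zs}" for xs
  define heavy where "heavy xs \<longleftrightarrow> infinite (ext xs)" for xs
  have heavyE: "\<exists>zs. xs @ zs \<in> M" if "heavy xs" for xs
  proof -
    have "ext xs \<noteq> {}" using that unfolding heavy_def by auto
    then show ?thesis unfolding ext_def by blast
  qed
  have heavy_walk: "walk S ?v xs" if h: "heavy xs" for xs
    using heavyE[OF h] sf(2) walk_append by blast
  have heavy_prefix: "heavy xs" if h: "heavy (xs @ zs)" for xs zs
  proof -
    have "ext (xs @ zs) \<subseteq> ext xs" unfolding ext_def by auto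
    then show ?thesis using h unfolding heavy_def by (meson finite_subset)
  qed
  have heavy_Nil: "heavy []" using infM by (simp add: heavy_def ext_def)
  have witness: "\<exists>\<eta>\<in>Y. \<eta> \<in> cylinder S (?v, xs @ zs) \<and> \<eta> \<in> cylinder S (?v, xs)" if m: "xs @ zs \<in> M" for xs zs
  proof -
    have "(?v, xs @ zs) \<in> paths S" using sf(2)[OF m] by simp
    then obtain \<eta> where \<eta>: "\<eta> \<in> boundary_paths S" "\<eta> \<in> cylinder S (?v, xs @ zs)" by (rule boundary_extension)
    then have "\<eta> \<in> cylinder S (?v, xs)" using cylinder_pcatD[of \<eta> "(?v, xs)" "(undefined, zs)"] by simp
    then show ?thesis using \<eta> boundary_Y by blast
  qed
  have not_trivial: "\<not> trivial_at g (?v, []) \<xi>" if h: "\<And>n. reaches \<xi> n \<Longrightarrow> heavy (snd (pre S \<xi> n))" for \<xi>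
  proof
    assume "trivial_at g (?v, []) \<xi>"
    then obtain \<mu> where \<mu>: "minimal_strongly_fixed S g \<mu>" "\<xi> \<in> cylinder S (pcat (?v, []) \<mu>)"
      unfolding trivial_at_iff_minimal by blast
    obtain ms where ms: "\<mu> = (?v, ms)" using fst_v[OF \<mu>(1)] by (cases \<mu>) simp
    have "reaches \<xi> (length ms)" "pre S \<xi> (length ms) = (?v, ms)" using \<mu>(2) by (auto simp: ms cylinder_iff)
    then have "heavy ms" using h[of "length ms"] by simp
    moreover have "ext ms \<subseteq> {ms}"
    proof
      fix ys assume "ys \<in> ext ms"
      then obtain zs where zs: "ys = ms @ zs" "ms @ zs \<in> M" unfolding ext_def by auto
      obtain \<eta> where "\<eta> \<in> cylinder S (?v, ms @ zs)" "\<eta> \<in> cylinder S (?v, ms)" using witness[OF zs(2)] by blast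
      then have "(?v, ms @ zs) = (?v, ms)"
        using minimal_unique[of g "(?v, ms @ zs)" "(?v, ms)" \<eta> "(?v, [])"] zs(2) \<mu>(1) by (simp add: M_def ms)
      then show "ys \<in> {ms}" using zs(1) by simp
    qed
    ultimately show False unfolding heavy_def by (meson finite.emptyI finite.insertI finite_subset)
  qed
  show ?thesis
  \<comment> \<open>Infinite branching at a heavy word makes its end an infinite receiver, so the
    finite path itself is a boundary path and serves as limit point. With finite branching, heavy
    words extend forever to an infinite path.\<close>
  proof (cases "\<exists>xs. heavy xs \<and> infinite {e. \<exists>zs. xs @ e # zs \<in> M}")
    case True
    then obtain xs where xs: "heavy xs" "infinite {e. \<exists>zs. xs @ e # zs \<in> M}" by blast
    let ?\<nu> = "(?v, xs)"
    have w: "?\<nu> \<in> paths S" using heavy_walk[OF xs(1)] by simp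
    have "{e. \<exists>zs. xs @ e # zs \<in> M} \<subseteq> edges_into S (psrc S ?\<nu>)"
      by (auto dest!: sf(2) simp: walk_append edges_into_def)
    then have "infinite (edges_into S (psrc S ?\<nu>))" using xs(2) finite_subset by blast
    then have "FinP ?\<nu> \<in> boundary_paths S"
      using w psrc_Vert[OF w] by (auto simp: boundary_paths_def singular_vertex_def regular_vertex_def)
    then have Y: "FinP ?\<nu> \<in> Y" "FinP ?\<nu> \<in> path_space S" using boundary_Y boundary_subset by auto
    show ?thesis
    proof (intro bexI[OF _ Y(1)] conjI allI impI)
      show "FinP ?\<nu> \<in> cylinder S (?v, [])" using Y(2) by (simp add: vertex_cylinder)
      have "heavy (take n xs)" for n using heavy_prefix[of "take n xs" "drop n xs"] xs(1) by simp
      then show "\<not> trivial_at g (?v, []) (FinP ?\<nu>)" by (intro not_trivial) simp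
      fix P assume "eventually P (near (FinP ?\<nu>))"
      then obtain A where A: "finite A" "\<And>e \<eta>. e \<notin> A \<Longrightarrow> \<eta> \<in> Y \<Longrightarrow> \<eta> \<in> cylinder S (pcat ?\<nu> (psrc S ?\<nu>, [e])) \<Longrightarrow> P \<eta>"
        by (rule near_FinP[OF _ w]) blast
      obtain e zs where e: "e \<notin> A" "xs @ e # zs \<in> M"
      proof -
        have "infinite ({e. \<exists>zs. xs @ e # zs \<in> M} - A)" using xs(2) A(1) by simp
        then have "{e. \<exists>zs. xs @ e # zs \<in> M} - A \<noteq> {}" by (metis finite.emptyI)
        then show thesis using that by blast
      qed
      have "(xs @ [e]) @ zs \<in> M" using e(2) by simp
      from witness[OF this] obtain \<eta> where \<eta>: "\<eta> \<in> Y" "\<eta> \<in> cylinder S (?v, xs @ e # zs)" "\<eta> \<in> cylinder S (?v, xs @ [e])" by auto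
      then have "P \<eta>" using A(2)[OF e(1)] by simp
      then show "\<exists>\<eta> \<mu>. \<eta> \<in> Y \<and> P \<eta> \<and> strongly_fixed S g \<mu> \<and> \<eta> \<in> cylinder S \<mu>" using \<eta> sf(1)[OF e(2)] by blast
    qed
  next
    case False
    have ex_step: "\<exists>e. heavy (xs @ [e])" if h: "heavy xs" for xs
    proof (rule ccontr)
      assume "\<nexists>e. heavy (xs @ [e])"
      then have fin: "finite (ext (xs @ [e]))" for e unfolding heavy_def by blast
      have "finite {e. \<exists>zs. xs @ e # zs \<in> M}" using False h by blast
      then have "finite (insert xs (\<Union>e\<in>{e. \<exists>zs. xs @ e # zs \<in> M}. ext (xs @ [e])))" using fin by simp
      moreover have "ext xs \<subseteq> insert xs (\<Union>e\<in>{e. \<exists>zs. xs @ e # zs \<in> M}. ext (xs @ [e]))"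
      proof
        fix ys assume "ys \<in> ext xs"
        then obtain zs where zs: "ys = xs @ zs" "ys \<in> M" unfolding ext_def by blast
        show "ys \<in> insert xs (\<Union>e\<in>{e. \<exists>zs. xs @ e # zs \<in> M}. ext (xs @ [e]))"
        proof (cases zs)
          case (Cons e ws)
          then have "ys \<in> ext (xs @ [e])" using zs unfolding ext_def by simp
          then show ?thesis using zs Cons by blast
        qed (use zs in simp)
      qed
      ultimately show False using h finite_subset unfolding heavy_def by blast
    qed
    define s where "s = rec_nat [] (\<lambda>_ xs. xs @ [SOME e. heavy (xs @ [e])])"
    define x where "x n = (SOME e. heavy (s n @ [e]))" for n
    have s: "s 0 = []" "s (Suc n) = s n @ [x n]" for n by (simp_all add: s_def x_def)
    have hs: "heavy (s n)" for n
    proof (induction n)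
      case (Suc n)
      then show ?case unfolding s x_def by (rule someI_ex[OF ex_step])
    qed (simp add: s heavy_Nil)
    have sx: "s n = map x [0..<n]" for n by (induction n) (simp_all add: s)
    have w: "walk S ?v (map x [0..<n])" for n using heavy_walk[OF hs] unfolding sx .
    have x0: "erng S (x 0) = ?v" using w[of 1] by simp
    have "x \<in> inf_paths S" unfolding inf_paths_iff using w x0 by simp
    then have "InfP x \<in> boundary_paths S" by (simp add: boundary_paths_def)
    then have Y: "InfP x \<in> Y" "InfP x \<in> path_space S" using boundary_Y boundary_subset by auto
    show ?thesis
    proof (intro bexI[OF _ Y(1)] conjI allI impI)
      show "InfP x \<in> cylinder S (?v, [])" using Y(2) x0 by (simp add: vertex_cylinder)
      show "\<not> trivial_at g (?v, []) (InfP x)" by (rule not_trivial) (use hs in \<open>simp add: sx\<close>)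
      fix P assume ev: "eventually P (near (InfP x))"
      show "\<exists>\<eta> \<mu>. \<eta> \<in> Y \<and> P \<eta> \<and> strongly_fixed S g \<mu> \<and> \<eta> \<in> cylinder S \<mu>"
      proof (rule near_deep[OF ev Y(2)])
        fix L assume L: "\<And>n \<eta>. L \<le> n \<Longrightarrow> reaches (InfP x) n \<Longrightarrow> \<eta> \<in> Y \<Longrightarrow> \<eta> \<in> cylinder S (pre S (InfP x) n) \<Longrightarrow> P \<eta>"
        obtain zs where zs: "s L @ zs \<in> M" using heavyE[OF hs] by blast
        obtain \<eta> where \<eta>: "\<eta> \<in> Y" "\<eta> \<in> cylinder S (?v, s L @ zs)" "\<eta> \<in> cylinder S (?v, s L)" using witness[OF zs] by blast
        have "P \<eta>" using L[of L \<eta>] x0 \<eta>(1,3) by (simp add: sx)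
        then show ?thesis using \<eta>(1,2) sf(1)[OF zs] by blast
      qed
    qed
  qed
qed

text \<open>The expectation of \<open>W g\<close> is continuous, unimodular on strongly fixed paths and zero where
  \<open>g\<close> moves points. So \<open>g\<close> acts trivially near an accumulation point of strongly fixed paths.\<close>

lemma cartan_Fin:
  assumes "cartan_inclusion D (B K)"
  shows "cond_Fin S"
proof (rule ccontr)
  assume "\<not> cond_Fin S"
  then obtain g where g: "g \<in> Grp S" and inf: "infinite {\<mu>. minimal_strongly_fixed S g \<mu>}"
    unfolding cond_Fin_def by blast
  obtain E where masa: "B K \<inter> commutant D \<subseteq> D" and E: "conditional_expectation E D (B K)"
    using assms unfolding cartan_iff by blast
  note ce = E[unfolded conditional_expectation_def]
  have Eimg: "x \<in> B K \<Longrightarrow> E x \<in> D" and Eid: "a \<in> D \<Longrightarrow> E a = a"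
    and Esc: "x \<in> B K \<Longrightarrow> E (oscale c x) = oscale c (E x)"
    and Ebi: "a \<in> D \<Longrightarrow> x \<in> B K \<Longrightarrow> E (a o\<^sub>L x) = a o\<^sub>L E x" "a \<in> D \<Longrightarrow> x \<in> B K \<Longrightarrow> E (x o\<^sub>L a) = E x o\<^sub>L a" for a x c
    using ce by (simp_all add: image_subset_iff)
  obtain \<xi> where \<xi>: "\<xi> \<in> Y" "\<xi> \<in> cylinder S (gsrc S g, [])" "\<not> trivial_at g (gsrc S g, []) \<xi>"
    and acc: "\<forall>P. eventually P (near \<xi>) \<longrightarrow> (\<exists>\<eta> \<mu>. \<eta> \<in> Y \<and> P \<eta> \<and> strongly_fixed S g \<mu> \<and> \<eta> \<in> cylinder S \<mu>)"
    using strongly_fixed_accumulate[OF inf] by (elim bexE conjE)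
  have gg: "grng S g = gsrc S g"
    using acc[rule_format, OF always_eventually, of "\<lambda>_. True"] by (auto simp: strongly_fixed_def fixes_path_def pact_def prng_def)
  let ?f = "E (W g)"
  have f: "?f \<in> D" using Eimg W_in_B[OF g] .
  have cf: "clinear_op ?f" using on_X_clinear[OF on_X_D[OF f]] .
  define val where "val \<eta> = entry ?f (germ_of S (unit_rep \<eta>)) (germ_of S (unit_rep \<eta>))" for \<eta>
  have u: "germ_of S (unit_rep \<eta>) \<in> X" "rng (germ_of S (unit_rep \<eta>)) = \<eta>" if "\<eta> \<in> Y" for \<eta>
    using unit_rep[OF that] by (auto simp: germ_in_X reps_germ_reps rng_germ_of)
  have unimodular: "cmod (val \<eta>) = 1" if \<mu>: "strongly_fixed S g \<mu>" and \<eta>: "\<eta> \<in> Y" "\<eta> \<in> cylinder S \<mu>" for \<mu> \<eta>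
  proof -
    have m: "\<mu> \<in> paths S" "gsrc S g = prng \<mu>" "pact S g \<mu> = \<mu>" "psect S g \<mu> = psrc S \<mu>"
      using \<mu> by (auto simp: strongly_fixed_def fixes_path_def)
    have "W g o\<^sub>L Q \<mu> = oscale (ptw S g \<mu>) (Q \<mu>)"
      using W_Q(1)[OF g m(1,2)] Q_eq_N(1)[OF m(1)] m by simp
    then have "E (W g o\<^sub>L Q \<mu>) = oscale (ptw S g \<mu>) (E (Q \<mu>))" using Esc[OF Q_in_B[OF m(1)]] by simp
    then have "?f o\<^sub>L Q \<mu> = oscale (ptw S g \<mu>) (Q \<mu>)"
      using Ebi(2)[OF Q_in_D[OF m(1)] W_in_B[OF g]] Eid[OF Q_in_D[OF m(1)]] by simp
    then have "entry (?f o\<^sub>L Q \<mu>) (germ_of S (unit_rep \<eta>)) (germ_of S (unit_rep \<eta>)) = ptw S g \<mu>"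
      using u[OF \<eta>(1)] \<eta>(2) entry_Q[OF m(1)] by simp
    then have "val \<eta> = ptw S g \<mu>"
      using entry_comp_diagonal_right[OF cf diagonal_Q[OF m(1)]] u[OF \<eta>(1)] \<eta>(2) entry_Q[OF m(1)] by (simp add: val_def)
    moreover have "walk S (gsrc S g) (snd \<mu>)" using m by (cases \<mu>) simp
    ultimately show ?thesis using twE_list_circle[OF g] by (simp add: ptw_def)
  qed
  have moved: "val \<eta> = 0" if \<kappa>: "\<kappa> \<in> paths S" "prng \<kappa> = gsrc S g" "pact S g \<kappa> \<noteq> \<kappa>" and \<eta>: "\<eta> \<in> Y" "\<eta> \<in> cylinder S \<kappa>" for \<kappa> \<eta>
  proof -
    \<comment> \<open>Moving \<open>Q \<kappa>\<close> past \<open>W g\<close> turns it into the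
      projection of a different path of the same length. So
      \<open>Q \<kappa> o\<^sub>L W g o\<^sub>L Q \<kappa>\<close> is zero, and by the bimodule
      property \<open>val\<close> vanishes on the cylinder of \<open>\<kappa>\<close>.\<close>
    let ?\<kappa> = "pact S (ginv S g) \<kappa>"
    have c: "Q \<kappa> o\<^sub>L W g = W g o\<^sub>L Q ?\<kappa>" "?\<kappa> \<in> paths S" using Q_commute_W[OF g \<kappa>(1)] \<kappa>(2) gg by auto
    obtain es where es: "\<kappa> = (gsrc S g, es)" "walk S (gsrc S g) es" using \<kappa> by (cases \<kappa>) auto
    have "act_list S g (act_list S (ginv S g) es) = es"
      using act_list_ginv(1)[OF ginv_closed[OF g], of es] es(2) gg by (simp add: gsrc_ginv[OF g] ginv_ginv[OF g])
    then have neq: "?\<kappa> \<noteq> \<kappa>" using \<kappa>(3) gg grng_ginv[OF g] by (auto simp: es(1))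
    have disj: "\<zeta> \<notin> cylinder S ?\<kappa> \<or> \<zeta> \<notin> cylinder S \<kappa>" for \<zeta>
    proof -
      have "plen ?\<kappa> = plen \<kappa>" by (simp add: es(1))
      then show ?thesis using neq by (metis cylinder_iff)
    qed
    have "Q ?\<kappa> o\<^sub>L Q \<kappa> = 0"
    proof (rule diagonal_eqI)
      show "diagonal (Q ?\<kappa> o\<^sub>L Q \<kappa>)" using diagonal_comp[OF diagonal_Q[OF c(2)] diagonal_Q[OF \<kappa>(1)]] .
      fix x
      show "entry (Q ?\<kappa> o\<^sub>L Q \<kappa>) x x = entry 0 x x"
        using entry_comp_diagonal_right[OF clinear_Q[OF c(2)] diagonal_Q[OF \<kappa>(1)], of x x] disj[of "rng x"]
        by (auto simp: entry_Q[OF c(2)] entry_Q[OF \<kappa>(1)])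
    qed simp
    then have "Q \<kappa> o\<^sub>L W g o\<^sub>L Q \<kappa> = 0" unfolding c(1) comp_assoc by simp
    moreover have "Q \<kappa> o\<^sub>L W g \<in> B K" using cstar_algebraD(4)[OF cstar_B Q_in_B[OF \<kappa>(1)] W_in_B[OF g]] .
    ultimately have "E 0 = Q \<kappa> o\<^sub>L ?f o\<^sub>L Q \<kappa>"
      using Ebi(2)[OF Q_in_D[OF \<kappa>(1)], of "Q \<kappa> o\<^sub>L W g"] Ebi(1)[OF Q_in_D[OF \<kappa>(1)] W_in_B[OF g]] by simp
    then have "entry (Q \<kappa> o\<^sub>L ?f o\<^sub>L Q \<kappa>) (germ_of S (unit_rep \<eta>)) (germ_of S (unit_rep \<eta>)) = 0"
      using Eid[OF cstar_algebraD(6)[OF cstar_D]] by simp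
    then show ?thesis
      using entry_comp_diagonal_right[OF clinear_op_comp[OF clinear_Q[OF \<kappa>(1)] cf] diagonal_Q[OF \<kappa>(1)]]
        entry_comp_diagonal_left[OF cf diagonal_Q[OF \<kappa>(1)]] u[OF \<eta>(1)] \<eta>(2) entry_Q[OF \<kappa>(1)] by (simp add: val_def)
  qed
  have lim: "(val \<longlongrightarrow> val \<xi>) (near \<xi>)" unfolding val_def using D_near[OF f \<xi>(1)] .
  \<comment> \<open>Modulus 1 at strongly fixed paths within distance \<open>1 / 2\<close> puts
    \<open>val \<xi>\<close> above \<open>1 / 2\<close> in modulus, and then \<open>val\<close> has
    no zero on the same neighbourhood.\<close>
  have ev: "eventually (\<lambda>\<eta>. dist (val \<eta>) (val \<xi>) < 1 / 2) (near \<xi>)" by (rule tendstoD[OF lim]) simp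
  obtain \<eta> \<mu> where "\<eta> \<in> Y" "dist (val \<eta>) (val \<xi>) < 1 / 2" "strongly_fixed S g \<mu>" "\<eta> \<in> cylinder S \<mu>"
    using acc[rule_format, OF ev] by blast
  then have half: "cmod (val \<xi>) > 1 / 2"
    using unimodular[of \<mu> \<eta>] norm_triangle_ineq2[of "val \<eta>" "val \<xi>"] by (simp add: dist_norm)
  have "eventually (\<lambda>\<eta>. \<eta> \<in> cylinder S (gsrc S g, []) \<longrightarrow> (\<forall>n. act_list S g (snd (pre S \<eta> n)) = snd (pre S \<eta> n))) (near \<xi>)"
    using ev eventually_near_Y[of \<xi>]
  proof eventually_elim
    case (elim \<eta>)
    have nz: "val \<eta> \<noteq> 0" using elim(1) half by (auto simp: dist_norm)
    show ?case
    proof (intro impI allI, rule ccontr)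
      fix n assume c: "\<eta> \<in> cylinder S (gsrc S g, [])" and ne: "act_list S g (snd (pre S \<eta> n)) \<noteq> snd (pre S \<eta> n)"
      have ps: "\<eta> \<in> path_space S" "prng (pre S \<eta> n) = gsrc S g"
        using c fst_pre[of S \<eta> n] by (auto simp: vertex_cylinder prng_def)
      have "pact S g (pre S \<eta> n) \<noteq> pre S \<eta> n" using ne by (metis pact_def snd_conv)
      then show False using moved[OF pre_paths[OF ps(1)] ps(2) _ elim(2) cylinder_pre[OF ps(1)]] nz by blast
    qed
  qed
  then show False using trivial_at_of_masa[OF masa g gg \<xi>(1,2)] \<xi>(3) by blast
qed

lemma cartan_Evr: "cartan_inclusion D (B K) \<Longrightarrow> cond_Evr S"
  and cartan_Rec: "cartan_inclusion D (B K) \<Longrightarrow> Y = path_space S \<Longrightarrow> cond_Rec S"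
  and cartan_Cyc: "cartan_inclusion D (B NoSub) \<Longrightarrow> Y = boundary_paths S \<Longrightarrow> cond_Cyc S"
  unfolding cartan_iff using masa_Evr masa_Rec masa_Cyc by blast+

end

theorem theorem6:
  fixes S :: "('g, 'e) twisted_action"
  assumes "twisted_self_similar_action S"
  shows "(\<forall>k. cartan_inclusion (C0_boundary S) (O_red S k) \<or>
              cartan_inclusion (C0_path_space S) (T_red S k) \<longrightarrow> cond_Fin S \<and> cond_Evr S) \<and>
         (cond_Fin S \<longrightarrow>
           (\<forall>k. O_red_eq_ess S k \<and> T_red_eq_ess S k) \<and>
           (cartan_inclusion (C0_boundary S) (O_red S NoSub) \<longleftrightarrow> cond_Cyc S \<and> cond_Evr S) \<and>
           (\<forall>k. cartan_inclusion (C0_path_space S) (T_red S k) \<longleftrightarrow> cond_Rec S \<and> cond_Evr S) \<and>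
           (\<forall>k\<in>{Sub0, Sub00}. cartan_inclusion (C0_boundary S) (O_red S k) \<longleftrightarrow> cond_Evr S))"
proof -
  interpret twisted_self_similar_action S by fact
  \<comment> \<open>The path space and the boundary as two instances of one locale; ranges of germs
    stay in the boundary by \<open>rep_range_boundary\<close>.\<close>
  interpret T: boundary_rep S "path_space S"
    by unfold_locales (auto simp: boundary_subset[THEN subsetD] rep_range_path_space)
  interpret O: boundary_rep S "boundary_paths S"
    by unfold_locales (auto simp: boundary_subset[THEN subsetD] rep_range_boundary)
  have TX: "T.X = toeplitz_groupoid S"
  proof -
    have "rep_source p \<in> path_space S" if "p \<in> germ_reps S" for p
      using that by (cases p) (auto simp: germ_reps_iff cylinder_iff)
    then show ?thesis unfolding T.X_def toeplitz_groupoid_eq by blast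
  qed
  have OX: "O.X = boundary_groupoid S"
    unfolding O.X_def boundary_groupoid_def using rep_range_boundary by blast
  have red: "T_red S k = T.B k" "O_red S k = O.B k" "C0_path_space S = T.D" "C0_boundary S = O.D" for k
    by (simp_all add: T_red_def O_red_def C0_path_space_def C0_boundary_def T.B_def O.B_def T.D_def O.D_def TX OX)
  \<comment> \<open>Under (Fin) every germ is a Hausdorff point, so the reduced and the essential
    algebras are the same sets of operators.\<close>
  have ess: "O_red_eq_ess S k \<and> T_red_eq_ess S k" if Fin: "cond_Fin S" for k
  proof -
    have "toeplitz_hausdorff S = T.X"
      using T.hausdorff_points_X[OF Fin] subtopology_topspace[of "toeplitz_topology S"]
      by (simp add: TX T.topspace_toeplitz toeplitz_hausdorff_def)
    moreover have "boundary_hausdorff S = O.X"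
      using O.hausdorff_points_X[OF Fin] by (simp add: OX boundary_hausdorff_def boundary_topology_def)
    ultimately show ?thesis
      using T.cstar_isomorphism_restrict[of k] O.cstar_isomorphism_restrict[of k]
      by (simp add: O_red_eq_ess_def T_red_eq_ess_def T_red_def T_ess_def O_red_def O_ess_def T.B_def O.B_def TX OX)
  qed
  have Cyc: "cartan_inclusion O.D (O.B NoSub)" if Fin: "cond_Fin S" and Evr: "cond_Evr S" and Cyc: "cond_Cyc S"
    by (rule O.cartan_of_masa[OF Fin], rule O.masa_of_effective[OF Fin], simp)
      (rule O.effective_boundary[OF Fin Evr refl Cyc]; assumption)
  have Rec: "cartan_inclusion T.D (T.B k)" if Fin: "cond_Fin S" and Evr: "cond_Evr S" and Rec: "cond_Rec S" for k
    by (rule T.cartan_of_masa[OF Fin], rule T.masa_of_effective[OF Fin], simp)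
      (rule T.effective_path_space[OF Fin Evr Rec refl]; assumption)
  \<comment> \<open>The generators with subscript \<open>0\<close> preserve the length of the left
    path, so only germs with equally long left paths have to be compared, and these are settled by
    (Evr). The algebra with subscript \<open>00\<close> is contained in this one.\<close>
  have Evr0: "cartan_inclusion O.D (O.B k)" if Fin: "cond_Fin S" and Evr: "cond_Evr S" and k: "k \<in> {Sub0, Sub00}" for k
  proof (rule O.cartan_of_masa0[OF Fin _ k])
    show "O.B Sub0 \<inter> commutant O.D \<subseteq> O.D"
    proof (rule O.masa_of_effective[OF Fin])
      fix \<alpha> \<gamma> h k \<beta> \<zeta>
      assume "(\<alpha>, h, \<beta>, \<zeta>) \<in> O.reps" "(\<gamma>, k, \<beta>, \<zeta>) \<in> O.reps" "Sub0 = Sub0 \<Longrightarrow> plen \<gamma> = plen \<alpha>"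
        "eventually (\<lambda>\<eta>. rep_range S (\<alpha>, h, \<beta>, \<eta>) = rep_range S (\<gamma>, k, \<beta>, \<eta>)) (O.near \<zeta>)"
      then show "germ_of S (\<alpha>, h, \<beta>, \<zeta>) = germ_of S (\<gamma>, k, \<beta>, \<zeta>)"
        using O.effective_same_length[OF Fin Evr] by blast
    qed simp
  qed
  show ?thesis
    unfolding red
    using O.cartan_Fin T.cartan_Fin O.cartan_Evr T.cartan_Evr O.cartan_Cyc[OF _ refl] T.cartan_Rec[OF _ refl]
      ess Cyc Rec Evr0 by blast
qed

end
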